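(* Let $\Phi$ be a barrelled nuclear space over $\mathbb{R}$ and let $L=\{L_t\}_{t\ge0}$ be a $\Phi'_\beta$-valued Lévy process. Then $L$ has a $\Phi'_\beta$-valued, regular, càdlàg version $\tilde L=\{\tilde L_t\}_{t\ge0}$ that is also a Lévy process. Moreover there exists a countably Hilbertian topology $\vartheta_L$ on $\Phi$ such that $\tilde L$ is a $(\widetilde{\Phi_{\vartheta_L}})'_\beta$-valued càdlàg process.
   Context: $\Phi'_\beta$ is the strong dual of $\Phi$, $f[\phi]$ the pairing. A semi-norm $p$ on $\Phi$ is Hilbertian if $p(\phi)^2=Q(\phi,\phi)$ for a symmetric non-negative bilinear form $Q$; $\Phi_p$ is then the Hilbert completion of $\Phi/\ker p$ and, for $p\le q$, $i_{p,q}:\Phi_q\to\Phi_p$ is the canonical map. A Hausdorff locally convex space is nuclear if its topology is generated by a family of Hilbertian semi-norms such that for each member $p$ there is a member $q\ge p$ with $i_{p,q}$ Hilbert-Schmidt. It is barrelled if every convex, balanced, absorbing, closed subset is a neighbourhood of zero. All random variables are defined on a complete probability space. A (weaker) countably Hilbertian topology $\theta$ on $\Phi$ is one generated by an increasing sequence of continuous Hilbertian semi-norms on $\Phi$; $\Phi_\theta=(\Phi,\theta)$, $\Phi'_\theta$ is its dual, $\widetilde{\Phi_\theta}$ its completion and $(\widetilde{\Phi_\theta})'_\beta$ the strong dual of the completion, canonically contained in $\Phi'_\beta$. A $\Phi'_\beta$-valued random variable $X$ is regular if $\mathbb{P}(X\in\Phi'_\theta)=1$ for some such $\theta$; a process is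 regular if it is so at each time. Càdlàg means that a.s. the paths are right-continuous with left limits. A Borel measure on $\Phi'_\beta$ is Radon if every Borel set $\Gamma$ contains, for each $\epsilon>0$, a compact set $K$ with measure of $\Gamma\setminus K$ less than $\epsilon$; $\mathfrak{M}^1_R(\Phi'_\beta)$ is the set of Radon probability measures. A $\Phi'_\beta$-valued process is a Lévy process if it starts at $0$ a.s., has independent and stationary increments, and the law $\mu_t$ at each time $t$ is Radon with $t\mapsto\mu_t\in\mathfrak{M}^1_R(\Phi'_\beta)$ weakly continuous at $0$. *)

theory Defs
  imports "HOL-Probability.Probability" "HOL-Library.Function_Algebras"
begin

section \<open>Linear topologies\<close>

text \<open>Pointwise scalar multiplication: linear functionals and sequences of vectors are themselves
  elements of a real vector space, so that the notions below apply to them as well.\<close>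

instantiation "fun" :: (type, real_vector) real_vector
begin

definition scaleR_fun :: "real \<Rightarrow> ('a \<Rightarrow> 'b) \<Rightarrow> 'a \<Rightarrow> 'b"
  where "scaleR_fun c f = (\<lambda>x. c *\<^sub>R f x)"

instance
  by standard (simp_all add: scaleR_fun_def fun_eq_iff scaleR_add_right scaleR_add_left)

end

text \<open>The translation-invariant topology on a linear subspace \<open>S\<close> for which (the traces on \<open>S\<close> of)
  the finite intersections of members of \<open>\<B>\<close> form a base of neighbourhoods of zero.\<close>

definition nbhd_topology :: "'b::ab_group_add set \<Rightarrow> 'b set set \<Rightarrow> 'b topology"
  where "nbhd_topology S \<B> = topology (\<lambda>U. U \<subseteq> S \<and>
    (\<forall>x\<in>U. \<exists>\<F>. finite \<F> \<and> \<F> \<subseteq> \<B> \<and> (\<forall>y\<in>S. (\<forall>N\<in>\<F>. y - x \<in> N) \<longrightarrow> y \<in> U)))"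

lemma openin_nbhd_topology:
  "openin (nbhd_topology S \<B>) U \<longleftrightarrow> U \<subseteq> S \<and>
    (\<forall>x\<in>U. \<exists>\<F>. finite \<F> \<and> \<F> \<subseteq> \<B> \<and> (\<forall>y\<in>S. (\<forall>N\<in>\<F>. y - x \<in> N) \<longrightarrow> y \<in> U))"
proof -
  let ?P = "\<lambda>U. U \<subseteq> S \<and>
    (\<forall>x\<in>U. \<exists>\<F>. finite \<F> \<and> \<F> \<subseteq> \<B> \<and> (\<forall>y\<in>S. (\<forall>N\<in>\<F>. y - x \<in> N) \<longrightarrow> y \<in> U))"
  have "istopology ?P"
    unfolding istopology_def
  proof (intro conjI allI impI)
    fix U V assume U: "?P U" and V: "?P V"
    show "U \<inter> V \<subseteq> S" using U by blast
    show "\<forall>x\<in>U \<inter> V. \<exists>\<F>. finite \<F> \<and> \<F> \<subseteq> \<B> \<and>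
        (\<forall>y\<in>S. (\<forall>N\<in>\<F>. y - x \<in> N) \<longrightarrow> y \<in> U \<inter> V)"
    proof
      fix x assume x: "x \<in> U \<inter> V"
      obtain F where F: "finite F" "F \<subseteq> \<B>" "\<forall>y\<in>S. (\<forall>N\<in>F. y - x \<in> N) \<longrightarrow> y \<in> U"
        using U x by blast
      obtain G where G: "finite G" "G \<subseteq> \<B>" "\<forall>y\<in>S. (\<forall>N\<in>G. y - x \<in> N) \<longrightarrow> y \<in> V"
        using V x by blast
      show "\<exists>\<F>. finite \<F> \<and> \<F> \<subseteq> \<B> \<and>
          (\<forall>y\<in>S. (\<forall>N\<in>\<F>. y - x \<in> N) \<longrightarrow> y \<in> U \<inter> V)"
        by (rule exI[of _ "F \<union> G"]) (use F G in auto)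
    qed
  next
    fix K assume K: "\<forall>U\<in>K. ?P U"
    show "\<Union> K \<subseteq> S" using K by blast
    show "\<forall>x\<in>\<Union> K. \<exists>\<F>. finite \<F> \<and> \<F> \<subseteq> \<B> \<and>
        (\<forall>y\<in>S. (\<forall>N\<in>\<F>. y - x \<in> N) \<longrightarrow> y \<in> \<Union> K)"
    proof
      fix x assume "x \<in> \<Union> K"
      then obtain U where U: "U \<in> K" "x \<in> U" by blast
      then obtain F where "finite F" "F \<subseteq> \<B>" "\<forall>y\<in>S. (\<forall>N\<in>F. y - x \<in> N) \<longrightarrow> y \<in> U"
        using K by meson
      then show "\<exists>\<F>. finite \<F> \<and> \<F> \<subseteq> \<B> \<and>
          (\<forall>y\<in>S. (\<forall>N\<in>\<F>. y - x \<in> N) \<longrightarrow> y \<in> \<Union> K)"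
        using U by (intro exI[of _ F]) blast
    qed
  qed
  then show ?thesis
    by (simp add: nbhd_topology_def)
qed

lemma topspace_nbhd_topology [simp]: "topspace (nbhd_topology S \<B>) = S"
proof
  show "topspace (nbhd_topology S \<B>) \<subseteq> S"
    by (auto simp: topspace_def openin_nbhd_topology)
  have "openin (nbhd_topology S \<B>) S"
    by (auto simp: openin_nbhd_topology)
  then show "S \<subseteq> topspace (nbhd_topology S \<B>)"
    by (rule openin_subset)
qed

definition zero_nbhd :: "'b::ab_group_add topology \<Rightarrow> 'b set \<Rightarrow> bool"
  where "zero_nbhd T U \<longleftrightarrow> (\<exists>V. openin T V \<and> 0 \<in> V \<and> V \<subseteq> U)"

definition seminorm_topology :: "('b::real_vector \<Rightarrow> real) set \<Rightarrow> 'b topology"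
  where "seminorm_topology P = nbhd_topology UNIV {{x. p x < e} | p e. p \<in> P \<and> 0 < e}"


section \<open>Dual spaces\<close>

definition vn_bounded :: "'b::real_vector topology \<Rightarrow> 'b set \<Rightarrow> bool"
  where "vn_bounded T B \<longleftrightarrow> B \<subseteq> topspace T \<and>
    (\<forall>U. zero_nbhd T U \<longrightarrow> (\<exists>r>0. B \<subseteq> (\<lambda>x. r *\<^sub>R x) ` U))"

text \<open>\<open>topspace T\<close> may be a proper linear subspace of the type; a functional on it is represented by
  the function that vanishes elsewhere.\<close>

definition dual :: "'b::real_vector topology \<Rightarrow> ('b \<Rightarrow> real) set"
  where "dual T = {f.
    (\<forall>x\<in>topspace T. \<forall>y\<in>topspace T. f (x + y) = f x + f y) \<and>
    (\<forall>c. \<forall>x\<in>topspace T. f (c *\<^sub>R x) = c * f x) \<and>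
    continuous_map T euclideanreal f \<and> (\<forall>x. x \<notin> topspace T \<longrightarrow> f x = 0)}"

definition strong_dual :: "'b::real_vector topology \<Rightarrow> ('b \<Rightarrow> real) topology"
  where "strong_dual T =
    nbhd_topology (dual T) {{f. \<forall>x\<in>B. \<bar>f x\<bar> < e} | B e. vn_bounded T B \<and> 0 < e}"


section \<open>Completion of a pseudo-metrizable space\<close>

definition cauchy_seqs :: "'b::ab_group_add topology \<Rightarrow> (nat \<Rightarrow> 'b) set"
  where "cauchy_seqs T =
    {x. \<forall>U. zero_nbhd T U \<longrightarrow> (\<exists>N. \<forall>m\<ge>N. \<forall>n\<ge>N. x m - x n \<in> U)}"

text \<open>For pseudo-metrizable \<open>T\<close> the completion is realised by Cauchy sequences, the original space
  being embedded as the constant sequences. Countably Hilbertian topologies need not be Hausdorff;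
  accordingly sequences with the same limit are not identified. Passing to the Hausdorff quotient
  would change neither the continuous linear functionals nor (up to preimages) the bounded sets, hence
  not the strong dual.\<close>

definition seq_completion :: "'b::real_vector topology \<Rightarrow> (nat \<Rightarrow> 'b) topology"
  where "seq_completion T =
    nbhd_topology (cauchy_seqs T) {{x. \<forall>\<^sub>F k in sequentially. x k \<in> U} | U. zero_nbhd T U}"

definition restrict_const :: "((nat \<Rightarrow> 'b) \<Rightarrow> real) \<Rightarrow> 'b \<Rightarrow> real"
  where "restrict_const F = (\<lambda>\<phi>. F (\<lambda>_. \<phi>))"

lemma inj_on_restrict_const: "inj_on restrict_const (dual (seq_completion T))"
proof (rule inj_onI, rule ext)
  let ?C = "seq_completion T"
  fix F G x
  assume F: "F \<in> dual ?C" and G: "G \<in> dual ?C" and eq: "restrict_const F = restrict_const G"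
  define H where "H y = F y - G y" for y
  have H_const: "H (\<lambda>_. \<phi>) = 0" for \<phi>
    using fun_cong[OF eq, of \<phi>] by (simp add: restrict_const_def H_def)
  have H_cont: "continuous_map ?C euclideanreal H"
    unfolding H_def using F G by (intro continuous_map_diff) (auto simp: dual_def)
  have "H x = 0"
  proof (cases "x \<in> cauchy_seqs T")
    case False
    then show ?thesis using F G by (simp add: H_def dual_def seq_completion_def)
  next
    case True
    show ?thesis
    proof (rule ccontr)
      assume "H x \<noteq> 0"
      define W where "W = {y \<in> topspace ?C. H y \<in> - {0}}"
      have "openin ?C W"
        unfolding W_def using H_cont by (rule openin_continuous_map_preimage) auto
      moreover have "x \<in> W"
        using True \<open>H x \<noteq> 0\<close> by (simp add: W_def seq_completion_def)
      ultimately obtain \<F> where \<F>: "finite \<F>"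
        "\<F> \<subseteq> {{x. \<forall>\<^sub>F k in sequentially. x k \<in> U} | U. zero_nbhd T U}"
        "\<forall>y\<in>cauchy_seqs T. (\<forall>N\<in>\<F>. y - x \<in> N) \<longrightarrow> y \<in> W"
        unfolding seq_completion_def openin_nbhd_topology by blast
      have "\<forall>\<^sub>F n in sequentially. (\<lambda>_. x n) - x \<in> N" if NF: "N \<in> \<F>" for N
      proof -
        obtain U where U: "zero_nbhd T U" "N = {x. \<forall>\<^sub>F k in sequentially. x k \<in> U}"
          using subsetD[OF \<F>(2) NF] by blast
        then obtain n0 where "\<forall>m\<ge>n0. \<forall>n\<ge>n0. x m - x n \<in> U"
          using True by (auto simp: cauchy_seqs_def)
        then show ?thesis
          unfolding U(2) eventually_sequentially by auto
      qed
      then have "\<forall>\<^sub>F n in sequentially. \<forall>N\<in>\<F>. (\<lambda>_. x n) - x \<in> N"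
        using \<F>(1) by (simp add: eventually_ball_finite)
      then obtain n where "\<forall>N\<in>\<F>. (\<lambda>_. x n) - x \<in> N"
        by (auto simp: eventually_sequentially)
      moreover have "(\<lambda>_. x n) \<in> cauchy_seqs T"
        by (auto simp: cauchy_seqs_def zero_nbhd_def)
      ultimately have "(\<lambda>_. x n) \<in> W" using \<F>(3) by blast
      then show False by (simp add: W_def H_const)
    qed
  qed
  then show "F x = G x" by (simp add: H_def)
qed

text \<open>The strong dual of the completion, viewed through the canonical injection as a space of
  functionals on the original space: its topology is the strong topology of the completion,
  transported along the bijection \<open>restrict_const\<close> (and not the one inherited from
  \<open>strong_dual T\<close>).\<close>

definition completion_dual :: "'b::real_vector topology \<Rightarrow> ('b \<Rightarrow> real) topology"
  where "completion_dual T =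
    pullback_topology (restrict_const ` dual (seq_completion T))
      (inv_into (dual (seq_completion T)) restrict_const) (strong_dual (seq_completion T))"


section \<open>Hilbertian semi-norms and nuclear spaces\<close>

definition hilbertian_seminorm :: "('b::real_vector \<Rightarrow> real) \<Rightarrow> bool"
  where "hilbertian_seminorm p \<longleftrightarrow> (\<forall>\<phi>. 0 \<le> p \<phi>) \<and>
    (\<exists>Q. (\<forall>\<phi>. linear (Q \<phi>)) \<and> (\<forall>\<psi>. linear (\<lambda>\<phi>. Q \<phi> \<psi>)) \<and>
      (\<forall>\<phi> \<psi>. Q \<phi> \<psi> = Q \<psi> \<phi>) \<and> (\<forall>\<phi>. 0 \<le> Q \<phi> \<phi>) \<and> (\<forall>\<phi>. (p \<phi>)\<^sup>2 = Q \<phi> \<phi>))"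

text \<open>\<open>Q\<close> is recovered from \<open>p\<close> by polarization. Elements of the Hilbert completion \<open>\<Phi>\<^sub>p\<close> of
  \<open>\<Phi>/ker p\<close> are given by representatives, namely \<open>p\<close>-Cauchy sequences in \<open>\<Phi>\<close>; two of them represent
  the same element iff their difference has \<open>completion_inner p\<close>-norm zero.\<close>

definition polar_form :: "('b::real_vector \<Rightarrow> real) \<Rightarrow> 'b \<Rightarrow> 'b \<Rightarrow> real"
  where "polar_form p \<phi> \<psi> = ((p (\<phi> + \<psi>))\<^sup>2 - (p (\<phi> - \<psi>))\<^sup>2) / 4"

definition completion_inner ::
    "('b::real_vector \<Rightarrow> real) \<Rightarrow> (nat \<Rightarrow> 'b) \<Rightarrow> (nat \<Rightarrow> 'b) \<Rightarrow> real"
  where "completion_inner p x y = lim (\<lambda>k. polar_form p (x k) (y k))"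

definition orthonormal_basis :: "('b::real_vector \<Rightarrow> real) \<Rightarrow> (nat \<Rightarrow> 'b) set \<Rightarrow> bool"
  where "orthonormal_basis p E \<longleftrightarrow> E \<subseteq> cauchy_seqs (seminorm_topology {p}) \<and>
    (\<forall>e\<in>E. \<forall>e'\<in>E. completion_inner p e e' = (if e = e' then 1 else 0)) \<and>
    (\<forall>x\<in>cauchy_seqs (seminorm_topology {p}).
      (\<forall>e\<in>E. completion_inner p x e = 0) \<longrightarrow> completion_inner p x x = 0)"

text \<open>For \<open>p \<le> q\<close> the canonical map \<open>i\<^sub>p\<^sub>,\<^sub>q\<close> sends the element of \<open>\<Phi>\<^sub>q\<close> represented by a
  \<open>q\<close>-Cauchy sequence to the element of \<open>\<Phi>\<^sub>p\<close> represented by the same sequence.\<close>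

definition hilbert_schmidt_inclusion ::
    "('b::real_vector \<Rightarrow> real) \<Rightarrow> ('b \<Rightarrow> real) \<Rightarrow> bool"
  where "hilbert_schmidt_inclusion p q \<longleftrightarrow>
    (\<exists>E. orthonormal_basis q E \<and> (\<lambda>e. completion_inner p e e) summable_on E)"

definition nuclear_space :: "'b::real_vector topology \<Rightarrow> bool"
  where "nuclear_space T \<longleftrightarrow> Hausdorff_space T \<and>
    (\<exists>P. (\<forall>p\<in>P. hilbertian_seminorm p) \<and> T = seminorm_topology P \<and>
      (\<forall>p\<in>P. \<exists>q\<in>P. p \<le> q \<and> hilbert_schmidt_inclusion p q))"

definition barrelled_space :: "'b::real_vector topology \<Rightarrow> bool"
  where "barrelled_space T \<longleftrightarrow>
    (\<forall>B. convex B \<and> (\<forall>x\<in>B. \<forall>c. \<bar>c\<bar> \<le> 1 \<longrightarrow> c *\<^sub>R x \<in> B) \<and>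
      (\<forall>x. \<exists>r>0. \<forall>c. \<bar>c\<bar> \<le> r \<longrightarrow> c *\<^sub>R x \<in> B) \<and> closedin T B \<longrightarrow> zero_nbhd T B)"

definition countably_hilbertian :: "'b::real_vector topology \<Rightarrow> 'b topology \<Rightarrow> bool"
  where "countably_hilbertian T \<theta> \<longleftrightarrow>
    (\<exists>p :: nat \<Rightarrow> 'b \<Rightarrow> real. incseq p \<and>
      (\<forall>n. hilbertian_seminorm (p n) \<and> continuous_map T euclideanreal (p n)) \<and>
      \<theta> = seminorm_topology (range p))"


section \<open>Random variables and processes with values in a topological space\<close>

definition borel_of :: "'b topology \<Rightarrow> 'b measure"
  where "borel_of S = sigma (topspace S) {U. openin S U}"

definition radon_prob :: "'b topology \<Rightarrow> 'b measure \<Rightarrow> bool"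
  where "radon_prob S \<mu> \<longleftrightarrow> prob_space \<mu> \<and> sets \<mu> = sets (borel_of S) \<and>
    (\<forall>\<Gamma>\<in>sets \<mu>. \<forall>e>0. \<exists>K\<subseteq>\<Gamma>. compactin S K \<and> measure \<mu> (\<Gamma> - K) < e)"

text \<open>The time set is \<open>[0, \<infinity>)\<close>; values of a process at negative times are irrelevant.\<close>

definition stoch_process :: "'w measure \<Rightarrow> 'b topology \<Rightarrow> (real \<Rightarrow> 'w \<Rightarrow> 'b) \<Rightarrow> bool"
  where "stoch_process M S X \<longleftrightarrow> (\<forall>t\<ge>0. X t \<in> measurable M (borel_of S))"

definition cadlag :: "'b topology \<Rightarrow> (real \<Rightarrow> 'b) \<Rightarrow> bool"
  where "cadlag S x \<longleftrightarrow> (\<forall>t\<ge>0. limitin S x (x t) (at_right t)) \<and>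
    (\<forall>t>0. \<exists>l. limitin S x l (at_left t))"

definition cadlag_process :: "'w measure \<Rightarrow> 'b topology \<Rightarrow> (real \<Rightarrow> 'w \<Rightarrow> 'b) \<Rightarrow> bool"
  where "cadlag_process M S X \<longleftrightarrow>
    stoch_process M S X \<and> (AE \<omega> in M. cadlag S (\<lambda>t. X t \<omega>))"

definition is_version ::
    "'w measure \<Rightarrow> (real \<Rightarrow> 'w \<Rightarrow> 'b) \<Rightarrow> (real \<Rightarrow> 'w \<Rightarrow> 'b) \<Rightarrow> bool"
  where "is_version M X Y \<longleftrightarrow> (\<forall>t\<ge>0. AE \<omega> in M. X t \<omega> = Y t \<omega>)"

definition regular_process ::
    "'w measure \<Rightarrow> 'b::real_vector topology \<Rightarrow> (real \<Rightarrow> 'w \<Rightarrow> 'b \<Rightarrow> real) \<Rightarrow> bool"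
  where "regular_process M T X \<longleftrightarrow> stoch_process M (strong_dual T) X \<and>
    (\<forall>t\<ge>0. \<exists>\<theta>. countably_hilbertian T \<theta> \<and>
      {\<omega> \<in> space M. X t \<omega> \<in> dual \<theta>} \<in> sets M \<and>
      measure M {\<omega> \<in> space M. X t \<omega> \<in> dual \<theta>} = 1)"

definition independent_increments ::
    "'w measure \<Rightarrow> 'b::real_vector topology \<Rightarrow> (real \<Rightarrow> 'w \<Rightarrow> 'b) \<Rightarrow> bool"
  where "independent_increments M S X \<longleftrightarrow>
    (\<forall>n. \<forall>t :: nat \<Rightarrow> real. 0 \<le> t 0 \<and> (\<forall>i<n. t i < t (Suc i)) \<longrightarrow>
      prob_space.indep_vars M (\<lambda>_. borel_of S) (\<lambda>i \<omega>. X (t (Suc i)) \<omega> - X (t i) \<omega>) {..<n})"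

definition stationary_increments ::
    "'w measure \<Rightarrow> 'b::real_vector topology \<Rightarrow> (real \<Rightarrow> 'w \<Rightarrow> 'b) \<Rightarrow> bool"
  where "stationary_increments M S X \<longleftrightarrow>
    (\<forall>s\<ge>0. \<forall>h\<ge>0. distr M (borel_of S) (\<lambda>\<omega>. X (s + h) \<omega> - X s \<omega>) =
      distr M (borel_of S) (\<lambda>\<omega>. X h \<omega> - X 0 \<omega>))"

definition weakly_continuous_at_zero :: "'b topology \<Rightarrow> (real \<Rightarrow> 'b measure) \<Rightarrow> bool"
  where "weakly_continuous_at_zero S \<mu> \<longleftrightarrow>
    (\<forall>f. continuous_map S euclideanreal f \<and> bounded (f ` topspace S) \<longrightarrow>
      ((\<lambda>t. \<integral>x. f x \<partial>\<mu> t) \<longlongrightarrow> (\<integral>x. f x \<partial>\<mu> 0)) (at_right 0))"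

definition levy_process ::
    "'w measure \<Rightarrow> 'b::real_vector topology \<Rightarrow> (real \<Rightarrow> 'w \<Rightarrow> 'b) \<Rightarrow> bool"
  where "levy_process M S X \<longleftrightarrow> stoch_process M S X \<and>
    (AE \<omega> in M. X 0 \<omega> = 0) \<and>
    independent_increments M S X \<and> stationary_increments M S X \<and>
    (\<forall>t\<ge>0. radon_prob S (distr M (borel_of S) (X t))) \<and>
    weakly_continuous_at_zero S (\<lambda>t. distr M (borel_of S) (X t))"

end

theory Submission
  imports Defs
begin

text \<open>For fixed \<open>\<phi>\<close> the process \<open>L\<^sub>t(\<phi>)\<close> is a real Levy process, so \<open>E exp(i u L\<^sub>t(\<phi>)) = exp(t \<eta>(u\<phi>))\<close>
  at dyadic \<open>t\<close>. The law of \<open>L\<^sub>1\<close> is Radon and compact sets of functionals are equicontinuous because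
  \<open>\<Phi>\<close> is barrelled; hence \<open>\<eta>\<close> is small near zero and, by Ottaviani's inequality, so is
  \<open>sup\<^sub>t |L\<^sub>t(\<phi>)|\<close> over bounded time intervals. Averaging over random signs (instead of the Gaussian
  measure usual in Minlos' lemma) turns this bound and the Hilbert--Schmidt property into a bound on
  the dual norm of \<open>L\<^sub>t\<close>, uniform over dyadic \<open>t\<close>, for one of countably many semi-norms \<open>q\<^sub>n\<close>. For each \<open>\<phi>\<close>
  the number of oscillations of \<open>L\<^sub>t(\<phi>)\<close> is almost surely finite, so one-sided limits along the dyadics
  exist. On sets of functionals bounded by \<open>n q\<^sub>n\<close> the strong topologies coincide with pointwise
  convergence on a countable dense set, as \<open>q\<^sub>n\<^sub>+\<^sub>1\<close>-balls are totally bounded for \<open>q\<^sub>n\<close>. Therefore the right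
  limits along the dyadics form a cadlag process; it is a version of \<open>L\<close> by stochastic continuity and,
  once more, tightness of the laws.\<close>

section \<open>Hilbertian semi-norms\<close>

text \<open>Two obstacles shape the proof. The strong dual is in general neither metrizable nor
  separable, so neither path regularity nor Borel measurability can be checked in it directly; both
  are moved to the sets \<open>H n\<close>, where countably many evaluations decide everything. And
  the semi-norm that dominates \<open>L t\<close> with probability near one depends on
  \<open>t\<close>, whereas one topology has to serve all times. Hence only dyadic times enter the
  choice of the \<open>q n\<close>, and boundedness on a whole time interval is drawn from the law
  of \<open>L 1\<close>: for \<open>c\<close> near 1 the function \<open>exp (t * Ln c)\<close> is
  close to 1 uniformly in bounded \<open>t\<close>, and Ottaviani's inequality passes from single
  times to suprema at the price of a factor 2. Sign averages are finite sums, so they commute with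
  integrals, and all they need is a Paley--Zygmund bound of 1/9. This explains the constants: 9
  comes from the signs, 18 from adding two errors of equal size, 4 from doubling the threshold 2 of
  the truncation inequality.\<close>

lemma hilbertian_seminorm_form:
  assumes "hilbertian_seminorm p"
  shows "linear (polar_form p x)" "linear (\<lambda>x. polar_form p x y)"
    "polar_form p x y = polar_form p y x" "polar_form p x x = (p x)\<^sup>2" "0 \<le> p x"
proof -
  obtain Q where Q: "\<And>x. linear (Q x)" "\<And>y. linear (\<lambda>x. Q x y)" "\<And>x y. Q x y = Q y x"
    and pQ: "\<And>x. (p x)\<^sup>2 = Q x x" and nn: "\<And>x. 0 \<le> p x"
    using assms unfolding hilbertian_seminorm_def by blast
  have eq: "polar_form p = Q"
  proof (intro ext)
    fix x y
    show "polar_form p x y = Q x y"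
      unfolding polar_form_def pQ
      by (simp add: linear_add[OF Q(1)] linear_add[OF Q(2)] linear_diff[OF Q(1)]
          linear_diff[OF Q(2)] Q(3)[of y x])
  qed
  show "linear (polar_form p x)" "linear (\<lambda>x. polar_form p x y)"
    "polar_form p x y = polar_form p y x" "polar_form p x x = (p x)\<^sup>2" "0 \<le> p x"
    unfolding eq by (fact Q nn pQ[symmetric])+
qed

lemma hilbertian_seminormI:
  assumes "\<And>x. 0 \<le> p x" and "\<And>x. linear (Q x)" and "\<And>x y. Q x y = Q y x"
    and "\<And>x. (p x)\<^sup>2 = Q x x"
  shows "hilbertian_seminorm p"
proof -
  have "linear (\<lambda>x. Q x y)" for y
    using assms(2)[of y] by (simp add: linear_iff assms(3)[of _ y])
  moreover have "0 \<le> Q x x" for x by (metis assms(4) zero_le_power2)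
  ultimately show ?thesis
    unfolding hilbertian_seminorm_def using assms by (intro conjI exI[of _ Q]) auto
qed

locale hilbertian =
  fixes p :: "'a::real_vector \<Rightarrow> real"
  assumes hilbertian: "hilbertian_seminorm p"
begin

abbreviation B where "B \<equiv> polar_form p"

lemmas form_linear = hilbertian_seminorm_form(1)[OF hilbertian]
lemmas form_linear_left = hilbertian_seminorm_form(2)[OF hilbertian]
lemmas form_commute = hilbertian_seminorm_form(3)[OF hilbertian]
lemmas form_self = hilbertian_seminorm_form(4)[OF hilbertian]
lemmas nonneg [simp] = hilbertian_seminorm_form(5)[OF hilbertian]

lemmas form_simps =
  linear_add[OF form_linear] linear_add[OF form_linear_left]
  linear_diff[OF form_linear] linear_diff[OF form_linear_left]
  linear_scale[OF form_linear] linear_scale[OF form_linear_left]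
  linear_0[OF form_linear] linear_0[OF form_linear_left]
  linear_sum[OF form_linear] linear_sum[OF form_linear_left]

lemma scale: "p (c *\<^sub>R x) = \<bar>c\<bar> * p x"
proof -
  have "(p (c *\<^sub>R x))\<^sup>2 = (\<bar>c\<bar> * p x)\<^sup>2"
    by (simp add: form_self[symmetric] form_simps power_mult_distrib)
      (simp add: power2_eq_square)
  then show ?thesis by (rule power2_eq_imp_eq) auto
qed

lemma zero [simp]: "p 0 = 0"
  using scale[of 0 0] by simp

lemma minus: "p (- x) = p x"
  using scale[of "-1" x] by simp

lemma minus_commute: "p (x - y) = p (y - x)"
  using minus[of "x - y"] by simp

lemma Cauchy_Schwarz: "\<bar>B x y\<bar> \<le> p x * p y"
proof (cases "p y = 0")
  case True
  have *: "0 \<le> (p x)\<^sup>2 + 2 * c * B x y" for c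
  proof -
    have "0 \<le> (p (x + c *\<^sub>R y))\<^sup>2" by simp
    also have "\<dots> = (p x)\<^sup>2 + 2 * c * B x y"
      using True by (simp add: form_self[symmetric] form_simps form_commute[of y x])
        (simp add: form_self)
    finally show ?thesis .
  qed
  have "B x y = 0"
  proof (rule ccontr)
    assume "B x y \<noteq> 0"
    with *[of "- ((p x)\<^sup>2 + 1) / (2 * B x y)"] have "0 \<le> (p x)\<^sup>2 - ((p x)\<^sup>2 + 1)" by (simp add: field_simps)
    then show False by simp
  qed
  with True show ?thesis by simp
next
  case False
  let ?c = "B x y / (p y)\<^sup>2"
  have "0 \<le> (p (x - ?c *\<^sub>R y))\<^sup>2" by simp
  also have "\<dots> = (p x)\<^sup>2 - 2 * ?c * B x y + ?c * ?c * (p y)\<^sup>2"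
    by (simp add: form_self[symmetric] form_simps form_commute[of y x] algebra_simps)
  also have "\<dots> = (p x)\<^sup>2 - (B x y)\<^sup>2 / (p y)\<^sup>2"
    using False by (simp add: field_simps power2_eq_square)
  finally have "(B x y)\<^sup>2 \<le> (p x * p y)\<^sup>2"
    using False by (simp add: field_simps power_mult_distrib)
  then show ?thesis
    by (metis abs_le_square_iff abs_of_nonneg mult_nonneg_nonneg nonneg)
qed

lemma triangle: "p (x + y) \<le> p x + p y"
proof (rule power2_le_imp_le)
  have "(p (x + y))\<^sup>2 = (p x)\<^sup>2 + 2 * B x y + (p y)\<^sup>2"
    by (simp add: form_self[symmetric] form_simps form_commute[of y x])
  also have "\<dots> \<le> (p x + p y)\<^sup>2"
    using Cauchy_Schwarz[of x y] by (simp add: power2_sum)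
  finally show "(p (x + y))\<^sup>2 \<le> (p x + p y)\<^sup>2" .
qed simp

lemma triangle_diff: "p (x - z) \<le> p (x - y) + p (y - z)"
  using triangle[of "x - y" "y - z"] by simp

lemma reverse_triangle: "\<bar>p x - p y\<bar> \<le> p (x - y)"
  using triangle[of "x - y" y] triangle[of "y - x" x] minus_commute[of x y] by simp

end

section \<open>Gram--Schmidt systems that may contain null vectors\<close>

context hilbertian
begin

text \<open>Null vectors of the semi-norm are allowed to be members of the system, so that it can span
  any given vectors.\<close>

definition orthosystem :: "nat \<Rightarrow> (nat \<Rightarrow> 'a) \<Rightarrow> bool"
  where "orthosystem n g \<longleftrightarrow> (\<forall>i<n. \<forall>j<n. i \<noteq> j \<longrightarrow> B (g i) (g j) = 0) \<and>
    (\<forall>i<n. p (g i) = 0 \<or> p (g i) = 1)"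

text \<open>The slack \<open>\<eta>\<close> pays for null vectors: they carry a coefficient in the
  expansion although they add nothing to \<open>p v\<close>.\<close>

definition expands :: "real \<Rightarrow> nat \<Rightarrow> (nat \<Rightarrow> 'a) \<Rightarrow> 'a \<Rightarrow> bool"
  where "expands \<eta> n g v \<longleftrightarrow>
    (\<exists>c. v = (\<Sum>i<n. c i *\<^sub>R g i) \<and> (\<Sum>i<n. (c i)\<^sup>2) \<le> (p v)\<^sup>2 + \<eta>)"

lemma form_null: "p y = 0 \<Longrightarrow> B x y = 0" "p y = 0 \<Longrightarrow> B y x = 0"
  using Cauchy_Schwarz[of x y] Cauchy_Schwarz[of y x] by auto

lemma orthosystem_form:
  assumes "orthosystem n g" and "j < n"
  shows "B (\<Sum>i<n. c i *\<^sub>R g i) (g j) = c j * (p (g j))\<^sup>2"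
proof -
  have "B (\<Sum>i<n. c i *\<^sub>R g i) (g j) = (\<Sum>i<n. c i * B (g i) (g j))"
    by (simp add: form_simps)
  also have "\<dots> = (\<Sum>i<n. if i = j then c j * (p (g j))\<^sup>2 else 0)"
    using assms by (intro sum.cong) (auto simp: orthosystem_def form_self)
  also have "\<dots> = c j * (p (g j))\<^sup>2" using assms by simp
  finally show ?thesis .
qed

lemma orthosystem_norm:
  assumes "orthosystem n g"
  shows "(p (\<Sum>i<n. c i *\<^sub>R g i))\<^sup>2 = (\<Sum>i<n. (c i)\<^sup>2 * (p (g i))\<^sup>2)"
proof -
  have "(p (\<Sum>i<n. c i *\<^sub>R g i))\<^sup>2 = (\<Sum>j<n. c j * B (\<Sum>i<n. c i *\<^sub>R g i) (g j))"
    by (simp add: form_self[symmetric] linear_sum[OF form_linear] linear_scale[OF form_linear])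
  also have "\<dots> = (\<Sum>i<n. (c i)\<^sup>2 * (p (g i))\<^sup>2)"
    using orthosystem_form[OF assms] by (intro sum.cong) (auto simp: power2_eq_square)
  finally show ?thesis .
qed

lemma orthosystem_extend:
  assumes g: "orthosystem n g" and w: "\<And>j. j < n \<Longrightarrow> B w (g j) = 0" and "p w = 0 \<or> p w = 1"
  shows "orthosystem (Suc n) (g(n := w))"
  unfolding orthosystem_def
proof (intro conjI allI impI)
  fix i j assume "i < Suc n" "j < Suc n" "i \<noteq> j"
  then consider "i < n" "j < n" | "i = n" "j < n" | "i < n" "j = n" by linarith
  then show "B ((g(n := w)) i) ((g(n := w)) j) = 0"
  proof cases
    case 1
    then show ?thesis using g \<open>i \<noteq> j\<close> by (simp add: orthosystem_def)
  next
    case 2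
    then show ?thesis using w by simp
  next
    case 3
    then show ?thesis using w[of i] form_commute[of w "g i"] by simp
  qed
next
  fix i assume "i < Suc n"
  then show "p ((g(n := w)) i) = 0 \<or> p ((g(n := w)) i) = 1"
    using g assms(3) by (auto simp: orthosystem_def less_Suc_eq)
qed

text \<open>Pythagoras. Null members do no harm: by Cauchy--Schwarz their coefficients
  \<open>B v (g i)\<close> vanish.\<close>

lemma orthosystem_residual:
  fixes v
  assumes g: "orthosystem n g"
  defines "w \<equiv> v - (\<Sum>i<n. B v (g i) *\<^sub>R g i)"
  shows "\<And>j. j < n \<Longrightarrow> B w (g j) = 0" and "(p v)\<^sup>2 = (\<Sum>i<n. (B v (g i))\<^sup>2) + (p w)\<^sup>2"
proof -
  define c where "c i = B v (g i)" for i
  have w: "w = v - (\<Sum>i<n. c i *\<^sub>R g i)" by (simp add: w_def c_def)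
  have c0: "c i = 0" if "p (g i) = 0" for i
    using form_null that by (simp add: c_def)
  show wg: "B w (g j) = 0" if "j < n" for j
  proof -
    have "B w (g j) = c j - c j * (p (g j))\<^sup>2"
      unfolding w using orthosystem_form[OF g that]
      by (simp only: form_simps(4)) (simp add: c_def)
    then show ?thesis using g that c0[of j] by (auto simp: orthosystem_def)
  qed
  have "B w (\<Sum>i<n. c i *\<^sub>R g i) = 0"
    using wg by (simp add: linear_sum[OF form_linear] linear_scale[OF form_linear])
  then have "(p (w + (\<Sum>i<n. c i *\<^sub>R g i)))\<^sup>2 = (p w)\<^sup>2 + (p (\<Sum>i<n. c i *\<^sub>R g i))\<^sup>2"
    by (simp add: form_self[symmetric] linear_add[OF form_linear] linear_add[OF form_linear_left]
        form_commute[of "\<Sum>i<n. c i *\<^sub>R g i" w])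
  moreover have "(p (\<Sum>i<n. c i *\<^sub>R g i))\<^sup>2 = (\<Sum>i<n. (c i)\<^sup>2)"
    unfolding orthosystem_norm[OF g]
    using g c0 by (intro sum.cong) (auto simp: orthosystem_def)
  ultimately have "(p v)\<^sup>2 = (\<Sum>i<n. (c i)\<^sup>2) + (p w)\<^sup>2" by (simp add: w)
  then show "(p v)\<^sup>2 = (\<Sum>i<n. (B v (g i))\<^sup>2) + (p w)\<^sup>2" by (simp add: c_def)
qed

lemma orthosystem_Suc:
  assumes g: "orthosystem n g" and "\<eta> > 0"
  shows "\<exists>g'. orthosystem (Suc n) g' \<and> (\<forall>i<n. g' i = g i) \<and> expands \<eta> (Suc n) g' v"
proof -
  define c where "c i = B v (g i)" for i
  define w where "w = v - (\<Sum>i<n. B v (g i) *\<^sub>R g i)"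
  \<comment> \<open>A null residual cannot be normalized. Dividing it by \<open>sqrt \<eta>\<close>
    keeps it null and makes its coefficient cost exactly \<open>\<eta>\<close>.\<close>
  define l where "l = (if p w = 0 then sqrt \<eta> else p w)"
  have l: "l > 0"
    using \<open>\<eta> > 0\<close> nonneg[of w] unfolding l_def by (cases "p w = 0") (simp_all del: nonneg)
  have l2: "l\<^sup>2 \<le> (p w)\<^sup>2 + \<eta>"
    using \<open>\<eta> > 0\<close> unfolding l_def by simp
  define g' where "g' = g(n := (1 / l) *\<^sub>R w)"
  have g'i: "g' i = g i" if "i < n" for i using that by (simp add: g'_def)
  have ortho: "orthosystem (Suc n) g'"
    unfolding g'_def
  proof (rule orthosystem_extend[OF g])
    show "B ((1 / l) *\<^sub>R w) (g j) = 0" if "j < n" for j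
      using orthosystem_residual(1)[OF g that, of v]
      by (simp add: linear_scale[OF form_linear_left] w_def)
    show "p ((1 / l) *\<^sub>R w) = 0 \<or> p ((1 / l) *\<^sub>R w) = 1"
      using l by (auto simp: scale l_def)
  qed
  have v: "v = (\<Sum>i<Suc n. (c(n := l)) i *\<^sub>R g' i)"
    using l by (simp add: g'_def w_def c_def)
  have "(p v)\<^sup>2 = (\<Sum>i<n. (c i)\<^sup>2) + (p w)\<^sup>2"
    using orthosystem_residual(2)[OF g, of v] unfolding w_def c_def .
  then have "(\<Sum>i<Suc n. ((c(n := l)) i)\<^sup>2) \<le> (p v)\<^sup>2 + \<eta>"
    using l2 by simp
  with v have "expands \<eta> (Suc n) g' v"
    unfolding expands_def by blast
  then show ?thesis using ortho g'i by (intro exI[of _ g'] conjI allI impI)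
qed

lemma gram_schmidt:
  assumes "finite A" and "\<eta> > 0"
  obtains n g where "orthosystem n g"
    "\<And>v. v \<in> A \<Longrightarrow> expands \<eta> n g v"
proof -
  have "\<exists>n g. orthosystem n g \<and>
    (\<forall>v\<in>A. expands \<eta> n g v)"
    using assms(1)
  proof induction
    case empty
    have "orthosystem 0 (\<lambda>_. 0)" by (simp add: orthosystem_def)
    then show ?case by (intro exI[of _ 0] exI[of _ "\<lambda>_. 0"]) simp
  next
    case (insert v A)
    then obtain n g where g: "orthosystem n g"
      and A: "\<forall>v\<in>A. expands \<eta> n g v"
      by blast
    obtain g' where g': "orthosystem (Suc n) g'" "\<forall>i<n. g' i = g i"
      and v: "expands \<eta> (Suc n) g' v"
      using orthosystem_Suc[OF g assms(2), of v] by blast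
    \<comment> \<open>Earlier vectors get the coefficient 0 at the new member, so the slack does not
      accumulate.\<close>
    have "expands \<eta> (Suc n) g' u" if u: "u \<in> A" for u
    proof -
      obtain c where c: "u = (\<Sum>i<n. c i *\<^sub>R g i)" "(\<Sum>i<n. (c i)\<^sup>2) \<le> (p u)\<^sup>2 + \<eta>"
        using bspec[OF A u] unfolding expands_def by blast
      have "u = (\<Sum>i<n. c i *\<^sub>R g' i)"
        unfolding c(1) using g'(2) by (intro sum.cong) auto
      then show ?thesis
        unfolding expands_def using c(2) by (intro exI[of _ "c(n := 0)"]) simp
    qed
    then have "\<forall>u\<in>insert v A. expands \<eta> (Suc n) g' u"
      using v by simp
    with g'(1) show ?case by (intro exI[of _ "Suc n"] exI[of _ g'] conjI)
  qed
  then show ?thesis using that by metis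
qed

end

text \<open>The linear map from Euclidean n-space that sends the unit vectors to the
  \<open>f j\<close> has norm at most one for \<open>q\<close>.\<close>

definition contractive :: "('a::real_vector \<Rightarrow> real) \<Rightarrow> nat \<Rightarrow> (nat \<Rightarrow> 'a) \<Rightarrow> bool"
  where "contractive q n f \<longleftrightarrow> (\<forall>c. (q (\<Sum>j<n. c j *\<^sub>R f j))\<^sup>2 \<le> (\<Sum>j<n. (c j)\<^sup>2))"

text \<open>The Hilbert--Schmidt condition without completions or bases: the supremum of these sums
  is the squared Hilbert--Schmidt norm of the canonical map.\<close>

definition HS_bound :: "('a::real_vector \<Rightarrow> real) \<Rightarrow> ('a \<Rightarrow> real) \<Rightarrow> real \<Rightarrow> bool"
  where "HS_bound p q C \<longleftrightarrow> (\<forall>n f. contractive q n f \<longrightarrow> (\<Sum>j<n. (p (f j))\<^sup>2) \<le> C)"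

context hilbertian
begin

lemma orthosystem_contractive: "orthosystem n g \<Longrightarrow> contractive p n g"
  unfolding contractive_def
proof
  fix c
  assume g: "orthosystem n g"
  show "(p (\<Sum>j<n. c j *\<^sub>R g j))\<^sup>2 \<le> (\<Sum>j<n. (c j)\<^sup>2)"
    unfolding orthosystem_norm[OF g]
    using g by (intro sum_mono) (auto simp: orthosystem_def)
qed

text \<open>The adjoint of a contraction is a contraction: testing against the combination with
  coefficients \<open>B (f j) w\<close> bounds the sum \<open>s\<close> by
  \<open>sqrt s * p w\<close>.\<close>

lemma contractive_Bessel:
  assumes "contractive p n f"
  shows "(\<Sum>j<n. (B (f j) w)\<^sup>2) \<le> (p w)\<^sup>2"
proof -
  define d where "d j = B (f j) w" for j
  define s where "s = (\<Sum>j<n. (d j)\<^sup>2)"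
  have s0: "s \<ge> 0" by (simp add: s_def sum_nonneg)
  have "s = B (\<Sum>j<n. d j *\<^sub>R f j) w"
    by (simp add: s_def form_simps d_def power2_eq_square)
  also have "\<dots> \<le> p (\<Sum>j<n. d j *\<^sub>R f j) * p w" using Cauchy_Schwarz[of "\<Sum>j<n. d j *\<^sub>R f j" w] by simp
  also have "\<dots> \<le> sqrt s * p w"
    using assms by (intro mult_right_mono real_le_rsqrt) (auto simp: contractive_def s_def)
  finally have "sqrt s * sqrt s \<le> sqrt s * p w" using s0 by simp
  then have "sqrt s \<le> p w"
    using s0 by (cases "s = 0") (auto simp del: real_sqrt_mult_self)
  then have "s \<le> (p w)\<^sup>2"
    using s0 nonneg[of w] by (simp add: sqrt_le_D)
  then show ?thesis by (simp add: s_def d_def)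
qed

text \<open>The trace inequality \<open>tr (A\<^sup>T A P) \<le> tr P\<close> for a contraction \<open>A\<close> and a Gram matrix \<open>P\<close>.\<close>

lemma sum_contraction_le:
  assumes "finite F"
    and a: "\<And>x. (\<Sum>j<n. (\<Sum>e\<in>F. a j e * x e)\<^sup>2) \<le> (\<Sum>e\<in>F. (x e)\<^sup>2)"
  shows "(\<Sum>j<n. (p (\<Sum>e\<in>F. a j e *\<^sub>R v e))\<^sup>2) \<le> (\<Sum>e\<in>F. (p (v e))\<^sup>2)"
proof -
  \<comment> \<open>The contraction acts on the index \<open>e\<close> only. Expanding all
    \<open>v e\<close> in one orthosystem lets the hypothesis be applied to each coordinate
    \<open>i\<close> separately.\<close>
  obtain m g where g: "orthosystem m g"
    and vg: "\<And>u. u \<in> v ` F \<Longrightarrow> expands 1 m g u"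
    using gram_schmidt[of "v ` F" 1] \<open>finite F\<close> by auto
  have "\<forall>e\<in>F. \<exists>c. v e = (\<Sum>i<m. c i *\<^sub>R g i)" using vg unfolding expands_def by blast
  then obtain c where "\<forall>e\<in>F. v e = (\<Sum>i<m. c e i *\<^sub>R g i)"
    by (rule bchoice[THEN exE])
  then have c: "\<And>e. e \<in> F \<Longrightarrow> v e = (\<Sum>i<m. c e i *\<^sub>R g i)" by blast
  have "(p (\<Sum>e\<in>F. a j e *\<^sub>R v e))\<^sup>2 = (\<Sum>i<m. (\<Sum>e\<in>F. a j e * c e i)\<^sup>2 * (p (g i))\<^sup>2)" for j
  proof -
    have "(\<Sum>e\<in>F. a j e *\<^sub>R v e) = (\<Sum>e\<in>F. \<Sum>i<m. (a j e * c e i) *\<^sub>R g i)"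
      by (intro sum.cong) (simp_all add: c scaleR_sum_right)
    also have "\<dots> = (\<Sum>i<m. (\<Sum>e\<in>F. a j e * c e i) *\<^sub>R g i)"
      by (subst sum.swap) (simp add: scaleR_sum_left)
    finally show ?thesis using orthosystem_norm[OF g] by simp
  qed
  then have "(\<Sum>j<n. (p (\<Sum>e\<in>F. a j e *\<^sub>R v e))\<^sup>2)
      = (\<Sum>i<m. (\<Sum>j<n. (\<Sum>e\<in>F. a j e * c e i)\<^sup>2) * (p (g i))\<^sup>2)"
    by (simp add: sum_distrib_right sum.swap[of _ "{..<m}"])
  also have "\<dots> \<le> (\<Sum>i<m. (\<Sum>e\<in>F. (c e i)\<^sup>2) * (p (g i))\<^sup>2)"
    by (intro sum_mono mult_right_mono a) auto
  also have "\<dots> = (\<Sum>e\<in>F. \<Sum>i<m. (c e i)\<^sup>2 * (p (g i))\<^sup>2)"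
    by (simp add: sum_distrib_right sum.swap[of _ "{..<m}"])
  also have "\<dots> = (\<Sum>e\<in>F. (p (v e))\<^sup>2)"
    by (intro sum.cong) (simp_all add: c orthosystem_norm[OF g])
  finally show ?thesis .
qed

end

section \<open>Completions and the Hilbert--Schmidt condition\<close>

lemma zero_nbhd_seminorm_topology:
  assumes P: "\<forall>p\<in>P. hilbertian_seminorm p"
  shows "zero_nbhd (seminorm_topology P) U \<longleftrightarrow>
    (\<exists>F e. finite F \<and> F \<subseteq> P \<and> 0 < e \<and> {x. \<forall>p\<in>F. p x < e} \<subseteq> U)"
proof
  assume "zero_nbhd (seminorm_topology P) U"
  then obtain V where V: "openin (seminorm_topology P) V" "0 \<in> V" "V \<subseteq> U"
    by (auto simp: zero_nbhd_def)
  have "\<forall>x\<in>V. \<exists>\<F>. finite \<F> \<and> \<F> \<subseteq> {{x. p x < e} | p e. p \<in> P \<and> 0 < e} \<and>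
      (\<forall>y\<in>UNIV. (\<forall>N\<in>\<F>. y - x \<in> N) \<longrightarrow> y \<in> V)"
    using V(1) unfolding seminorm_topology_def openin_nbhd_topology by (rule conjunct2)
  from bspec[OF this V(2)] obtain \<F> where \<F>: "finite \<F>"
    "\<F> \<subseteq> {{x. p x < e} | p e. p \<in> P \<and> 0 < e}"
    "\<forall>y\<in>UNIV. (\<forall>N\<in>\<F>. y - 0 \<in> N) \<longrightarrow> y \<in> V"
    by (elim exE conjE)
  have "\<forall>N\<in>\<F>. \<exists>pe. N = {x. fst pe x < snd pe} \<and> fst pe \<in> P \<and> 0 < snd pe"
  proof
    fix N assume "N \<in> \<F>"
    with \<F>(2) obtain p e where "N = {x. p x < e}" "p \<in> P" "0 < e" by blast
    then show "\<exists>pe. N = {x. fst pe x < snd pe} \<and> fst pe \<in> P \<and> 0 < snd pe"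
      by (intro exI[of _ "(p, e)"]) simp
  qed
  then obtain h where h: "\<forall>N\<in>\<F>. N = {x. fst (h N) x < snd (h N)} \<and> fst (h N) \<in> P \<and> 0 < snd (h N)"
    by (rule bchoice[THEN exE])
  \<comment> \<open>The inserted 1 keeps the minimum defined when \<open>\<F>\<close> is
    empty.\<close>
  define e where "e = Min (insert 1 ((\<lambda>N. snd (h N)) ` \<F>))"
  have "e > 0" unfolding e_def using \<F>(1) h by (subst Min_gr_iff) auto
  have e_le: "e \<le> snd (h N)" if "N \<in> \<F>" for N
    unfolding e_def using \<F>(1) that by (intro Min_le) auto
  have "x \<in> U" if x: "\<forall>p\<in>(\<lambda>N. fst (h N)) ` \<F>. p x < e" for x
  proof -
    have "x - 0 \<in> N" if N: "N \<in> \<F>" for N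
    proof -
      have "fst (h N) x < snd (h N)" using x e_le[OF N] N by fastforce
      then show ?thesis using h N by auto
    qed
    then show ?thesis using \<F>(3) V(3) by auto
  qed
  then show "\<exists>F e. finite F \<and> F \<subseteq> P \<and> 0 < e \<and> {x. \<forall>p\<in>F. p x < e} \<subseteq> U"
    using \<F>(1) h \<open>e > 0\<close> by (intro exI[of _ "(\<lambda>N. fst (h N)) ` \<F>"] exI[of _ e]) auto
next
  assume "\<exists>F e. finite F \<and> F \<subseteq> P \<and> 0 < e \<and> {x. \<forall>p\<in>F. p x < e} \<subseteq> U"
  then obtain F e where F: "finite F" "F \<subseteq> P" "0 < e" "{x. \<forall>p\<in>F. p x < e} \<subseteq> U"
    by blast
  define V where "V = {x. \<forall>p\<in>F. p x < e}"
  have "openin (seminorm_topology P) V"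
    unfolding seminorm_topology_def openin_nbhd_topology
  proof (intro conjI ballI)
    fix x assume x: "x \<in> V"
    \<comment> \<open>The room left at \<open>x\<close> is \<open>e - p x\<close>; by the triangle
      inequality it suffices.\<close>
    let ?F = "(\<lambda>p. {z. p z < e - p x}) ` F"
    have "y \<in> V" if y: "\<forall>N\<in>?F. y - x \<in> N" for y
      unfolding V_def
    proof safe
      fix p assume p: "p \<in> F"
      interpret hilbertian p using P F(2) p by unfold_locales auto
      show "p y < e" using y p triangle[of "y - x" x] by fastforce
    qed
    moreover have "?F \<subseteq> {{x. p x < e} | p e. p \<in> P \<and> 0 < e}"
      using x F(2) by (fastforce simp: V_def)
    ultimately show "\<exists>\<F>. finite \<F> \<and> \<F> \<subseteq> {{x. p x < e} | p e. p \<in> P \<and> 0 < e} \<and>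
        (\<forall>y\<in>UNIV. (\<forall>N\<in>\<F>. y - x \<in> N) \<longrightarrow> y \<in> V)"
      using F(1) by (intro exI[of _ ?F]) auto
  qed simp
  moreover have "0 \<in> V"
  proof -
    have *: "p 0 = 0" if "p \<in> F" for p
    proof -
      interpret hilbertian p using P F(2) that by unfold_locales auto
      show ?thesis by simp
    qed
    have "p 0 < e" if "p \<in> F" for p using F(3) *[OF that] by simp
    then show ?thesis by (simp add: V_def)
  qed
  ultimately show "zero_nbhd (seminorm_topology P) U"
    using F(4) unfolding zero_nbhd_def V_def by blast
qed

lemma topspace_seminorm_topology [simp]: "topspace (seminorm_topology P) = UNIV"
  by (simp add: seminorm_topology_def)

lemma cauchy_seqs_seminorm_topology:
  assumes P: "\<forall>p\<in>P. hilbertian_seminorm p"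
  shows "x \<in> cauchy_seqs (seminorm_topology P) \<longleftrightarrow>
    (\<forall>p\<in>P. \<forall>e>0. \<exists>N. \<forall>m\<ge>N. \<forall>n\<ge>N. p (x m - x n) < e)"
proof
  assume x: "x \<in> cauchy_seqs (seminorm_topology P)"
  show "\<forall>p\<in>P. \<forall>e>0. \<exists>N. \<forall>m\<ge>N. \<forall>n\<ge>N. p (x m - x n) < e"
  proof (intro ballI allI impI)
    fix p and e :: real assume "p \<in> P" "e > 0"
    then have "zero_nbhd (seminorm_topology P) {z. p z < e}"
      unfolding zero_nbhd_seminorm_topology[OF P]
      by (intro exI[of _ "{p}"] exI[of _ e]) auto
    then have "\<exists>N. \<forall>m\<ge>N. \<forall>n\<ge>N. x m - x n \<in> {z. p z < e}"
      using x unfolding cauchy_seqs_def by blast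
    then show "\<exists>N. \<forall>m\<ge>N. \<forall>n\<ge>N. p (x m - x n) < e" by simp
  qed
next
  assume x: "\<forall>p\<in>P. \<forall>e>0. \<exists>N. \<forall>m\<ge>N. \<forall>n\<ge>N. p (x m - x n) < e"
  show "x \<in> cauchy_seqs (seminorm_topology P)"
    unfolding cauchy_seqs_def mem_Collect_eq
  proof (intro allI impI)
    fix U assume "zero_nbhd (seminorm_topology P) U"
    then obtain F e where F: "finite F" "F \<subseteq> P" "0 < e" "{x. \<forall>p\<in>F. p x < e} \<subseteq> U"
      unfolding zero_nbhd_seminorm_topology[OF P] by blast
    have "\<exists>N. \<forall>m\<ge>N. \<forall>n\<ge>N. \<forall>p\<in>F. p (x m - x n) < e"
      using F(1,2)
    proof induction
      case (insert p F)
      then obtain N where N: "\<forall>m\<ge>N. \<forall>n\<ge>N. \<forall>p\<in>F. p (x m - x n) < e" by auto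
      obtain N' where N': "\<forall>m\<ge>N'. \<forall>n\<ge>N'. p (x m - x n) < e"
        using x insert.prems \<open>0 < e\<close> by blast
      show ?case using N N' by (intro exI[of _ "max N N'"]) auto
    qed auto
    then show "\<exists>N. \<forall>m\<ge>N. \<forall>n\<ge>N. x m - x n \<in> U" using F(4) by blast
  qed
qed

section \<open>Cauchy sequences as elements of the Hilbert completion\<close>

context hilbertian
begin

definition cauchy_set :: "(nat \<Rightarrow> 'a) set"
  where "cauchy_set = {x. \<forall>e>0. \<exists>N. \<forall>m\<ge>N. \<forall>n\<ge>N. p (x m - x n) < e}"

lemma cauchy_seqs_eq: "cauchy_seqs (seminorm_topology {p}) = cauchy_set"
  using cauchy_seqs_seminorm_topology[of "{p}"] hilbertian by (auto simp: cauchy_set_def)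

lemma cauchy_set_D: "x \<in> cauchy_set \<Longrightarrow> e > 0 \<Longrightarrow> \<exists>N. \<forall>m\<ge>N. \<forall>n\<ge>N. p (x m - x n) < e"
  unfolding cauchy_set_def by blast

lemma cauchy_set_const [simp]: "(\<lambda>_. f) \<in> cauchy_set" by (simp add: cauchy_set_def)

lemma cauchy_set_add:
  assumes "x \<in> cauchy_set" "y \<in> cauchy_set" shows "(\<lambda>k. x k + y k) \<in> cauchy_set"
  unfolding cauchy_set_def
proof safe
  fix e :: real assume "e > 0"
  obtain N where N: "\<forall>m\<ge>N. \<forall>n\<ge>N. p (x m - x n) < e / 2"
    using cauchy_set_D[OF assms(1), of "e / 2"] \<open>e > 0\<close> by auto
  obtain N' where N': "\<forall>m\<ge>N'. \<forall>n\<ge>N'. p (y m - y n) < e / 2"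
    using cauchy_set_D[OF assms(2), of "e / 2"] \<open>e > 0\<close> by auto
  have "p (x m + y m - (x n + y n)) < e" if "m \<ge> max N N'" "n \<ge> max N N'" for m n
  proof -
    have "p (x m + y m - (x n + y n)) \<le> p (x m - x n) + p (y m - y n)"
      using triangle[of "x m - x n" "y m - y n"] by (simp add: algebra_simps)
    also have "\<dots> < e / 2 + e / 2" using N N' that by (intro add_strict_mono) auto
    finally show ?thesis by simp
  qed
  then show "\<exists>N. \<forall>m\<ge>N. \<forall>n\<ge>N. p (x m + y m - (x n + y n)) < e" by blast
qed

lemma cauchy_set_scale:
  assumes "x \<in> cauchy_set" shows "(\<lambda>k. c *\<^sub>R x k) \<in> cauchy_set"
  unfolding cauchy_set_def
proof safe
  fix e :: real assume "e > 0"
  obtain N where N: "\<forall>m\<ge>N. \<forall>n\<ge>N. p (x m - x n) < e / (\<bar>c\<bar> + 1)"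
    using cauchy_set_D[OF assms, of "e / (\<bar>c\<bar> + 1)"] \<open>e > 0\<close> by auto
  have "p (c *\<^sub>R x m - c *\<^sub>R x n) < e" if "m \<ge> N" "n \<ge> N" for m n
  proof -
    have "p (c *\<^sub>R x m - c *\<^sub>R x n) = \<bar>c\<bar> * p (x m - x n)"
      by (simp add: scale[symmetric] scaleR_diff_right)
    also have "\<dots> \<le> (\<bar>c\<bar> + 1) * p (x m - x n)" by (intro mult_right_mono) auto
    also have "\<dots> < e" using N that by (simp add: field_simps)
    finally show ?thesis .
  qed
  then show "\<exists>N. \<forall>m\<ge>N. \<forall>n\<ge>N. p (c *\<^sub>R x m - c *\<^sub>R x n) < e" by blast
qed

lemma cauchy_set_diff: "x \<in> cauchy_set \<Longrightarrow> y \<in> cauchy_set \<Longrightarrow> (\<lambda>k. x k - y k) \<in> cauchy_set"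
  using cauchy_set_add[of x "\<lambda>k. (-1) *\<^sub>R y k"] cauchy_set_scale[of y "-1"] by simp

lemma cauchy_set_sum:
  assumes "finite F" and "\<And>e. e \<in> F \<Longrightarrow> x e \<in> cauchy_set" shows "(\<lambda>k. \<Sum>e\<in>F. x e k) \<in> cauchy_set"
  using assms by (induction F) (auto intro: cauchy_set_add)

lemma cauchy_set_convergent:
  assumes "x \<in> cauchy_set" shows "convergent (\<lambda>k. p (x k))"
proof -
  have "Cauchy (\<lambda>k. p (x k))"
  proof (rule metric_CauchyI)
    fix e :: real assume "e > 0"
    then obtain N where "\<forall>m\<ge>N. \<forall>n\<ge>N. p (x m - x n) < e" using cauchy_set_D assms by blast
    then show "\<exists>M. \<forall>m\<ge>M. \<forall>n\<ge>M. dist (p (x m)) (p (x n)) < e"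
      by (intro exI[of _ N]) (auto simp: dist_real_def intro: le_less_trans[OF reverse_triangle])
  qed
  then show ?thesis by (simp add: Cauchy_convergent_iff)
qed

lemma cauchy_set_bounded:
  assumes "x \<in> cauchy_set" obtains b where "b > 0" "\<And>k. p (x k) \<le> b"
proof -
  obtain b where b: "b > 0" "\<forall>k. norm (p (x k)) \<le> b"
    using BseqE[OF convergent_imp_Bseq[OF cauchy_set_convergent[OF assms]]] by blast
  have "p (x k) \<le> b" for k using b(2)[rule_format, of k] by simp
  then show ?thesis using that b(1) by blast
qed

text \<open>Justifies the \<open>lim\<close> in \<open>completion_inner\<close>: polarization
  reduces it to the convergence of \<open>p (x k + y k)\<close> and
  \<open>p (x k - y k)\<close>.\<close>

lemma completion_inner_tendsto:
  assumes "x \<in> cauchy_set" "y \<in> cauchy_set"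
  shows "(\<lambda>k. B (x k) (y k)) \<longlonglongrightarrow> completion_inner p x y"
proof -
  obtain a b where "(\<lambda>k. p (x k + y k)) \<longlonglongrightarrow> a" "(\<lambda>k. p (x k - y k)) \<longlonglongrightarrow> b"
    using cauchy_set_convergent[OF cauchy_set_add[OF assms]] cauchy_set_convergent[OF cauchy_set_diff[OF assms]]
    unfolding convergent_def by blast
  then have "(\<lambda>k. B (x k) (y k)) \<longlonglongrightarrow> (a\<^sup>2 - b\<^sup>2) / 4"
    unfolding polar_form_def by (intro tendsto_intros) auto
  then show ?thesis by (simp add: completion_inner_def limI)
qed

lemma sum_le: "p (\<Sum>i\<in>I. x i) \<le> (\<Sum>i\<in>I. p (x i))"
  by (induction I rule: infinite_finite_induct) (auto intro: order_trans[OF triangle])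

lemma diff_sq: "(p (x - y))\<^sup>2 = (p x)\<^sup>2 - 2 * B x y + (p y)\<^sup>2"
  by (simp add: form_self[symmetric] linear_diff[OF form_linear] linear_diff[OF form_linear_left]
      form_commute[of y x])

text \<open>\<open>E\<close> is only known to be maximal. Let \<open>s\<close> be the supremum of
  the finite Bessel sums; the residuals of \<open>f\<close> along nearly optimal finite sets form a
  Cauchy sequence in the completion. A diagonal sequence \<open>y\<close> in the space itself
  represents their limit; it is orthogonal to \<open>E\<close>, hence null by maximality, and so
  \<open>(p f)\<^sup>2 \<le> s\<close>. The claim covers all larger finite sets so that several
  vectors can share one set.\<close>

lemma Parseval:
  assumes E: "orthonormal_basis p E" and "\<delta> > 0"
  shows "\<exists>F. finite F \<and> F \<subseteq> E \<and> (\<forall>F'. finite F' \<longrightarrow> F \<subseteq> F' \<longrightarrow> F' \<subseteq> E \<longrightarrow>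
    (p f)\<^sup>2 - (\<Sum>e\<in>F'. (completion_inner p (\<lambda>_. f) e)\<^sup>2) < \<delta>)"
proof -
  define c where "c e = completion_inner p (\<lambda>_. f) e" for e
  define u where "u F k = f - (\<Sum>e\<in>F. c e *\<^sub>R e k)" for F and k :: nat
  have EPC: "e \<in> cauchy_set" if "e \<in> E" for e
    using E that by (auto simp: orthonormal_basis_def cauchy_seqs_eq)
  have ONB: "completion_inner p e e' = (if e = e' then 1 else 0)" if "e \<in> E" "e' \<in> E" for e e'
    using E that by (simp add: orthonormal_basis_def)
  have lim_ee: "(\<lambda>k. B (e k) (e' k)) \<longlonglongrightarrow> (if e = e' then 1 else 0)" if "e \<in> E" "e' \<in> E" for e e'
    using completion_inner_tendsto[OF EPC EPC, OF that] ONB[OF that] by simp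
  have lim_f: "(\<lambda>k. B f (e k)) \<longlonglongrightarrow> c e" if "e \<in> E" for e
    using completion_inner_tendsto[OF cauchy_set_const EPC[OF that]] by (simp add: c_def)
  have lim_sq: "(\<lambda>k. (p (\<Sum>e\<in>F. d e *\<^sub>R e k))\<^sup>2) \<longlonglongrightarrow> (\<Sum>e\<in>F. (d e)\<^sup>2)"
    if "finite F" "F \<subseteq> E" for F d
  proof -
    have "(\<lambda>k. \<Sum>e\<in>F. \<Sum>e'\<in>F. d e * (d e' * B (e' k) (e k)))
        \<longlonglongrightarrow> (\<Sum>e\<in>F. \<Sum>e'\<in>F. d e * (d e' * (if e' = e then 1 else 0)))"
      using that by (intro tendsto_intros lim_ee) auto
    moreover have "(\<Sum>e\<in>F. \<Sum>e'\<in>F. d e * (d e' * (if e' = e then 1 else 0))) = (\<Sum>e\<in>F. (d e)\<^sup>2)"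
      using that by (intro sum.cong) (auto simp: power2_eq_square if_distrib cong: if_cong)
    moreover have "(p (\<Sum>e\<in>F. d e *\<^sub>R e k))\<^sup>2 = (\<Sum>e\<in>F. \<Sum>e'\<in>F. d e * (d e' * B (e' k) (e k)))" for k
      by (simp add: form_self[symmetric] linear_sum[OF form_linear] linear_sum[OF form_linear_left]
          linear_scale[OF form_linear] linear_scale[OF form_linear_left] sum_distrib_left)
    ultimately show ?thesis by simp
  qed
  have lim_fs: "(\<lambda>k. B f (\<Sum>e\<in>F. c e *\<^sub>R e k)) \<longlonglongrightarrow> (\<Sum>e\<in>F. c e * c e)"
    if "finite F" "F \<subseteq> E" for F
  proof -
    have "(\<lambda>k. \<Sum>e\<in>F. c e * B f (e k)) \<longlonglongrightarrow> (\<Sum>e\<in>F. c e * c e)"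
      using that by (intro tendsto_intros lim_f) auto
    then show ?thesis
      by (simp add: linear_sum[OF form_linear] linear_scale[OF form_linear])
  qed
  have lim_u: "(\<lambda>k. (p (u F k))\<^sup>2) \<longlonglongrightarrow> (p f)\<^sup>2 - (\<Sum>e\<in>F. (c e)\<^sup>2)"
    if "finite F" "F \<subseteq> E" for F
  proof -
    have "(\<lambda>k. (p (u F k))\<^sup>2) \<longlonglongrightarrow> (p f)\<^sup>2 - 2 * (\<Sum>e\<in>F. c e * c e) + (\<Sum>e\<in>F. (c e)\<^sup>2)"
      unfolding u_def diff_sq using that by (intro tendsto_intros lim_fs lim_sq)
    then show ?thesis by (simp add: power2_eq_square)
  qed
  have Bessel: "(\<Sum>e\<in>F. (c e)\<^sup>2) \<le> (p f)\<^sup>2" if "finite F" "F \<subseteq> E" for F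
    using LIMSEQ_le_const[OF lim_u[OF that], of 0] by auto
  define S where "S = {\<Sum>e\<in>F. (c e)\<^sup>2 | F. finite F \<and> F \<subseteq> E}"
  define s where "s = Sup S"
  have S: "S \<noteq> {}" "bdd_above S"
    using Bessel by (auto simp: S_def intro!: bdd_aboveI[of _ "(p f)\<^sup>2"])
  have s_upper: "(\<Sum>e\<in>F. (c e)\<^sup>2) \<le> s" if "finite F" "F \<subseteq> E" for F
    unfolding s_def using that S(2) by (intro cSup_upper) (auto simp: S_def)
  have ex: "\<exists>G. finite G \<and> G \<subseteq> E \<and> s - \<epsilon> < (\<Sum>e\<in>G. (c e)\<^sup>2)" if "\<epsilon> > 0" for \<epsilon>
  proof -
    obtain z where "z \<in> S" "s - \<epsilon> < z"
      using less_cSup_iff[OF S, of "s - \<epsilon>"] \<open>\<epsilon> > 0\<close> by (auto simp: s_def)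
    then show ?thesis by (auto simp: S_def)
  qed
  have "\<forall>n::nat. \<exists>G. finite G \<and> G \<subseteq> E \<and> s - 1 / Suc n < (\<Sum>e\<in>G. (c e)\<^sup>2)"
    by (intro allI ex) simp
  then obtain G where G: "\<forall>n::nat. finite (G n) \<and> G n \<subseteq> E \<and> s - 1 / Suc n < (\<Sum>e\<in>G n. (c e)\<^sup>2)"
    by (rule choice[THEN exE])
  define F where "F n = (\<Union>i\<le>n. G i)" for n
  have F: "finite (F n)" "F n \<subseteq> E" for n using G by (auto simp: F_def)
  have F_mono: "F n \<subseteq> F m" if "n \<le> m" for n m
    unfolding F_def using that by (intro UN_mono) auto
  have F_s: "s - 1 / Suc n < (\<Sum>e\<in>F n. (c e)\<^sup>2)" for n
  proof -
    have "(\<Sum>e\<in>G n. (c e)\<^sup>2) \<le> (\<Sum>e\<in>F n. (c e)\<^sup>2)"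
      using F by (intro sum_mono2) (auto simp: F_def)
    then show ?thesis using G by (meson less_le_trans)
  qed
  have uPC: "u (F n) \<in> cauchy_set" for n
  proof -
    have "(\<lambda>k. f - (\<Sum>e\<in>F n. c e *\<^sub>R e k)) \<in> cauchy_set"
      using F EPC by (intro cauchy_set_diff cauchy_set_const cauchy_set_sum cauchy_set_scale) auto
    then show ?thesis by (simp add: u_def[abs_def])
  qed
  \<comment> \<open>Stage \<open>K n\<close> represents the \<open>n\<close>-th residual up to
    \<open>1 / Suc n\<close>; the diagonal sequence \<open>y\<close> picks this stage.\<close>
  have "\<forall>n. \<exists>K. \<forall>k\<ge>K. p (u (F n) K - u (F n) k) \<le> 1 / Suc n"
  proof
    fix n
    obtain K where "\<forall>k\<ge>K. \<forall>l\<ge>K. p (u (F n) k - u (F n) l) < 1 / Suc n"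
      using cauchy_set_D[OF uPC, of "1 / Suc n" n] by auto
    then have "\<forall>k\<ge>K. p (u (F n) K - u (F n) k) \<le> 1 / Suc n" by (simp add: less_imp_le)
    then show "\<exists>K. \<forall>k\<ge>K. p (u (F n) K - u (F n) k) \<le> 1 / Suc n" by blast
  qed
  then obtain K where K: "\<forall>n. \<forall>k\<ge>K n. p (u (F n) (K n) - u (F n) k) \<le> 1 / Suc n"
    by (rule choice[THEN exE])
  define y where "y n = u (F n) (K n)" for n
  have yu: "p (y n - u (F n) k) \<le> 1 / Suc n" if "k \<ge> K n" for n k
    using K that by (simp add: y_def)
  \<comment> \<open>Each of the two replacements of \<open>y\<close> by a residual costs
    \<open>1 / Suc n\<close>. The squared distance of the residuals is in the limit the Bessel sum
    over \<open>F m - F n\<close>, which is small because \<open>F n\<close> nearly attains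
    \<open>s\<close>.\<close>
  have y_diff: "p (y n - y m) \<le> 2 / Suc n + sqrt (2 / Suc n)" if nm: "n \<le> m" for n m
  proof -
    have eq: "u (F n) k - u (F m) k = (\<Sum>e\<in>F m - F n. c e *\<^sub>R e k)" for k
      using F_mono[OF nm] F by (simp add: u_def sum_diff)
    have "(\<Sum>e\<in>F m - F n. (c e)\<^sup>2) = (\<Sum>e\<in>F m. (c e)\<^sup>2) - (\<Sum>e\<in>F n. (c e)\<^sup>2)"
      using F_mono[OF nm] F by (simp add: sum_diff)
    also have "\<dots> < 1 / Suc n"
      using s_upper[OF F, of m] F_s[of n] by linarith
    also have "\<dots> \<le> 2 / Suc n" by (simp add: divide_right_mono)
    finally have "\<forall>\<^sub>F k in sequentially. (p (u (F n) k - u (F m) k))\<^sup>2 < 2 / Suc n"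
      unfolding eq using F by (intro order_tendstoD(2)[OF lim_sq]) auto
    then have "\<forall>\<^sub>F k in sequentially. (p (u (F n) k - u (F m) k))\<^sup>2 < 2 / Suc n \<and> k \<ge> K n \<and> k \<ge> K m"
      by (intro eventually_conj eventually_ge_at_top)
    then obtain k where k: "(p (u (F n) k - u (F m) k))\<^sup>2 < 2 / Suc n" "k \<ge> K n" "k \<ge> K m"
      using eventually_happens'[OF sequentially_bot] by blast
    have "p (y n - y m) \<le> p (y n - u (F n) k) + (p (u (F n) k - u (F m) k) + p (u (F m) k - y m))"
      using triangle_diff[of "y n" "y m" "u (F n) k"] triangle_diff[of "u (F n) k" "y m" "u (F m) k"]
      by linarith
    moreover have "p (y n - u (F n) k) \<le> 1 / Suc n" using yu k by simp
    moreover have "p (u (F m) k - y m) \<le> 1 / Suc n"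
    proof -
      have "p (u (F m) k - y m) \<le> 1 / Suc m" using yu[of m k] k by (simp add: minus_commute)
      also have "\<dots> \<le> 1 / Suc n" using nm by (simp add: field_simps)
      finally show ?thesis .
    qed
    moreover have "p (u (F n) k - u (F m) k) \<le> sqrt (2 / Suc n)"
      using k(1) by (intro real_le_rsqrt) simp
    ultimately show ?thesis by simp
  qed
  have r0: "(\<lambda>n. 2 / Suc n + sqrt (2 / Suc n)) \<longlonglongrightarrow> 0"
  proof -
    have 2: "(\<lambda>n. 2 / real (Suc n)) \<longlonglongrightarrow> 0"
      using tendsto_mult_right_zero[OF LIMSEQ_Suc[OF lim_1_over_n], of 2] by simp
    show ?thesis using tendsto_add[OF 2 tendsto_real_sqrt[OF 2]] by simp
  qed
  have yPC: "y \<in> cauchy_set"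
    unfolding cauchy_set_def
  proof safe
    fix e :: real assume "e > 0"
    then obtain N where N: "2 / Suc N + sqrt (2 / Suc N) < e / 2"
      using order_tendstoD(2)[OF r0, of "e / 2"] eventually_happens'[OF sequentially_bot] by force
    have "p (y m - y n) < e" if "m \<ge> N" "n \<ge> N" for m n
      using triangle_diff[of "y m" "y n" "y N"] y_diff[of N m] y_diff[of N n] N that
        minus_commute[of "y m" "y N"] by linarith
    then show "\<exists>N. \<forall>m\<ge>N. \<forall>n\<ge>N. p (y m - y n) < e" by blast
  qed
  obtain b where b: "b > 0" "\<And>n. p (y n) \<le> b" using cauchy_set_bounded[OF yPC] by blast
  have "completion_inner p y e = 0" if e: "e \<in> E" for e
  proof -
    obtain b' where b': "b' > 0" "\<And>n. p (e n) \<le> b'" using cauchy_set_bounded[OF EPC[OF e]] by blast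
    \<comment> \<open>Three errors: moving the index of \<open>e\<close> from \<open>l\<close> to
      \<open>k\<close>, replacing \<open>y n\<close> by the residual, and the coefficient
      \<open>d\<close> that the residual keeps at \<open>e\<close>.\<close>
    have bound: "\<bar>B (y n) (e l)\<bar> \<le> b * \<epsilon> + b' / Suc n + sqrt (1 / Suc n)"
      if eps: "\<forall>k\<ge>N. \<forall>l\<ge>N. p (e k - e l) < \<epsilon>" and l: "l \<ge> N" for n N l \<epsilon>
    proof -
      define d where "d = c e - (\<Sum>e'\<in>F n. c e' * (if e' = e then 1 else 0))"
      have "(\<lambda>k. B f (e k) - (\<Sum>e'\<in>F n. c e' * B (e' k) (e k))) \<longlonglongrightarrow> d"
        unfolding d_def using F e by (intro tendsto_intros lim_f lim_ee) auto
      then have "(\<lambda>k. B (u (F n) k) (e k)) \<longlonglongrightarrow> d"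
        by (simp add: u_def linear_diff[OF form_linear_left] linear_sum[OF form_linear_left]
            linear_scale[OF form_linear_left])
      then have lim: "(\<lambda>k. b * \<epsilon> + b' / Suc n + \<bar>B (u (F n) k) (e k)\<bar>) \<longlonglongrightarrow> b * \<epsilon> + b' / Suc n + \<bar>d\<bar>"
        by (intro tendsto_intros)
      have "\<bar>B (y n) (e l)\<bar> \<le> b * \<epsilon> + b' / Suc n + \<bar>B (u (F n) k) (e k)\<bar>" if k: "k \<ge> max N (K n)" for k
      proof -
        have "B (y n) (e l) = B (y n) (e l - e k) + B (y n - u (F n) k) (e k) + B (u (F n) k) (e k)"
          by (simp add: linear_diff[OF form_linear] linear_diff[OF form_linear_left])
        moreover have "\<bar>B (y n) (e l - e k)\<bar> \<le> b * \<epsilon>"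
          using eps l k b by (intro order_trans[OF Cauchy_Schwarz] mult_mono) (auto intro: less_imp_le)
        moreover have "\<bar>B (y n - u (F n) k) (e k)\<bar> \<le> (1 / Suc n) * b'"
          using yu[of n k] k b' by (intro order_trans[OF Cauchy_Schwarz] mult_mono) auto
        ultimately show ?thesis by simp
      qed
      then have "\<bar>B (y n) (e l)\<bar> \<le> b * \<epsilon> + b' / Suc n + \<bar>d\<bar>"
        by (intro LIMSEQ_le_const[OF lim]) blast
      moreover have "\<bar>d\<bar> \<le> sqrt (1 / Suc n)"
      proof (cases "e \<in> F n")
        case True
        then have "d = 0" using F by (simp add: d_def if_distrib cong: if_cong)
        then show ?thesis by simp
      next
        case False
        then have "d = c e" unfolding d_def by (auto intro!: sum.neutral)
        \<comment> \<open>Adding \<open>e\<close> to \<open>F n\<close> cannot push the Bessel sum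
          above \<open>s\<close>, so a missing coefficient is small.\<close>
        moreover have "(\<Sum>e'\<in>insert e (F n). (c e')\<^sup>2) \<le> s" using F e by (intro s_upper) auto
        then have "(c e)\<^sup>2 + (\<Sum>e'\<in>F n. (c e')\<^sup>2) \<le> s" using False F by simp
        then have "(c e)\<^sup>2 \<le> 1 / Suc n" using F_s[of n] by linarith
        ultimately show ?thesis by (simp add: real_le_rsqrt)
      qed
      ultimately show ?thesis by simp
    qed
    have "(\<lambda>n. B (y n) (e n)) \<longlonglongrightarrow> 0"
    proof (rule LIMSEQ_I)
      fix r :: real assume "r > 0"
      define \<epsilon> where "\<epsilon> = r / (2 * b)"
      have "\<epsilon> > 0" using \<open>r > 0\<close> b by (simp add: \<epsilon>_def)
      then obtain N where N: "\<forall>k\<ge>N. \<forall>l\<ge>N. p (e k - e l) < \<epsilon>" using cauchy_set_D[OF EPC[OF e]] by blast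
      have "(\<lambda>n. b' * (1 / real (Suc n)) + sqrt (1 / real (Suc n))) \<longlonglongrightarrow> b' * 0 + sqrt 0"
        by (intro tendsto_intros LIMSEQ_Suc[OF lim_1_over_n])
      then have "\<forall>\<^sub>F n in sequentially. b' * (1 / real (Suc n)) + sqrt (1 / real (Suc n)) < r / 2"
        using \<open>r > 0\<close> by (intro order_tendstoD(2)) auto
      then obtain N' where N': "\<forall>n\<ge>N'. b' * (1 / real (Suc n)) + sqrt (1 / real (Suc n)) < r / 2"
        unfolding eventually_sequentially by blast
      have "norm (B (y n) (e n) - 0) < r" if "n \<ge> max N N'" for n
      proof -
        have "\<bar>B (y n) (e n)\<bar> \<le> b * \<epsilon> + b' / Suc n + sqrt (1 / Suc n)"
          using bound[OF N, of n] that by simp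
        moreover have "b * \<epsilon> = r / 2" using b by (simp add: \<epsilon>_def)
        moreover have "b' / Suc n + sqrt (1 / Suc n) < r / 2" using N' that by simp
        ultimately have "\<bar>B (y n) (e n)\<bar> < r" by linarith
        then show ?thesis by simp
      qed
      then show "\<exists>no. \<forall>n\<ge>no. norm (B (y n) (e n) - 0) < r" by blast
    qed
    then show ?thesis
      using completion_inner_tendsto[OF yPC EPC[OF e]] LIMSEQ_unique by blast
  qed
  \<comment> \<open>Here completeness of the basis enters: an element orthogonal to \<open>E\<close>
    is null.\<close>
  then have "completion_inner p y y = 0"
    using E yPC by (simp add: orthonormal_basis_def cauchy_seqs_eq)
  then have "(\<lambda>n. (p (y n))\<^sup>2) \<longlonglongrightarrow> 0"
    using completion_inner_tendsto[OF yPC yPC] by (simp add: form_self)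
  then have py0: "(\<lambda>n. p (y n) + 1 / Suc n) \<longlonglongrightarrow> 0"
    using tendsto_add[OF tendsto_real_sqrt LIMSEQ_inverse_real_of_nat] by (fastforce simp: divide_inverse)
  have "sqrt ((p f)\<^sup>2 - s) \<le> p (y n) + 1 / Suc n" for n
  proof -
    have "sqrt ((p f)\<^sup>2 - s) \<le> sqrt ((p f)\<^sup>2 - (\<Sum>e\<in>F n. (c e)\<^sup>2))"
      using s_upper[OF F] by simp
    also have "\<dots> \<le> p (y n) + 1 / Suc n"
    proof (rule LIMSEQ_le_const2[OF tendsto_real_sqrt[OF lim_u[OF F]]])
      show "\<exists>N. \<forall>k\<ge>N. sqrt ((p (u (F n) k))\<^sup>2) \<le> p (y n) + 1 / Suc n"
      proof (intro exI allI impI)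
        fix k assume "k \<ge> K n"
        then show "sqrt ((p (u (F n) k))\<^sup>2) \<le> p (y n) + 1 / Suc n"
          using reverse_triangle[of "y n" "u (F n) k"] yu[of n k] by simp
      qed
    qed
    finally show ?thesis .
  qed
  then have "sqrt ((p f)\<^sup>2 - s) \<le> 0"
    by (intro LIMSEQ_le_const[OF py0]) blast
  then have fs: "(p f)\<^sup>2 \<le> s" by simp
  obtain G' where G': "finite G'" "G' \<subseteq> E" "s - \<delta> < (\<Sum>e\<in>G'. (c e)\<^sup>2)" using ex[OF \<open>\<delta> > 0\<close>] by blast
  have "(p f)\<^sup>2 - (\<Sum>e\<in>F'. (c e)\<^sup>2) < \<delta>" if "finite F'" "G' \<subseteq> F'" for F'
  proof -
    have "(\<Sum>e\<in>G'. (c e)\<^sup>2) \<le> (\<Sum>e\<in>F'. (c e)\<^sup>2)" using that by (intro sum_mono2) auto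
    then show ?thesis using G'(3) fs by linarith
  qed
  then show ?thesis using G'(1,2) unfolding c_def by blast
qed

end

text \<open>The coefficients of the \<open>f j\<close> in the basis form a contraction, by
  \<open>contractive_Bessel\<close>. Truncating to finitely many basis elements and applying
  \<open>sum_contraction_le\<close> bounds the sum by the trace over the basis; the truncation error
  is small for \<open>q\<close>, hence for \<open>p\<close>.\<close>

lemma hilbert_schmidt_imp_HS_bound:
  assumes p: "hilbertian_seminorm p" and q: "hilbertian_seminorm q" and pq: "p \<le> q"
    and HS: "hilbert_schmidt_inclusion p q"
  obtains C where "HS_bound p q C"
proof -
  interpret p: hilbertian p by unfold_locales fact
  interpret q: hilbertian q by unfold_locales fact
  have le: "p x \<le> q x" for x using pq by (simp add: le_fun_def)
  obtain E where E: "orthonormal_basis q E" and S: "(\<lambda>e. completion_inner p e e) summable_on E"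
    using HS by (auto simp: hilbert_schmidt_inclusion_def)
  define C where "C = infsum (\<lambda>e. completion_inner p e e) E"
  have EQ: "e \<in> q.cauchy_set" if "e \<in> E" for e
    using E that by (auto simp: orthonormal_basis_def q.cauchy_seqs_eq)
  have PQ: "e \<in> p.cauchy_set" if e: "e \<in> q.cauchy_set" for e
    unfolding p.cauchy_set_def mem_Collect_eq
  proof (intro allI impI)
    fix r :: real assume "r > 0"
    then obtain N where "\<forall>m\<ge>N. \<forall>n\<ge>N. q (e m - e n) < r" using q.cauchy_set_D[OF e] by blast
    then show "\<exists>N. \<forall>m\<ge>N. \<forall>n\<ge>N. p (e m - e n) < r"
      by (intro exI[of _ N]) (auto intro: le_less_trans[OF le])
  qed
  have lim_p: "(\<lambda>k. (p (e k))\<^sup>2) \<longlonglongrightarrow> completion_inner p e e" if "e \<in> E" for e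
    using p.completion_inner_tendsto[OF PQ PQ, OF EQ EQ, OF that that] by (simp add: p.form_self)
  have ONB: "completion_inner q e e' = (if e = e' then 1 else 0)" if "e \<in> E" "e' \<in> E" for e e'
    using E that by (simp add: orthonormal_basis_def)
  have "HS_bound p q C"
    unfolding HS_bound_def
  proof (intro allI impI)
    fix n and f :: "nat \<Rightarrow> 'a"
    assume f: "contractive q n f"
    define a where "a j e = completion_inner q (\<lambda>_. f j) e" for j e
    have lim_a: "(\<lambda>k. q.B (f j) (e k)) \<longlonglongrightarrow> a j e" if "e \<in> E" for e j
      using q.completion_inner_tendsto[OF q.cauchy_set_const EQ[OF that]] by (simp add: a_def)
    have contr: "(\<Sum>j<n. (\<Sum>e\<in>F. a j e * x e)\<^sup>2) \<le> (\<Sum>e\<in>F. (x e)\<^sup>2)" if F: "finite F" "F \<subseteq> E" for F x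
    proof -
      have "(\<lambda>k. \<Sum>j<n. (\<Sum>e\<in>F. q.B (f j) (e k) * x e)\<^sup>2) \<longlonglongrightarrow> (\<Sum>j<n. (\<Sum>e\<in>F. a j e * x e)\<^sup>2)"
        using F by (intro tendsto_intros lim_a) auto
      moreover have "(\<lambda>k. \<Sum>e\<in>F. \<Sum>e'\<in>F. x e * (x e' * q.B (e' k) (e k)))
          \<longlonglongrightarrow> (\<Sum>e\<in>F. \<Sum>e'\<in>F. x e * (x e' * completion_inner q e' e))"
        using F EQ by (intro tendsto_intros q.completion_inner_tendsto) auto
      moreover have "(\<Sum>e\<in>F. \<Sum>e'\<in>F. x e * (x e' * completion_inner q e' e))
          = (\<Sum>e\<in>F. \<Sum>e'\<in>F. x e * (x e' * (if e' = e then 1 else 0)))"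
        using F by (intro sum.cong) (auto simp: ONB subset_iff)
      moreover have "\<dots> = (\<Sum>e\<in>F. (x e)\<^sup>2)"
        using F by (intro sum.cong) (auto simp: power2_eq_square if_distrib cong: if_cong)
      moreover have "(\<Sum>j<n. (\<Sum>e\<in>F. q.B (f j) (e k) * x e)\<^sup>2)
          \<le> (\<Sum>e\<in>F. \<Sum>e'\<in>F. x e * (x e' * q.B (e' k) (e k)))" for k
      proof -
        define w where "w = (\<Sum>e\<in>F. x e *\<^sub>R e k)"
        have "(\<Sum>e\<in>F. q.B (f j) (e k) * x e) = q.B (f j) w" for j
          by (simp add: w_def linear_sum[OF q.form_linear] linear_scale[OF q.form_linear] mult.commute)
        moreover have "(\<Sum>e\<in>F. \<Sum>e'\<in>F. x e * (x e' * q.B (e' k) (e k))) = (q w)\<^sup>2"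
          by (simp add: w_def q.form_self[symmetric] linear_sum[OF q.form_linear]
              linear_sum[OF q.form_linear_left] linear_scale[OF q.form_linear]
              linear_scale[OF q.form_linear_left] sum_distrib_left)
        ultimately show ?thesis using q.contractive_Bessel[OF f, of w] by simp
      qed
      ultimately show ?thesis
        by (intro LIMSEQ_le[where X = "\<lambda>k. \<Sum>j<n. (\<Sum>e\<in>F. q.B (f j) (e k) * x e)\<^sup>2"]) auto
    qed
    \<comment> \<open>\<open>\<delta>\<close> is the truncation error and \<open>\<eta>\<close> the
      price of separating it from the main term; first \<open>\<delta>\<close> tends to zero, then
      \<open>\<eta>\<close>.\<close>
    have bound: "(\<Sum>j<n. (p (f j))\<^sup>2) \<le> (1 + \<eta>) * C + (1 + 1 / \<eta>) * (real n * \<delta>)"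
      if eta: "\<eta> > 0" and delta: "\<delta> > 0" for \<eta> \<delta> :: real
    proof -
      have "\<forall>j. \<exists>F. finite F \<and> F \<subseteq> E \<and> (\<forall>F'. finite F' \<longrightarrow> F \<subseteq> F' \<longrightarrow> F' \<subseteq> E \<longrightarrow>
          (q (f j))\<^sup>2 - (\<Sum>e\<in>F'. (a j e)\<^sup>2) < \<delta>)"
        unfolding a_def by (intro allI q.Parseval[OF E delta])
      then obtain G where G: "\<forall>j. finite (G j) \<and> G j \<subseteq> E \<and> (\<forall>F'. finite F' \<longrightarrow> G j \<subseteq> F' \<longrightarrow> F' \<subseteq> E \<longrightarrow>
          (q (f j))\<^sup>2 - (\<Sum>e\<in>F'. (a j e)\<^sup>2) < \<delta>)"
        by (rule choice[THEN exE])
      \<comment> \<open>Parseval holds for every larger finite set, so one \<open>F\<close> serves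
        all \<open>j\<close>.\<close>
      define F where "F = (\<Union>j<n. G j)"
      have F: "finite F" "F \<subseteq> E" using G by (auto simp: F_def)
      define v where "v j k = (\<Sum>e\<in>F. a j e *\<^sub>R e k)" for j k
      have res: "\<forall>\<^sub>F k in sequentially. (p (f j - v j k))\<^sup>2 \<le> \<delta>" if "j < n" for j
      proof -
        have "(\<lambda>k. \<Sum>e\<in>F. a j e * q.B (f j) (e k)) \<longlonglongrightarrow> (\<Sum>e\<in>F. a j e * a j e)"
          using F by (intro tendsto_intros lim_a) auto
        then have 1: "(\<lambda>k. q.B (f j) (v j k)) \<longlonglongrightarrow> (\<Sum>e\<in>F. (a j e)\<^sup>2)"
          by (simp add: v_def linear_sum[OF q.form_linear] linear_scale[OF q.form_linear] power2_eq_square)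
        have "(\<lambda>k. \<Sum>e\<in>F. \<Sum>e'\<in>F. a j e * (a j e' * q.B (e' k) (e k)))
            \<longlonglongrightarrow> (\<Sum>e\<in>F. \<Sum>e'\<in>F. a j e * (a j e' * completion_inner q e' e))"
          using F EQ by (intro tendsto_intros q.completion_inner_tendsto) auto
        moreover have "(\<Sum>e\<in>F. \<Sum>e'\<in>F. a j e * (a j e' * completion_inner q e' e))
            = (\<Sum>e\<in>F. \<Sum>e'\<in>F. a j e * (a j e' * (if e' = e then 1 else 0)))"
          using F by (intro sum.cong) (auto simp: ONB subset_iff)
        moreover have "\<dots> = (\<Sum>e\<in>F. (a j e)\<^sup>2)"
          using F by (intro sum.cong) (auto simp: power2_eq_square if_distrib cong: if_cong)
        moreover have "(\<Sum>e\<in>F. \<Sum>e'\<in>F. a j e * (a j e' * q.B (e' k) (e k))) = (q (v j k))\<^sup>2" for k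
          by (simp add: v_def q.form_self[symmetric] linear_sum[OF q.form_linear]
              linear_sum[OF q.form_linear_left] linear_scale[OF q.form_linear]
              linear_scale[OF q.form_linear_left] sum_distrib_left)
        ultimately have 2: "(\<lambda>k. (q (v j k))\<^sup>2) \<longlonglongrightarrow> (\<Sum>e\<in>F. (a j e)\<^sup>2)" by simp
        have "(\<lambda>k. (q (f j - v j k))\<^sup>2) \<longlonglongrightarrow>
            (q (f j))\<^sup>2 - 2 * (\<Sum>e\<in>F. (a j e)\<^sup>2) + (\<Sum>e\<in>F. (a j e)\<^sup>2)"
          unfolding q.diff_sq by (intro tendsto_intros 1 2)
        moreover have "(q (f j))\<^sup>2 - (\<Sum>e\<in>F. (a j e)\<^sup>2) < \<delta>"
        proof -
          have "G j \<subseteq> F" using that by (auto simp: F_def)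
          then show ?thesis using G F by blast
        qed
        ultimately have "\<forall>\<^sub>F k in sequentially. (q (f j - v j k))\<^sup>2 < \<delta>"
          by (intro order_tendstoD(2)) auto
        then show ?thesis
        proof eventually_elim
          case (elim k)
          have "(p (f j - v j k))\<^sup>2 \<le> (q (f j - v j k))\<^sup>2" using le by (intro power_mono) auto
          then show ?case using elim by linarith
        qed
      qed
      have "\<forall>\<^sub>F k in sequentially. \<forall>j\<in>{..<n}. (p (f j - v j k))\<^sup>2 \<le> \<delta>"
        using res by (intro eventually_ball_finite) auto
      then have ev: "\<forall>\<^sub>F k in sequentially. (\<Sum>j<n. (p (f j))\<^sup>2)
          \<le> (1 + \<eta>) * (\<Sum>e\<in>F. (p (e k))\<^sup>2) + (1 + 1 / \<eta>) * (real n * \<delta>)"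
      proof eventually_elim
        case (elim k)
        have "(p (f j))\<^sup>2 \<le> (1 + \<eta>) * (p (v j k))\<^sup>2 + (1 + 1 / \<eta>) * \<delta>" if "j < n" for j
        proof -
          let ?s = "p (v j k)" and ?t = "p (f j - v j k)"
          have "(p (f j))\<^sup>2 \<le> (?s + ?t)\<^sup>2"
            using p.triangle[of "v j k" "f j - v j k"] by (intro power_mono) auto
          \<comment> \<open>Young's inequality, with its defect written as a square.\<close>
          also have "\<dots> = (1 + \<eta>) * ?s\<^sup>2 + (1 + 1 / \<eta>) * ?t\<^sup>2 - (\<eta> * ?s - ?t)\<^sup>2 / \<eta>"
            using eta by (simp add: field_simps power2_eq_square)
          also have "\<dots> \<le> (1 + \<eta>) * ?s\<^sup>2 + (1 + 1 / \<eta>) * ?t\<^sup>2" using eta by simp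
          also have "\<dots> \<le> (1 + \<eta>) * ?s\<^sup>2 + (1 + 1 / \<eta>) * \<delta>"
            using elim that eta by (intro add_left_mono mult_left_mono) auto
          finally show ?thesis .
        qed
        then have "(\<Sum>j<n. (p (f j))\<^sup>2) \<le> (\<Sum>j<n. (1 + \<eta>) * (p (v j k))\<^sup>2 + (1 + 1 / \<eta>) * \<delta>)"
          by (intro sum_mono) auto
        also have "\<dots> = (1 + \<eta>) * (\<Sum>j<n. (p (v j k))\<^sup>2) + (1 + 1 / \<eta>) * (real n * \<delta>)"
          by (simp add: sum.distrib sum_distrib_left mult.left_commute)
        also have "(\<Sum>j<n. (p (v j k))\<^sup>2) \<le> (\<Sum>e\<in>F. (p (e k))\<^sup>2)"
          unfolding v_def by (rule p.sum_contraction_le[OF F(1) contr[OF F]])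
        finally show ?case using eta by (simp add: mult_left_mono)
      qed
      have "(\<lambda>k. (1 + \<eta>) * (\<Sum>e\<in>F. (p (e k))\<^sup>2) + (1 + 1 / \<eta>) * (real n * \<delta>))
          \<longlonglongrightarrow> (1 + \<eta>) * (\<Sum>e\<in>F. completion_inner p e e) + (1 + 1 / \<eta>) * (real n * \<delta>)"
        using F by (intro tendsto_intros lim_p) auto
      then have "(\<Sum>j<n. (p (f j))\<^sup>2) \<le> (1 + \<eta>) * (\<Sum>e\<in>F. completion_inner p e e) + (1 + 1 / \<eta>) * (real n * \<delta>)"
        using ev by (intro tendsto_lowerbound) auto
      moreover have "(\<Sum>e\<in>F. completion_inner p e e) \<le> C"
      proof -
        have "0 \<le> completion_inner p e e" if "e \<in> E" for e
          by (rule LIMSEQ_le_const[OF lim_p[OF that]]) auto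
        then show ?thesis unfolding C_def
          using F by (intro finite_sum_le_infsum S) auto
      qed
      then have "(1 + \<eta>) * (\<Sum>e\<in>F. completion_inner p e e) \<le> (1 + \<eta>) * C"
        using eta by (intro mult_left_mono) auto
      ultimately show ?thesis by linarith
    qed
    have bound': "(\<Sum>j<n. (p (f j))\<^sup>2) \<le> (1 + \<eta>) * C" if "\<eta> > 0" for \<eta>
    proof (rule tendsto_lowerbound)
      show "((\<lambda>\<delta>. (1 + \<eta>) * C + (1 + 1 / \<eta>) * (real n * \<delta>)) \<longlongrightarrow> (1 + \<eta>) * C) (at_right 0)"
        by (auto intro!: tendsto_eq_intros)
      show "\<forall>\<^sub>F \<delta> in at_right 0. (\<Sum>j<n. (p (f j))\<^sup>2) \<le> (1 + \<eta>) * C + (1 + 1 / \<eta>) * (real n * \<delta>)"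
        using eventually_at_right_less[of 0] by eventually_elim (use bound that in auto)
    qed simp
    show "(\<Sum>j<n. (p (f j))\<^sup>2) \<le> C"
    proof (rule tendsto_lowerbound)
      show "((\<lambda>\<eta>. (1 + \<eta>) * C) \<longlongrightarrow> C) (at_right 0)"
        by (auto intro!: tendsto_eq_intros)
      show "\<forall>\<^sub>F \<eta> in at_right 0. (\<Sum>j<n. (p (f j))\<^sup>2) \<le> (1 + \<eta>) * C"
        using eventually_at_right_less[of 0] by eventually_elim (use bound' in auto)
    qed simp
  qed
  then show ?thesis by (rule that)
qed

section \<open>Nuclear and barrelled spaces\<close>

text \<open>Choose a \<open>q\<close>-orthosystem whose \<open>p\<close>-sum comes within
  \<open>(\<epsilon> / 2)\<^sup>2\<close> of the supremum. A normalized residual would extend it, so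
  its \<open>p\<close>-norm is at most \<open>\<epsilon> / 2\<close>; the component in the finite
  span is handled by a grid.\<close>

lemma HS_bound_totally_bounded:
  assumes p: "hilbertian_seminorm p" and q: "hilbertian_seminorm q" and pq: "p \<le> q"
    and HS: "HS_bound p q C" and "\<epsilon> > 0"
  shows "\<exists>A. finite A \<and> (\<forall>x. q x \<le> 1 \<longrightarrow> (\<exists>a\<in>A. p (x - a) \<le> \<epsilon>))"
proof -
  interpret p: hilbertian p by unfold_locales fact
  interpret q: hilbertian q by unfold_locales fact
  have le: "p x \<le> q x" for x using pq by (simp add: le_fun_def)
  define V where "V = {\<Sum>j<n. (p (f j))\<^sup>2 | n f. q.orthosystem n f}"
  have V: "V \<noteq> {}" "bdd_above V"
  proof -
    have "q.orthosystem 0 (\<lambda>_. 0)" by (simp add: q.orthosystem_def)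
    then show "V \<noteq> {}" unfolding V_def by blast
    show "bdd_above V"
      using HS q.orthosystem_contractive unfolding HS_bound_def V_def
      by (intro bdd_aboveI[of _ C]) blast
  qed
  have "Sup V - (\<epsilon> / 2)\<^sup>2 < Sup V" using \<open>\<epsilon> > 0\<close> by simp
  then obtain z where "z \<in> V" "Sup V - (\<epsilon> / 2)\<^sup>2 < z"
    using less_cSup_iff[OF V] by blast
  then obtain n f where f: "q.orthosystem n f" and sup: "Sup V - (\<epsilon> / 2)\<^sup>2 < (\<Sum>j<n. (p (f j))\<^sup>2)"
    unfolding V_def by blast
  define c where "c x j = q.B x (f j)" for x j
  define w where "w x = x - (\<Sum>j<n. c x j *\<^sub>R f j)" for x
  have wf: "q.B (w x) (f j) = 0" if "j < n" for x j
    using q.orthosystem_residual(1)[OF f that] by (simp add: w_def c_def)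
  have qw: "(q x)\<^sup>2 = (\<Sum>j<n. (c x j)\<^sup>2) + (q (w x))\<^sup>2" for x
    using q.orthosystem_residual(2)[OF f, of x] unfolding w_def c_def .
  have pw: "p (w x) \<le> \<epsilon> / 2" if x: "q x \<le> 1" for x
  proof (cases "q (w x) = 0")
    case True
    then have "p (w x) \<le> 0" using le[of "w x"] by simp
    then show ?thesis using \<open>\<epsilon> > 0\<close> by simp
  next
    case False
    define l where "l = q (w x)"
    have l: "l > 0" using False q.nonneg[of "w x"] unfolding l_def by linarith
    have "(q (w x))\<^sup>2 \<le> (q x)\<^sup>2" using qw[of x] by (simp add: sum_nonneg)
    then have "l \<le> q x" unfolding l_def by (rule power2_le_imp_le) simp
    then have l1: "l \<le> 1" using x by simp
    define g where "g = (1 / l) *\<^sub>R w x"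
    have "q.orthosystem (Suc n) (f(n := g))"
    proof (rule q.orthosystem_extend[OF f])
      show "q.B g (f j) = 0" if "j < n" for j
        using wf[OF that, of x] by (simp add: g_def linear_scale[OF q.form_linear_left])
      show "q g = 0 \<or> q g = 1" using l by (simp add: g_def q.scale l_def)
    qed
    then have "(\<Sum>j<Suc n. (p ((f(n := g)) j))\<^sup>2) \<in> V" unfolding V_def by blast
    then have "(\<Sum>j<Suc n. (p ((f(n := g)) j))\<^sup>2) \<le> Sup V" using V(2) by (rule cSup_upper)
    then have "(p g)\<^sup>2 \<le> (\<epsilon> / 2)\<^sup>2" using sup by simp
    then have "p g \<le> \<epsilon> / 2" by (rule power2_le_imp_le) (use \<open>\<epsilon> > 0\<close> in simp)
    moreover have "p (w x) = l * p g" using l by (simp add: g_def p.scale)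
    moreover have "l * p g \<le> 1 * p g" using l1 by (intro mult_right_mono) auto
    ultimately show ?thesis by linarith
  qed
  \<comment> \<open>Each of the \<open>n\<close> coordinates is rounded to a multiple of
    \<open>1 / K\<close>, and \<open>p (f j) \<le> 1\<close>, so rounding costs at most
    \<open>n / K\<close>.\<close>
  define K :: nat where "K = nat \<lceil>2 * real n / \<epsilon>\<rceil> + 1"
  have K: "K > 0" "real n / real K \<le> \<epsilon> / 2"
  proof -
    show "K > 0" by (simp add: K_def)
    have "2 * real n / \<epsilon> \<le> real K" unfolding K_def by linarith
    then show "real n / real K \<le> \<epsilon> / 2" using \<open>K > 0\<close> \<open>\<epsilon> > 0\<close> by (simp add: field_simps)
  qed
  define grid where "grid = (\<lambda>i::int. real_of_int i / K) ` {- int K..int K}"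
  define A where "A = (\<lambda>d. \<Sum>j<n. d j *\<^sub>R f j) ` (PiE {..<n} (\<lambda>_. grid))"
  have "finite A" unfolding A_def grid_def by (intro finite_imageI finite_PiE) auto
  moreover have "\<exists>a\<in>A. p (x - a) \<le> \<epsilon>" if x: "q x \<le> 1" for x
  proof -
    have c1: "\<bar>c x j\<bar> \<le> 1" if "j < n" for j
    proof -
      have "\<bar>c x j\<bar> \<le> q x * q (f j)" unfolding c_def by (rule q.Cauchy_Schwarz)
      also have "\<dots> \<le> 1 * 1" using x f that by (intro mult_mono) (auto simp: q.orthosystem_def)
      finally show ?thesis by simp
    qed
    define d where "d = restrict (\<lambda>j. real_of_int \<lfloor>c x j * K\<rfloor> / K) {..<n}"
    have d_grid: "d \<in> PiE {..<n} (\<lambda>_. grid)"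
    proof -
      have "\<lfloor>c x j * K\<rfloor> \<in> {- int K..int K}" if "j < n" for j
      proof -
        have "\<bar>c x j * K\<bar> \<le> 1 * real K"
          unfolding abs_mult using c1[OF that] by (intro mult_mono) auto
        then have "c x j * K \<le> K" "- real K \<le> c x j * K" by linarith+
        then show ?thesis by (auto simp: le_floor_iff floor_le_iff)
      qed
      then show ?thesis unfolding d_def grid_def by auto
    qed
    have cd: "\<bar>c x j - d j\<bar> \<le> 1 / K" if "j < n" for j
    proof -
      have "c x j - d j = (c x j * K - \<lfloor>c x j * K\<rfloor>) / K"
        using that K by (simp add: d_def field_simps)
      moreover have "0 \<le> c x j * K - \<lfloor>c x j * K\<rfloor>" "c x j * K - \<lfloor>c x j * K\<rfloor> \<le> 1" by linarith+
      ultimately show ?thesis using K by (simp add: divide_right_mono)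
    qed
    define a where "a = (\<Sum>j<n. d j *\<^sub>R f j)"
    have "a \<in> A" using d_grid by (auto simp: A_def a_def)
    have "x - a = w x + (\<Sum>j<n. (c x j - d j) *\<^sub>R f j)"
      by (simp add: w_def a_def scaleR_diff_left sum_subtractf)
    then have "p (x - a) \<le> p (w x) + p (\<Sum>j<n. (c x j - d j) *\<^sub>R f j)"
      using p.triangle by simp
    also have "p (\<Sum>j<n. (c x j - d j) *\<^sub>R f j) \<le> (\<Sum>j<n. p ((c x j - d j) *\<^sub>R f j))"
      by (rule p.sum_le)
    also have "\<dots> \<le> (\<Sum>j<n. 1 / K)"
    proof (rule sum_mono)
      fix j assume j: "j \<in> {..<n}"
      have "p (f j) \<le> 1" using le[of "f j"] f j by (auto simp: q.orthosystem_def)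
      then have "\<bar>c x j - d j\<bar> * p (f j) \<le> (1 / K) * 1"
        using cd j by (intro mult_mono) auto
      then show "p ((c x j - d j) *\<^sub>R f j) \<le> 1 / K" by (simp add: p.scale)
    qed
    also have "\<dots> = real n / K" by simp
    also have "\<dots> \<le> \<epsilon> / 2" by (rule K)
    finally show ?thesis using pw[OF x] \<open>a \<in> A\<close> by (intro bexI[of _ a]) auto
  qed
  ultimately show ?thesis by blast
qed

definition dense_for :: "('a::real_vector \<Rightarrow> real) \<Rightarrow> 'a set \<Rightarrow> bool"
  where "dense_for p S \<longleftrightarrow> (\<forall>x. \<forall>e>0. \<exists>s\<in>S. p (x - s) < e)"

lemma HS_bound_separable:
  assumes p: "hilbertian_seminorm p" and q: "hilbertian_seminorm q" and pq: "p \<le> q"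
    and HS: "HS_bound p q C"
  shows "\<exists>S. countable S \<and> dense_for p S"
proof -
  interpret p: hilbertian p by unfold_locales fact
  interpret q: hilbertian q by unfold_locales fact
  \<comment> \<open>The squared accuracy on the unit ball becomes \<open>1 / Suc n\<close> after the
    net is blown up to the ball of radius \<open>Suc n\<close>.\<close>
  have "\<forall>n::nat. \<exists>A. finite A \<and> (\<forall>x. q x \<le> 1 \<longrightarrow> (\<exists>a\<in>A. p (x - a) \<le> 1 / (real (Suc n) * real (Suc n))))"
    by (intro allI HS_bound_totally_bounded[OF p q pq HS]) (simp del: of_nat_Suc)
  then obtain A where A: "\<forall>n::nat. finite (A n) \<and> (\<forall>x. q x \<le> 1 \<longrightarrow> (\<exists>a\<in>A n. p (x - a) \<le> 1 / (real (Suc n) * real (Suc n))))"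
    by (rule choice[THEN exE])
  define S where "S = (\<Union>n. (\<lambda>a. real (Suc n) *\<^sub>R a) ` A n)"
  have "countable (A n)" for n using A by (intro countable_finite) blast
  then have "countable S"
    unfolding S_def by (intro countable_UN countable_image) auto
  moreover have "dense_for p S"
    unfolding dense_for_def
  proof (intro allI impI)
    fix x and e :: real assume "e > 0"
    obtain n :: nat where n: "max (q x) (1 / e) < n" using reals_Archimedean2 by blast
    then have n': "q x \<le> Suc n" "1 / e < Suc n" by auto
    have "q ((1 / Suc n) *\<^sub>R x) = q x / Suc n" by (subst q.scale) simp
    then have "q ((1 / Suc n) *\<^sub>R x) \<le> 1" using n' by simp
    then obtain a where a: "a \<in> A n" "p ((1 / Suc n) *\<^sub>R x - a) \<le> 1 / (real (Suc n) * real (Suc n))"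
      using A by blast
    have "x - real (Suc n) *\<^sub>R a = real (Suc n) *\<^sub>R ((1 / Suc n) *\<^sub>R x - a)"
      by (simp add: scaleR_diff_right del: of_nat_Suc)
    then have "p (x - real (Suc n) *\<^sub>R a) = Suc n * p ((1 / Suc n) *\<^sub>R x - a)"
      by (simp add: p.scale del: of_nat_Suc)
    also have "\<dots> \<le> Suc n * (1 / (real (Suc n) * real (Suc n)))"
      using a(2) by (intro mult_left_mono) (auto simp del: of_nat_Suc)
    also have "\<dots> = 1 / Suc n" by (simp del: of_nat_Suc)
    also have "\<dots> < e" using n'(2) \<open>e > 0\<close> by (simp add: field_simps del: of_nat_Suc)
    finally show "\<exists>s\<in>S. p (x - s) < e" using a(1) unfolding S_def by blast
  qed
  ultimately show ?thesis by blast
qed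

definition continuous_hilbertian :: "'a::real_vector topology \<Rightarrow> ('a \<Rightarrow> real) \<Rightarrow> bool"
  where "continuous_hilbertian T p \<longleftrightarrow> hilbertian_seminorm p \<and> continuous_map T euclideanreal p"

text \<open>Sums and maxima of Hilbertian semi-norms are in general not Hilbertian; the Euclidean
  combination is, because the bilinear forms add.\<close>

lemma hilbertian_seminorm_l2:
  assumes "\<forall>i\<in>I. hilbertian_seminorm (r i)"
  shows "hilbertian_seminorm (\<lambda>x. sqrt (\<Sum>i\<in>I. (c i * r i x)\<^sup>2))"
proof (rule hilbertian_seminormI[where Q = "\<lambda>x y. \<Sum>i\<in>I. (c i)\<^sup>2 * polar_form (r i) x y"])
  show "0 \<le> sqrt (\<Sum>i\<in>I. (c i * r i x)\<^sup>2)" for x by (simp add: sum_nonneg)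
  have "linear (\<lambda>y. (c i)\<^sup>2 * polar_form (r i) x y)" if "i \<in> I" for i x
    using linear_compose_scale_right[OF hilbertian_seminorm_form(1)[of "r i" x], of "(c i)\<^sup>2"] assms that by simp
  then show "linear (\<lambda>y. \<Sum>i\<in>I. (c i)\<^sup>2 * polar_form (r i) x y)" for x
    by (intro linear_compose_sum) auto
  show "(\<Sum>i\<in>I. (c i)\<^sup>2 * polar_form (r i) x y) = (\<Sum>i\<in>I. (c i)\<^sup>2 * polar_form (r i) y x)" for x y
    using assms by (intro sum.cong) (auto intro: hilbertian_seminorm_form(3))
  show "(sqrt (\<Sum>i\<in>I. (c i * r i x)\<^sup>2))\<^sup>2 = (\<Sum>i\<in>I. (c i)\<^sup>2 * polar_form (r i) x x)" for x
    using assms by (simp add: sum_nonneg hilbertian_seminorm_form(4) power_mult_distrib)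
qed

lemma HS_bound_mono_left:
  assumes "HS_bound p q C" and "\<And>x. 0 \<le> p' x" and "\<And>x. p' x \<le> p x"
  shows "HS_bound p' q C"
  unfolding HS_bound_def
proof (intro allI impI)
  fix n f assume "contractive q n f"
  then have "(\<Sum>j<n. (p (f j))\<^sup>2) \<le> C" using assms(1) by (simp add: HS_bound_def)
  moreover have "(\<Sum>j<n. (p' (f j))\<^sup>2) \<le> (\<Sum>j<n. (p (f j))\<^sup>2)"
    using assms(2,3) by (intro sum_mono power_mono) auto
  ultimately show "(\<Sum>j<n. (p' (f j))\<^sup>2) \<le> C" by linarith
qed

section \<open>Continuous Hilbertian semi-norms on a nuclear space\<close>

locale nuclear =
  fixes T :: "'a::real_vector topology" and P :: "('a \<Rightarrow> real) set"
  assumes hilb: "\<forall>p\<in>P. hilbertian_seminorm p"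
    and T_eq: "T = seminorm_topology P"
    and HS: "\<forall>p\<in>P. \<exists>q\<in>P. p \<le> q \<and> hilbert_schmidt_inclusion p q"
begin

lemma topspace_T [simp]: "topspace T = UNIV"
  by (simp add: T_eq)

lemma zero_nbhd_iff: "zero_nbhd T U \<longleftrightarrow>
    (\<exists>F e. finite F \<and> F \<subseteq> P \<and> 0 < e \<and> {x. \<forall>p\<in>F. p x < e} \<subseteq> U)"
  unfolding T_eq by (rule zero_nbhd_seminorm_topology[OF hilb])

lemma continuous_hilbertian_iff:
  "continuous_hilbertian T p \<longleftrightarrow> hilbertian_seminorm p \<and>
    (\<exists>F C. finite F \<and> F \<subseteq> P \<and> C > 0 \<and> (\<forall>x. p x \<le> C * (\<Sum>r\<in>F. r x)))"
proof safe
  assume p: "continuous_hilbertian T p"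
  then interpret hilbertian p by unfold_locales (simp add: continuous_hilbertian_def)
  show "hilbertian_seminorm p" by (rule hilbertian)
  have "openin T {x \<in> topspace T. p x \<in> {..<1}}"
    using p by (intro openin_continuous_map_preimage[of _ euclideanreal]) (auto simp: continuous_hilbertian_def)
  then have "zero_nbhd T {x. p x < 1}"
    unfolding zero_nbhd_def by (intro exI[of _ "{x. p x < 1}"]) simp
  then obtain F e where F: "finite F" "F \<subseteq> P" "0 < e" "{x. \<forall>p\<in>F. p x < e} \<subseteq> {x. p x < 1}"
    unfolding zero_nbhd_iff by blast
  have "p x \<le> (1 / e) * (\<Sum>r\<in>F. r x)" for x
  proof -
    define s where "s = (\<Sum>r\<in>F. r x)"
    have nn: "0 \<le> r y" if "r \<in> F" for r y
      using hilbertian_seminorm_form(5) hilb F(2) that by blast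
    have s0: "s \<ge> 0" unfolding s_def using nn by (intro sum_nonneg) auto
    have "p x \<le> s / e + \<eta>" if "\<eta> > 0" for \<eta>
    proof -
      \<comment> \<open>\<open>x\<close> is scaled into the basic neighbourhood;
        \<open>\<eta>\<close> covers the case that all \<open>r x\<close> vanish.\<close>
      define c where "c = e / (s + e * \<eta>)"
      have d: "s + e * \<eta> > 0" using s0 F(3) that by (simp add: add_nonneg_pos)
      then have c: "c > 0" using F(3) by (simp add: c_def)
      have "r (c *\<^sub>R x) < e" if r: "r \<in> F" for r
      proof -
        interpret r: hilbertian r using hilb F(2) r by unfold_locales auto
        have "r x \<le> s" unfolding s_def using F(1) r nn by (intro member_le_sum) auto
        then have "r x < s + e * \<eta>" using F(3) \<open>\<eta> > 0\<close> by (simp add: add_strict_increasing2 le_less_trans)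
        then have "c * r x < c * (s + e * \<eta>)" using c by simp
        also have "\<dots> = e" using d by (simp add: c_def)
        finally show ?thesis using c by (simp add: r.scale)
      qed
      then have "p (c *\<^sub>R x) < 1" using F(4) by blast
      then have "p x < 1 / c" using c by (simp add: scale field_simps)
      also have "1 / c = s / e + \<eta>" using F(3) by (simp add: c_def add_divide_distrib)
      finally show ?thesis by simp
    qed
    then have "p x \<le> s / e" by (rule field_le_epsilon)
    then show ?thesis by (simp add: s_def)
  qed
  then show "\<exists>F C. finite F \<and> F \<subseteq> P \<and> C > 0 \<and> (\<forall>x. p x \<le> C * (\<Sum>r\<in>F. r x))"
    using F by (intro exI[of _ F] exI[of _ "1 / e"]) simp
next
  fix F C assume p: "hilbertian_seminorm p" and F: "finite F" "F \<subseteq> P"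
    and C: "C > 0" "\<forall>x. p x \<le> C * (\<Sum>r\<in>F. r x)"
  interpret hilbertian p by unfold_locales fact
  have "continuous_map T euclideanreal p"
    unfolding continuous_map_def
  proof (intro conjI allI impI)
    fix U assume U: "openin euclideanreal U"
    show "openin T {x \<in> topspace T. p x \<in> U}"
      unfolding T_eq seminorm_topology_def openin_nbhd_topology
    proof (intro conjI ballI)
      fix x assume x: "x \<in> {x \<in> topspace (nbhd_topology UNIV {{x. p x < e} |p e. p \<in> P \<and> 0 < e}). p x \<in> U}"
      then obtain d where d: "d > 0" "\<forall>y. dist y (p x) < d \<longrightarrow> y \<in> U"
        using U by (auto simp: open_dist)
      \<comment> \<open>The extra 1 makes the final estimate strict and covers an empty
        \<open>F\<close>.\<close>
      define e where "e = d / (C * (card F + 1))"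
      have e: "e > 0" using d C by (simp add: e_def)
      let ?F = "(\<lambda>r. {z. r z < e}) ` F"
      have "y \<in> {x \<in> topspace (nbhd_topology UNIV {{x. p x < e} |p e. p \<in> P \<and> 0 < e}). p x \<in> U}"
        if y: "\<forall>N\<in>?F. y - x \<in> N" for y
      proof -
        have "\<bar>p y - p x\<bar> \<le> p (y - x)" by (rule reverse_triangle)
        also have "\<dots> \<le> C * (\<Sum>r\<in>F. r (y - x))" using C by blast
        also have "\<dots> \<le> C * (\<Sum>r\<in>F. e)"
          using C y by (intro mult_left_mono sum_mono) (auto intro: less_imp_le)
        also have "\<dots> = C * (card F) * e" by simp
        also have "\<dots> < C * (card F + 1) * e" using C e by simp
        also have "\<dots> = d" using C by (simp add: e_def)
        finally show ?thesis using d by (simp add: dist_real_def)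
      qed
      moreover have "?F \<subseteq> {{x. p x < e} |p e. p \<in> P \<and> 0 < e}" using F(2) e by blast
      ultimately show "\<exists>\<F>. finite \<F> \<and> \<F> \<subseteq> {{x. p x < e} |p e. p \<in> P \<and> 0 < e} \<and>
          (\<forall>y\<in>UNIV. (\<forall>N\<in>\<F>. y - x \<in> N) \<longrightarrow>
            y \<in> {x \<in> topspace (nbhd_topology UNIV {{x. p x < e} |p e. p \<in> P \<and> 0 < e}). p x \<in> U})"
        using F(1) by (intro exI[of _ ?F] conjI) auto
    qed simp
  qed simp
  then show "continuous_hilbertian T p" using p by (simp add: continuous_hilbertian_def)
qed

lemma continuous_hilbertian_l2:
  assumes I: "finite I" and r: "\<forall>i\<in>I. continuous_hilbertian T (r i)"
  shows "continuous_hilbertian T (\<lambda>x. sqrt (\<Sum>i\<in>I. (c i * r i x)\<^sup>2))"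
proof -
  have "hilbertian_seminorm (\<lambda>x. sqrt (\<Sum>i\<in>I. (c i * r i x)\<^sup>2))"
    using r by (intro hilbertian_seminorm_l2) (simp add: continuous_hilbertian_def)
  moreover have "continuous_map T euclideanreal (\<lambda>x. sqrt (\<Sum>i\<in>I. (c i * r i x)\<^sup>2))"
    using r by (intro continuous_map_sqrt continuous_map_sum[OF I] continuous_map_real_pow
        continuous_map_real_mult_left) (simp add: continuous_hilbertian_def)
  ultimately show ?thesis by (simp add: continuous_hilbertian_def)
qed

lemma continuous_hilbertian_members: "r \<in> P \<Longrightarrow> continuous_hilbertian T r"
  unfolding continuous_hilbertian_iff using hilb
  by (intro conjI exI[of _ "{r}"] exI[of _ 1]) auto

lemma zero_nbhd_hilbertian:
  assumes "zero_nbhd T U"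
  shows "\<exists>p. continuous_hilbertian T p \<and> (\<forall>x. p x < 1 \<longrightarrow> x \<in> U)"
proof -
  obtain F e where F: "finite F" "F \<subseteq> P" "0 < e" "{x. \<forall>p\<in>F. p x < e} \<subseteq> U"
    using assms unfolding zero_nbhd_iff by blast
  let ?p = "\<lambda>x. sqrt (\<Sum>r\<in>F. ((1 / e) * r x)\<^sup>2)"
  have "continuous_hilbertian T ?p"
    using F by (intro continuous_hilbertian_l2[where r = "\<lambda>r. r"]) (auto intro: continuous_hilbertian_members)
  moreover have "x \<in> U" if "?p x < 1" for x
  proof -
    have "r x < e" if r: "r \<in> F" for r
    proof -
      have "\<bar>(1 / e) * r x\<bar> = sqrt (((1 / e) * r x)\<^sup>2)" by simp
      also have "\<dots> \<le> ?p x"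
        unfolding real_sqrt_le_iff using F(1) r by (intro member_le_sum[of r F "\<lambda>r. ((1 / e) * r x)\<^sup>2"]) auto
      finally have "\<bar>(1 / e) * r x\<bar> < 1" using \<open>?p x < 1\<close> by linarith
      then show ?thesis using F(3) by (simp add: abs_less_iff field_simps)
    qed
    then show ?thesis using F(4) by blast
  qed
  ultimately show ?thesis by (intro exI[of _ ?p]) blast
qed

text \<open>By assumption only the members of \<open>P\<close> have Hilbert--Schmidt majorants. A
  general \<open>p\<close> lies below a multiple of a finite sum of members; \<open>q\<close> is the
  Euclidean combination of their majorants, enlarged by \<open>K\<close> to absorb the factor from
  Cauchy--Schwarz.\<close>

lemma HS_majorant:
  assumes "continuous_hilbertian T p"
  obtains q C where "continuous_hilbertian T q" "p \<le> q" "HS_bound p q C"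
proof -
  obtain F C where F: "finite F" "F \<subseteq> P" and C: "C > 0" "\<forall>x. p x \<le> C * (\<Sum>r\<in>F. r x)"
    and p: "hilbertian_seminorm p"
    using assms unfolding continuous_hilbertian_iff by blast
  interpret hilbertian p by unfold_locales fact
  have "\<forall>r\<in>F. \<exists>q. q \<in> P \<and> r \<le> q \<and> (\<exists>c. HS_bound r q c)"
  proof
    fix r assume "r \<in> F"
    then have "r \<in> P" using F by blast
    then obtain q where q: "q \<in> P" "r \<le> q" "hilbert_schmidt_inclusion r q" using HS by blast
    then obtain c where "HS_bound r q c"
      using hilbert_schmidt_imp_HS_bound hilb \<open>r \<in> P\<close> by metis
    then show "\<exists>q. q \<in> P \<and> r \<le> q \<and> (\<exists>c. HS_bound r q c)" using q by blast
  qed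
  then obtain Q where Q: "\<forall>r\<in>F. Q r \<in> P \<and> r \<le> Q r \<and> (\<exists>c. HS_bound r (Q r) c)"
    by (rule bchoice[THEN exE])
  then have "\<forall>r\<in>F. \<exists>c. HS_bound r (Q r) c" by blast
  then obtain c where c: "\<forall>r\<in>F. HS_bound r (Q r) (c r)" by (rule bchoice[THEN exE])
  \<comment> \<open>\<open>C * sqrt (card F)\<close> compares the sum with the Euclidean
    combination; the 1 keeps \<open>K\<close> positive.\<close>
  define K where "K = C * sqrt (card F) + 1"
  have K: "K > 0" using C by (simp add: K_def add_nonneg_pos)
  have K2: "C\<^sup>2 * card F \<le> K\<^sup>2"
  proof -
    have "C\<^sup>2 * card F = (C * sqrt (card F))\<^sup>2" by (simp add: power_mult_distrib)
    also have "\<dots> \<le> K\<^sup>2" unfolding K_def using C by (intro power_mono) auto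
    finally show ?thesis .
  qed
  have nn: "0 \<le> r x" if "r \<in> F" for r x
    using hilbertian_seminorm_form(5) hilb F(2) that by blast
  have p2: "(p x)\<^sup>2 \<le> (\<Sum>r\<in>F. K\<^sup>2 * (r x)\<^sup>2)" for x
  proof -
    have "(p x)\<^sup>2 \<le> (C * (\<Sum>r\<in>F. r x))\<^sup>2" using C by (intro power_mono) auto
    also have "\<dots> = C\<^sup>2 * (\<Sum>r\<in>F. r x)\<^sup>2" by (simp add: power_mult_distrib)
    also have "\<dots> \<le> C\<^sup>2 * ((\<Sum>r\<in>F. (r x)\<^sup>2) * card F)"
      by (intro mult_left_mono sum_squared_le_sum_of_squares) simp
    also have "\<dots> = (C\<^sup>2 * card F) * (\<Sum>r\<in>F. (r x)\<^sup>2)" by simp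
    also have "\<dots> \<le> K\<^sup>2 * (\<Sum>r\<in>F. (r x)\<^sup>2)"
      using K2 by (intro mult_right_mono) (auto intro: sum_nonneg)
    finally show ?thesis by (simp add: sum_distrib_left)
  qed
  define q where "q x = sqrt (\<Sum>r\<in>F. (K * Q r x)\<^sup>2)" for x
  have q2: "(q x)\<^sup>2 = (\<Sum>r\<in>F. (K * Q r x)\<^sup>2)" for x by (simp add: q_def sum_nonneg)
  have q_nn: "0 \<le> q x" for x by (simp add: q_def sum_nonneg)
  have cq: "continuous_hilbertian T q"
    unfolding q_def[abs_def] using F Q
    by (intro continuous_hilbertian_l2) (auto intro: continuous_hilbertian_members)
  have rQ: "r x \<le> Q r x" if "r \<in> F" for r x using Q that by (simp add: le_fun_def)
  have pq: "p x \<le> q x" for x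
  proof (rule power2_le_imp_le)
    have "(p x)\<^sup>2 \<le> (\<Sum>r\<in>F. K\<^sup>2 * (r x)\<^sup>2)" by (rule p2)
    also have "\<dots> \<le> (\<Sum>r\<in>F. (K * Q r x)\<^sup>2)"
      unfolding power_mult_distrib using rQ nn by (intro sum_mono mult_left_mono power_mono) auto
    finally show "(p x)\<^sup>2 \<le> (q x)\<^sup>2" by (simp add: q2)
  qed (rule q_nn)
  have "HS_bound p q (\<Sum>r\<in>F. c r)"
    unfolding HS_bound_def
  proof (intro allI impI)
    fix n f assume f: "contractive q n f"
    have rf: "(\<Sum>j<n. K\<^sup>2 * (r (f j))\<^sup>2) \<le> c r" if r: "r \<in> F" for r
    proof -
      interpret r: hilbertian r using hilb F(2) r by unfold_locales auto
      interpret Qr: hilbertian "Q r" using hilb Q r by unfold_locales auto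
      \<comment> \<open>\<open>q\<close> dominates \<open>K * Q r\<close>, so stretching by
        \<open>K\<close> turns a \<open>q\<close>-contractive system into a
        \<open>Q r\<close>-contractive one.\<close>
      have "contractive (Q r) n (\<lambda>j. K *\<^sub>R f j)"
        unfolding contractive_def
      proof
        fix d
        have "(\<Sum>j<n. d j *\<^sub>R (K *\<^sub>R f j)) = K *\<^sub>R (\<Sum>j<n. d j *\<^sub>R f j)"
          by (simp add: scaleR_sum_right mult.commute)
        then have "(Q r (\<Sum>j<n. d j *\<^sub>R (K *\<^sub>R f j)))\<^sup>2 = (K * Q r (\<Sum>j<n. d j *\<^sub>R f j))\<^sup>2"
          using K by (simp add: Qr.scale)
        also have "\<dots> \<le> (q (\<Sum>j<n. d j *\<^sub>R f j))\<^sup>2"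
          unfolding q2 using F(1) r
          by (intro member_le_sum[of r F "\<lambda>r. (K * Q r (\<Sum>j<n. d j *\<^sub>R f j))\<^sup>2"]) auto
        also have "\<dots> \<le> (\<Sum>j<n. (d j)\<^sup>2)" using f by (simp add: contractive_def)
        finally show "(Q r (\<Sum>j<n. d j *\<^sub>R (K *\<^sub>R f j)))\<^sup>2 \<le> (\<Sum>j<n. (d j)\<^sup>2)" .
      qed
      then have "(\<Sum>j<n. (r (K *\<^sub>R f j))\<^sup>2) \<le> c r" using c[rule_format, OF r, unfolded HS_bound_def] by blast
      then show ?thesis by (simp add: r.scale power_mult_distrib)
    qed
    have "(\<Sum>j<n. (p (f j))\<^sup>2) \<le> (\<Sum>j<n. \<Sum>r\<in>F. K\<^sup>2 * (r (f j))\<^sup>2)"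
      by (intro sum_mono p2)
    also have "\<dots> = (\<Sum>r\<in>F. \<Sum>j<n. K\<^sup>2 * (r (f j))\<^sup>2)" by (rule sum.swap)
    also have "\<dots> \<le> (\<Sum>r\<in>F. c r)" by (intro sum_mono rf)
    finally show "(\<Sum>j<n. (p (f j))\<^sup>2) \<le> (\<Sum>r\<in>F. c r)" .
  qed
  then show ?thesis using that cq pq by (simp add: le_fun_def)
qed

lemma separable:
  assumes "continuous_hilbertian T p"
  obtains S where "countable S" "dense_for p S"
proof -
  obtain q C where "continuous_hilbertian T q" "p \<le> q" "HS_bound p q C"
    using HS_majorant[OF assms] .
  then show ?thesis
    using HS_bound_separable[of p q C] assms that by (auto simp: continuous_hilbertian_def)
qed

lemma continuous_hilbertian_pair:
  assumes "continuous_hilbertian T p" "continuous_hilbertian T q"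
  obtains r where "continuous_hilbertian T r" "p \<le> r" "q \<le> r"
proof -
  define r where "r x = sqrt (\<Sum>i\<in>(UNIV :: bool set). (1 * (if i then p else q) x)\<^sup>2)" for x
  have "continuous_hilbertian T r"
    unfolding r_def[abs_def] using assms by (intro continuous_hilbertian_l2) auto
  moreover have "p \<le> r" "q \<le> r"
    by (auto simp: le_fun_def r_def UNIV_bool real_le_rsqrt)
  ultimately show ?thesis by (rule that)
qed

text \<open>Dependent choice: join the current semi-norm with the next prescribed one, then pass to
  a Hilbert--Schmidt majorant.\<close>

lemma HS_chain:
  assumes r: "\<And>n::nat. continuous_hilbertian T (r n)"
  obtains q :: "nat \<Rightarrow> 'a \<Rightarrow> real" where "\<And>n. continuous_hilbertian T (q n)" "\<And>n. r n \<le> q n"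
    "\<And>n. q n \<le> q (Suc n)" "\<And>n. \<exists>C. HS_bound (q n) (q (Suc n)) C"
proof -
  have "\<exists>q. \<forall>n. (continuous_hilbertian T (q n) \<and> r n \<le> q n) \<and>
      (q n \<le> q (Suc n) \<and> (\<exists>C. HS_bound (q n) (q (Suc n)) C))"
  proof (rule dependent_nat_choice)
    show "\<exists>p. continuous_hilbertian T p \<and> r 0 \<le> p" using r by blast
    fix p n assume p: "continuous_hilbertian T p \<and> r n \<le> p"
    obtain p' where p': "continuous_hilbertian T p'" "p \<le> p'" "r (Suc n) \<le> p'"
      using continuous_hilbertian_pair p r by metis
    obtain q C where q: "continuous_hilbertian T q" "p' \<le> q" "HS_bound p' q C"
      using HS_majorant[OF p'(1)] .
    have "HS_bound p q C"
      using p p'(2) by (intro HS_bound_mono_left[OF q(3)])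
        (auto simp: le_fun_def continuous_hilbertian_def hilbertian_seminorm_def)
    then show "\<exists>q. (continuous_hilbertian T q \<and> r (Suc n) \<le> q) \<and> (p \<le> q \<and> (\<exists>C. HS_bound p q C))"
      using q p' by (intro exI[of _ q]) (auto intro: order_trans)
  qed
  then show ?thesis using that by blast
qed

lemma vn_bounded_singleton: "vn_bounded T {x}"
  unfolding vn_bounded_def
proof (intro conjI allI impI)
  fix U assume "zero_nbhd T U"
  then obtain p where p: "continuous_hilbertian T p" "\<And>x. p x < 1 \<Longrightarrow> x \<in> U"
    using zero_nbhd_hilbertian by blast
  then interpret hilbertian p by unfold_locales (simp add: continuous_hilbertian_def)
  define r where "r = p x + 1"
  have r: "r > 0" unfolding r_def using nonneg[of x] by linarith
  have "p ((1 / r) *\<^sub>R x) < 1" using r by (simp add: scale r_def)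
  then have "(1 / r) *\<^sub>R x \<in> U" by (rule p)
  then have "x \<in> (\<lambda>x. r *\<^sub>R x) ` U" using r by (intro image_eqI[of _ _ "(1 / r) *\<^sub>R x"]) auto
  then show "\<exists>r>0. {x} \<subseteq> (\<lambda>x. r *\<^sub>R x) ` U" using r by auto
qed simp

lemma continuous_map_eval: "continuous_map (strong_dual T) euclideanreal (\<lambda>f. f x)"
  unfolding continuous_map_def
proof (intro conjI allI impI)
  fix U assume U: "openin euclideanreal U"
  show "openin (strong_dual T) {f \<in> topspace (strong_dual T). f x \<in> U}"
    unfolding strong_dual_def openin_nbhd_topology
  proof (intro conjI ballI)
    let ?B = "{{f. \<forall>x\<in>B. \<bar>f x\<bar> < e} |B e. vn_bounded T B \<and> 0 < e}"
    fix f assume f: "f \<in> {f \<in> topspace (nbhd_topology (dual T) ?B). f x \<in> U}"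
    then obtain d where d: "d > 0" "\<forall>y. dist y (f x) < d \<longrightarrow> y \<in> U"
      using U by (auto simp: open_dist)
    have "{f. \<forall>x\<in>{x}. \<bar>f x\<bar> < d} \<in> ?B" using vn_bounded_singleton d(1) by blast
    then show "\<exists>\<F>. finite \<F> \<and> \<F> \<subseteq> ?B \<and> (\<forall>y\<in>dual T. (\<forall>N\<in>\<F>. y - f \<in> N) \<longrightarrow>
        y \<in> {f \<in> topspace (nbhd_topology (dual T) ?B). f x \<in> U})"
      using d(2) by (intro exI[of _ "{{f. \<forall>x\<in>{x}. \<bar>f x\<bar> < d}}"]) (auto simp: dist_real_def)
  qed auto
qed simp

lemma dual_linear: "f \<in> dual T \<Longrightarrow> linear f"
  by (simp add: dual_def linear_iff)

lemma topspace_strong_dual [simp]: "topspace (strong_dual S) = dual S"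
  by (simp add: strong_dual_def)

text \<open>Evaluations are strongly continuous and separate functionals. The property makes compact
  sets closed, hence Borel, in \<open>radon_compact\<close>.\<close>

lemma Hausdorff_strong_dual: "Hausdorff_space (strong_dual T)"
  unfolding Hausdorff_space_def
proof (intro allI impI)
  fix f g :: "'a \<Rightarrow> real" assume fg: "f \<in> topspace (strong_dual T) \<and> g \<in> topspace (strong_dual T) \<and> f \<noteq> g"
  then obtain x where "f x \<noteq> g x" by auto
  then obtain U V where UV: "open U" "open V" "f x \<in> U" "g x \<in> V" "U \<inter> V = {}"
    using hausdorff[OF \<open>f x \<noteq> g x\<close>] by blast
  let ?e = "\<lambda>U. {f \<in> topspace (strong_dual T). f x \<in> U}"
  have "openin (strong_dual T) (?e U)" "openin (strong_dual T) (?e V)"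
    by (rule openin_continuous_map_preimage[OF continuous_map_eval]; use UV in simp)+
  moreover have "disjnt (?e U) (?e V)" using UV by (auto simp: disjnt_def)
  ultimately show "\<exists>U V. openin (strong_dual T) U \<and> openin (strong_dual T) V \<and> f \<in> U \<and> g \<in> V \<and> disjnt U V"
    using fg UV by (intro exI[of _ "?e U"] exI[of _ "?e V"]) auto
qed

text \<open>The polar of a compact set of functionals is a barrel.\<close>

lemma compact_dominated:
  assumes "barrelled_space T" and K: "compactin (strong_dual T) K"
  obtains p where "continuous_hilbertian T p" "\<And>f x. f \<in> K \<Longrightarrow> \<bar>f x\<bar> \<le> p x"
proof -
  have Kd: "K \<subseteq> dual T" using compactin_subset_topspace[OF K] by simp
  define D where "D = {x. \<forall>f\<in>K. \<bar>f x\<bar> \<le> 1}"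
  have lin: "f (x + y) = f x + f y" "f (c *\<^sub>R x) = c * f x" if "f \<in> K" for f x y c
    using Kd that by (auto simp: dual_def)
  have "zero_nbhd T D"
  proof (rule assms(1)[unfolded barrelled_space_def, rule_format], intro conjI)
    show "convex D"
      unfolding convex_def D_def
    proof (intro ballI allI impI CollectI)
      fix x y u v f
      assume *: "x \<in> {x. \<forall>f\<in>K. \<bar>f x\<bar> \<le> 1}" "y \<in> {x. \<forall>f\<in>K. \<bar>f x\<bar> \<le> 1}"
        "0 \<le> u" "0 \<le> v" "u + v = (1::real)" "f \<in> K"
      have "\<bar>f (u *\<^sub>R x + v *\<^sub>R y)\<bar> \<le> u * \<bar>f x\<bar> + v * \<bar>f y\<bar>"
        using abs_triangle_ineq[of "u * f x" "v * f y"] * by (simp add: lin abs_mult)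
      also have "\<dots> \<le> u * 1 + v * 1" using * by (intro add_mono mult_left_mono) auto
      finally show "\<bar>f (u *\<^sub>R x + v *\<^sub>R y)\<bar> \<le> 1" using * by simp
    qed
    show "\<forall>x\<in>D. \<forall>c. \<bar>c\<bar> \<le> 1 \<longrightarrow> c *\<^sub>R x \<in> D"
    proof (intro ballI allI impI)
      fix x and c :: real assume x: "x \<in> D" and c: "\<bar>c\<bar> \<le> 1"
      have "\<bar>f (c *\<^sub>R x)\<bar> \<le> 1" if "f \<in> K" for f
      proof -
        have "\<bar>c\<bar> * \<bar>f x\<bar> \<le> 1 * 1" using x c that by (intro mult_mono) (auto simp: D_def)
        then show ?thesis using lin(2)[OF that] by (simp add: abs_mult)
      qed
      then show "c *\<^sub>R x \<in> D" by (simp add: D_def)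
    qed
    \<comment> \<open>Absorbing: a compact set has a bounded image under each evaluation.\<close>
    show "\<forall>x. \<exists>r>0. \<forall>c. \<bar>c\<bar> \<le> r \<longrightarrow> c *\<^sub>R x \<in> D"
    proof
      fix x
      have "compact ((\<lambda>f. f x) ` K)"
        using image_compactin[OF K continuous_map_eval[of x]] by simp
      then obtain b where b: "b > 0" "\<forall>y\<in>(\<lambda>f. f x) ` K. norm y \<le> b"
        using compact_imp_bounded bounded_pos by metis
      have "c *\<^sub>R x \<in> D" if c: "\<bar>c\<bar> \<le> 1 / b" for c
      proof -
        have "\<bar>f (c *\<^sub>R x)\<bar> \<le> 1" if f: "f \<in> K" for f
        proof -
          have "\<bar>c\<bar> * \<bar>f x\<bar> \<le> (1 / b) * b" using b c f by (intro mult_mono) auto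
          then show ?thesis using lin(2)[OF f] b by (simp add: abs_mult)
        qed
        then show ?thesis by (simp add: D_def)
      qed
      then show "\<exists>r>0. \<forall>c. \<bar>c\<bar> \<le> r \<longrightarrow> c *\<^sub>R x \<in> D" using b by (intro exI[of _ "1 / b"]) auto
    qed
    show "closedin T D"
    proof -
      have "closedin T {x \<in> topspace T. f x \<in> {-1..1}}" if "f \<in> K" for f
        using Kd that by (intro closedin_continuous_map_preimage[of _ euclideanreal]) (auto simp: dual_def)
      \<comment> \<open>\<open>closedin_Inter\<close> asks for a non-empty family; for empty
        \<open>K\<close> the barrel is the whole space.\<close>
      then have "closedin T (\<Inter>f\<in>K. {x. f x \<in> {-1..1}}) \<or> K = {}"
        by (cases "K = {}") (auto intro!: closedin_Inter)
      moreover have "D = (\<Inter>f\<in>K. {x. f x \<in> {-1..1}})" by (auto simp: D_def abs_le_iff)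
      moreover have "closedin T UNIV" using closedin_topspace[of T] by simp
      ultimately show ?thesis by auto
    qed
  qed
  then obtain p where p: "continuous_hilbertian T p" "\<And>x. p x < 1 \<Longrightarrow> x \<in> D"
    using zero_nbhd_hilbertian by blast
  then interpret hilbertian p by unfold_locales (simp add: continuous_hilbertian_def)
  have "\<bar>f x\<bar> \<le> p x" if f: "f \<in> K" for f x
  proof (rule field_le_epsilon)
    fix e :: real assume "e > 0"
    define r where "r = p x + e"
    have r: "r > 0" using \<open>e > 0\<close> nonneg[of x] by (simp add: r_def add_nonneg_pos)
    have "p ((1 / r) *\<^sub>R x) < 1" using r \<open>e > 0\<close> by (simp add: scale r_def)
    then have "\<bar>f ((1 / r) *\<^sub>R x)\<bar> \<le> 1" using p(2) f by (auto simp: D_def)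
    then show "\<bar>f x\<bar> \<le> p x + e" using r lin(2)[OF f] by (simp add: abs_mult field_simps r_def)
  qed
  with p(1) show ?thesis by (rule that)
qed

end

lemma nuclear_spaceE:
  assumes "nuclear_space T" obtains P where "nuclear T P"
  using assms unfolding nuclear_space_def nuclear_def by metis

section \<open>Maximal and oscillation inequalities for independent increments\<close>

context prob_space
begin

text \<open>Independence of disjoint blocks, with the two blocks indexed by \<open>bool\<close>, in
  the product form that \<open>first_passage\<close> uses.\<close>

lemma indep_vars_split:
  fixes Z :: "nat \<Rightarrow> 'a \<Rightarrow> real"
  assumes Z: "indep_vars (\<lambda>_. borel) Z I" and JK: "J \<subseteq> I" "K \<subseteq> I" "J \<inter> K = {}"
    and A: "A \<in> sets (PiM J (\<lambda>_. borel))" and B: "B \<in> sets (PiM K (\<lambda>_. borel))"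
  shows "prob {\<omega> \<in> space M. (\<lambda>i\<in>J. Z i \<omega>) \<in> A \<and> (\<lambda>i\<in>K. Z i \<omega>) \<in> B} =
    prob {\<omega> \<in> space M. (\<lambda>i\<in>J. Z i \<omega>) \<in> A} * prob {\<omega> \<in> space M. (\<lambda>i\<in>K. Z i \<omega>) \<in> B}"
proof -
  define L where "L b = (if b then J else K)" for b
  define AB where "AB b = (if b then A else B)" for b
  have "indep_vars (\<lambda>b. PiM (L b) (\<lambda>_. borel)) (\<lambda>b \<omega>. \<lambda>i\<in>L b. Z i \<omega>) (UNIV :: bool set)"
    using JK by (intro indep_vars_restrict[OF Z]) (auto simp: L_def disjoint_family_on_def)
  then have "prob (\<Inter>b\<in>UNIV. (\<lambda>\<omega>. \<lambda>i\<in>L b. Z i \<omega>) -` AB b \<inter> space M)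
      = (\<Prod>b\<in>UNIV. prob ((\<lambda>\<omega>. \<lambda>i\<in>L b. Z i \<omega>) -` AB b \<inter> space M))"
    using A B by (intro indep_varsD) (auto simp: L_def AB_def)
  moreover have "(\<Inter>b\<in>UNIV. (\<lambda>\<omega>. \<lambda>i\<in>L b. Z i \<omega>) -` AB b \<inter> space M)
      = {\<omega> \<in> space M. (\<lambda>i\<in>J. Z i \<omega>) \<in> A \<and> (\<lambda>i\<in>K. Z i \<omega>) \<in> B}"
    by (auto simp: UNIV_bool L_def AB_def)
  moreover have "(\<lambda>\<omega>. \<lambda>i\<in>J. Z i \<omega>) -` A \<inter> space M = {\<omega> \<in> space M. (\<lambda>i\<in>J. Z i \<omega>) \<in> A}"
    "(\<lambda>\<omega>. \<lambda>i\<in>K. Z i \<omega>) -` B \<inter> space M = {\<omega> \<in> space M. (\<lambda>i\<in>K. Z i \<omega>) \<in> B}" by auto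
  ultimately show ?thesis by (simp add: UNIV_bool L_def AB_def)
qed

text \<open>\<open>A j\<close> is an event of the past of \<open>j\<close>, \<open>B j\<close> one of its future; the left-hand side requires
  \<open>B j\<close> at the first index \<open>j\<close> at which \<open>A j\<close> occurs.\<close>

lemma first_passage:
  fixes Z :: "nat \<Rightarrow> 'a \<Rightarrow> real"
  assumes Z: "indep_vars (\<lambda>_. borel) Z {..<n}"
    and A: "\<And>j. j \<le> n \<Longrightarrow> A j \<in> sets (PiM {..<j} (\<lambda>_. borel))"
    and B: "\<And>j. j \<le> n \<Longrightarrow> B j \<in> sets (PiM {j..<n} (\<lambda>_. borel))"
  defines "EA \<equiv> \<lambda>j. {\<omega> \<in> space M. (\<lambda>i\<in>{..<j}. Z i \<omega>) \<in> A j}"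
  defines "EB \<equiv> \<lambda>j. {\<omega> \<in> space M. (\<lambda>i\<in>{j..<n}. Z i \<omega>) \<in> B j}"
  assumes b: "\<And>j. j \<le> n \<Longrightarrow> prob (EB j) \<le> b"
  shows "prob (\<Union>j\<le>n. EA j \<inter> EB j - (\<Union>i<j. EA i)) \<le> b * prob (\<Union>j\<le>n. EA j)"
proof -
  have Zm [measurable]: "Z i \<in> borel_measurable M" if "i < n" for i
    using Z that by (auto simp: indep_vars_def)
  have EA_ev: "EA j \<in> events" if "j \<le> n" for j
  proof -
    have "(\<lambda>\<omega>. \<lambda>i\<in>{..<j}. Z i \<omega>) \<in> measurable M (PiM {..<j} (\<lambda>_. borel))"
      using that by (intro measurable_restrict) auto
    from measurable_sets[OF this A[OF that]] show ?thesis by (simp add: EA_def vimage_def Int_def conj_commute)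
  qed
  have EB_ev: "EB j \<in> events" if "j \<le> n" for j
  proof -
    have "(\<lambda>\<omega>. \<lambda>i\<in>{j..<n}. Z i \<omega>) \<in> measurable M (PiM {j..<n} (\<lambda>_. borel))"
      using that by (intro measurable_restrict) auto
    from measurable_sets[OF this B[OF that]] show ?thesis by (simp add: EB_def vimage_def Int_def conj_commute)
  qed
  \<comment> \<open>First occurrence at \<open>j\<close>: these events are disjoint, and each
    depends on the past of \<open>j\<close> only.\<close>
  define F where "F j = EA j - (\<Union>i<j. EA i)" for j
  have F_ev: "F j \<in> events" if "j \<le> n" for j
    unfolding F_def using EA_ev that by (intro sets.Diff sets.finite_UN) auto
  have F_disj: "disjoint_family_on F {..n}"
    unfolding disjoint_family_on_def
  proof (intro ballI impI)
    fix i j assume "i \<in> {..n}" "j \<in> {..n}" "i \<noteq> j"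
    then consider "i < j" | "j < i" by linarith
    then show "F i \<inter> F j = {}" by cases (auto simp: F_def)
  qed
  have FB: "prob (F j \<inter> EB j) = prob (F j) * prob (EB j)" if j: "j \<le> n" for j
  proof -
    \<comment> \<open>The same event as a set of past coordinates, so that independence of the
      future applies.\<close>
    define A' where "A' = A j - (\<Union>i<j. (\<lambda>x. restrict x {..<i}) -` A i \<inter> space (PiM {..<j} (\<lambda>_. borel :: real measure)))"
    have "(\<lambda>x. restrict x {..<i}) -` A i \<inter> space (PiM {..<j} (\<lambda>_. borel :: real measure)) \<in> sets (PiM {..<j} (\<lambda>_. borel))"
      if "i < j" for i
      using that j by (intro measurable_sets[OF measurable_restrict_subset A]) auto
    then have "A' \<in> sets (PiM {..<j} (\<lambda>_. borel))"
      unfolding A'_def using A[OF j] by (intro sets.Diff sets.finite_UN) auto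
    then have "prob {\<omega> \<in> space M. (\<lambda>i\<in>{..<j}. Z i \<omega>) \<in> A' \<and> (\<lambda>i\<in>{j..<n}. Z i \<omega>) \<in> B j} =
        prob {\<omega> \<in> space M. (\<lambda>i\<in>{..<j}. Z i \<omega>) \<in> A'} * prob {\<omega> \<in> space M. (\<lambda>i\<in>{j..<n}. Z i \<omega>) \<in> B j}"
      using j by (intro indep_vars_split[OF Z _ _ _ _ B[OF j]]) auto
    moreover have eq: "{\<omega> \<in> space M. (\<lambda>i\<in>{..<j}. Z i \<omega>) \<in> A'} = F j"
    proof -
      have "restrict (\<lambda>i\<in>{..<j}. Z i \<omega>) {..<i} = (\<lambda>i\<in>{..<i}. Z i \<omega>)" if "i < j" for i \<omega>
        using that by (auto simp: restrict_def fun_eq_iff)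
      then show ?thesis by (auto simp: A'_def F_def EA_def space_PiM)
    qed
    moreover have "{\<omega> \<in> space M. (\<lambda>i\<in>{..<j}. Z i \<omega>) \<in> A' \<and> (\<lambda>i\<in>{j..<n}. Z i \<omega>) \<in> B j} = F j \<inter> EB j"
      unfolding eq[symmetric] EB_def by auto
    ultimately show ?thesis by (simp add: EB_def)
  qed
  have "(\<Union>j\<le>n. EA j \<inter> EB j - (\<Union>i<j. EA i)) = (\<Union>j\<le>n. F j \<inter> EB j)" by (auto simp: F_def)
  also have "prob \<dots> \<le> (\<Sum>j\<le>n. prob (F j \<inter> EB j))"
    using F_ev EB_ev by (intro finite_measure_subadditive_finite) auto
  also have "\<dots> \<le> (\<Sum>j\<le>n. prob (F j) * b)"
    using b by (intro sum_mono) (auto simp: FB intro!: mult_left_mono)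
  also have "\<dots> = b * (\<Sum>j\<le>n. prob (F j))" by (simp add: sum_distrib_left mult.commute)
  also have "(\<Sum>j\<le>n. prob (F j)) = prob (\<Union>j\<le>n. F j)"
    using F_ev F_disj by (intro finite_measure_finite_Union[symmetric]) auto
  also have "(\<Union>j\<le>n. F j) = (\<Union>j\<le>n. EA j)"
  proof (intro equalityI subsetI)
    fix \<omega> assume "\<omega> \<in> (\<Union>j\<le>n. EA j)"
    then obtain j where j: "j \<le> n" "\<omega> \<in> EA j" by blast
    define l where "l = (LEAST i. \<omega> \<in> EA i)"
    have l: "\<omega> \<in> EA l" "l \<le> j" using j unfolding l_def by (auto intro: LeastI Least_le)
    have "\<omega> \<notin> EA i" if "i < l" for i using that not_less_Least unfolding l_def by blast
    then have "\<omega> \<in> F l" using l by (auto simp: F_def)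
    then show "\<omega> \<in> (\<Union>j\<le>n. F j)" using l j by (intro UN_I[of l]) auto
  qed (auto simp: F_def)
  finally show ?thesis .
qed

text \<open>When a partial sum first exceeds \<open>2 * a\<close>, either the total sum exceeds
  \<open>a\<close> or the remaining tail does. The tail is independent of the past, so
  \<open>first_passage\<close> bounds the second case by \<open>\<alpha>\<close> times a
  probability.\<close>

lemma Ottaviani:
  fixes Z :: "nat \<Rightarrow> 'a \<Rightarrow> real"
  assumes Z: "indep_vars (\<lambda>_. borel) Z {..<n}"
    and \<alpha>: "\<And>j. j \<le> n \<Longrightarrow> prob {\<omega> \<in> space M. a < \<bar>\<Sum>i\<in>{j..<n}. Z i \<omega>\<bar>} \<le> \<alpha>"
  shows "prob {\<omega> \<in> space M. \<exists>j\<le>n. 2 * a < \<bar>\<Sum>i<j. Z i \<omega>\<bar>} \<le> 2 * \<alpha>"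
proof -
  have Zm [measurable]: "Z i \<in> borel_measurable M" if "i < n" for i
    using Z that by (auto simp: indep_vars_def)
  define A where "A j = {x \<in> space (PiM {..<j} (\<lambda>_. borel :: real measure)). 2 * a < \<bar>\<Sum>i<j. x i\<bar>}" for j :: nat
  define B where "B j = {x \<in> space (PiM {j..<n} (\<lambda>_. borel :: real measure)). a < \<bar>\<Sum>i\<in>{j..<n}. x i\<bar>}" for j :: nat
  define EA where "EA j = {\<omega> \<in> space M. (\<lambda>i\<in>{..<j}. Z i \<omega>) \<in> A j}" for j
  define EB where "EB j = {\<omega> \<in> space M. (\<lambda>i\<in>{j..<n}. Z i \<omega>) \<in> B j}" for j
  have EA: "EA j = {\<omega> \<in> space M. 2 * a < \<bar>\<Sum>i<j. Z i \<omega>\<bar>}" for j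
    by (auto simp: EA_def A_def space_PiM)
  have EB: "EB j = {\<omega> \<in> space M. a < \<bar>\<Sum>i\<in>{j..<n}. Z i \<omega>\<bar>}" for j
    by (auto simp: EB_def B_def space_PiM)
  have *: "prob (\<Union>j\<le>n. EA j \<inter> EB j - (\<Union>i<j. EA i)) \<le> \<alpha> * prob (\<Union>j\<le>n. EA j)"
    unfolding EA_def EB_def
  proof (rule first_passage[OF Z])
    show "A j \<in> sets (PiM {..<j} (\<lambda>_. borel))" for j unfolding A_def by measurable
    show "B j \<in> sets (PiM {j..<n} (\<lambda>_. borel))" for j unfolding B_def by measurable
    show "prob {\<omega> \<in> space M. (\<lambda>i\<in>{j..<n}. Z i \<omega>) \<in> B j} \<le> \<alpha>" if "j \<le> n" for j
      using \<alpha>[OF that] unfolding EB[symmetric] EB_def .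
  qed
  have "\<alpha> \<ge> 0" using \<alpha>[of n] measure_nonneg order_trans by blast
  then have **: "\<alpha> * prob (\<Union>j\<le>n. EA j) \<le> \<alpha> * 1" by (intro mult_left_mono) auto
  have Zs: "(\<lambda>\<omega>. \<Sum>i\<in>J. Z i \<omega>) \<in> borel_measurable M" if "J \<subseteq> {..<n}" for J
    using that by (intro borel_measurable_sum Zm) auto
  have EAm: "EA j \<in> events" if "j \<le> n" for j
  proof -
    have [measurable]: "(\<lambda>\<omega>. \<Sum>i<j. Z i \<omega>) \<in> borel_measurable M" using that by (intro Zs) auto
    show ?thesis unfolding EA by measurable
  qed
  have EBm: "EB j \<in> events" for j
  proof -
    have [measurable]: "(\<lambda>\<omega>. \<Sum>i\<in>{j..<n}. Z i \<omega>) \<in> borel_measurable M" by (intro Zs) auto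
    show ?thesis unfolding EB by measurable
  qed
  have "{\<omega> \<in> space M. \<exists>j\<le>n. 2 * a < \<bar>\<Sum>i<j. Z i \<omega>\<bar>}
      \<subseteq> EB 0 \<union> (\<Union>j\<le>n. EA j \<inter> EB j - (\<Union>i<j. EA i))"
  proof
    fix \<omega> assume "\<omega> \<in> {\<omega> \<in> space M. \<exists>j\<le>n. 2 * a < \<bar>\<Sum>i<j. Z i \<omega>\<bar>}"
    then obtain j where j: "j \<le> n" "\<omega> \<in> EA j" and \<omega>: "\<omega> \<in> space M" by (auto simp: EA)
    define l where "l = (LEAST i. \<omega> \<in> EA i)"
    have l: "\<omega> \<in> EA l" "l \<le> j" using j unfolding l_def by (auto intro: LeastI Least_le)
    have nl: "\<omega> \<notin> EA i" if "i < l" for i using that not_less_Least unfolding l_def by blast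
    have "(\<Sum>i<n. Z i \<omega>) = (\<Sum>i<l. Z i \<omega>) + (\<Sum>i\<in>{l..<n}. Z i \<omega>)"
      using l j by (simp add: lessThan_atLeast0 sum.atLeastLessThan_concat)
    then have "\<omega> \<in> EB 0 \<or> \<omega> \<in> EB l"
      using l(1) \<omega> by (auto simp: EA EB lessThan_atLeast0)
    then show "\<omega> \<in> EB 0 \<union> (\<Union>j\<le>n. EA j \<inter> EB j - (\<Union>i<j. EA i))"
      using l j nl by auto
  qed
  then have "prob {\<omega> \<in> space M. \<exists>j\<le>n. 2 * a < \<bar>\<Sum>i<j. Z i \<omega>\<bar>}
      \<le> prob (EB 0 \<union> (\<Union>j\<le>n. EA j \<inter> EB j - (\<Union>i<j. EA i)))"
    by (intro finite_measure_mono) (auto intro!: sets.Un sets.finite_UN sets.Diff sets.Int EAm EBm)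
  also have "\<dots> \<le> prob (EB 0) + prob (\<Union>j\<le>n. EA j \<inter> EB j - (\<Union>i<j. EA i))"
    by (intro measure_Un_le) (auto intro!: sets.Un sets.finite_UN sets.Diff sets.Int EAm EBm)
  also have "\<dots> \<le> \<alpha> + \<alpha> * 1" using \<alpha>[of 0] * ** by (intro add_mono) (auto simp: EB)
  finally show ?thesis by simp
qed

end

text \<open>The sequence with increments \<open>x\<close> makes \<open>p\<close> consecutive oscillations of size exceeding \<open>c\<close>
  between the indices \<open>i\<close> and \<open>n\<close>.\<close>

fun osc :: "(nat \<Rightarrow> real) \<Rightarrow> real \<Rightarrow> nat \<Rightarrow> nat \<Rightarrow> nat \<Rightarrow> bool" where
  "osc x c n 0 i = True"
| "osc x c n (Suc p) i =
    (\<exists>k\<le>n. \<exists>l\<le>n. i \<le> k \<and> k < l \<and> c < \<bar>\<Sum>m\<in>{k..<l}. x m\<bar> \<and> osc x c n p l)"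

lemma osc_mono: "osc x c n p i \<Longrightarrow> j \<le> i \<Longrightarrow> osc x c n p j"
  by (cases p) (auto intro: order_trans)

lemma osc_cong:
  "(\<And>m. i \<le> m \<Longrightarrow> m < n \<Longrightarrow> x m = y m) \<Longrightarrow> osc x c n p i = osc y c n p i"
proof (induction p arbitrary: i)
  case (Suc p)
  have "(i \<le> k \<and> k < l \<and> c < \<bar>\<Sum>m\<in>{k..<l}. x m\<bar> \<and> osc x c n p l) \<longleftrightarrow>
      (i \<le> k \<and> k < l \<and> c < \<bar>\<Sum>m\<in>{k..<l}. y m\<bar> \<and> osc y c n p l)" if "l \<le> n" for k l
  proof (cases "i \<le> k \<and> k < l")
    case True
    have "(\<Sum>m\<in>{k..<l}. x m) = (\<Sum>m\<in>{k..<l}. y m)"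
      using True that by (intro sum.cong Suc.prems) auto
    moreover have "osc x c n p l = osc y c n p l"
      using True by (intro Suc.IH Suc.prems) auto
    ultimately show ?thesis by simp
  qed auto
  then show ?case by auto
qed simp

lemma measurable_osc:
  assumes "i \<le> l"
  shows "Measurable.pred (PiM {i..<n} (\<lambda>_. borel)) (\<lambda>x. osc x c n p l)"
  using assms
proof (induction p arbitrary: l)
  case (Suc p)
  define Q where "Q k j x \<longleftrightarrow> k \<le> n \<and> j \<le> n \<and> l \<le> k \<and> k < j \<and> c < \<bar>\<Sum>m\<in>{k..<j}. x m\<bar> \<and> osc x c n p j"
    for k j and x :: "nat \<Rightarrow> real"
  have [measurable]: "Measurable.pred (PiM {i..<n} (\<lambda>_. borel)) (Q k j)" for k j
  proof (cases "k \<le> n \<and> j \<le> n \<and> l \<le> k \<and> k < j")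
    case True
    have [measurable]: "(\<lambda>x. \<Sum>m\<in>{k..<j}. x m) \<in> borel_measurable (PiM {i..<n} (\<lambda>_. borel :: real measure))"
      using True Suc.prems by (intro borel_measurable_sum measurable_component_singleton) auto
    have [measurable]: "Measurable.pred (PiM {i..<n} (\<lambda>_. borel)) (\<lambda>x. osc x c n p j)"
      using True Suc.prems by (intro Suc.IH) auto
    have "Q k j = (\<lambda>x. c < \<bar>\<Sum>m\<in>{k..<j}. x m\<bar> \<and> osc x c n p j)" using True by (auto simp: Q_def)
    then show ?thesis by simp
  next
    case False
    then have "Q k j = (\<lambda>x. False)" by (auto simp: Q_def)
    then show ?thesis by simp
  qed
  have "(\<lambda>x. osc x c n (Suc p) l) = (\<lambda>x. \<exists>k. \<exists>j. Q k j x)"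
    by (auto simp: Q_def fun_eq_iff)
  then show ?case by simp
qed simp

section \<open>Geometric decay of the number of oscillations\<close>

context prob_space
begin

text \<open>Stop at the first index \<open>j\<close> at which an oscillation begun after
  \<open>i\<close> ends: the past decides this, and the other \<open>p\<close> oscillations can be
  taken after \<open>j\<close>. An oscillation above \<open>4 * a\<close> forces an excursion above
  \<open>2 * a\<close> from \<open>i\<close>, which has probability at most \<open>\<beta>\<close>;
  the future contributes the independent factor \<open>\<beta> ^ p\<close>.\<close>

lemma prob_osc_Suc:
  fixes Z :: "nat \<Rightarrow> 'a \<Rightarrow> real"
  assumes Z: "indep_vars (\<lambda>_. borel) Z {..<n}"
    and \<beta>: "\<And>i. i \<le> n \<Longrightarrow> prob {\<omega> \<in> space M. \<exists>l\<in>{i..n}. 2 * a < \<bar>\<Sum>m\<in>{i..<l}. Z m \<omega>\<bar>} \<le> \<beta>"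
    and "i \<le> n"
  defines "c \<equiv> 4 * a"
  assumes IH: "\<And>j. j \<le> n \<Longrightarrow> {\<omega> \<in> space M. osc (\<lambda>m. Z m \<omega>) c n p j} \<in> events"
    "\<And>j. j \<le> n \<Longrightarrow> prob {\<omega> \<in> space M. osc (\<lambda>m. Z m \<omega>) c n p j} \<le> \<beta> ^ p"
  shows "{\<omega> \<in> space M. osc (\<lambda>m. Z m \<omega>) c n (Suc p) i} \<in> events"
    "prob {\<omega> \<in> space M. osc (\<lambda>m. Z m \<omega>) c n (Suc p) i} \<le> \<beta> ^ Suc p"
proof -
  have Zm [measurable]: "Z i \<in> borel_measurable M" if "i < n" for i
    using Z that by (auto simp: indep_vars_def)
  have \<beta>0: "\<beta> \<ge> 0" using \<beta>[of n] measure_nonneg order_trans by blast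
  define A where "A j = {x \<in> space (PiM {..<j} (\<lambda>_. borel :: real measure)).
      \<exists>k\<in>{i..<j}. c < \<bar>\<Sum>m\<in>{k..<j}. x m\<bar>}" for j :: nat
  define B where "B j = {x \<in> space (PiM {j..<n} (\<lambda>_. borel :: real measure)). osc x c n p j}" for j :: nat
  define EA where "EA j = {\<omega> \<in> space M. (\<lambda>i\<in>{..<j}. Z i \<omega>) \<in> A j}" for j
  define EB where "EB j = {\<omega> \<in> space M. (\<lambda>i\<in>{j..<n}. Z i \<omega>) \<in> B j}" for j
  have EA: "EA j = {\<omega> \<in> space M. \<exists>k\<in>{i..<j}. c < \<bar>\<Sum>m\<in>{k..<j}. Z m \<omega>\<bar>}" for j
    by (auto simp: EA_def A_def space_PiM)
  have EB: "EB j = {\<omega> \<in> space M. osc (\<lambda>m. Z m \<omega>) c n p j}" for j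
  proof -
    have "osc (\<lambda>m\<in>{j..<n}. Z m \<omega>) c n p j = osc (\<lambda>m. Z m \<omega>) c n p j" for \<omega>
      by (rule osc_cong) simp
    then show ?thesis by (simp add: EB_def B_def space_PiM)
  qed
  have Am: "A j \<in> sets (PiM {..<j} (\<lambda>_. borel))" for j
    unfolding A_def
  proof (intro predE pred_intros_finite finite_atLeastLessThan)
    fix k assume "k \<in> {i..<j}"
    then have [measurable]: "(\<lambda>x. \<Sum>m\<in>{k..<j}. x m) \<in> borel_measurable (PiM {..<j} (\<lambda>_. borel :: real measure))"
      by (intro borel_measurable_sum measurable_component_singleton) auto
    show "Measurable.pred (PiM {..<j} (\<lambda>_. borel)) (\<lambda>x. c < \<bar>\<Sum>m\<in>{k..<j}. x m\<bar>)" by measurable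
  qed
  have Bm: "B j \<in> sets (PiM {j..<n} (\<lambda>_. borel))" for j
    using measurable_osc[where i = j and l = j and n = n and c = c and p = p] unfolding B_def by (intro predE) simp
  have *: "prob (\<Union>j\<le>n. EA j \<inter> EB j - (\<Union>i<j. EA i)) \<le> \<beta> ^ p * prob (\<Union>j\<le>n. EA j)"
    unfolding EA_def EB_def
  proof (rule first_passage[OF Z])
    show "A j \<in> sets (PiM {..<j} (\<lambda>_. borel))" "B j \<in> sets (PiM {j..<n} (\<lambda>_. borel))" for j
      by (rule Am Bm)+
    show "prob {\<omega> \<in> space M. (\<lambda>i\<in>{j..<n}. Z i \<omega>) \<in> B j} \<le> \<beta> ^ p" if "j \<le> n" for j
      using IH(2)[OF that] unfolding EB_def[symmetric] EB .
  qed
  have EAm: "EA j \<in> events" if "j \<le> n" for j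
    unfolding EA
  proof (intro predE pred_intros_finite finite_atLeastLessThan)
    fix k assume "k \<in> {i..<j}"
    then have [measurable]: "(\<lambda>\<omega>. \<Sum>m\<in>{k..<j}. Z m \<omega>) \<in> borel_measurable M"
      using that by (intro borel_measurable_sum Zm) auto
    show "Measurable.pred M (\<lambda>\<omega>. c < \<bar>\<Sum>m\<in>{k..<j}. Z m \<omega>\<bar>)" by measurable
  qed
  have EBm: "EB j \<in> events" if "j \<le> n" for j
    using IH(1)[OF that] unfolding EB .
  have eq: "{\<omega> \<in> space M. osc (\<lambda>m. Z m \<omega>) c n (Suc p) i} = (\<Union>j\<le>n. EA j \<inter> EB j - (\<Union>i<j. EA i))"
  proof (intro equalityI subsetI)
    fix \<omega> assume "\<omega> \<in> {\<omega> \<in> space M. osc (\<lambda>m. Z m \<omega>) c n (Suc p) i}"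
    then obtain k j where kj: "j \<le> n" "i \<le> k" "k < j" "c < \<bar>\<Sum>m\<in>{k..<j}. Z m \<omega>\<bar>"
      and osc: "osc (\<lambda>m. Z m \<omega>) c n p j" and \<omega>: "\<omega> \<in> space M"
      by auto
    have j: "j \<le> n" "\<omega> \<in> EA j"
      unfolding EA using kj \<omega> by (auto intro!: bexI[of _ k])
    define l where "l = (LEAST i. \<omega> \<in> EA i)"
    have l: "\<omega> \<in> EA l" "l \<le> j" using j unfolding l_def by (auto intro: LeastI Least_le)
    have nl: "\<omega> \<notin> EA i" if "i < l" for i using that not_less_Least unfolding l_def by blast
    \<comment> \<open>The remaining oscillations start no earlier than \<open>j\<close>, hence no
      earlier than \<open>l\<close>.\<close>
    have "\<omega> \<in> EB l" using osc_mono[OF osc l(2)] \<omega> by (simp add: EB)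
    then show "\<omega> \<in> (\<Union>j\<le>n. EA j \<inter> EB j - (\<Union>i<j. EA i))"
      using l nl j by (intro UN_I[of l]) auto
  next
    fix \<omega> assume "\<omega> \<in> (\<Union>j\<le>n. EA j \<inter> EB j - (\<Union>i<j. EA i))"
    then obtain j where j: "j \<le> n" "\<omega> \<in> EA j" "\<omega> \<in> EB j" by blast
    then obtain k where k: "i \<le> k" "k < j" "c < \<bar>\<Sum>m\<in>{k..<j}. Z m \<omega>\<bar>" "\<omega> \<in> space M"
      unfolding EA by auto
    have "osc (\<lambda>m. Z m \<omega>) c n p j" using j(3) by (simp add: EB)
    then have "osc (\<lambda>m. Z m \<omega>) c n (Suc p) i"
      unfolding osc.simps using j(1) k by (intro exI[of _ k] exI[of _ j] conjI) auto
    then show "\<omega> \<in> {\<omega> \<in> space M. osc (\<lambda>m. Z m \<omega>) c n (Suc p) i}" using k(4) by simp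
  qed
  have "(\<Union>j\<le>n. EA j) \<subseteq> {\<omega> \<in> space M. \<exists>l\<in>{i..n}. 2 * a < \<bar>\<Sum>m\<in>{i..<l}. Z m \<omega>\<bar>}"
  proof
    fix \<omega> assume "\<omega> \<in> (\<Union>j\<le>n. EA j)"
    then obtain j k where jk: "j \<le> n" "k \<in> {i..<j}" "c < \<bar>\<Sum>m\<in>{k..<j}. Z m \<omega>\<bar>" "\<omega> \<in> space M"
      by (auto simp: EA)
    have "(\<Sum>m\<in>{i..<j}. Z m \<omega>) = (\<Sum>m\<in>{i..<k}. Z m \<omega>) + (\<Sum>m\<in>{k..<j}. Z m \<omega>)"
      using jk by (simp add: sum.atLeastLessThan_concat)
    \<comment> \<open>The oscillation is the difference of two excursions from
      \<open>i\<close>.\<close>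
    then have "2 * a < \<bar>\<Sum>m\<in>{i..<j}. Z m \<omega>\<bar> \<or> 2 * a < \<bar>\<Sum>m\<in>{i..<k}. Z m \<omega>\<bar>"
      using jk(3) unfolding c_def by linarith
    moreover have "j \<in> {i..n}" "k \<in> {i..n}" using jk by auto
    ultimately show "\<omega> \<in> {\<omega> \<in> space M. \<exists>l\<in>{i..n}. 2 * a < \<bar>\<Sum>m\<in>{i..<l}. Z m \<omega>\<bar>}"
      using jk(4) by blast
  qed
  moreover have "{\<omega> \<in> space M. \<exists>l\<in>{i..n}. 2 * a < \<bar>\<Sum>m\<in>{i..<l}. Z m \<omega>\<bar>} \<in> events"
  proof (intro predE pred_intros_finite finite_atLeastAtMost)
    fix l assume "l \<in> {i..n}"
    then have [measurable]: "(\<lambda>\<omega>. \<Sum>m\<in>{i..<l}. Z m \<omega>) \<in> borel_measurable M"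
      by (intro borel_measurable_sum Zm) auto
    show "Measurable.pred M (\<lambda>\<omega>. 2 * a < \<bar>\<Sum>m\<in>{i..<l}. Z m \<omega>\<bar>)" by measurable
  qed
  ultimately have "prob (\<Union>j\<le>n. EA j) \<le> prob {\<omega> \<in> space M. \<exists>l\<in>{i..n}. 2 * a < \<bar>\<Sum>m\<in>{i..<l}. Z m \<omega>\<bar>}"
    by (rule finite_measure_mono)
  then have "prob (\<Union>j\<le>n. EA j) \<le> \<beta>"
    using \<beta>[OF \<open>i \<le> n\<close>] by linarith
  then have "\<beta> ^ p * prob (\<Union>j\<le>n. EA j) \<le> \<beta> ^ p * \<beta>" using \<beta>0 by (intro mult_left_mono) auto
  then show "prob {\<omega> \<in> space M. osc (\<lambda>m. Z m \<omega>) c n (Suc p) i} \<le> \<beta> ^ Suc p"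
    using * unfolding eq by (simp add: mult.commute)
  show "{\<omega> \<in> space M. osc (\<lambda>m. Z m \<omega>) c n (Suc p) i} \<in> events"
    unfolding eq using EAm EBm by (intro sets.finite_UN sets.Diff sets.Int) auto
qed

lemma prob_osc_le:
  fixes Z :: "nat \<Rightarrow> 'a \<Rightarrow> real"
  assumes Z: "indep_vars (\<lambda>_. borel) Z {..<n}"
    and \<beta>: "\<And>i. i \<le> n \<Longrightarrow> prob {\<omega> \<in> space M. \<exists>l\<in>{i..n}. 2 * a < \<bar>\<Sum>m\<in>{i..<l}. Z m \<omega>\<bar>} \<le> \<beta>"
  shows "\<forall>i\<le>n. {\<omega> \<in> space M. osc (\<lambda>m. Z m \<omega>) (4 * a) n p i} \<in> events \<and>
    prob {\<omega> \<in> space M. osc (\<lambda>m. Z m \<omega>) (4 * a) n p i} \<le> \<beta> ^ p"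
proof (induction p)
  case 0
  show ?case by (simp add: prob_space)
next
  case (Suc p)
  show ?case
  proof (intro allI impI conjI)
    fix i assume i: "i \<le> n"
    show "{\<omega> \<in> space M. osc (\<lambda>m. Z m \<omega>) (4 * a) n (Suc p) i} \<in> events"
      by (rule prob_osc_Suc(1)[OF Z]) (use \<beta> Suc.IH i in auto)
    show "prob {\<omega> \<in> space M. osc (\<lambda>m. Z m \<omega>) (4 * a) n (Suc p) i} \<le> \<beta> ^ Suc p"
      by (rule prob_osc_Suc(2)[OF Z]) (use \<beta> Suc.IH i in auto)
  qed
qed

end

section \<open>Real Levy processes\<close>

text \<open>Truncation inequality: averaged over \<open>u\<close> in \<open>{0..1}\<close>,
  \<open>1 - cos (u * y)\<close> gives \<open>1 - sin y / y\<close>, which is at least 1/2 once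
  \<open>\<bar>y\<bar> \<ge> 2\<close>. Tonelli exchanges this average with the expectation.\<close>

lemma (in prob_space) prob_ge_2_le_char:
  assumes [measurable]: "Y \<in> borel_measurable M"
    and char: "\<And>u. u \<in> {0..1} \<Longrightarrow> norm (char (distr M borel Y) u - 1) \<le> \<epsilon>"
  shows "prob {\<omega> \<in> space M. 2 \<le> \<bar>Y \<omega>\<bar>} \<le> 2 * \<epsilon>"
proof -
  have "0 \<le> norm (char (distr M borel Y) 0 - 1)" by simp
  also have "\<dots> \<le> \<epsilon>" by (rule char) simp
  finally have e0: "\<epsilon> \<ge> 0" .
  define g where "g u \<omega> = ennreal (1 - cos (u * Y \<omega>)) * indicator {0..1} u" for u :: real and \<omega>
  interpret pair_sigma_finite M lborel by unfold_locales
  have [measurable]: "(\<lambda>(\<omega>, u). g u \<omega>) \<in> borel_measurable (M \<Otimes>\<^sub>M lborel)"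
    unfolding g_def by measurable
  have inner: "(\<integral>\<^sup>+\<omega>. g u \<omega> \<partial>M) \<le> ennreal \<epsilon> * indicator {0..1} u" for u
  proof (cases "u \<in> {0..1}")
    case True
    have int_cos: "integrable M (\<lambda>\<omega>. cos (u * Y \<omega>))"
      by (intro integrable_const_bound[of _ 1]) auto
    have "Re (char (distr M borel Y) u) = (\<integral>\<omega>. cos (u * Y \<omega>) \<partial>M)"
    proof -
      have "char (distr M borel Y) u = (CLINT \<omega>|M. iexp (u * Y \<omega>))"
        unfolding char_def by (subst integral_distr) auto
      also have "Re \<dots> = (\<integral>\<omega>. Re (iexp (u * Y \<omega>)) \<partial>M)"
        by (intro integral_Re[symmetric] integrable_const_bound[of _ 1]) auto
      finally show ?thesis by (simp add: Re_exp)
    qed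
    moreover have "1 - Re (char (distr M borel Y) u) \<le> \<epsilon>"
      using char[OF True] abs_Re_le_cmod[of "char (distr M borel Y) u - 1"] by simp
    ultimately have "(\<integral>\<omega>. 1 - cos (u * Y \<omega>) \<partial>M) \<le> \<epsilon>"
      using int_cos by (simp add: prob_space)
    moreover have "(\<integral>\<^sup>+\<omega>. ennreal (1 - cos (u * Y \<omega>)) \<partial>M) = ennreal (\<integral>\<omega>. 1 - cos (u * Y \<omega>) \<partial>M)"
      using int_cos by (intro nn_integral_eq_integral) auto
    ultimately show ?thesis using True by (simp add: g_def ennreal_leI)
  qed (simp add: g_def)
  have "ennreal (1 / 2) * emeasure M {\<omega> \<in> space M. 2 \<le> \<bar>Y \<omega>\<bar>}
      = (\<integral>\<^sup>+\<omega>. ennreal (1 / 2) * indicator {\<omega> \<in> space M. 2 \<le> \<bar>Y \<omega>\<bar>} \<omega> \<partial>M)"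
    by (subst nn_integral_cmult_indicator) auto
  also have "\<dots> \<le> (\<integral>\<^sup>+\<omega>. (\<integral>\<^sup>+u. g u \<omega> \<partial>lborel) \<partial>M)"
  proof (intro nn_integral_mono)
    fix \<omega>
    show "ennreal (1 / 2) * indicator {\<omega> \<in> space M. 2 \<le> \<bar>Y \<omega>\<bar>} \<omega> \<le> (\<integral>\<^sup>+u. g u \<omega> \<partial>lborel)"
    proof (cases "2 \<le> \<bar>Y \<omega>\<bar>")
      case True
      then have y: "Y \<omega> \<noteq> 0" by auto
      let ?F = "\<lambda>u. u - sin (u * Y \<omega>) / Y \<omega>"
      have "(\<integral>\<^sup>+u. ennreal (1 - cos (u * Y \<omega>)) * indicator {0..1} u \<partial>lborel) = ennreal (?F 1 - ?F 0)"
        using y by (intro nn_integral_FTC_Icc) (auto intro!: derivative_eq_intros)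
      moreover have "1 / 2 \<le> ?F 1 - ?F 0"
      proof -
        have "\<bar>sin (Y \<omega>) / Y \<omega>\<bar> \<le> 1 / 2"
          unfolding abs_divide using True abs_sin_le_one[of "Y \<omega>"] by (intro frac_le) auto
        then have "sin (Y \<omega>) / Y \<omega> \<le> 1 / 2" by linarith
        then show ?thesis by simp
      qed
      ultimately have "ennreal (1 / 2) \<le> (\<integral>\<^sup>+u. g u \<omega> \<partial>lborel)"
        unfolding g_def by (simp only: ennreal_leI)
      moreover have "ennreal (1 / 2) * indicator {\<omega> \<in> space M. 2 \<le> \<bar>Y \<omega>\<bar>} \<omega> \<le> ennreal (1 / 2) * 1"
        by (intro mult_left_mono) (auto simp: indicator_def)
      ultimately show ?thesis by simp
    qed simp
  qed
  also have "\<dots> = (\<integral>\<^sup>+u. (\<integral>\<^sup>+\<omega>. g u \<omega> \<partial>M) \<partial>lborel)"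
    using Fubini'[of "\<lambda>\<omega> u. g u \<omega>"] by simp
  also have "\<dots> \<le> (\<integral>\<^sup>+u. ennreal \<epsilon> * indicator {0..1::real} u \<partial>lborel)"
    by (intro nn_integral_mono inner)
  also have "\<dots> = ennreal \<epsilon>" by (simp add: nn_integral_cmult_indicator)
  finally have "ennreal (1 / 2) * emeasure M {\<omega> \<in> space M. 2 \<le> \<bar>Y \<omega>\<bar>} \<le> ennreal \<epsilon>" .
  moreover have "ennreal (1 / 2) * emeasure M {\<omega> \<in> space M. 2 \<le> \<bar>Y \<omega>\<bar>}
      = ennreal ((1 / 2) * prob {\<omega> \<in> space M. 2 \<le> \<bar>Y \<omega>\<bar>})"
    unfolding emeasure_eq_measure by (rule ennreal_mult[symmetric]) auto
  ultimately have "ennreal ((1 / 2) * prob {\<omega> \<in> space M. 2 \<le> \<bar>Y \<omega>\<bar>}) \<le> ennreal \<epsilon>"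
    by simp
  then show ?thesis using e0 by (simp add: ennreal_le_iff)
qed

text \<open>The \<open>\<delta>\<close> depends on the time horizon \<open>N\<close> and on
  \<open>\<epsilon>\<close> only: closeness of a characteristic function to 1 at time 1 is
  transferred to all times up to \<open>N\<close>. The positive real part keeps \<open>c\<close> off
  the branch cut of \<open>Ln\<close>.\<close>

lemma exp_mult_Ln_small:
  assumes "N \<ge> 0" and "\<epsilon> > 0"
  obtains \<delta> :: real where "\<delta> > 0"
    "\<And>c. norm (c - 1) \<le> \<delta> \<Longrightarrow> Re c > 0 \<and> (\<forall>t\<in>{0..N}. norm (exp (of_real t * Ln c) - 1) \<le> \<epsilon>)"
proof -
  have "isCont exp (0 :: complex)" by simp
  then obtain \<eta> where \<eta>: "\<eta> > 0" "\<And>z :: complex. norm z < \<eta> \<Longrightarrow> norm (exp z - 1) < \<epsilon>"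
    using \<open>\<epsilon> > 0\<close> unfolding continuous_at_eps_delta by (auto simp: dist_norm)
  have "isCont Ln (1 :: complex)" by (intro continuous_at_Ln) auto
  then obtain d where d: "d > 0" "\<And>c. norm (c - 1) < d \<Longrightarrow> norm (Ln c) < \<eta> / (N + 1)"
    using \<eta>(1) \<open>N \<ge> 0\<close> unfolding continuous_at_eps_delta
    by (auto simp: dist_norm dest!: spec[of _ "\<eta> / (N + 1)"])
  define \<delta> where "\<delta> = min (d / 2) (1 / 2)"
  have "\<delta> > 0" using d by (simp add: \<delta>_def)
  moreover have "Re c > 0 \<and> (\<forall>t\<in>{0..N}. norm (exp (of_real t * Ln c) - 1) \<le> \<epsilon>)"
    if c: "norm (c - 1) \<le> \<delta>" for c
  proof (intro conjI ballI)
    have "\<bar>Re c - 1\<bar> \<le> 1 / 2" using c abs_Re_le_cmod[of "c - 1"] by (simp add: \<delta>_def)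
    then show "Re c > 0" by linarith
    fix t assume t: "t \<in> {0..N}"
    have "norm (Ln c) < \<eta> / (N + 1)" using c d by (intro d(2)) (simp add: \<delta>_def)
    then have "norm (of_real t * Ln c) \<le> N * (\<eta> / (N + 1))"
      using t unfolding norm_mult by (intro mult_mono) auto
    also have "\<dots> < \<eta>" using \<eta>(1) \<open>N \<ge> 0\<close> by (simp add: field_simps)
    finally show "norm (exp (of_real t * Ln c) - 1) \<le> \<epsilon>" using \<eta>(2) by (intro less_imp_le)
  qed
  ultimately show ?thesis using that by blast
qed

text \<open>Stochastic continuity is expressed through a bounded continuous test function, the form
  in which weak continuity of the laws delivers it.\<close>

locale real_levy = prob_space M for M :: "'w measure" +
  fixes X :: "real \<Rightarrow> 'w \<Rightarrow> real"
  assumes X_measurable: "\<And>t. t \<ge> 0 \<Longrightarrow> X t \<in> borel_measurable M"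
    and X_0: "AE \<omega> in M. X 0 \<omega> = 0"
    and X_indep: "\<And>n t. 0 \<le> t 0 \<Longrightarrow> (\<And>i. i < n \<Longrightarrow> t i < t (Suc i)) \<Longrightarrow>
      indep_vars (\<lambda>_. borel) (\<lambda>i \<omega>. X (t (Suc i)) \<omega> - X (t i) \<omega>) {..<(n::nat)}"
    and X_stat: "\<And>s h. s \<ge> 0 \<Longrightarrow> h \<ge> 0 \<Longrightarrow>
      distr M borel (\<lambda>\<omega>. X (s + h) \<omega> - X s \<omega>) = distr M borel (X h)"
    and X_cont: "((\<lambda>h. \<integral>\<omega>. min \<bar>X h \<omega>\<bar> 1 \<partial>M) \<longlongrightarrow> 0) (at_right 0)"
begin

lemma prob_increment:
  assumes "s \<ge> 0" "s \<le> t"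
  shows "prob {\<omega> \<in> space M. a < \<bar>X t \<omega> - X s \<omega>\<bar>} = prob {\<omega> \<in> space M. a < \<bar>X (t - s) \<omega>\<bar>}"
proof -
  have [measurable]: "X t \<in> borel_measurable M" "X s \<in> borel_measurable M" "X (t - s) \<in> borel_measurable M"
    using assms by (auto intro: X_measurable)
  have "measure (distr M borel (\<lambda>\<omega>. X t \<omega> - X s \<omega>)) {x. a < \<bar>x\<bar>} = measure (distr M borel (X (t - s))) {x. a < \<bar>x\<bar>}"
    using X_stat[of s "t - s"] assms by simp
  then show ?thesis
    by (simp add: measure_distr vimage_def Int_def conj_commute)
qed

lemma grid_indep:
  assumes "s \<ge> 0" "h > 0"
  shows "indep_vars (\<lambda>_. borel) (\<lambda>i \<omega>. X (s + real (Suc i) * h) \<omega> - X (s + real i * h) \<omega>) {..<n}"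
  using X_indep[of "\<lambda>i. s + real i * h" n] assms by simp

lemma grid_sum:
  "k \<le> l \<Longrightarrow> (\<Sum>i\<in>{k..<l}. X (s + real (Suc i) * h) \<omega> - X (s + real i * h) \<omega>)
    = X (s + real l * h) \<omega> - X (s + real k * h) \<omega>"
  using sum_Suc_diff'[of k l "\<lambda>i. X (s + real i * h) \<omega>"] by simp

text \<open>By stationarity the tail after the \<open>j\<close>-th grid point has the law of
  \<open>X\<close> at time \<open>(n - j) * h\<close>, so a bound on one-dimensional laws feeds
  Ottaviani's inequality.\<close>

lemma grid_max:
  assumes "s \<ge> 0" "h > 0" and \<alpha>: "\<And>j. j \<le> n \<Longrightarrow> prob {\<omega> \<in> space M. a < \<bar>X (real j * h) \<omega>\<bar>} \<le> \<alpha>"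
  shows "prob {\<omega> \<in> space M. \<exists>j\<le>n. 2 * a < \<bar>X (s + real j * h) \<omega> - X s \<omega>\<bar>} \<le> 2 * \<alpha>"
proof -
  have "prob {\<omega> \<in> space M. \<exists>j\<le>n. 2 * a < \<bar>\<Sum>i<j. X (s + real (Suc i) * h) \<omega> - X (s + real i * h) \<omega>\<bar>} \<le> 2 * \<alpha>"
  proof (rule Ottaviani[OF grid_indep[OF assms(1,2)]])
    fix j assume j: "j \<le> n"
    have "prob {\<omega> \<in> space M. a < \<bar>X (s + real n * h) \<omega> - X (s + real j * h) \<omega>\<bar>}
        = prob {\<omega> \<in> space M. a < \<bar>X (s + real n * h - (s + real j * h)) \<omega>\<bar>}"
      using assms j by (intro prob_increment) (auto intro!: mult_right_mono)
    also have "s + real n * h - (s + real j * h) = real (n - j) * h"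
      using j by (simp add: of_nat_diff algebra_simps)
    also have "prob {\<omega> \<in> space M. a < \<bar>X (real (n - j) * h) \<omega>\<bar>} \<le> \<alpha>" by (rule \<alpha>) simp
    finally show "prob {\<omega> \<in> space M. a < \<bar>\<Sum>i\<in>{j..<n}. X (s + real (Suc i) * h) \<omega> - X (s + real i * h) \<omega>\<bar>} \<le> \<alpha>"
      unfolding grid_sum[OF j] .
  qed
  moreover have "(\<Sum>i<j. X (s + real (Suc i) * h) \<omega> - X (s + real i * h) \<omega>) = X (s + real j * h) \<omega> - X s \<omega>" for j \<omega>
    using grid_sum[of 0 j s h \<omega>] by (simp add: lessThan_atLeast0)
  ultimately show ?thesis by simp
qed

lemma grid_osc:
  fixes p n :: nat
  assumes "s \<ge> 0" "h > 0" and \<alpha>: "\<And>j. j \<le> n \<Longrightarrow> prob {\<omega> \<in> space M. a < \<bar>X (real j * h) \<omega>\<bar>} \<le> \<alpha>"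
  defines "Os \<equiv> {\<omega> \<in> space M. osc (\<lambda>i. X (s + real (Suc i) * h) \<omega> - X (s + real i * h) \<omega>) (4 * a) n p 0}"
  shows "Os \<in> events" and "prob Os \<le> (2 * \<alpha>) ^ p"
proof -
  \<comment> \<open>The excursion bound \<open>2 * \<alpha>\<close> is \<open>grid_max\<close>
    restarted at the \<open>i\<close>-th grid point.\<close>
  have "prob {\<omega> \<in> space M. \<exists>l\<in>{i..n}. 2 * a < \<bar>\<Sum>m\<in>{i..<l}. X (s + real (Suc m) * h) \<omega> - X (s + real m * h) \<omega>\<bar>} \<le> 2 * \<alpha>"
    if i: "i \<le> n" for i
  proof -
    let ?s = "s + real i * h"
    have "prob {\<omega> \<in> space M. \<exists>j\<le>n - i. 2 * a < \<bar>X (?s + real j * h) \<omega> - X ?s \<omega>\<bar>} \<le> 2 * \<alpha>"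
      using assms(1,2) by (intro grid_max \<alpha>) auto
    moreover have "(\<exists>l\<in>{i..n}. 2 * a < \<bar>\<Sum>m\<in>{i..<l}. X (s + real (Suc m) * h) \<omega> - X (s + real m * h) \<omega>\<bar>)
        \<longleftrightarrow> (\<exists>j\<le>n - i. 2 * a < \<bar>X (?s + real j * h) \<omega> - X ?s \<omega>\<bar>)" for \<omega>
    proof -
      have "{i..n} = (\<lambda>j. i + j) ` {..n - i}"
        using i image_add_atLeastAtMost[of i 0 "n - i"] by (simp add: atMost_atLeast0)
      then have "(\<exists>l\<in>{i..n}. 2 * a < \<bar>\<Sum>m\<in>{i..<l}. X (s + real (Suc m) * h) \<omega> - X (s + real m * h) \<omega>\<bar>)
        \<longleftrightarrow> (\<exists>j\<in>{..n - i}. 2 * a < \<bar>\<Sum>m\<in>{i..<i + j}. X (s + real (Suc m) * h) \<omega> - X (s + real m * h) \<omega>\<bar>)"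
        by simp
      also have "\<dots> \<longleftrightarrow> (\<exists>j\<in>{..n - i}. 2 * a < \<bar>X (?s + real j * h) \<omega> - X ?s \<omega>\<bar>)"
        by (subst grid_sum) (simp_all add: algebra_simps)
      finally show ?thesis by (simp add: Bex_def)
    qed
    ultimately show ?thesis by simp
  qed
  from prob_osc_le[OF grid_indep[OF assms(1,2)] this, of p]
  show "Os \<in> events" "prob Os \<le> (2 * \<alpha>) ^ p" unfolding Os_def by blast+
qed

section \<open>Characteristic functions at dyadic times\<close>

definition ch :: "real \<Rightarrow> real \<Rightarrow> complex" where "ch t u = char (distr M borel (X t)) u"

lemma ch_mult:
  assumes "h > 0" shows "ch (real n * h) u = ch h u ^ n"
proof -
  let ?Z = "\<lambda>i \<omega>. X (0 + real (Suc i) * h) \<omega> - X (0 + real i * h) \<omega>"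
  have "char (distr M borel (\<lambda>\<omega>. \<Sum>i\<in>{..<n}. ?Z i \<omega>)) u = (\<Prod>i\<in>{..<n}. char (distr M borel (?Z i)) u)"
    by (rule char_distr_sum[OF grid_indep]) (use assms in auto)
  moreover have "(\<lambda>\<omega>. \<Sum>i\<in>{..<n}. ?Z i \<omega>) = (\<lambda>\<omega>. X (0 + real n * h) \<omega> - X 0 \<omega>)"
    using grid_sum[of 0 n 0 h] by (simp add: lessThan_atLeast0 fun_eq_iff)
  moreover have "distr M borel (\<lambda>\<omega>. X (0 + real n * h) \<omega> - X 0 \<omega>) = distr M borel (X (real n * h))"
    using assms by (intro X_stat) auto
  moreover have "distr M borel (?Z i) = distr M borel (X h)" for i
  proof -
    have "0 + real (Suc i) * h = (0 + real i * h) + h" by (simp add: algebra_simps)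
    then show ?thesis using X_stat[of "0 + real i * h" h] assms by (simp only:) simp
  qed
  ultimately show ?thesis by (simp add: ch_def)
qed

lemma ch_0 [simp]: "t \<ge> 0 \<Longrightarrow> ch t 0 = 1"
  unfolding ch_def
  by (intro real_distribution.char_zero real_distribution_distr X_measurable)

lemma continuous_ch: "t \<ge> 0 \<Longrightarrow> isCont (ch t) u"
  unfolding ch_def[abs_def]
  by (intro real_distribution.isCont_char real_distribution_distr X_measurable)

text \<open>The square root of \<open>ch\<close> is the principal one by continuity in \<open>u\<close>, starting from \<open>u = 0\<close>.\<close>

lemma ch_dyadic:
  assumes pos: "\<And>u. u \<in> {0..1} \<Longrightarrow> Re (ch 1 u) > 0"
  shows "u \<in> {0..1} \<Longrightarrow> ch (1 / 2 ^ k) u = exp (Ln (ch 1 u) / 2 ^ k)"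
proof (induction k arbitrary: u)
  case 0
  then have "ch 1 u \<noteq> 0" using pos[of u] by auto
  then show ?case by simp
next
  case (Suc k)
  \<comment> \<open>Division by \<open>2 ^ m\<close> shrinks the imaginary part of the logarithm, so
    the exponential stays in the right half-plane.\<close>
  have Re_exp_pos: "Re (exp (Ln (ch 1 v) / 2 ^ m)) > 0" if "v \<in> {0..1}" for v m
  proof -
    have "ch 1 v \<noteq> 0" using pos[OF that] by auto
    then have "\<bar>Im (Ln (ch 1 v))\<bar> < pi / 2" using pos[OF that] Re_Ln_pos_lt by blast
    moreover have "\<bar>Im (Ln (ch 1 v) / 2 ^ m)\<bar> \<le> \<bar>Im (Ln (ch 1 v))\<bar>"
    proof -
      have "Ln (ch 1 v) / 2 ^ m = Ln (ch 1 v) / of_real (2 ^ m)" by simp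
      then have "Im (Ln (ch 1 v) / 2 ^ m) = Im (Ln (ch 1 v)) / 2 ^ m" by (simp only: Im_divide_of_real)
      moreover have "\<bar>Im (Ln (ch 1 v))\<bar> / 2 ^ m \<le> \<bar>Im (Ln (ch 1 v))\<bar> / 1"
        by (intro divide_left_mono) auto
      ultimately show ?thesis by simp
    qed
    ultimately have "\<bar>Im (Ln (ch 1 v) / 2 ^ m)\<bar> < pi / 2" by linarith
    then have "- (pi / 2) < Im (Ln (ch 1 v) / 2 ^ m)" "Im (Ln (ch 1 v) / 2 ^ m) < pi / 2" by linarith+
    then have "cos (Im (Ln (ch 1 v) / 2 ^ m)) > 0" by (rule cos_gt_zero_pi)
    then show ?thesis unfolding Re_exp by simp
  qed
  let ?w = "ch (1 / 2 ^ Suc k)"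
  have sq: "(?w v)\<^sup>2 = exp (Ln (ch 1 v) / 2 ^ k)" if "v \<in> {0..1}" for v
    using ch_mult[of "1 / 2 ^ Suc k" 2 v] Suc.IH[OF that] by simp
  \<comment> \<open>A purely imaginary number has a non-positive square, but the square lies in the
    right half-plane. So the real part keeps its sign along \<open>{0..u}\<close>.\<close>
  have nz: "Re (?w v) \<noteq> 0" if "v \<in> {0..1}" for v
  proof
    assume "Re (?w v) = 0"
    then have "Re ((?w v)\<^sup>2) \<le> 0" by (simp add: power2_eq_square)
    then show False using Re_exp_pos[OF that, of k] sq[OF that] by simp
  qed
  have "Re (?w u) > 0"
  proof (rule ccontr)
    assume "\<not> Re (?w u) > 0"
    moreover have "Re (?w 0) = 1" by simp
    moreover have "continuous_on {0..u} (\<lambda>v. Re (?w v))"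
      by (intro continuous_at_imp_continuous_on ballI continuous_intros continuous_ch) simp
    ultimately obtain v where "0 \<le> v" "v \<le> u" "Re (?w v) = 0"
      using IVT2'[of "\<lambda>v. Re (?w v)" u 0 0] Suc.prems by auto
    then show False using nz[of v] Suc.prems by auto
  qed
  moreover have "(?w u)\<^sup>2 = (exp (Ln (ch 1 u) / 2 ^ Suc k))\<^sup>2"
    unfolding sq[OF Suc.prems] exp_double[symmetric] by simp
  then have "?w u = exp (Ln (ch 1 u) / 2 ^ Suc k) \<or> ?w u = - exp (Ln (ch 1 u) / 2 ^ Suc k)"
    by (simp only: power2_eq_iff)
  ultimately show ?case using Re_exp_pos[OF Suc.prems, of "Suc k"] by auto
qed

text \<open>The bound is independent of \<open>k\<close>, which permits refining the grid later. At
  a single time the value exceeds 2 with probability at most \<open>2 * \<epsilon>\<close> by the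
  truncation inequality; Ottaviani doubles both numbers.\<close>

lemma grid_sup_le:
  assumes c: "\<And>c. norm (c - 1) \<le> \<delta> \<Longrightarrow>
      Re c > 0 \<and> (\<forall>t\<in>{0..real N}. norm (exp (of_real t * Ln c) - 1) \<le> \<epsilon>)"
    and X1: "\<And>u. u \<in> {0..1} \<Longrightarrow> norm (ch 1 u - 1) \<le> \<delta>"
  shows "prob {\<omega> \<in> space M. \<exists>j\<le>N * 2 ^ k. 4 < \<bar>X (real j / 2 ^ k) \<omega>\<bar>} \<le> 4 * \<epsilon>"
proof -
  have pos: "Re (ch 1 u) > 0" if "u \<in> {0..1}" for u using c X1[OF that] by blast
  have tail: "prob {\<omega> \<in> space M. 2 < \<bar>X (real j * (1 / 2 ^ k)) \<omega>\<bar>} \<le> 2 * \<epsilon>" if j: "j \<le> N * 2 ^ k" for j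
  proof -
    have m: "X (real j * (1 / 2 ^ k)) \<in> borel_measurable M" by (intro X_measurable) simp
    then have [measurable]: "X (real j / 2 ^ k) \<in> borel_measurable M" by simp
    have "prob {\<omega> \<in> space M. 2 < \<bar>X (real j * (1 / 2 ^ k)) \<omega>\<bar>} \<le> prob {\<omega> \<in> space M. 2 \<le> \<bar>X (real j * (1 / 2 ^ k)) \<omega>\<bar>}"
      by (intro finite_measure_mono) auto
    also have "\<dots> \<le> 2 * \<epsilon>"
    proof (rule prob_ge_2_le_char)
      fix u :: real assume u: "u \<in> {0..1}"
      have dy: "ch (1 / 2 ^ k) u = exp (Ln (ch 1 u) / 2 ^ k)"
        by (rule ch_dyadic[OF _ u]) (rule pos)
      have "char (distr M borel (X (real j * (1 / 2 ^ k)))) u = ch (1 / 2 ^ k) u ^ j"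
        unfolding ch_def[symmetric] by (rule ch_mult) simp
      also have "\<dots> = exp (Ln (ch 1 u) / 2 ^ k) ^ j" unfolding dy ..
      also have "\<dots> = exp (of_real (real j / 2 ^ k) * Ln (ch 1 u))"
        by (simp add: exp_of_nat_mult[symmetric])
      finally have eq: "char (distr M borel (X (real j * (1 / 2 ^ k)))) u = exp (of_real (real j / 2 ^ k) * Ln (ch 1 u))" .
      have "real j \<le> real N * 2 ^ k" using of_nat_mono[OF j, where 'a = real] by simp
      then have "real j / 2 ^ k \<in> {0..real N}" by (simp add: divide_le_eq)
      then show "norm (char (distr M borel (X (real j * (1 / 2 ^ k)))) u - 1) \<le> \<epsilon>"
        unfolding eq using c X1[OF u] by blast
    qed (rule m)
    finally show ?thesis .
  qed
  have "prob {\<omega> \<in> space M. \<exists>j\<le>N * 2 ^ k. 2 * 2 < \<bar>X (0 + real j * (1 / 2 ^ k)) \<omega> - X 0 \<omega>\<bar>} \<le> 2 * (2 * \<epsilon>)"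
  proof (rule grid_max)
    show "prob {\<omega> \<in> space M. 2 < \<bar>X (real j * (1 / 2 ^ k)) \<omega>\<bar>} \<le> 2 * \<epsilon>" if "j \<le> N * 2 ^ k" for j
      using that by (rule tail)
  qed simp_all
  \<comment> \<open>\<open>X 0\<close> vanishes only almost surely, so the two events agree up to a
    null set.\<close>
  moreover have "prob {\<omega> \<in> space M. \<exists>j\<le>N * 2 ^ k. 2 * 2 < \<bar>X (0 + real j * (1 / 2 ^ k)) \<omega> - X 0 \<omega>\<bar>}
      = prob {\<omega> \<in> space M. \<exists>j\<le>N * 2 ^ k. 4 < \<bar>X (real j / 2 ^ k) \<omega>\<bar>}"
  proof (rule measure_eq_AE)
    have [measurable]: "X (real j / 2 ^ k) \<in> borel_measurable M" "X 0 \<in> borel_measurable M" for j :: nat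
      by (rule X_measurable, simp)+
    show "{\<omega> \<in> space M. \<exists>j\<le>N * 2 ^ k. 4 < \<bar>X (real j / 2 ^ k) \<omega>\<bar>} \<in> events"
      "{\<omega> \<in> space M. \<exists>j\<le>N * 2 ^ k. 2 * 2 < \<bar>X (0 + real j * (1 / 2 ^ k)) \<omega> - X 0 \<omega>\<bar>} \<in> events"
      by simp_all
    show "AE \<omega> in M. (\<omega> \<in> {\<omega> \<in> space M. \<exists>j\<le>N * 2 ^ k. 2 * 2 < \<bar>X (0 + real j * (1 / 2 ^ k)) \<omega> - X 0 \<omega>\<bar>})
        = (\<omega> \<in> {\<omega> \<in> space M. \<exists>j\<le>N * 2 ^ k. 4 < \<bar>X (real j / 2 ^ k) \<omega>\<bar>})"
      using X_0 by eventually_elim simp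
  qed
  ultimately show ?thesis by simp
qed

lemma small_increments:
  assumes "\<epsilon> > 0" "a > 0"
  shows "\<exists>r>0. \<forall>h\<in>{0..r}. prob {\<omega> \<in> space M. a < \<bar>X h \<omega>\<bar>} \<le> \<epsilon>"
proof -
  define b where "b = min a 1"
  have b: "b > 0" "b \<le> 1" "b \<le> a" using assms by (auto simp: b_def)
  have "\<forall>\<^sub>F h in at_right 0. (\<integral>\<omega>. min \<bar>X h \<omega>\<bar> 1 \<partial>M) < \<epsilon> * b"
    using X_cont assms b by (intro order_tendstoD(2)) auto
  then obtain r where r: "r > 0" "\<And>h. 0 < h \<Longrightarrow> h < r \<Longrightarrow> (\<integral>\<omega>. min \<bar>X h \<omega>\<bar> 1 \<partial>M) < \<epsilon> * b"
    unfolding eventually_at_right_field by blast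
  \<comment> \<open>\<open>r\<close> is halved because the limit controls \<open>h < r\<close> only;
    \<open>h = 0\<close> is covered by \<open>X_0\<close>.\<close>
  have "prob {\<omega> \<in> space M. a < \<bar>X h \<omega>\<bar>} \<le> \<epsilon>" if h: "h \<in> {0..r / 2}" for h
  proof (cases "h = 0")
    case True
    have "prob {\<omega> \<in> space M. a < \<bar>X h \<omega>\<bar>} = 0"
      using X_0 assms unfolding True by (intro prob_eq_0_AE) (auto elim!: eventually_mono)
    then show ?thesis using assms by simp
  next
    case False
    have [measurable]: "X h \<in> borel_measurable M" using h by (intro X_measurable) auto
    have int: "integrable M (\<lambda>\<omega>. min \<bar>X h \<omega>\<bar> 1)"
      by (intro integrable_const_bound[of _ 1]) auto
    have "prob {\<omega> \<in> space M. a < \<bar>X h \<omega>\<bar>} \<le> prob {\<omega> \<in> space M. min \<bar>X h \<omega>\<bar> 1 \<ge> b}"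
      using b by (intro finite_measure_mono) auto
    also have "\<dots> \<le> (\<integral>\<omega>. min \<bar>X h \<omega>\<bar> 1 \<partial>M) / b"
      using int b by (intro integral_Markov_inequality_measure[where A = "space M"]) auto
    also have "\<dots> \<le> \<epsilon>" using r(2)[of h] False h r(1) b by (simp add: divide_le_eq)
    finally show ?thesis .
  qed
  then show ?thesis using r(1) by (intro exI[of _ "r / 2"]) auto
qed

end

section \<open>Rademacher averages\<close>

text \<open>\<open>rademacher vs g\<close> is the expectation of \<open>g (\<Sum>\<^sub>j \<epsilon>\<^sub>j v\<^sub>j)\<close> for independent random signs
  \<open>\<epsilon>\<^sub>j\<close>.\<close>

fun rademacher :: "'v::real_vector list \<Rightarrow> ('v \<Rightarrow> real) \<Rightarrow> real" where
  "rademacher [] g = g 0"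
| "rademacher (v # vs) g = (rademacher vs (\<lambda>x. g (x + v)) + rademacher vs (\<lambda>x. g (x - v))) / 2"

lemma rademacher_add: "rademacher vs (\<lambda>x. f x + g x) = rademacher vs f + rademacher vs g"
proof (induction vs arbitrary: f g)
  case (Cons v vs)
  show ?case by (simp add: Cons.IH field_simps)
qed simp

lemma rademacher_cmult: "rademacher vs (\<lambda>x. c * f x) = c * rademacher vs f"
proof (induction vs arbitrary: f)
  case (Cons v vs)
  show ?case by (simp add: Cons.IH field_simps)
qed simp

lemma rademacher_const [simp]: "rademacher vs (\<lambda>_. c) = c"
  by (induction vs) auto

lemma rademacher_mono: "(\<And>x. f x \<le> g x) \<Longrightarrow> rademacher vs f \<le> rademacher vs g"
proof (induction vs arbitrary: f g)
  case (Cons v vs)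
  have "rademacher vs (\<lambda>x. f (x + v)) \<le> rademacher vs (\<lambda>x. g (x + v))"
    "rademacher vs (\<lambda>x. f (x - v)) \<le> rademacher vs (\<lambda>x. g (x - v))"
    by (rule Cons.IH; rule Cons.prems)+
  then show ?case by simp
qed simp

lemma rademacher_linear:
  assumes "linear L" shows "rademacher vs (\<lambda>x. g (L x)) = rademacher (map L vs) g"
proof (induction vs arbitrary: g)
  case (Cons v vs)
  show ?case
    using Cons.IH[of "\<lambda>y. g (y + L v)"] Cons.IH[of "\<lambda>y. g (y - L v)"]
    by (simp add: linear_add[OF assms] linear_diff[OF assms])
qed (simp add: linear_0[OF assms])

lemma rademacher_integral:
  assumes "\<And>x. integrable M (h x)"
  shows "integrable M (\<lambda>\<omega>. rademacher vs (\<lambda>x. h x \<omega>)) \<and>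
    (\<integral>\<omega>. rademacher vs (\<lambda>x. h x \<omega>) \<partial>M) = rademacher vs (\<lambda>x. \<integral>\<omega>. h x \<omega> \<partial>M)"
  using assms
proof (induction vs arbitrary: h)
  case (Cons v vs)
  have "integrable M (\<lambda>\<omega>. rademacher vs (\<lambda>x. h (x + v) \<omega>)) \<and>
    (\<integral>\<omega>. rademacher vs (\<lambda>x. h (x + v) \<omega>) \<partial>M) = rademacher vs (\<lambda>x. \<integral>\<omega>. h (x + v) \<omega> \<partial>M)"
    by (rule Cons.IH[of "\<lambda>x. h (x + v)"]) (rule Cons.prems)
  moreover have "integrable M (\<lambda>\<omega>. rademacher vs (\<lambda>x. h (x - v) \<omega>)) \<and>
    (\<integral>\<omega>. rademacher vs (\<lambda>x. h (x - v) \<omega>) \<partial>M) = rademacher vs (\<lambda>x. \<integral>\<omega>. h (x - v) \<omega> \<partial>M)"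
    by (rule Cons.IH[of "\<lambda>x. h (x - v)"]) (rule Cons.prems)
  ultimately show ?case by simp
qed simp

lemma rademacher_square:
  fixes as :: "real list"
  shows "rademacher as (\<lambda>x. (x + y)\<^sup>2) = y\<^sup>2 + (\<Sum>a\<leftarrow>as. a\<^sup>2)"
proof (induction as arbitrary: y)
  case (Cons a as)
  have "rademacher as (\<lambda>x. (x + a + y)\<^sup>2) = (y + a)\<^sup>2 + (\<Sum>a\<leftarrow>as. a\<^sup>2)"
    using Cons.IH[of "y + a"] by (simp add: add_ac)
  moreover have "rademacher as (\<lambda>x. (x - a + y)\<^sup>2) = (y - a)\<^sup>2 + (\<Sum>a\<leftarrow>as. a\<^sup>2)"
    using Cons.IH[of "y - a"] by (simp add: algebra_simps)
  ultimately show ?case by (simp add: power2_eq_square algebra_simps)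
qed simp

text \<open>The factor 3 is the classical fourth-moment constant for sign sums. The shift
  \<open>y\<close> is carried along because the induction adds one sign at a time.\<close>

lemma rademacher_fourth:
  fixes as :: "real list"
  shows "rademacher as (\<lambda>x. (x + y) ^ 4) \<le> y ^ 4 + 6 * y\<^sup>2 * (\<Sum>a\<leftarrow>as. a\<^sup>2) + 3 * (\<Sum>a\<leftarrow>as. a\<^sup>2)\<^sup>2"
proof (induction as arbitrary: y)
  case (Cons a as)
  define s where "s = (\<Sum>a\<leftarrow>as. a\<^sup>2)"
  have "rademacher as (\<lambda>x. (x + a + y) ^ 4) \<le> (y + a) ^ 4 + 6 * (y + a)\<^sup>2 * s + 3 * s\<^sup>2"
    using Cons.IH[of "y + a"] by (simp add: add_ac s_def)
  moreover have "rademacher as (\<lambda>x. (x - a + y) ^ 4) \<le> (y - a) ^ 4 + 6 * (y - a)\<^sup>2 * s + 3 * s\<^sup>2"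
    using Cons.IH[of "y - a"] by (simp add: algebra_simps s_def)
  ultimately have "rademacher (a # as) (\<lambda>x. (x + y) ^ 4) \<le>
      ((y + a) ^ 4 + (y - a) ^ 4) / 2 + 3 * ((y + a)\<^sup>2 + (y - a)\<^sup>2) * s + 3 * s\<^sup>2"
    by (simp add: field_simps)
  also have "\<dots> = y ^ 4 + 6 * y\<^sup>2 * (a\<^sup>2 + s) + a ^ 4 + 6 * a\<^sup>2 * s + 3 * s\<^sup>2"
    by (simp add: power2_eq_square power4_eq_xxxx algebra_simps)
  also have "\<dots> \<le> y ^ 4 + 6 * y\<^sup>2 * (a\<^sup>2 + s) + 3 * (a\<^sup>2 + s)\<^sup>2"
  proof -
    have "3 * (a\<^sup>2 + s)\<^sup>2 = 3 * a ^ 4 + 6 * a\<^sup>2 * s + 3 * s\<^sup>2"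
      by (simp add: power2_eq_square power4_eq_xxxx algebra_simps)
    moreover have "a ^ 4 \<le> 3 * a ^ 4" by simp
    ultimately show ?thesis by linarith
  qed
  finally show ?case by (simp add: s_def)
qed simp

text \<open>Paley--Zygmund: \<open>1 - (4/81) (v - 5)\<^sup>2\<close> lies below the indicator of \<open>v > 1/2\<close> on \<open>[0, \<infinity>)\<close>.\<close>

lemma rademacher_Paley_Zygmund:
  fixes as :: "real list"
  assumes s: "(\<Sum>a\<leftarrow>as. a\<^sup>2) \<ge> 2"
  shows "1 / 9 \<le> rademacher as (\<lambda>x. of_bool (1 < \<bar>x\<bar>))"
proof -
  define s where "s = (\<Sum>a\<leftarrow>as. a\<^sup>2)"
  have s2: "s \<ge> 2" using s by (simp add: s_def)
  have E2: "rademacher as (\<lambda>x. x\<^sup>2) = s"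
    using rademacher_square[of as 0] by (simp add: s_def)
  have E4: "rademacher as (\<lambda>x. x ^ 4) \<le> 3 * s\<^sup>2"
    using rademacher_fourth[of as 0] by (simp add: s_def)
  have "1 - (4 / 81) * (x\<^sup>2 / s - 5)\<^sup>2 \<le> of_bool (1 < \<bar>x\<bar>)" for x
  proof (cases "1 < \<bar>x\<bar>")
    case False
    then have "x\<^sup>2 \<le> 1" using abs_le_square_iff[of x 1] by simp
    then have "x\<^sup>2 / s \<le> 1 / 2" using s2 by (intro frac_le) auto
    then have "(9 / 2)\<^sup>2 \<le> (5 - x\<^sup>2 / s)\<^sup>2" by (intro power_mono) auto
    then show ?thesis using False by (simp add: power2_commute[of 5] power_divide)
  qed simp
  then have "rademacher as (\<lambda>x. 1 - (4 / 81) * (x\<^sup>2 / s - 5)\<^sup>2) \<le> rademacher as (\<lambda>x. of_bool (1 < \<bar>x\<bar>))"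
    by (rule rademacher_mono)
  moreover have "(\<lambda>x. 1 - (4 / 81) * (x\<^sup>2 / s - 5)\<^sup>2)
      = (\<lambda>x. (1 - 100 / 81) + ((40 / (81 * s)) * x\<^sup>2 + (- (4 / (81 * s\<^sup>2))) * x ^ 4))"
    using s2 by (auto simp: fun_eq_iff field_simps power2_eq_square power4_eq_xxxx)
  \<comment> \<open>With \<open>v = x\<^sup>2 / s\<close> the mean of \<open>v\<close> is 1 and that
    of \<open>v\<^sup>2\<close> at most 3, so the mean of \<open>(v - 5)\<^sup>2\<close> is at most
    18, and 4/81 of this leaves 1/9 below 1.\<close>
  ultimately have "(1 - 100 / 81) + ((40 / (81 * s)) * s + (- (4 / (81 * s\<^sup>2))) * rademacher as (\<lambda>x. x ^ 4))
      \<le> rademacher as (\<lambda>x. of_bool (1 < \<bar>x\<bar>))"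
    by (simp only: rademacher_add rademacher_cmult rademacher_const E2)
  moreover have "(4 / (81 * s\<^sup>2)) * rademacher as (\<lambda>x. x ^ 4) \<le> (4 / (81 * s\<^sup>2)) * (3 * s\<^sup>2)"
    using E4 by (intro mult_left_mono) auto
  moreover have "(4 / (81 * s\<^sup>2)) * (3 * s\<^sup>2) = 12 / 81" "(40 / (81 * s)) * s = 40 / 81"
    using s2 by auto
  ultimately show ?thesis by linarith
qed

section \<open>Minlos' lemma\<close>

text \<open>The parallelogram law removes one sign at a time; the result is the trace that
  \<open>HS_bound\<close> controls.\<close>

lemma (in hilbertian) rademacher_norm:
  "rademacher vs (\<lambda>x. (p (x + y))\<^sup>2) = (p y)\<^sup>2 + (\<Sum>v\<leftarrow>vs. (p v)\<^sup>2)"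
proof (induction vs arbitrary: y)
  case (Cons v vs)
  have "rademacher vs (\<lambda>x. (p (x + v + y))\<^sup>2) = (p (y + v))\<^sup>2 + (\<Sum>v\<leftarrow>vs. (p v)\<^sup>2)"
    using Cons.IH[of "y + v"] by (simp add: add_ac)
  moreover have "rademacher vs (\<lambda>x. (p (x - v + y))\<^sup>2) = (p (y - v))\<^sup>2 + (\<Sum>v\<leftarrow>vs. (p v)\<^sup>2)"
    using Cons.IH[of "y - v"] by (simp add: algebra_simps)
  moreover have "(p (y + v))\<^sup>2 + (p (y - v))\<^sup>2 = 2 * (p y)\<^sup>2 + 2 * (p v)\<^sup>2"
    using diff_sq[of y "- v"] diff_sq[of y v]
    by (simp add: minus linear_neg[OF form_linear])
  ultimately show ?case by simp
qed simp

context prob_space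
begin

text \<open>Let \<open>x\<close> be the sum of the \<open>\<sigma> *\<^sub>R f i\<close> with random
  signs. If some \<open>Y j \<omega>\<close> is large on the system, then
  \<open>\<bar>Y j \<omega> x\<bar> > 1\<close> with sign probability at least 1/9. Integrating over
  \<open>\<omega>\<close> first, a fixed \<open>x\<close> contributes at most
  \<open>\<epsilon> + (p x)\<^sup>2\<close>, and the sign average of the second term is at most
  \<open>\<sigma>\<^sup>2 * C\<close>.\<close>

lemma Minlos_bound:
  fixes Y :: "'i \<Rightarrow> 'a \<Rightarrow> 'v::real_vector \<Rightarrow> real"
  assumes J: "finite J"
    and lin: "\<And>\<omega> j. \<omega> \<in> space M \<Longrightarrow> j \<in> J \<Longrightarrow> linear (Y j \<omega>)"
    and meas: "\<And>j x. j \<in> J \<Longrightarrow> (\<lambda>\<omega>. Y j \<omega> x) \<in> borel_measurable M"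
    and p: "hilbertian_seminorm p" and HS: "HS_bound p q C" and f: "contractive q n f"
    and \<epsilon>: "\<And>x. p x \<le> 1 \<Longrightarrow> prob {\<omega> \<in> space M. \<exists>j\<in>J. 1 < \<bar>Y j \<omega> x\<bar>} \<le> \<epsilon>"
    and \<sigma>: "\<sigma> > 0"
  shows "prob {\<omega> \<in> space M. \<exists>j\<in>J. 2 / \<sigma>\<^sup>2 \<le> (\<Sum>i<n. (Y j \<omega> (f i))\<^sup>2)} \<le> 9 * (\<epsilon> + \<sigma>\<^sup>2 * C)"
proof -
  interpret p: hilbertian p by unfold_locales fact
  define vs where "vs = map (\<lambda>i. \<sigma> *\<^sub>R f i) [0..<n]"
  define h :: "'v \<Rightarrow> 'a \<Rightarrow> real" where "h x \<omega> = of_bool (\<exists>j\<in>J. 1 < \<bar>Y j \<omega> x\<bar>)" for x \<omega>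
  define E where "E = {\<omega> \<in> space M. \<exists>j\<in>J. 2 / \<sigma>\<^sup>2 \<le> (\<Sum>i<n. (Y j \<omega> (f i))\<^sup>2)}"
  have "0 \<le> prob {\<omega> \<in> space M. \<exists>j\<in>J. 1 < \<bar>Y j \<omega> 0\<bar>}" by simp
  also have "\<dots> \<le> \<epsilon>" by (rule \<epsilon>) simp
  finally have \<epsilon>0: "\<epsilon> \<ge> 0" .
  have ev: "{\<omega> \<in> space M. \<exists>j\<in>J. 1 < \<bar>Y j \<omega> x\<bar>} \<in> events" for x
  proof (intro predE pred_intros_finite J)
    fix j assume "j \<in> J"
    then have [measurable]: "(\<lambda>\<omega>. Y j \<omega> x) \<in> borel_measurable M" by (rule meas)
    show "Measurable.pred M (\<lambda>\<omega>. 1 < \<bar>Y j \<omega> x\<bar>)" by measurable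
  qed
  have E_ev: "E \<in> events"
    unfolding E_def
  proof (intro predE pred_intros_finite J)
    fix j assume "j \<in> J"
    then have [measurable]: "(\<lambda>\<omega>. Y j \<omega> x) \<in> borel_measurable M" for x by (rule meas)
    show "Measurable.pred M (\<lambda>\<omega>. 2 / \<sigma>\<^sup>2 \<le> (\<Sum>i<n. (Y j \<omega> (f i))\<^sup>2))" by measurable
  qed
  have h_meas [measurable]: "h x \<in> borel_measurable M" for x
  proof -
    have "h x \<in> borel_measurable M \<longleftrightarrow> indicator {\<omega> \<in> space M. \<exists>j\<in>J. 1 < \<bar>Y j \<omega> x\<bar>} \<in> (borel_measurable M :: ('a \<Rightarrow> real) set)"
      by (intro measurable_cong) (auto simp: h_def indicator_def)
    then show ?thesis using ev by simp
  qed
  have h_int: "integrable M (h x)" for x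
    by (intro integrable_const_bound[of _ 1]) (auto simp: h_def)
  have h_prob: "(\<integral>\<omega>. h x \<omega> \<partial>M) = prob {\<omega> \<in> space M. \<exists>j\<in>J. 1 < \<bar>Y j \<omega> x\<bar>}" for x
  proof -
    have "(\<integral>\<omega>. h x \<omega> \<partial>M) = (\<integral>\<omega>. indicator {\<omega> \<in> space M. \<exists>j\<in>J. 1 < \<bar>Y j \<omega> x\<bar>} \<omega> \<partial>M)"
      by (intro Bochner_Integration.integral_cong) (auto simp: h_def indicator_def)
    then show ?thesis using ev by simp
  qed
  have point: "indicator E \<omega> \<le> 9 * rademacher vs (\<lambda>x. h x \<omega>)" if \<omega>: "\<omega> \<in> space M" for \<omega>
  proof (cases "\<omega> \<in> E")
    case True
    then obtain j where j: "j \<in> J" "2 / \<sigma>\<^sup>2 \<le> (\<Sum>i<n. (Y j \<omega> (f i))\<^sup>2)" by (auto simp: E_def)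
    have lj: "linear (Y j \<omega>)" using lin \<omega> j(1) by blast
    have "(\<Sum>a\<leftarrow>map (Y j \<omega>) vs. a\<^sup>2) = (\<Sum>i<n. (Y j \<omega> (\<sigma> *\<^sub>R f i))\<^sup>2)"
      by (simp add: vs_def comp_def interv_sum_list_conv_sum_set_nat lessThan_atLeast0)
    also have "\<dots> = \<sigma>\<^sup>2 * (\<Sum>i<n. (Y j \<omega> (f i))\<^sup>2)"
      by (simp add: linear_scale[OF lj] power_mult_distrib sum_distrib_left)
    also have "\<dots> \<ge> 2" using j(2) \<sigma> by (simp add: divide_le_eq mult.commute)
    finally have "1 / 9 \<le> rademacher (map (Y j \<omega>) vs) (\<lambda>x. of_bool (1 < \<bar>x\<bar>))"
      by (rule rademacher_Paley_Zygmund)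
    also have "\<dots> = rademacher vs (\<lambda>x. of_bool (1 < \<bar>Y j \<omega> x\<bar>))"
      by (rule rademacher_linear[OF lj, symmetric])
    also have "\<dots> \<le> rademacher vs (\<lambda>x. h x \<omega>)"
      using j(1) by (intro rademacher_mono) (auto simp: h_def)
    finally show ?thesis using True by simp
  next
    case False
    have "rademacher vs (\<lambda>_. 0) \<le> rademacher vs (\<lambda>x. h x \<omega>)"
      by (intro rademacher_mono) (auto simp: h_def)
    then show ?thesis using False by simp
  qed
  have ri: "integrable M (\<lambda>\<omega>. rademacher vs (\<lambda>x. h x \<omega>)) \<and>
      (\<integral>\<omega>. rademacher vs (\<lambda>x. h x \<omega>) \<partial>M) = rademacher vs (\<lambda>x. \<integral>\<omega>. h x \<omega> \<partial>M)"
    by (rule rademacher_integral) (rule h_int)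
  have "prob E = (\<integral>\<omega>. indicator E \<omega> \<partial>M)" using E_ev by simp
  also have "\<dots> \<le> (\<integral>\<omega>. 9 * rademacher vs (\<lambda>x. h x \<omega>) \<partial>M)"
    using E_ev ri point by (intro integral_mono) (auto simp: less_top[symmetric])
  also have "\<dots> = 9 * rademacher vs (\<lambda>x. \<integral>\<omega>. h x \<omega> \<partial>M)"
    using ri by simp
  also have "rademacher vs (\<lambda>x. \<integral>\<omega>. h x \<omega> \<partial>M) \<le> rademacher vs (\<lambda>x. \<epsilon> + (p x)\<^sup>2)"
  proof (rule rademacher_mono)
    fix x
    \<comment> \<open>For \<open>p x > 1\<close> the hypothesis says nothing, but then
      \<open>(p x)\<^sup>2\<close> exceeds any probability.\<close>
    show "(\<integral>\<omega>. h x \<omega> \<partial>M) \<le> \<epsilon> + (p x)\<^sup>2"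
    proof (cases "p x \<le> 1")
      case True
      then have "(\<integral>\<omega>. h x \<omega> \<partial>M) \<le> \<epsilon>" using \<epsilon> by (simp add: h_prob)
      then show ?thesis by (simp add: add_increasing2)
    next
      case False
      then have "1 \<le> (p x)\<^sup>2" by (simp add: one_le_power)
      moreover have "(\<integral>\<omega>. h x \<omega> \<partial>M) \<le> 1" unfolding h_prob by (rule prob_le_1)
      ultimately show ?thesis using \<epsilon>0 by linarith
    qed
  qed
  also have "rademacher vs (\<lambda>x. \<epsilon> + (p x)\<^sup>2) = \<epsilon> + (\<Sum>v\<leftarrow>vs. (p v)\<^sup>2)"
    using p.rademacher_norm[of vs 0] by (simp add: rademacher_add)
  also have "(\<Sum>v\<leftarrow>vs. (p v)\<^sup>2) = \<sigma>\<^sup>2 * (\<Sum>i<n. (p (f i))\<^sup>2)"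
    by (simp add: vs_def comp_def interv_sum_list_conv_sum_set_nat lessThan_atLeast0
        p.scale power_mult_distrib sum_distrib_left)
  also have "\<sigma>\<^sup>2 * (\<Sum>i<n. (p (f i))\<^sup>2) \<le> \<sigma>\<^sup>2 * C"
    using HS f by (intro mult_left_mono) (auto simp: HS_bound_def)
  finally show ?thesis by (simp add: E_def)
qed

text \<open>\<open>Minlos_bound\<close> controls \<open>L\<close> on an orthosystem that expands the
  first \<open>m\<close> vectors, Cauchy--Schwarz transfers the bound to these vectors, and
  \<open>m\<close> tends to infinity. The 18 is 9 times the two errors \<open>\<epsilon>\<close> and
  \<open>\<sigma>\<^sup>2 * C \<le> \<epsilon>\<close>.\<close>

lemma dyadic_dual_bound:
  fixes L :: "real \<Rightarrow> 'a \<Rightarrow> 'v::real_vector \<Rightarrow> real" and s :: "nat \<Rightarrow> 'v" and N :: nat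
  assumes lin: "\<And>\<omega> t. \<omega> \<in> space M \<Longrightarrow> t \<ge> 0 \<Longrightarrow> linear (L t \<omega>)"
    and meas: "\<And>t x. t \<ge> 0 \<Longrightarrow> (\<lambda>\<omega>. L t \<omega> x) \<in> borel_measurable M"
    and p: "hilbertian_seminorm p" and q: "hilbertian_seminorm q" and HS: "HS_bound p q C"
    and \<epsilon>: "\<And>k x. p x \<le> 1 \<Longrightarrow> prob {\<omega> \<in> space M. \<exists>j\<le>N * 2 ^ k. 1 < \<bar>L (real j / 2 ^ k) \<omega> x\<bar>} \<le> \<epsilon>"
    and \<sigma>: "\<sigma> > 0" and C: "\<sigma>\<^sup>2 * C \<le> \<epsilon>"
  defines "G \<equiv> {\<omega> \<in> space M. \<forall>k j i. j \<le> N * 2 ^ k \<longrightarrow> \<bar>L (real j / 2 ^ k) \<omega> (s i)\<bar> \<le> sqrt 2 / \<sigma> * q (s i)}"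
  shows "G \<in> events" "1 - 18 * \<epsilon> \<le> prob G"
proof -
  interpret q: hilbertian q by unfold_locales fact
  have Lm [measurable]: "(\<lambda>\<omega>. L (real j / 2 ^ k) \<omega> x) \<in> borel_measurable M" for j k :: nat and x
    by (rule meas) simp
  show G_ev: "G \<in> events" unfolding G_def by measurable
  define R where "R = sqrt 2 / \<sigma>"
  \<comment> \<open>One index serves as grid level, as number of vectors and, through
    \<open>1 / Suc m\<close>, as slack of the expansion. The events decrease, and their intersection
    lies in \<open>G\<close>.\<close>
  define Bd where "Bd m = {\<omega> \<in> space M. \<forall>j\<le>N * 2 ^ m. \<forall>i<m.
      \<bar>L (real j / 2 ^ m) \<omega> (s i)\<bar> \<le> R * sqrt ((q (s i))\<^sup>2 + 1 / Suc m)}" for m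
  have R: "R > 0" "R\<^sup>2 = 2 / \<sigma>\<^sup>2" using \<sigma> by (auto simp: R_def power_divide)
  have Bd_ev: "Bd m \<in> events" for m unfolding Bd_def by measurable
  have Bd_prob: "1 - 18 * \<epsilon> \<le> prob (Bd m)" for m
  proof -
    obtain n g where g: "q.orthosystem n g"
      and sg: "\<And>v. v \<in> s ` {..<m} \<Longrightarrow> q.expands (1 / Suc m) n g v"
      using q.gram_schmidt[of "s ` {..<m}" "1 / Suc m"] by auto
    let ?E = "{\<omega> \<in> space M. \<exists>j\<in>{..N * 2 ^ m}. 2 / \<sigma>\<^sup>2 \<le> (\<Sum>i<n. (L (real j / 2 ^ m) \<omega> (g i))\<^sup>2)}"
    have "prob ?E \<le> 9 * (\<epsilon> + \<sigma>\<^sup>2 * C)"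
    proof (rule Minlos_bound[OF _ _ _ p HS q.orthosystem_contractive[OF g] _ \<sigma>])
      show "prob {\<omega> \<in> space M. \<exists>j\<in>{..N * 2 ^ m}. 1 < \<bar>L (real j / 2 ^ m) \<omega> x\<bar>} \<le> \<epsilon>" if "p x \<le> 1" for x
        using \<epsilon>[OF that, of m] by (simp add: Bex_def)
    qed (auto intro: lin)
    also have "\<dots> \<le> 18 * \<epsilon>" using C by simp
    finally have "prob ?E \<le> 18 * \<epsilon>" .
    have E_ev: "?E \<in> events" by measurable
    have "space M - ?E \<subseteq> Bd m"
    proof
      fix \<omega> assume \<omega>: "\<omega> \<in> space M - ?E"
      have "\<bar>L (real j / 2 ^ m) \<omega> (s i)\<bar> \<le> R * sqrt ((q (s i))\<^sup>2 + 1 / Suc m)"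
        if j: "j \<le> N * 2 ^ m" and i: "i < m" for j i
      proof -
        let ?l = "L (real j / 2 ^ m) \<omega>"
        have l: "linear ?l" using \<omega> by (intro lin) auto
        obtain c where c: "s i = (\<Sum>i<n. c i *\<^sub>R g i)" "(\<Sum>i<n. (c i)\<^sup>2) \<le> (q (s i))\<^sup>2 + 1 / Suc m"
          using sg[of "s i"] i unfolding q.expands_def by blast
        have "\<bar>?l (s i)\<bar> = \<bar>\<Sum>i<n. c i * ?l (g i)\<bar>"
          by (subst c(1)) (simp add: linear_sum[OF l] linear_scale[OF l])
        also have "\<dots> \<le> (\<Sum>i<n. \<bar>c i\<bar> * \<bar>?l (g i)\<bar>)"
          by (rule order_trans[OF sum_abs]) (simp add: abs_mult)
        also have "\<dots> \<le> L2_set c {..<n} * L2_set (\<lambda>i. ?l (g i)) {..<n}"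
          by (rule L2_set_mult_ineq)
        also have "\<dots> \<le> sqrt ((q (s i))\<^sup>2 + 1 / Suc m) * R"
        proof (rule mult_mono)
          show "L2_set c {..<n} \<le> sqrt ((q (s i))\<^sup>2 + 1 / Suc m)"
            unfolding L2_set_def using c(2) by (rule real_sqrt_le_mono)
          have "(\<Sum>i<n. (?l (g i))\<^sup>2) < 2 / \<sigma>\<^sup>2" using \<omega> j by (auto simp: not_le)
          then have "(\<Sum>i<n. (?l (g i))\<^sup>2) \<le> R\<^sup>2" using R(2) by simp
          then show "L2_set (\<lambda>i. ?l (g i)) {..<n} \<le> R"
            unfolding L2_set_def using R(1) by (intro real_le_lsqrt) (auto intro: sum_nonneg)
        qed (auto simp: L2_set_nonneg)
        finally show ?thesis by (simp add: mult.commute)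
      qed
      then show "\<omega> \<in> Bd m" using \<omega> by (auto simp: Bd_def)
    qed
    then have "prob (space M - ?E) \<le> prob (Bd m)" by (intro finite_measure_mono Bd_ev)
    then show ?thesis using prob_compl[OF E_ev] \<open>prob ?E \<le> 18 * \<epsilon>\<close> by linarith
  qed
  have "decseq Bd"
  proof (rule decseq_SucI, rule subsetI)
    fix m \<omega> assume \<omega>: "\<omega> \<in> Bd (Suc m)"
    have "\<bar>L (real j / 2 ^ m) \<omega> (s i)\<bar> \<le> R * sqrt ((q (s i))\<^sup>2 + 1 / Suc m)"
      if j: "j \<le> N * 2 ^ m" and i: "i < m" for j i
    proof -
      have "real j / 2 ^ m = real (2 * j) / 2 ^ Suc m" by simp
      moreover have "\<bar>L (real (2 * j) / 2 ^ Suc m) \<omega> (s i)\<bar> \<le> R * sqrt ((q (s i))\<^sup>2 + 1 / Suc (Suc m))"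
      proof -
        have "2 * j \<le> N * 2 ^ Suc m" "i < Suc m" using j i by auto
        then show ?thesis using \<omega> unfolding Bd_def by blast
      qed
      moreover have "R * sqrt ((q (s i))\<^sup>2 + 1 / Suc (Suc m)) \<le> R * sqrt ((q (s i))\<^sup>2 + 1 / Suc m)"
        using R(1) by (intro mult_left_mono real_sqrt_le_mono add_left_mono divide_left_mono) auto
      ultimately show ?thesis by simp
    qed
    then show "\<omega> \<in> Bd m" using \<omega> by (auto simp: Bd_def)
  qed
  then have "(\<lambda>m. prob (Bd m)) \<longlonglongrightarrow> prob (\<Inter>m. Bd m)"
    using Bd_ev by (intro finite_Lim_measure_decseq) auto
  then have "1 - 18 * \<epsilon> \<le> prob (\<Inter>m. Bd m)"
    by (rule LIMSEQ_le_const) (use Bd_prob in auto)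
  also have "prob (\<Inter>m. Bd m) \<le> prob G"
  proof (intro finite_measure_mono G_ev subsetI)
    fix \<omega> assume \<omega>: "\<omega> \<in> (\<Inter>m. Bd m)"
    have "\<bar>L (real j / 2 ^ k) \<omega> (s i)\<bar> \<le> R * q (s i)" if j: "j \<le> N * 2 ^ k" for k j i
    proof (rule LIMSEQ_le_const)
      have "(\<lambda>m. R * sqrt ((q (s i))\<^sup>2 + 1 / Suc m)) \<longlonglongrightarrow> R * sqrt ((q (s i))\<^sup>2 + 0)"
        by (intro tendsto_intros LIMSEQ_Suc[OF lim_1_over_n])
      then show "(\<lambda>m. R * sqrt ((q (s i))\<^sup>2 + 1 / Suc m)) \<longlonglongrightarrow> R * q (s i)" by simp
      \<comment> \<open>From \<open>k + Suc i\<close> on, level \<open>m\<close> contains both the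
        time \<open>j / 2 ^ k\<close> and the vector \<open>s i\<close>.\<close>
      have "\<bar>L (real j / 2 ^ k) \<omega> (s i)\<bar> \<le> R * sqrt ((q (s i))\<^sup>2 + 1 / Suc m)" if m: "m \<ge> k + Suc i" for m
      proof -
        define j' where "j' = j * 2 ^ (m - k)"
        have e: "(2::nat) ^ m = 2 ^ k * 2 ^ (m - k)" using m by (simp add: power_add[symmetric])
        have "j' \<le> N * 2 ^ m" using j unfolding j'_def e by simp
        moreover have "real j' / 2 ^ m = real j / 2 ^ k"
        proof -
          have "(2::real) ^ m = 2 ^ k * 2 ^ (m - k)" using m by (simp add: power_add[symmetric])
          then show ?thesis by (simp add: j'_def)
        qed
        moreover have "\<omega> \<in> Bd m" using \<omega> by blast
        moreover have "i < m" using m by simp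
        ultimately show ?thesis unfolding Bd_def by (metis (mono_tags, lifting) mem_Collect_eq)
      qed
      then show "\<exists>M. \<forall>m\<ge>M. \<bar>L (real j / 2 ^ k) \<omega> (s i)\<bar> \<le> R * sqrt ((q (s i))\<^sup>2 + 1 / Suc m)" by blast
    qed
    moreover have "\<omega> \<in> space M" using \<omega> unfolding Bd_def by blast
    ultimately show "\<omega> \<in> G" by (simp add: G_def R_def)
  qed
  finally show "1 - 18 * \<epsilon> \<le> prob G" .
qed

end

section \<open>Oscillations and one-sided limits\<close>

text \<open>Counterpart of \<open>osc\<close> with times from an arbitrary set: the two agree on
  finite grids, and monotonicity in the set allows the passage to all dyadics.\<close>

fun oscs :: "(real \<Rightarrow> real) \<Rightarrow> real set \<Rightarrow> real \<Rightarrow> nat \<Rightarrow> real \<Rightarrow> bool" where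
  "oscs x D c 0 u = True"
| "oscs x D c (Suc p) u =
    (\<exists>s\<in>D. \<exists>t\<in>D. u \<le> s \<and> s < t \<and> c < \<bar>x t - x s\<bar> \<and> oscs x D c p t)"

lemma oscs_mono_start: "oscs x D c p u \<Longrightarrow> v \<le> u \<Longrightarrow> oscs x D c p v"
  by (cases p) (auto intro: order_trans)

lemma oscs_mono_set: "oscs x D c p u \<Longrightarrow> D \<subseteq> D' \<Longrightarrow> oscs x D' c p u"
proof (induction p arbitrary: u)
  case (Suc p)
  then obtain s t where st: "s \<in> D" "t \<in> D" "u \<le> s" "s < t" "c < \<bar>x t - x s\<bar>" "oscs x D c p t"
    by auto
  then have "s \<in> D'" "t \<in> D'" "oscs x D' c p t" using Suc.IH Suc.prems(2) by auto
  then show ?case using st unfolding oscs.simps by blast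
qed simp

text \<open>A pattern of oscillations uses finitely many times, which all lie in one member of an
  increasing union.\<close>

lemma oscs_UN:
  assumes "incseq (G :: nat \<Rightarrow> real set)"
  shows "oscs x (\<Union>k. G k) c p u \<longleftrightarrow> (\<exists>k. oscs x (G k) c p u)"
proof
  show "oscs x (\<Union>k. G k) c p u \<Longrightarrow> \<exists>k. oscs x (G k) c p u"
  proof (induction p arbitrary: u)
    case (Suc p)
    then obtain s t i j where st: "s \<in> G i" "t \<in> G j" "u \<le> s" "s < t" "c < \<bar>x t - x s\<bar>"
      and "oscs x (\<Union>k. G k) c p t" by auto
    from Suc.IH[OF this(6)] obtain k where k: "oscs x (G k) c p t" by blast
    define m where "m = max k (max i j)"
    have "G i \<subseteq> G m" "G j \<subseteq> G m" "G k \<subseteq> G m"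
      by (rule incseqD[OF assms], simp add: m_def)+
    then have "s \<in> G m" "t \<in> G m" "oscs x (G m) c p t"
      using st(1,2) oscs_mono_set[OF k] by auto
    then have "oscs x (G m) c (Suc p) u" using st unfolding oscs.simps by blast
    then show ?case by blast
  qed simp
next
  assume "\<exists>k. oscs x (G k) c p u"
  then show "oscs x (\<Union>k. G k) c p u" using oscs_mono_set by blast
qed

lemma oscs_grid:
  assumes "h > 0"
  shows "oscs x ((\<lambda>j. s + real j * h) ` {..n}) c p (s + real i * h) \<longleftrightarrow>
    osc (\<lambda>j. x (s + real (Suc j) * h) - x (s + real j * h)) c n p i"
proof (induction p arbitrary: i)
  case (Suc p)
  have sum: "k < l \<Longrightarrow> (\<Sum>m\<in>{k..<l}. x (s + real (Suc m) * h) - x (s + real m * h))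
      = x (s + real l * h) - x (s + real k * h)" for k l
    using sum_Suc_diff'[of k l "\<lambda>i. x (s + real i * h)"] by simp
  have "oscs x ((\<lambda>j. s + real j * h) ` {..n}) c (Suc p) (s + real i * h) \<longleftrightarrow>
      (\<exists>k\<le>n. \<exists>l\<le>n. i \<le> k \<and> k < l \<and> c < \<bar>x (s + real l * h) - x (s + real k * h)\<bar> \<and>
        oscs x ((\<lambda>j. s + real j * h) ` {..n}) c p (s + real l * h))"
    using assms by (auto simp: mult_le_cancel_right)
  also have "\<dots> \<longleftrightarrow> osc (\<lambda>j. x (s + real (Suc j) * h) - x (s + real j * h)) c n (Suc p) i"
    unfolding osc.simps Suc.IH using sum by (metis (no_types, lifting))
  finally show ?case .
qed simp

section \<open>Dyadic times and almost sure finiteness of oscillations\<close>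

definition dyadics :: "real set" where "dyadics = {real j / 2 ^ k | j k :: nat. True}"

lemma dyadics_nonneg: "t \<in> dyadics \<Longrightarrow> 0 \<le> t"
  by (auto simp: dyadics_def)

lemma countable_dyadics: "countable dyadics"
proof -
  have "dyadics = (\<lambda>(j, k). real j / 2 ^ k) ` (UNIV :: (nat \<times> nat) set)"
    by (auto simp: dyadics_def)
  then show ?thesis by (metis countable_image countableI_type)
qed

lemma dyadics_dense:
  assumes "0 \<le> a" "a < b" shows "\<exists>t\<in>dyadics. a < t \<and> t < b"
proof -
  obtain k :: nat where k: "2 / (b - a) < 2 ^ k"
    using real_arch_pow[of 2 "2 / (b - a)"] by auto
  define j where "j = nat \<lfloor>a * 2 ^ k\<rfloor> + 1"
  have j: "real j = real_of_int \<lfloor>a * 2 ^ k\<rfloor> + 1" using assms by (simp add: j_def)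
  have "a * 2 ^ k < real j" "real j \<le> a * 2 ^ k + 1" unfolding j by linarith+
  moreover have "a * 2 ^ k + 1 < b * 2 ^ k"
    using k assms by (simp add: field_simps)
  ultimately have "a < real j / 2 ^ k" "real j / 2 ^ k < b"
    by (auto simp: less_divide_eq divide_less_eq)
  then show ?thesis unfolding dyadics_def by blast
qed

text \<open>Grids start at the left end of a block, as in \<open>grid_osc\<close>; writing a dyadic
  time over the denominator \<open>2 ^ (m + k)\<close> places it on such a grid.\<close>

lemma dyadics_block:
  fixes i m :: nat
  defines "r \<equiv> 1 / 2 ^ m"
  shows "dyadics \<inter> {real i * r..(real i + 1) * r} \<subseteq> (\<Union>k. (\<lambda>j. real i * r + real j * (1 / 2 ^ (m + k))) ` {..2 ^ k})"
proof
  fix t assume t: "t \<in> dyadics \<inter> {real i * r..(real i + 1) * r}"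
  then obtain j k :: nat where jk: "t = real j / 2 ^ k" by (auto simp: dyadics_def)
  have t1: "real i * 2 ^ k \<le> real (j * 2 ^ m)" "real (j * 2 ^ m) \<le> (real i + 1) * 2 ^ k"
    using t by (simp_all add: jk r_def field_simps)
  have t2: "i * 2 ^ k \<le> j * 2 ^ m"
  proof -
    have "real (i * 2 ^ k) \<le> real (j * 2 ^ m)" using t1(1) by simp
    then show ?thesis by (simp only: of_nat_le_iff)
  qed
  define l where "l = j * 2 ^ m - i * 2 ^ k"
  have l: "real l = real (j * 2 ^ m) - real i * 2 ^ k" using t2 by (simp add: l_def of_nat_diff)
  have "real l \<le> real (2 ^ k)" using t1(2) unfolding l by (simp add: algebra_simps)
  then have "l \<le> 2 ^ k" by (simp only: of_nat_le_iff)
  moreover have "t = real i * r + real l * (1 / 2 ^ (m + k))"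
    unfolding l jk r_def by (simp add: power_add field_simps)
  ultimately show "t \<in> (\<Union>k. (\<lambda>j. real i * r + real j * (1 / 2 ^ (m + k))) ` {..2 ^ k})" by blast
qed

text \<open>On blocks so short that increments exceed \<open>c / 4\<close> with probability at most
  1/4, each oscillation above \<open>c\<close> costs a factor 1/2, uniformly over the refinements of
  the grid. Hence arbitrarily long patterns have probability zero.\<close>

lemma (in real_levy) finitely_many_oscillations:
  assumes "c > 0"
  shows "\<exists>r>0. AE \<omega> in M. \<forall>i::nat. \<exists>p.
    \<not> oscs (\<lambda>t. X t \<omega>) (dyadics \<inter> {real i * r..(real i + 1) * r}) c p (real i * r)"
proof -
  obtain r0 where r0: "r0 > 0" "\<And>h. h \<in> {0..r0} \<Longrightarrow> prob {\<omega> \<in> space M. c / 4 < \<bar>X h \<omega>\<bar>} \<le> 1 / 4"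
    using small_increments[of "1 / 4" "c / 4"] assms by auto
  \<comment> \<open>The block length is a power of 1/2 so that \<open>dyadics_block\<close>
    applies.\<close>
  obtain m :: nat where m: "(1 / 2) ^ m < r0" using real_arch_pow_inv[OF r0(1), of "1 / 2"] by auto
  define r :: real where "r = 1 / 2 ^ m"
  have r: "r > 0" "r \<le> r0" using m by (auto simp: r_def power_divide)
  have "AE \<omega> in M. \<exists>p. \<not> oscs (\<lambda>t. X t \<omega>) (dyadics \<inter> {real i * r..(real i + 1) * r}) c p (real i * r)" for i :: nat
  proof -
    let ?s = "real i * r"
    define h :: "nat \<Rightarrow> real" where "h k = 1 / 2 ^ (m + k)" for k
    define G where "G k = (\<lambda>j. ?s + real j * h k) ` {..2 ^ k}" for k
    have h: "h k > 0" for k by (simp add: h_def)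
    have Gk: "G k \<subseteq> G (Suc k)" for k
    proof
      fix t assume "t \<in> G k"
      then obtain j where j: "j \<le> 2 ^ k" "t = ?s + real j * h k" by (auto simp: G_def)
      have "t = ?s + real (2 * j) * h (Suc k)" by (simp add: j(2) h_def)
      moreover have "2 * j \<le> 2 ^ Suc k" using j(1) by simp
      ultimately show "t \<in> G (Suc k)" unfolding G_def by blast
    qed
    then have G: "incseq G" by (rule incseq_SucI)
    define E where "E k p = {\<omega> \<in> space M. oscs (\<lambda>t. X t \<omega>) (G k) c p ?s}" for k p
    have E: "E k p \<in> events \<and> prob (E k p) \<le> (1 / 2) ^ p" for k p
    proof -
      have alpha: "prob {\<omega> \<in> space M. c / 4 < \<bar>X (real j * h k) \<omega>\<bar>} \<le> 1 / 4" if "j \<le> 2 ^ k" for j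
      proof (rule r0(2))
        have "real j \<le> 2 ^ k" using of_nat_mono[OF that, where 'a = real] by simp
        then have "real j * h k \<le> r" by (simp add: h_def r_def power_add field_simps)
        then show "real j * h k \<in> {0..r0}" using r h[of k] by auto
      qed
      have eq: "E k p = {\<omega> \<in> space M. osc (\<lambda>j. X (?s + real (Suc j) * h k) \<omega> - X (?s + real j * h k) \<omega>) (4 * (c / 4)) (2 ^ k) p 0}"
        using oscs_grid[OF h, of "\<lambda>t. X t \<omega>" ?s k "2 ^ k" c p 0 for \<omega>] by (simp add: E_def G_def)
      have s0: "?s \<ge> 0" using r by simp
      show ?thesis
        using grid_osc[OF s0 h[of k], of "2 ^ k" "c / 4" "1 / 4" p] alpha unfolding eq by simp
    qed
    have "E k p \<subseteq> E (Suc k) p" for k p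
      unfolding E_def using oscs_mono_set[OF _ Gk] by blast
    then have inc: "incseq (\<lambda>k. E k p)" for p by (rule incseq_SucI)
    have "prob (\<Union>k. E k p) \<le> (1 / 2) ^ p" for p
      by (rule LIMSEQ_le_const2[OF finite_Lim_measure_incseq[OF _ inc]]) (use E in auto)
    moreover have "prob (\<Inter>p. \<Union>k. E k p) \<le> prob (\<Union>k. E k p)" for p
      by (rule finite_measure_mono) (use E in auto)
    ultimately have small: "prob (\<Inter>p. \<Union>k. E k p) \<le> (1 / 2) ^ p" for p
      using order_trans by blast
    have "prob (\<Inter>p. \<Union>k. E k p) \<le> 0"
      by (rule LIMSEQ_le_const[OF LIMSEQ_power_zero[of "1 / 2"]]) (use small in auto)
    then have "prob (\<Inter>p. \<Union>k. E k p) = 0" by (simp add: measure_le_0_iff)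
    then have "(\<Inter>p. \<Union>k. E k p) \<in> null_sets M"
      using E by (intro null_setsI) (auto simp: emeasure_eq_measure)
    then have "AE \<omega> in M. \<omega> \<notin> (\<Inter>p. \<Union>k. E k p)" by (rule AE_not_in)
    then show ?thesis
    proof (rule AE_mp, intro AE_I2 impI)
      fix \<omega> assume \<omega>: "\<omega> \<in> space M" "\<omega> \<notin> (\<Inter>p. \<Union>k. E k p)"
      then obtain p where p: "\<forall>k. \<omega> \<notin> E k p" by blast
      have "\<not> oscs (\<lambda>t. X t \<omega>) (\<Union>k. G k) c p ?s"
        unfolding oscs_UN[OF G] using p \<omega>(1) by (simp add: E_def)
      then have "\<not> oscs (\<lambda>t. X t \<omega>) (dyadics \<inter> {?s..(real i + 1) * r}) c p ?s"
        using oscs_mono_set[OF _ dyadics_block[of i m]] unfolding G_def h_def r_def by blast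
      then show "\<exists>p. \<not> oscs (\<lambda>t. X t \<omega>) (dyadics \<inter> {?s..(real i + 1) * r}) c p ?s" by blast
    qed
  qed
  then show ?thesis using r(1) by (intro exI[of _ r]) (simp add: AE_all_countable)
qed

lemma Cauchy_filterlim_ex:
  fixes x :: "'b \<Rightarrow> real"
  assumes "\<And>e. e > 0 \<Longrightarrow> \<exists>P. eventually P F \<and> (\<forall>s t. P s \<longrightarrow> P t \<longrightarrow> \<bar>x s - x t\<bar> \<le> e)"
  shows "\<exists>l. (x \<longlongrightarrow> l) F"
proof (cases "F = bot")
  case False
  have "cauchy_filter (filtermap x F)"
    unfolding cauchy_filter_metric
  proof (intro allI impI)
    fix e :: real assume "e > 0"
    then obtain P where P: "eventually P F" "\<forall>s t. P s \<longrightarrow> P t \<longrightarrow> \<bar>x s - x t\<bar> \<le> e / 2"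
      using assms[of "e / 2"] by auto
    show "\<exists>Q. eventually Q (filtermap x F) \<and> (\<forall>u v. Q u \<and> Q v \<longrightarrow> dist u v < e)"
    proof (intro exI[of _ "\<lambda>u. \<exists>s. P s \<and> u = x s"] conjI allI impI)
      show "\<forall>\<^sub>F u in filtermap x F. \<exists>s. P s \<and> u = x s"
        unfolding eventually_filtermap using P(1) by eventually_elim auto
      fix u v assume "(\<exists>s. P s \<and> u = x s) \<and> (\<exists>s. P s \<and> v = x s)"
      then obtain s t where "P s" "P t" "u = x s" "v = x t" by blast
      then have "\<bar>u - v\<bar> \<le> e / 2" using P(2) by blast
      then show "dist u v < e" using \<open>e > 0\<close> by (simp add: dist_real_def)
    qed
  qed
  then obtain l where "filtermap x F \<le> nhds l"
    using complete_UNIV[where 'a = real] False unfolding complete_uniform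
    by (metis filtermap_bot_iff principal_UNIV top_greatest)
  then show ?thesis by (auto simp: filterlim_def)
qed simp

text \<open>If the path were not Cauchy at \<open>t\<close>, pairs with oscillation above
  \<open>c\<close> would exist arbitrarily close to \<open>t\<close>, and chaining them would give
  any number of oscillations in one block. To the right of \<open>t\<close> the chain grows
  backwards, each new pair being closer to \<open>t\<close>; to the left it grows forwards.\<close>

lemma finite_oscillations_limits:
  assumes osc: "\<And>c. c > 0 \<Longrightarrow> \<exists>r>0. \<forall>i::nat. \<exists>p.
    \<not> oscs x (D \<inter> {real i * r..(real i + 1) * r}) c p (real i * r)"
  shows "t \<ge> 0 \<Longrightarrow> \<exists>l. (x \<longlongrightarrow> l) (at t within (D \<inter> {t<..}))"
    and "t > 0 \<Longrightarrow> \<exists>l. (x \<longlongrightarrow> l) (at t within (D \<inter> {..<t}))"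
proof -
  assume t: "t \<ge> 0"
  show "\<exists>l. (x \<longlongrightarrow> l) (at t within (D \<inter> {t<..}))"
  proof (rule Cauchy_filterlim_ex)
    fix c :: real assume "c > 0"
    from osc[OF this] obtain r where r: "r > 0" and p: "\<And>i::nat. \<exists>p.
      \<not> oscs x (D \<inter> {real i * r..(real i + 1) * r}) c p (real i * r)" by blast
    \<comment> \<open>The block must leave room on the side of the limit: rounding down puts
      \<open>t\<close> strictly before the right end.\<close>
    define i where "i = nat \<lfloor>t / r\<rfloor>"
    have "real i = real_of_int \<lfloor>t / r\<rfloor>" using t r by (simp add: i_def)
    then have "real i \<le> t / r" "t / r < real i + 1" by linarith+
    then have i: "real i * r \<le> t" "t < (real i + 1) * r" using r by (auto simp: field_simps)
    let ?D = "D \<inter> {real i * r..(real i + 1) * r}"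
    obtain p where np: "\<not> oscs x ?D c p (real i * r)" using p by blast
    have "\<exists>\<delta>>0. \<forall>s\<in>D. \<forall>s'\<in>D. t < s \<longrightarrow> s < s' \<longrightarrow> s' < t + \<delta> \<longrightarrow> \<bar>x s' - x s\<bar> \<le> c"
    proof (rule ccontr)
      assume neg: "\<not> ?thesis"
      have "\<exists>v>t. oscs x ?D c p v" for p
      proof (induction p)
        case 0
        show ?case by (intro exI[of _ "t + 1"]) simp
      next
        case (Suc p)
        then obtain v where v: "v > t" "oscs x ?D c p v" by blast
        define \<delta> where "\<delta> = min (v - t) ((real i + 1) * r - t)"
        have "\<delta> > 0" using v i by (simp add: \<delta>_def)
        then obtain s s' where s: "s \<in> D" "s' \<in> D" "t < s" "s < s'" "s' < t + \<delta>" "c < \<bar>x s' - x s\<bar>"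
          using neg by (meson not_le)
        have "oscs x ?D c p s'" using oscs_mono_start[OF v(2), of s'] s by (simp add: \<delta>_def)
        moreover have "s \<in> ?D" "s' \<in> ?D" using s i by (auto simp: \<delta>_def)
        ultimately have "oscs x ?D c (Suc p) s" unfolding oscs.simps using s by blast
        then show ?case using s(3) by blast
      qed
      then obtain v where "v > t" "oscs x ?D c p v" by blast
      then show False using np oscs_mono_start[of x ?D c p v "real i * r"] i by simp
    qed
    then obtain \<delta> where \<delta>: "\<delta> > 0" "\<And>s s'. s \<in> D \<Longrightarrow> s' \<in> D \<Longrightarrow> t < s \<Longrightarrow> s < s' \<Longrightarrow> s' < t + \<delta> \<Longrightarrow> \<bar>x s' - x s\<bar> \<le> c"
      by blast
    have "\<forall>\<^sub>F s in at t within (D \<inter> {t<..}). s \<in> D \<and> t < s \<and> s < t + \<delta>"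
      unfolding eventually_at using \<delta>(1) by (intro exI[of _ \<delta>]) (auto simp: dist_real_def)
    moreover have "\<bar>x s - x s'\<bar> \<le> c" if "s \<in> D \<and> t < s \<and> s < t + \<delta>" "s' \<in> D \<and> t < s' \<and> s' < t + \<delta>" for s s'
      using \<delta>(2)[of s s'] \<delta>(2)[of s' s] that \<open>c > 0\<close> by (cases s s' rule: linorder_cases) (auto simp: abs_minus_commute)
    ultimately show "\<exists>P. eventually P (at t within (D \<inter> {t<..})) \<and> (\<forall>s s'. P s \<longrightarrow> P s' \<longrightarrow> \<bar>x s - x s'\<bar> \<le> c)"
      by (intro exI[of _ "\<lambda>s. s \<in> D \<and> t < s \<and> s < t + \<delta>"]) blast
  qed
next
  assume t: "t > 0"
  show "\<exists>l. (x \<longlongrightarrow> l) (at t within (D \<inter> {..<t}))"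
  proof (rule Cauchy_filterlim_ex)
    fix c :: real assume "c > 0"
    from osc[OF this] obtain r where r: "r > 0" and p: "\<And>i::nat. \<exists>p.
      \<not> oscs x (D \<inter> {real i * r..(real i + 1) * r}) c p (real i * r)" by blast
    \<comment> \<open>Rounding up and subtracting 1 puts \<open>t\<close> strictly after the left
      end, also when \<open>t\<close> is a multiple of \<open>r\<close>.\<close>
    define i where "i = nat (\<lceil>t / r\<rceil> - 1)"
    have "\<lceil>t / r\<rceil> \<ge> 1" using t r by simp
    then have "real i = real_of_int \<lceil>t / r\<rceil> - 1" by (simp add: i_def)
    then have "real i < t / r" "t / r \<le> real i + 1" by linarith+
    then have i: "real i * r < t" "t \<le> (real i + 1) * r" using r by (auto simp: field_simps)
    let ?D = "D \<inter> {real i * r..(real i + 1) * r}"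
    obtain p where np: "\<not> oscs x ?D c p (real i * r)" using p by blast
    have "\<exists>\<delta>>0. \<forall>s\<in>D. \<forall>s'\<in>D. t - \<delta> < s \<longrightarrow> s < s' \<longrightarrow> s' < t \<longrightarrow> \<bar>x s' - x s\<bar> \<le> c"
    proof (rule ccontr)
      assume neg: "\<not> ?thesis"
      have "oscs x ?D c p v" if "v < t" for p v
        using that
      proof (induction p arbitrary: v)
        case (Suc p)
        define \<delta> where "\<delta> = min (t - v) (t - real i * r)"
        have "\<delta> > 0" using Suc.prems i by (simp add: \<delta>_def)
        then obtain s s' where s: "s \<in> D" "s' \<in> D" "t - \<delta> < s" "s < s'" "s' < t" "c < \<bar>x s' - x s\<bar>"
          using neg by (meson not_le)
        have "oscs x ?D c p s'" using s by (intro Suc.IH)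
        moreover have "s \<in> ?D" "s' \<in> ?D" "v \<le> s" using s i by (auto simp: \<delta>_def)
        ultimately show ?case unfolding oscs.simps using s by blast
      qed simp
      then show False using np i by blast
    qed
    then obtain \<delta> where \<delta>: "\<delta> > 0" "\<And>s s'. s \<in> D \<Longrightarrow> s' \<in> D \<Longrightarrow> t - \<delta> < s \<Longrightarrow> s < s' \<Longrightarrow> s' < t \<Longrightarrow> \<bar>x s' - x s\<bar> \<le> c"
      by blast
    have "\<forall>\<^sub>F s in at t within (D \<inter> {..<t}). s \<in> D \<and> t - \<delta> < s \<and> s < t"
      unfolding eventually_at using \<delta>(1) by (intro exI[of _ \<delta>]) (auto simp: dist_real_def)
    moreover have "\<bar>x s - x s'\<bar> \<le> c" if "s \<in> D \<and> t - \<delta> < s \<and> s < t" "s' \<in> D \<and> t - \<delta> < s' \<and> s' < t" for s s'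
      using \<delta>(2)[of s s'] \<delta>(2)[of s' s] that \<open>c > 0\<close> by (cases s s' rule: linorder_cases) (auto simp: abs_minus_commute)
    ultimately show "\<exists>P. eventually P (at t within (D \<inter> {..<t})) \<and> (\<forall>s s'. P s \<longrightarrow> P s' \<longrightarrow> \<bar>x s - x s'\<bar> \<le> c)"
      by (intro exI[of _ "\<lambda>s. s \<in> D \<and> t - \<delta> < s \<and> s < t"]) blast
  qed
qed

section \<open>Functionals dominated by a chain of Hilbert--Schmidt semi-norms\<close>

lemma dual_seminormI:
  assumes P: "\<forall>p\<in>P. hilbertian_seminorm p" and y: "linear y"
    and nb: "\<And>e. e > 0 \<Longrightarrow> zero_nbhd (seminorm_topology P) {x. \<bar>y x\<bar> < e}"
  shows "y \<in> dual (seminorm_topology P)"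
proof -
  have "continuous_map (seminorm_topology P) euclideanreal y"
    unfolding continuous_map_def
  proof (intro conjI allI impI)
    fix U assume U: "openin euclideanreal U"
    show "openin (seminorm_topology P) {x \<in> topspace (seminorm_topology P). y x \<in> U}"
      unfolding seminorm_topology_def openin_nbhd_topology
    proof (intro conjI ballI)
      let ?B = "{{x. p x < e} |p e. p \<in> P \<and> 0 < e}"
      fix x assume "x \<in> {x \<in> topspace (nbhd_topology UNIV ?B). y x \<in> U}"
      then obtain d where d: "d > 0" "\<forall>z. dist z (y x) < d \<longrightarrow> z \<in> U"
        using U by (auto simp: open_dist)
      obtain F e where F: "finite F" "F \<subseteq> P" "0 < e" "{x. \<forall>p\<in>F. p x < e} \<subseteq> {x. \<bar>y x\<bar> < d}"
        using nb[OF d(1)] unfolding zero_nbhd_seminorm_topology[OF P] by blast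
      let ?F = "(\<lambda>r. {z. r z < e}) ` F"
      have "z \<in> {x \<in> topspace (nbhd_topology UNIV ?B). y x \<in> U}" if z: "\<forall>N\<in>?F. z - x \<in> N" for z
      proof -
        have "\<bar>y (z - x)\<bar> < d" using z F(4) by auto
        then show ?thesis using d(2) by (simp add: linear_diff[OF y] dist_real_def)
      qed
      moreover have "?F \<subseteq> ?B" using F(2,3) by blast
      ultimately show "\<exists>\<F>. finite \<F> \<and> \<F> \<subseteq> ?B \<and>
          (\<forall>z\<in>UNIV. (\<forall>N\<in>\<F>. z - x \<in> N) \<longrightarrow> z \<in> {x \<in> topspace (nbhd_topology UNIV ?B). y x \<in> U})"
        using F(1) by (intro exI[of _ ?F] conjI) auto
    qed simp
  qed simp
  then show ?thesis using y by (simp add: dual_def linear_add linear_scale)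
qed

locale HS_chain = nuclear T P
  for T :: "'a::real_vector topology" and P +
  fixes q :: "nat \<Rightarrow> 'a \<Rightarrow> real" and s :: "nat \<Rightarrow> 'a"
  assumes q_cont: "\<And>n. continuous_hilbertian T (q n)"
    and q_Suc: "\<And>n. q n \<le> q (Suc n)"
    and q_HS: "\<And>n. \<exists>C. HS_bound (q n) (q (Suc n)) C"
    and s_dense: "\<And>n. dense_for (q n) (range s)"
begin

lemma q_hilbertian: "hilbertian_seminorm (q n)"
  using q_cont by (simp add: continuous_hilbertian_def)

sublocale q: hilbertian "q n" for n by unfold_locales (rule q_hilbertian)

lemma q_mono: "m \<le> n \<Longrightarrow> q m x \<le> q n x"
  using incseqD[OF incseq_SucI[of q]] q_Suc by (simp add: le_fun_def)

definition \<theta> where "\<theta> = seminorm_topology (range q)"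

lemma countably_hilbertian_\<theta>: "countably_hilbertian T \<theta>"
  unfolding countably_hilbertian_def \<theta>_def
  using q_cont incseq_SucI[of q] q_Suc by (intro exI[of _ q]) (auto simp: continuous_hilbertian_def)

text \<open>One index bounds both the factor and the semi-norm, so that the sets increase and their
  union holds every linear functional dominated by a multiple of some \<open>q i\<close>.\<close>

definition H :: "nat \<Rightarrow> ('a \<Rightarrow> real) set"
  where "H n = {y. linear y \<and> (\<forall>x. \<bar>y x\<bar> \<le> real n * q n x)}"

lemma H_linear: "y \<in> H n \<Longrightarrow> linear y" by (simp add: H_def)
lemma H_bound: "y \<in> H n \<Longrightarrow> \<bar>y x\<bar> \<le> real n * q n x" by (simp add: H_def)

lemma H_I:
  assumes "linear y" and b: "\<And>x. \<bar>y x\<bar> \<le> c * q i x" and n: "c \<le> real n" "i \<le> n"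
  shows "y \<in> H n"
proof -
  have "\<bar>y x\<bar> \<le> real n * q n x" for x
  proof -
    have "c * q i x \<le> real n * q i x" using n by (intro mult_right_mono) auto
    also have "\<dots> \<le> real n * q n x" using q_mono[OF n(2)] by (intro mult_left_mono) auto
    finally show ?thesis using b[of x] by linarith
  qed
  then show ?thesis using assms(1) by (simp add: H_def)
qed

lemma zero_nbhd_q: "e > 0 \<Longrightarrow> zero_nbhd T {x. q n x < e}"
proof -
  assume "e > 0"
  moreover have "openin T {x \<in> topspace T. q n x \<in> {..<e}}"
    using q_cont[of n] by (intro openin_continuous_map_preimage[of _ euclideanreal]) (auto simp: continuous_hilbertian_def)
  ultimately show ?thesis unfolding zero_nbhd_def by (intro exI[of _ "{x. q n x < e}"]) simp
qed

lemma zero_nbhd_\<theta>_q: "e > 0 \<Longrightarrow> zero_nbhd \<theta> {x. q n x < e}"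
  unfolding \<theta>_def using q_hilbertian
  by (subst zero_nbhd_seminorm_topology) (auto intro!: exI[of _ "{q n}"] exI[of _ e])

lemma zero_nbhd_mono: "zero_nbhd S U \<Longrightarrow> U \<subseteq> V \<Longrightarrow> zero_nbhd S V"
  unfolding zero_nbhd_def by blast

lemma H_nbhd:
  assumes "y \<in> H n" "e > 0" shows "{x. q n x < e / (real n + 1)} \<subseteq> {x. \<bar>y x\<bar> < e}"
proof safe
  fix x assume x: "q n x < e / (real n + 1)"
  have "\<bar>y x\<bar> \<le> real n * q n x" by (rule H_bound[OF assms(1)])
  also have "\<dots> \<le> (real n + 1) * q n x" by (intro mult_right_mono) auto
  also have "\<dots> < e" using x by (simp add: less_divide_eq mult.commute add_nonneg_pos)
  finally show "\<bar>y x\<bar> < e" .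
qed

lemma zero_nbhd_H: "y \<in> H n \<Longrightarrow> e > 0 \<Longrightarrow> zero_nbhd T {x. \<bar>y x\<bar> < e}"
  by (rule zero_nbhd_mono[OF zero_nbhd_q H_nbhd]) (auto intro: divide_pos_pos add_nonneg_pos)

lemma zero_nbhd_\<theta>_H: "y \<in> H n \<Longrightarrow> e > 0 \<Longrightarrow> zero_nbhd \<theta> {x. \<bar>y x\<bar> < e}"
  by (rule zero_nbhd_mono[OF zero_nbhd_\<theta>_q H_nbhd]) (auto intro: divide_pos_pos add_nonneg_pos)

lemma H_dual: "y \<in> H n \<Longrightarrow> y \<in> dual T"
  unfolding T_eq by (rule dual_seminormI[OF hilb H_linear]) (auto simp: T_eq[symmetric] zero_nbhd_H)

lemma H_dual_\<theta>: "y \<in> H n \<Longrightarrow> y \<in> dual \<theta>"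
  unfolding \<theta>_def
  by (rule dual_seminormI[OF _ H_linear]) (auto simp: \<theta>_def[symmetric] zero_nbhd_\<theta>_H q_hilbertian)

lemma cauchy_\<theta>: "cauchy_seqs \<theta> = (\<Inter>n. q.cauchy_set n)"
  unfolding \<theta>_def using q_hilbertian
  by (auto simp: cauchy_seqs_seminorm_topology q.cauchy_set_def)

text \<open>Extension by continuity to the completion; it is 0 off the Cauchy sequences, as
  \<open>dual\<close> demands.\<close>

definition ext :: "('a \<Rightarrow> real) \<Rightarrow> (nat \<Rightarrow> 'a) \<Rightarrow> real"
  where "ext y x = (if x \<in> cauchy_seqs \<theta> then lim (\<lambda>k. y (x k)) else 0)"

lemma ext_tendsto:
  assumes y: "y \<in> H n" and x: "x \<in> cauchy_seqs \<theta>"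
  shows "(\<lambda>k. y (x k)) \<longlonglongrightarrow> ext y x"
proof -
  have "Cauchy (\<lambda>k. y (x k))"
  proof (rule metric_CauchyI)
    fix e :: real assume "e > 0"
    then have "e / (real n + 1) > 0" by (intro divide_pos_pos) auto
    then obtain N where "\<forall>k\<ge>N. \<forall>l\<ge>N. q n (x k - x l) < e / (real n + 1)"
      using q.cauchy_set_D[of x n "e / (real n + 1)"] x by (auto simp: cauchy_\<theta>)
    then have "\<forall>k\<ge>N. \<forall>l\<ge>N. \<bar>y (x k - x l)\<bar> < e" using H_nbhd[OF y \<open>e > 0\<close>] by blast
    then show "\<exists>M. \<forall>k\<ge>M. \<forall>l\<ge>M. dist (y (x k)) (y (x l)) < e"
      by (auto simp: dist_real_def linear_diff[OF H_linear[OF y]])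
  qed
  then have "convergent (\<lambda>k. y (x k))" by (simp add: Cauchy_convergent_iff)
  then show ?thesis using x by (simp add: ext_def convergent_LIMSEQ_iff)
qed

lemma cauchy_\<theta>_add: "x \<in> cauchy_seqs \<theta> \<Longrightarrow> z \<in> cauchy_seqs \<theta> \<Longrightarrow> x + z \<in> cauchy_seqs \<theta>"
  using q.cauchy_set_add by (auto simp: cauchy_\<theta> plus_fun_def)

lemma cauchy_\<theta>_scale: "x \<in> cauchy_seqs \<theta> \<Longrightarrow> c *\<^sub>R x \<in> cauchy_seqs \<theta>"
  using q.cauchy_set_scale by (auto simp: cauchy_\<theta> scaleR_fun_def)

lemma ext_dual:
  assumes y: "y \<in> H n" shows "ext y \<in> dual (seq_completion \<theta>)"
proof -
  have top: "topspace (seq_completion \<theta>) = cauchy_seqs \<theta>" by (simp add: seq_completion_def)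
  have lin: "linear y" by (rule H_linear[OF y])
  have add: "ext y (x + z) = ext y x + ext y z" if "x \<in> cauchy_seqs \<theta>" "z \<in> cauchy_seqs \<theta>" for x z
  proof -
    have "(\<lambda>k. y (x k) + y (z k)) \<longlonglongrightarrow> ext y x + ext y z"
      by (intro tendsto_add ext_tendsto[OF y] that)
    moreover have "(\<lambda>k. y (x k) + y (z k)) \<longlonglongrightarrow> ext y (x + z)"
      using ext_tendsto[OF y cauchy_\<theta>_add[OF that]] by (simp add: linear_add[OF lin])
    ultimately show ?thesis using LIMSEQ_unique by blast
  qed
  have scale: "ext y (c *\<^sub>R x) = c * ext y x" if "x \<in> cauchy_seqs \<theta>" for c x
  proof -
    have "(\<lambda>k. c * y (x k)) \<longlonglongrightarrow> c * ext y x"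
      by (intro tendsto_mult_left ext_tendsto[OF y] that)
    moreover have "(\<lambda>k. c * y (x k)) \<longlonglongrightarrow> ext y (c *\<^sub>R x)"
      using ext_tendsto[OF y cauchy_\<theta>_scale[OF that]] by (simp add: scaleR_fun_def linear_scale[OF lin])
    ultimately show ?thesis using LIMSEQ_unique by blast
  qed
  have "continuous_map (seq_completion \<theta>) euclideanreal (ext y)"
    unfolding continuous_map_def
  proof (intro conjI allI impI)
    fix U assume U: "openin euclideanreal U"
    let ?B = "{{x. \<forall>\<^sub>F k in sequentially. x k \<in> U} |U. zero_nbhd \<theta> U}"
    show "openin (seq_completion \<theta>) {x \<in> topspace (seq_completion \<theta>). ext y x \<in> U}"
      unfolding top unfolding seq_completion_def openin_nbhd_topology
    proof (intro conjI ballI)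
      fix x assume x: "x \<in> {x \<in> cauchy_seqs \<theta>. ext y x \<in> U}"
      then obtain d where d: "d > 0" "\<forall>z. dist z (ext y x) < d \<longrightarrow> z \<in> U"
        using U by (auto simp: open_dist)
      let ?W = "{x. \<bar>y x\<bar> < d / 2}"
      have W: "zero_nbhd \<theta> ?W" by (rule zero_nbhd_\<theta>_H[OF y]) (use d in simp)
      have "ext y z \<in> U" if z: "z \<in> cauchy_seqs \<theta>" and zx: "\<forall>\<^sub>F k in sequentially. (z - x) k \<in> ?W" for z
      proof -
        have "(\<lambda>k. \<bar>y (z k) - y (x k)\<bar>) \<longlonglongrightarrow> \<bar>ext y z - ext y x\<bar>"
          using x z by (intro tendsto_rabs tendsto_diff ext_tendsto[OF y]) auto
        moreover have "\<forall>\<^sub>F k in sequentially. \<bar>y (z k) - y (x k)\<bar> \<le> d / 2"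
          using zx by eventually_elim (simp add: linear_diff[OF lin])
        ultimately have "\<bar>ext y z - ext y x\<bar> \<le> d / 2" by (intro tendsto_upperbound) auto
        then show ?thesis using d by (simp add: dist_real_def)
      qed
      then show "\<exists>\<F>. finite \<F> \<and> \<F> \<subseteq> ?B \<and> (\<forall>z\<in>cauchy_seqs \<theta>. (\<forall>N\<in>\<F>. z - x \<in> N) \<longrightarrow>
          z \<in> {x \<in> cauchy_seqs \<theta>. ext y x \<in> U})"
      proof (intro exI[of _ "{{x. \<forall>\<^sub>F k in sequentially. x k \<in> ?W}}"] conjI)
        show "{{x. \<forall>\<^sub>F k in sequentially. x k \<in> ?W}} \<subseteq> ?B" using W by blast
        show "\<forall>z\<in>cauchy_seqs \<theta>. (\<forall>N\<in>{{x. \<forall>\<^sub>F k in sequentially. x k \<in> ?W}}. z - x \<in> N) \<longrightarrow>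
          z \<in> {x \<in> cauchy_seqs \<theta>. ext y x \<in> U}"
          using \<open>\<And>z. z \<in> cauchy_seqs \<theta> \<Longrightarrow> \<forall>\<^sub>F k in sequentially. (z - x) k \<in> ?W \<Longrightarrow> ext y z \<in> U\<close>
          by simp
      qed simp
    qed auto
  qed simp
  then show ?thesis
    unfolding dual_def top using add scale by (simp add: ext_def)
qed

lemma restrict_ext:
  assumes y: "y \<in> H n" shows "restrict_const (ext y) = y"
proof
  fix x
  have "(\<lambda>_. x) \<in> cauchy_seqs \<theta>" by (simp add: cauchy_\<theta>)
  from ext_tendsto[OF y this] show "restrict_const (ext y) x = y x"
    by (simp add: restrict_const_def LIMSEQ_const_iff)
qed

text \<open>The topology of \<open>completion_dual\<close> is transported along the inverse of
  \<open>restrict_const\<close>; on \<open>H n\<close> this inverse is the explicit map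
  \<open>ext\<close>.\<close>

lemma H_completion_dual:
  assumes y: "y \<in> H n"
  shows "y \<in> restrict_const ` dual (seq_completion \<theta>)"
    "inv_into (dual (seq_completion \<theta>)) restrict_const y = ext y"
proof -
  show "y \<in> restrict_const ` dual (seq_completion \<theta>)"
    using restrict_ext[OF y] ext_dual[OF y] by (metis imageI)
  show "inv_into (dual (seq_completion \<theta>)) restrict_const y = ext y"
    using inv_into_f_f[OF inj_on_restrict_const ext_dual[OF y]] restrict_ext[OF y] by simp
qed

text \<open>On \<open>\<Union>n. H n\<close> the topology is, for every \<open>m\<close>, coarser than that of uniform convergence on multiples
  of the \<open>q m\<close>-ball.\<close>

definition ball_coarse :: "('a \<Rightarrow> real) topology \<Rightarrow> bool"
  where "ball_coarse S \<longleftrightarrow> (\<forall>n. H n \<subseteq> topspace S) \<and>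
    (\<forall>U y m n. openin S U \<longrightarrow> y \<in> U \<longrightarrow> y \<in> H n \<longrightarrow>
      (\<exists>r>0. \<exists>e>0. \<forall>k. \<forall>z\<in>H k. (\<forall>x. q m x \<le> r \<longrightarrow> \<bar>z x - y x\<bar> \<le> e) \<longrightarrow> z \<in> U))"

text \<open>A bounded set is absorbed by the ball of every \<open>q m\<close>, so closeness on a
  large ball gives closeness on the set.\<close>

lemma ball_coarse_strong_dual: "ball_coarse (strong_dual T)"
  unfolding ball_coarse_def
proof (intro conjI allI impI)
  fix n show "H n \<subseteq> topspace (strong_dual T)" using H_dual by auto
next
  fix U y m n assume U: "openin (strong_dual T) U" and y: "y \<in> U" "y \<in> H n"
  let ?B = "{{f. \<forall>x\<in>B. \<bar>f x\<bar> < e} |B e. vn_bounded T B \<and> 0 < e}"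
  have "\<forall>x\<in>U. \<exists>\<F>. finite \<F> \<and> \<F> \<subseteq> ?B \<and> (\<forall>y\<in>dual T. (\<forall>N\<in>\<F>. y - x \<in> N) \<longrightarrow> y \<in> U)"
    using U unfolding strong_dual_def openin_nbhd_topology by (rule conjunct2)
  from bspec[OF this y(1)] obtain \<F> where \<F>: "finite \<F>" "\<F> \<subseteq> ?B"
    "\<forall>z\<in>dual T. (\<forall>N\<in>\<F>. z - y \<in> N) \<longrightarrow> z \<in> U" by (elim exE conjE)
  have "\<exists>r>0. \<exists>e>0. \<forall>k. \<forall>z\<in>H k. (\<forall>x. q m x \<le> r \<longrightarrow> \<bar>z x - y x\<bar> \<le> e) \<longrightarrow> (\<forall>N\<in>\<F>. z - y \<in> N)"
    using \<F>(1,2)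
  proof induction
    case empty
    show ?case by (intro exI[of _ "1 :: real"] conjI) auto
  next
    case (insert N \<F>)
    have "\<F> \<subseteq> ?B" using insert.prems by blast
    from insert.IH[OF this] obtain r e where re: "r > 0" "e > 0"
      "\<forall>k. \<forall>z\<in>H k. (\<forall>x. q m x \<le> r \<longrightarrow> \<bar>z x - y x\<bar> \<le> e) \<longrightarrow> (\<forall>N\<in>\<F>. z - y \<in> N)"
      by blast
    obtain B d where N: "N = {f. \<forall>x\<in>B. \<bar>f x\<bar> < d}" and B: "vn_bounded T B" and d: "d > 0"
      using insert.prems by blast
    obtain r' where r': "r' > 0" "B \<subseteq> (\<lambda>x. r' *\<^sub>R x) ` {x. q m x < 1}"
      using B zero_nbhd_q[of 1 m] unfolding vn_bounded_def by auto
    have qB: "q m x \<le> r'" if "x \<in> B" for x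
    proof -
      obtain v where v: "x = r' *\<^sub>R v" "q m v < 1" using r'(2) \<open>x \<in> B\<close> by blast
      then show ?thesis using r'(1) by (simp add: q.scale mult_left_le)
    qed
    \<comment> \<open>The larger radius and the smaller tolerance serve the old sets and the new
      one; \<open>d / 2\<close> turns a weak inequality into a strict one.\<close>
    have "\<forall>k. \<forall>z\<in>H k. (\<forall>x. q m x \<le> max r r' \<longrightarrow> \<bar>z x - y x\<bar> \<le> min e (d / 2)) \<longrightarrow>
        (\<forall>N'\<in>insert N \<F>. z - y \<in> N')"
    proof (intro allI ballI impI)
      fix k z assume z: "z \<in> H k" and *: "\<forall>x. q m x \<le> max r r' \<longrightarrow> \<bar>z x - y x\<bar> \<le> min e (d / 2)"
      fix N' assume "N' \<in> insert N \<F>"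
      then show "z - y \<in> N'"
      proof
        assume "N' = N"
        have "\<bar>z x - y x\<bar> < d" if "x \<in> B" for x
        proof -
          have "\<bar>z x - y x\<bar> \<le> min e (d / 2)" using * qB[OF that] by (simp add: max.coboundedI2)
          then show ?thesis using d by simp
        qed
        then show ?thesis unfolding \<open>N' = N\<close> N by simp
      next
        assume "N' \<in> \<F>"
        then show ?thesis using re(3) z * by simp
      qed
    qed
    moreover have "max r r' > 0" "min e (d / 2) > 0" using re d by auto
    ultimately show ?case by blast
  qed
  then show "\<exists>r>0. \<exists>e>0. \<forall>k. \<forall>z\<in>H k. (\<forall>x. q m x \<le> r \<longrightarrow> \<bar>z x - y x\<bar> \<le> e) \<longrightarrow> z \<in> U"
    using \<F>(3) H_dual by meson
qed

text \<open>As for the strong dual, one level up: a bounded set now consists of Cauchy sequences,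
  whose terms eventually lie in a multiple of the \<open>q m\<close>-ball, and the estimate passes
  to the limits that define \<open>ext\<close>.\<close>

lemma ball_coarse_completion_dual: "ball_coarse (completion_dual \<theta>)"
  unfolding ball_coarse_def
proof (intro conjI allI impI)
  fix n
  have "H n \<subseteq> restrict_const ` dual (seq_completion \<theta>)" using H_completion_dual(1) by blast
  moreover have "inv_into (dual (seq_completion \<theta>)) restrict_const z \<in> dual (seq_completion \<theta>)" if "z \<in> H n" for z
    unfolding H_completion_dual(2)[OF that] by (rule ext_dual[OF that])
  ultimately show "H n \<subseteq> topspace (completion_dual \<theta>)"
    unfolding completion_dual_def topspace_pullback_topology by auto
next
  fix U y m n assume U: "openin (completion_dual \<theta>) U" and y: "y \<in> U" "y \<in> H n"
  let ?C = "seq_completion \<theta>"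
  obtain V where V: "openin (strong_dual ?C) V"
    and UV: "U = inv_into (dual ?C) restrict_const -` V \<inter> restrict_const ` dual ?C"
    using U unfolding completion_dual_def openin_pullback_topology by blast
  have yV: "ext y \<in> V" using y(1) H_completion_dual(2)[OF y(2)] by (simp add: UV)
  let ?B = "{{f. \<forall>x\<in>B. \<bar>f x\<bar> < e} |B e. vn_bounded ?C B \<and> 0 < e}"
  have "\<forall>x\<in>V. \<exists>\<F>. finite \<F> \<and> \<F> \<subseteq> ?B \<and> (\<forall>y\<in>dual ?C. (\<forall>N\<in>\<F>. y - x \<in> N) \<longrightarrow> y \<in> V)"
    using V unfolding strong_dual_def openin_nbhd_topology by (rule conjunct2)
  from bspec[OF this yV] obtain \<F> where \<F>: "finite \<F>" "\<F> \<subseteq> ?B"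
    "\<forall>z\<in>dual ?C. (\<forall>N\<in>\<F>. z - ext y \<in> N) \<longrightarrow> z \<in> V" by (elim exE conjE)
  have "\<exists>r>0. \<exists>e>0. \<forall>k. \<forall>z\<in>H k. (\<forall>x. q m x \<le> r \<longrightarrow> \<bar>z x - y x\<bar> \<le> e) \<longrightarrow> (\<forall>N\<in>\<F>. ext z - ext y \<in> N)"
    using \<F>(1,2)
  proof induction
    case empty
    show ?case by (intro exI[of _ "1 :: real"] conjI) auto
  next
    case (insert N \<F>)
    have "\<F> \<subseteq> ?B" using insert.prems by blast
    from insert.IH[OF this] obtain r e where re: "r > 0" "e > 0"
      "\<forall>k. \<forall>z\<in>H k. (\<forall>x. q m x \<le> r \<longrightarrow> \<bar>z x - y x\<bar> \<le> e) \<longrightarrow> (\<forall>N\<in>\<F>. ext z - ext y \<in> N)"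
      by blast
    obtain B d where N: "N = {f. \<forall>x\<in>B. \<bar>f x\<bar> < d}" and B: "vn_bounded ?C B" and d: "d > 0"
      using insert.prems by blast
    let ?W = "{x. \<forall>\<^sub>F k in sequentially. x k \<in> {x. q m x < 1}}"
    have "zero_nbhd ?C ?W"
    proof -
      let ?BC = "{{x. \<forall>\<^sub>F k in sequentially. x k \<in> U} |U. zero_nbhd \<theta> U}"
      \<comment> \<open>\<open>?W\<close> need not be open, since the semi-norms of the terms may
        tend to 1; asking for a limit below 1 gives an open set inside it.\<close>
      define O' where "O' = {x \<in> cauchy_seqs \<theta>. lim (\<lambda>k. q m (x k)) < 1}"
      have lim: "(\<lambda>k. q m (x k)) \<longlonglongrightarrow> lim (\<lambda>k. q m (x k))" if "x \<in> cauchy_seqs \<theta>" for x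
        using q.cauchy_set_convergent[of x m] that by (simp add: cauchy_\<theta> convergent_LIMSEQ_iff)
      have "openin ?C O'"
        unfolding seq_completion_def openin_nbhd_topology
      proof (intro conjI ballI)
        fix x assume x: "x \<in> O'"
        define l where "l = lim (\<lambda>k. q m (x k))"
        define a where "a = (1 - l) / 2"
        have a: "a > 0" using x by (simp add: O'_def a_def l_def)
        have "z \<in> O'" if z: "z \<in> cauchy_seqs \<theta>" and zx: "\<forall>\<^sub>F k in sequentially. (z - x) k \<in> {x. q m x < a}" for z
        proof -
          have "\<forall>\<^sub>F k in sequentially. q m (z k) \<le> q m (x k) + a"
            using zx
          proof eventually_elim
            case (elim k)
            then show ?case using q.reverse_triangle[of m "z k" "x k"] by simp
          qed
          then have "lim (\<lambda>k. q m (z k)) \<le> l + a"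
            using x z by (intro tendsto_le[OF sequentially_bot _ lim]) (auto simp: O'_def l_def intro!: tendsto_intros lim)
          also have "l + a < 1" using a by (simp add: a_def field_simps)
          finally show ?thesis using z by (simp add: O'_def)
        qed
        then show "\<exists>\<F>. finite \<F> \<and> \<F> \<subseteq> ?BC \<and> (\<forall>z\<in>cauchy_seqs \<theta>. (\<forall>N\<in>\<F>. z - x \<in> N) \<longrightarrow> z \<in> O')"
        proof (intro exI[of _ "{{x. \<forall>\<^sub>F k in sequentially. x k \<in> {x. q m x < a}}}"] conjI)
          show "{{x. \<forall>\<^sub>F k in sequentially. x k \<in> {x. q m x < a}}} \<subseteq> ?BC"
            using zero_nbhd_\<theta>_q[OF a, of m] by blast
          show "\<forall>z\<in>cauchy_seqs \<theta>. (\<forall>N\<in>{{x. \<forall>\<^sub>F k in sequentially. x k \<in> {x. q m x < a}}}. z - x \<in> N) \<longrightarrow> z \<in> O'"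
            using \<open>\<And>z. z \<in> cauchy_seqs \<theta> \<Longrightarrow> \<forall>\<^sub>F k in sequentially. (z - x) k \<in> {x. q m x < a} \<Longrightarrow> z \<in> O'\<close>
            by simp
        qed simp
      qed (auto simp: O'_def)
      moreover have "0 \<in> O'" by (simp add: O'_def cauchy_\<theta> zero_fun_def)
      moreover have "O' \<subseteq> ?W"
      proof
        fix x assume x: "x \<in> O'"
        then have "\<forall>\<^sub>F k in sequentially. q m (x k) < 1"
          by (intro order_tendstoD(2)[OF lim]) (auto simp: O'_def)
        then show "x \<in> ?W" by simp
      qed
      ultimately show ?thesis unfolding zero_nbhd_def by blast
    qed
    then have "\<exists>r>0. B \<subseteq> (\<lambda>x. r *\<^sub>R x) ` ?W"
      using B unfolding vn_bounded_def by simp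
    then obtain r' where r': "r' > 0" "B \<subseteq> (\<lambda>x. r' *\<^sub>R x) ` ?W" by (elim exE conjE)
    have qB: "\<forall>\<^sub>F k in sequentially. q m (x k) \<le> r'" if x: "x \<in> B" for x
    proof -
      from subsetD[OF r'(2) x] obtain v where v: "x = r' *\<^sub>R v" "v \<in> ?W" by (rule imageE)
      from v(2) have "\<forall>\<^sub>F k in sequentially. q m (v k) < 1" by simp
      then show ?thesis
        by eventually_elim (use r'(1) in \<open>simp add: v(1) scaleR_fun_def q.scale mult_left_le\<close>)
    qed
    have BC: "B \<subseteq> cauchy_seqs \<theta>" using B by (simp add: vn_bounded_def seq_completion_def)
    have "\<forall>k. \<forall>z\<in>H k. (\<forall>x. q m x \<le> max r r' \<longrightarrow> \<bar>z x - y x\<bar> \<le> min e (d / 2)) \<longrightarrow>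
        (\<forall>N'\<in>insert N \<F>. ext z - ext y \<in> N')"
    proof (intro allI ballI impI)
      fix k z assume z: "z \<in> H k" and *: "\<forall>x. q m x \<le> max r r' \<longrightarrow> \<bar>z x - y x\<bar> \<le> min e (d / 2)"
      fix N' assume "N' \<in> insert N \<F>"
      then show "ext z - ext y \<in> N'"
      proof
        assume "N' = N"
        have "\<bar>ext z x - ext y x\<bar> < d" if x: "x \<in> B" for x
        proof -
          have xC: "x \<in> cauchy_seqs \<theta>" using x BC by blast
          have "(\<lambda>k. \<bar>z (x k) - y (x k)\<bar>) \<longlonglongrightarrow> \<bar>ext z x - ext y x\<bar>"
            by (intro tendsto_rabs tendsto_diff ext_tendsto[OF z xC] ext_tendsto[OF y(2) xC])
          moreover have "\<forall>\<^sub>F k in sequentially. \<bar>z (x k) - y (x k)\<bar> \<le> d / 2"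
            using qB[OF x]
          proof eventually_elim
            case (elim k)
            then have "\<bar>z (x k) - y (x k)\<bar> \<le> min e (d / 2)" using * by (simp add: max.coboundedI2)
            then show ?case by simp
          qed
          ultimately have "\<bar>ext z x - ext y x\<bar> \<le> d / 2" by (intro tendsto_upperbound) auto
          then show ?thesis using d by simp
        qed
        then show ?thesis unfolding \<open>N' = N\<close> N by simp
      next
        assume "N' \<in> \<F>"
        then show ?thesis using re(3) z * by simp
      qed
    qed
    moreover have "max r r' > 0" "min e (d / 2) > 0" using re d by auto
    ultimately show ?case by blast
  qed
  then obtain r e where re: "r > 0" "e > 0"
    "\<forall>k. \<forall>z\<in>H k. (\<forall>x. q m x \<le> r \<longrightarrow> \<bar>z x - y x\<bar> \<le> e) \<longrightarrow> (\<forall>N\<in>\<F>. ext z - ext y \<in> N)" by blast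
  have "z \<in> U" if z: "z \<in> H k" and *: "\<forall>x. q m x \<le> r \<longrightarrow> \<bar>z x - y x\<bar> \<le> e" for k z
  proof -
    have "ext z \<in> V" using re(3) z * \<F>(3) ext_dual[OF z] by blast
    then show ?thesis using H_completion_dual[OF z] by (simp add: UV)
  qed
  then show "\<exists>r>0. \<exists>e>0. \<forall>k. \<forall>z\<in>H k. (\<forall>x. q m x \<le> r \<longrightarrow> \<bar>z x - y x\<bar> \<le> e) \<longrightarrow> z \<in> U"
    using re(1,2) by blast
qed

text \<open>By total boundedness of the \<open>q (Suc n)\<close>-balls for \<open>q n\<close>, such a topology is on \<open>H n\<close> coarser than
  that of pointwise convergence on the countable dense set.\<close>

lemma cylinder_nbhd:
  assumes S: "ball_coarse S" and U: "openin S U" and y: "y \<in> U" "y \<in> H n"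
  shows "\<exists>j. \<exists>\<delta>>0. \<forall>z\<in>H n. (\<forall>i<j. \<bar>z (s i) - y (s i)\<bar> < \<delta>) \<longrightarrow> z \<in> U"
proof -
  \<comment> \<open>The ball of \<open>q (Suc n)\<close> is taken because it is totally bounded for
    \<open>q n\<close>, the semi-norm that controls \<open>H n\<close>.\<close>
  obtain r e where re: "r > 0" "e > 0"
    "\<And>k z. z \<in> H k \<Longrightarrow> (\<forall>x. q (Suc n) x \<le> r \<longrightarrow> \<bar>z x - y x\<bar> \<le> e) \<Longrightarrow> z \<in> U"
    using S U y unfolding ball_coarse_def by metis
  \<comment> \<open>The net point and its replacement by some \<open>s i\<close> cost
    \<open>r * \<eta>\<close> each, so \<open>y\<close> and \<open>z\<close> change by at most
    \<open>e / 4\<close> each; their difference at \<open>s i\<close> accounts for the other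
    \<open>e / 2\<close>.\<close>
  define \<eta> where "\<eta> = e / (8 * r * (real n + 1))"
  have \<eta>: "\<eta> > 0" using re by (simp add: \<eta>_def add_nonneg_pos)
  obtain C where "HS_bound (q n) (q (Suc n)) C" using q_HS by blast
  then obtain A where A: "finite A" "\<And>x. q (Suc n) x \<le> 1 \<Longrightarrow> \<exists>a\<in>A. q n (x - a) \<le> \<eta>"
    using HS_bound_totally_bounded[OF q_hilbertian q_hilbertian q_Suc _ \<eta>] by metis
  have "\<forall>a\<in>A. \<exists>i. q n (r *\<^sub>R a - s i) < r * \<eta>"
    using s_dense[of n] re(1) \<eta> unfolding dense_for_def by simp
  then obtain I where I: "\<forall>a\<in>A. q n (r *\<^sub>R a - s (I a)) < r * \<eta>" by (rule bchoice[THEN exE])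
  define j where "j = Suc (Max (insert 0 (I ` A)))"
  have Ij: "I a < j" if "a \<in> A" for a
    unfolding j_def using A(1) that by (intro le_imp_less_Suc Max_ge) auto
  show ?thesis
  proof (intro exI[of _ j] exI[of _ "e / 2"] conjI ballI impI)
    fix z assume z: "z \<in> H n" and *: "\<forall>i<j. \<bar>z (s i) - y (s i)\<bar> < e / 2"
    have lz: "linear z" and ly: "linear y" using z y(2) H_linear by auto
    have "\<bar>z x - y x\<bar> \<le> e" if x: "q (Suc n) x \<le> r" for x
    proof -
      have "q (Suc n) ((1 / r) *\<^sub>R x) \<le> 1" using x re(1) by (simp add: q.scale)
      then obtain a where a: "a \<in> A" "q n ((1 / r) *\<^sub>R x - a) \<le> \<eta>" using A(2) by blast
      have "x - r *\<^sub>R a = r *\<^sub>R ((1 / r) *\<^sub>R x - a)" using re(1) by (simp add: scaleR_diff_right)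
      then have "q n (x - r *\<^sub>R a) \<le> r * \<eta>" using a(2) re(1) by (simp add: q.scale)
      moreover have "q n (r *\<^sub>R a - s (I a)) \<le> r * \<eta>" using I a(1) by (simp add: less_imp_le)
      ultimately have qx: "q n (x - s (I a)) \<le> 2 * r * \<eta>"
        using q.triangle_diff[of n x "s (I a)" "r *\<^sub>R a"] by linarith
      define w where "w = x - s (I a)"
      have b: "\<bar>v w\<bar> \<le> e / 4" if "v \<in> H n" for v
      proof -
        have "\<bar>v w\<bar> \<le> real n * q n w" by (rule H_bound[OF that])
        also have "\<dots> \<le> (real n + 1) * (2 * r * \<eta>)" using qx unfolding w_def by (intro mult_mono) auto
        also have "\<dots> = e / 4" using re(1) by (simp add: \<eta>_def field_simps add_nonneg_eq_0_iff)
        finally show ?thesis .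
      qed
      have "z x - y x = z w - y w + (z (s (I a)) - y (s (I a)))"
        by (simp add: w_def linear_diff[OF lz] linear_diff[OF ly])
      moreover have "\<bar>z (s (I a)) - y (s (I a))\<bar> < e / 2" using * Ij[OF a(1)] by blast
      ultimately show ?thesis using b[OF z] b[OF y(2)] by linarith
    qed
    then show "z \<in> U" using re(3)[OF z] by blast
  qed (use re in simp)
qed

lemma limitin_H:
  assumes S: "ball_coarse S" and ev: "\<forall>\<^sub>F b in F. y b \<in> H n" and z: "z \<in> H n"
    and lim: "\<And>i. ((\<lambda>b. y b (s i)) \<longlongrightarrow> z (s i)) F"
  shows "limitin S y z F"
  unfolding limitin_def
proof (intro conjI allI impI)
  show "z \<in> topspace S" using S z by (auto simp: ball_coarse_def)
  fix U assume U: "openin S U \<and> z \<in> U"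
  then obtain j \<delta> where \<delta>: "\<delta> > 0" "\<forall>v\<in>H n. (\<forall>i<j. \<bar>v (s i) - z (s i)\<bar> < \<delta>) \<longrightarrow> v \<in> U"
    using cylinder_nbhd[OF S _ _ z] by meson
  have "\<forall>\<^sub>F b in F. \<forall>i\<in>{..<j}. \<bar>y b (s i) - z (s i)\<bar> < \<delta>"
    using lim \<delta>(1) by (intro eventually_ball_finite) (auto simp: tendsto_iff dist_real_def)
  with ev show "\<forall>\<^sub>F b in F. y b \<in> U"
    by eventually_elim (use \<delta>(2) in auto)
qed

text \<open>Membership in \<open>H n\<close> is equicontinuity for \<open>q n\<close>; it spreads
  convergence from the dense sequence to every vector and keeps the limit in
  \<open>H n\<close>.\<close>

lemma limit_functional:
  assumes "F \<noteq> bot" and ev: "\<forall>\<^sub>F b in F. y b \<in> H n"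
    and lim: "\<And>i. \<exists>l. ((\<lambda>b. y b (s i)) \<longlongrightarrow> l) F"
  shows "\<exists>z\<in>H n. \<forall>x. ((\<lambda>b. y b x) \<longlongrightarrow> z x) F"
proof -
  have "\<exists>l. ((\<lambda>b. y b x) \<longlongrightarrow> l) F" for x
  proof (rule Cauchy_filterlim_ex)
    fix e :: real assume "e > 0"
    then have "e / (4 * (real n + 1)) > 0" by (intro divide_pos_pos) auto
    then obtain i where i: "q n (x - s i) < e / (4 * (real n + 1))"
      using s_dense[of n] unfolding dense_for_def by blast
    obtain l where "((\<lambda>b. y b (s i)) \<longlongrightarrow> l) F" using lim by blast
    from tendstoD[OF this, of "e / 4"] have ev2: "\<forall>\<^sub>F b in F. \<bar>y b (s i) - l\<bar> < e / 4"
      using \<open>e > 0\<close> by (simp add: dist_real_def)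
    have "\<bar>y b x - y c x\<bar> \<le> e"
      if bc: "y b \<in> H n \<and> \<bar>y b (s i) - l\<bar> < e / 4" "y c \<in> H n \<and> \<bar>y c (s i) - l\<bar> < e / 4" for b c
    proof -
      have *: "\<bar>v x - v (s i)\<bar> \<le> e / 4" if v: "v \<in> H n" for v
      proof -
        have "\<bar>v x - v (s i)\<bar> = \<bar>v (x - s i)\<bar>" by (simp add: linear_diff[OF H_linear[OF v]])
        also have "\<dots> \<le> real n * q n (x - s i)" by (rule H_bound[OF v])
        also have "\<dots> \<le> (real n + 1) * (e / (4 * (real n + 1)))"
          using i \<open>e > 0\<close> by (intro mult_mono) auto
        also have "\<dots> = e / 4" by (simp add: field_simps add_nonneg_eq_0_iff)
        finally show ?thesis .
      qed
      show ?thesis using *[of "y b"] *[of "y c"] bc by linarith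
    qed
    then show "\<exists>P. eventually P F \<and> (\<forall>b c. P b \<longrightarrow> P c \<longrightarrow> \<bar>y b x - y c x\<bar> \<le> e)"
      using eventually_conj[OF ev ev2]
      by (intro exI[of _ "\<lambda>b. y b \<in> H n \<and> \<bar>y b (s i) - l\<bar> < e / 4"]) blast
  qed
  then have "\<forall>x. \<exists>l. ((\<lambda>b. y b x) \<longlongrightarrow> l) F" by blast
  then obtain z where z: "\<forall>x. ((\<lambda>b. y b x) \<longlongrightarrow> z x) F" by (rule choice[THEN exE])
  have "linear z"
  proof (rule linearI)
    fix x v
    have "((\<lambda>b. y b x + y b v) \<longlongrightarrow> z x + z v) F" using z by (intro tendsto_add) auto
    moreover have "\<forall>\<^sub>F b in F. y b x + y b v = y b (x + v)"
      using ev by eventually_elim (simp add: linear_add[OF H_linear])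
    ultimately have "((\<lambda>b. y b (x + v)) \<longlongrightarrow> z x + z v) F" by (rule Lim_transform_eventually)
    then show "z (x + v) = z x + z v" using tendsto_unique[OF assms(1)] z by blast
  next
    fix c x
    have "((\<lambda>b. c * y b x) \<longlongrightarrow> c * z x) F" using z by (intro tendsto_mult_left) auto
    moreover have "\<forall>\<^sub>F b in F. c * y b x = y b (c *\<^sub>R x)"
      using ev by eventually_elim (simp add: linear_scale[OF H_linear])
    ultimately have "((\<lambda>b. y b (c *\<^sub>R x)) \<longlongrightarrow> c * z x) F" by (rule Lim_transform_eventually)
    then show "z (c *\<^sub>R x) = c *\<^sub>R z x"
      using tendsto_unique[OF assms(1) _ z[rule_format, of "c *\<^sub>R x"]] by simp
  qed
  moreover have "\<bar>z x\<bar> \<le> real n * q n x" for x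
  proof (rule tendsto_upperbound[OF _ _ assms(1)])
    show "((\<lambda>b. \<bar>y b x\<bar>) \<longlongrightarrow> \<bar>z x\<bar>) F" using z by (intro tendsto_rabs) auto
    show "\<forall>\<^sub>F b in F. \<bar>y b x\<bar> \<le> real n * q n x"
      using ev by eventually_elim (rule H_bound)
  qed
  ultimately show ?thesis using z by (auto simp: H_def)
qed

end

section \<open>Regularization of paths\<close>

abbreviation right_dyadic :: "real \<Rightarrow> real filter" where
  "right_dyadic t \<equiv> at t within (dyadics \<inter> {t<..})"

abbreviation left_dyadic :: "real \<Rightarrow> real filter" where
  "left_dyadic t \<equiv> at t within (dyadics \<inter> {..<t})"

lemma eventually_right_dyadic:
  "eventually Q (right_dyadic t) \<longleftrightarrow> (\<exists>d>0. \<forall>u\<in>dyadics. t < u \<longrightarrow> u < t + d \<longrightarrow> Q u)"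
  unfolding eventually_at by (auto simp: dist_real_def)

lemma eventually_left_dyadic:
  "eventually Q (left_dyadic t) \<longleftrightarrow> (\<exists>d>0. \<forall>u\<in>dyadics. t - d < u \<longrightarrow> u < t \<longrightarrow> Q u)"
  unfolding eventually_at by (force simp: dist_real_def)

lemma right_dyadic_neq_bot: "t \<ge> 0 \<Longrightarrow> right_dyadic t \<noteq> bot"
proof
  assume "t \<ge> 0" "right_dyadic t = bot"
  then have "eventually (\<lambda>_. False) (right_dyadic t)" by simp
  then obtain d where "d > 0" "\<forall>u\<in>dyadics. t < u \<longrightarrow> u < t + d \<longrightarrow> False"
    unfolding eventually_right_dyadic by blast
  then show False using dyadics_dense[OF \<open>t \<ge> 0\<close>, of "t + d"] by auto
qed

lemma left_dyadic_neq_bot: "t > 0 \<Longrightarrow> left_dyadic t \<noteq> bot"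
proof
  assume "t > 0" "left_dyadic t = bot"
  then have "eventually (\<lambda>_. False) (left_dyadic t)" by simp
  then obtain d where "d > 0" "\<forall>u\<in>dyadics. t - d < u \<longrightarrow> u < t \<longrightarrow> False"
    unfolding eventually_left_dyadic by blast
  then show False using dyadics_dense[of "max 0 (t - d)" t] \<open>t > 0\<close> by auto
qed

text \<open>Dyadic times shortly after \<open>u\<close> still lie shortly after \<open>t\<close>, so
  the right limit at \<open>u\<close> inherits the estimate made at \<open>t\<close>.\<close>

lemma right_regularization_right:
  fixes x y :: "real \<Rightarrow> real"
  assumes y: "\<And>t. t \<ge> 0 \<Longrightarrow> (x \<longlongrightarrow> y t) (right_dyadic t)" and t: "t \<ge> 0"
  shows "(y \<longlongrightarrow> y t) (at_right t)"
proof (rule tendstoI)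
  fix e :: real assume "e > 0"
  then have "\<forall>\<^sub>F u in right_dyadic t. dist (x u) (y t) < e / 2"
    by (intro tendstoD[OF y[OF t]]) simp
  then obtain d where d: "d > 0" "\<forall>u\<in>dyadics. t < u \<longrightarrow> u < t + d \<longrightarrow> dist (x u) (y t) < e / 2"
    unfolding eventually_right_dyadic by blast
  have "dist (y u) (y t) < e" if u: "t < u" "u < t + d" for u
  proof -
    have u0: "u \<ge> 0" using t u by simp
    have "((\<lambda>v. dist (x v) (y t)) \<longlongrightarrow> dist (y u) (y t)) (right_dyadic u)"
      by (intro tendsto_dist y[OF u0] tendsto_const)
    moreover have "\<forall>\<^sub>F v in right_dyadic u. dist (x v) (y t) \<le> e / 2"
      unfolding eventually_right_dyadic using d u by (intro exI[of _ "t + d - u"]) (auto intro: less_imp_le)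
    ultimately have "dist (y u) (y t) \<le> e / 2"
      by (rule tendsto_upperbound) (rule right_dyadic_neq_bot[OF u0])
    then show ?thesis using \<open>e > 0\<close> by simp
  qed
  then show "\<forall>\<^sub>F u in at_right t. dist (y u) (y t) < e"
    unfolding eventually_at_right_field using d(1) by (intro exI[of _ "t + d"]) auto
qed

text \<open>The right limit at \<open>u < t\<close> can be taken along dyadic times below
  \<open>t\<close>, so it follows the left limit at \<open>t\<close>.\<close>

lemma right_regularization_left:
  fixes x y :: "real \<Rightarrow> real"
  assumes y: "\<And>t. t \<ge> 0 \<Longrightarrow> (x \<longlongrightarrow> y t) (right_dyadic t)" and t: "t > 0"
    and l: "(x \<longlongrightarrow> l) (left_dyadic t)"
  shows "(y \<longlongrightarrow> l) (at_left t)"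
proof (rule tendstoI)
  fix e :: real assume "e > 0"
  then have "\<forall>\<^sub>F u in left_dyadic t. dist (x u) l < e / 2"
    by (intro tendstoD[OF l]) simp
  then obtain d where d: "d > 0" "\<forall>u\<in>dyadics. t - d < u \<longrightarrow> u < t \<longrightarrow> dist (x u) l < e / 2"
    unfolding eventually_left_dyadic by blast
  have "dist (y u) l < e" if u: "max 0 (t - d) < u" "u < t" for u
  proof -
    have u0: "u \<ge> 0" using u by simp
    have "((\<lambda>v. dist (x v) l) \<longlongrightarrow> dist (y u) l) (right_dyadic u)"
      by (intro tendsto_dist y[OF u0] tendsto_const)
    moreover have "\<forall>\<^sub>F v in right_dyadic u. dist (x v) l \<le> e / 2"
      unfolding eventually_right_dyadic using d u by (intro exI[of _ "t - u"]) (auto intro: less_imp_le)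
    ultimately have "dist (y u) l \<le> e / 2"
      by (rule tendsto_upperbound) (rule right_dyadic_neq_bot[OF u0])
    then show ?thesis using \<open>e > 0\<close> by simp
  qed
  then show "\<forall>\<^sub>F u in at_left t. dist (y u) l < e"
    unfolding eventually_at_left_field using d(1) t by (intro exI[of _ "max 0 (t - d)"]) auto
qed

section \<open>Regularized paths and their measurability\<close>

context HS_chain
begin

text \<open>The two inputs of \<open>limit_functional\<close>: equicontinuity, locally uniform in
  time, and limits of the coordinates.\<close>

definition good_path :: "(real \<Rightarrow> 'a \<Rightarrow> real) \<Rightarrow> bool"
  where "good_path x \<longleftrightarrow> (\<forall>N::nat. \<exists>n. \<forall>t\<in>dyadics \<inter> {0..real N}. x t \<in> H n) \<and>
    (\<forall>i. (\<forall>t\<ge>0. \<exists>l. ((\<lambda>u. x u (s i)) \<longlongrightarrow> l) (right_dyadic t)) \<and>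
      (\<forall>t>0. \<exists>l. ((\<lambda>u. x u (s i)) \<longlongrightarrow> l) (left_dyadic t)))"

definition regularize :: "(real \<Rightarrow> 'a \<Rightarrow> real) \<Rightarrow> real \<Rightarrow> 'a \<Rightarrow> real"
  where "regularize x t = (\<lambda>\<phi>. Lim (right_dyadic t) (\<lambda>u. x u \<phi>))"

text \<open>The margin 1 makes one index \<open>n\<close> valid on a two-sided neighbourhood of
  \<open>t\<close>.\<close>

lemma good_path_H:
  assumes "good_path x"
  obtains n where "\<And>u. u \<in> dyadics \<Longrightarrow> u < t + 1 \<Longrightarrow> x u \<in> H n"
proof -
  obtain N :: nat where "t + 1 < real N" using reals_Archimedean2 by blast
  moreover obtain n where n: "\<forall>u\<in>dyadics \<inter> {0..real N}. x u \<in> H n"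
    using assms unfolding good_path_def by blast
  ultimately have "x u \<in> H n" if "u \<in> dyadics" "u < t + 1" for u
    using that dyadics_nonneg[OF that(1)] n by auto
  then show ?thesis by (rule that)
qed

lemma regularize_H:
  assumes x: "good_path x" and u: "0 \<le> u" "u < t + 1"
    and n: "\<And>v. v \<in> dyadics \<Longrightarrow> v < t + 1 \<Longrightarrow> x v \<in> H n"
  shows "regularize x u \<in> H n" and "((\<lambda>v. x v \<phi>) \<longlongrightarrow> regularize x u \<phi>) (right_dyadic u)"
proof -
  have "\<forall>\<^sub>F v in right_dyadic u. x v \<in> H n"
    unfolding eventually_right_dyadic using u n by (intro exI[of _ "t + 1 - u"]) auto
  moreover have "\<And>i. \<exists>l. ((\<lambda>v. x v (s i)) \<longlongrightarrow> l) (right_dyadic u)"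
    using x u by (auto simp: good_path_def)
  ultimately obtain z where z: "z \<in> H n" "\<forall>\<phi>. ((\<lambda>v. x v \<phi>) \<longlongrightarrow> z \<phi>) (right_dyadic u)"
    using limit_functional[OF right_dyadic_neq_bot[OF u(1)]] by metis
  have eq: "regularize x u = z"
    unfolding regularize_def using z(2) tendsto_Lim[OF right_dyadic_neq_bot[OF u(1)]] by blast
  show "regularize x u \<in> H n" "((\<lambda>v. x v \<phi>) \<longlongrightarrow> regularize x u \<phi>) (right_dyadic u)"
    unfolding eq using z by auto
qed

lemma regularize_tendsto:
  assumes x: "good_path x" and t: "t \<ge> 0"
  shows "((\<lambda>v. x v \<phi>) \<longlongrightarrow> regularize x t \<phi>) (right_dyadic t)"
proof -
  obtain n where "\<And>u. u \<in> dyadics \<Longrightarrow> u < t + 1 \<Longrightarrow> x u \<in> H n" using good_path_H[OF x] by blast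
  then show ?thesis by (intro regularize_H(2)[OF x t, of t n]) auto
qed

lemma regularize_in_H:
  assumes x: "good_path x" and t: "t \<ge> 0"
  shows "\<exists>n. regularize x t \<in> H n"
proof -
  obtain n where "\<And>u. u \<in> dyadics \<Longrightarrow> u < t + 1 \<Longrightarrow> x u \<in> H n" using good_path_H[OF x] by blast
  then have "regularize x t \<in> H n" by (intro regularize_H(1)[OF x t, of t n]) auto
  then show ?thesis by blast
qed

lemma regularize_cadlag:
  assumes x: "good_path x" and S: "ball_coarse S"
  shows "cadlag S (regularize x)"
  unfolding cadlag_def
proof (intro conjI allI impI)
  fix t :: real assume t: "t \<ge> 0"
  obtain n where n: "\<And>u. u \<in> dyadics \<Longrightarrow> u < t + 1 \<Longrightarrow> x u \<in> H n" using good_path_H[OF x] by blast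
  have RH: "regularize x u \<in> H n" if "0 \<le> u" "u < t + 1" for u
    by (rule regularize_H(1)[OF x that]) (rule n)
  show "limitin S (regularize x) (regularize x t) (at_right t)"
  proof (rule limitin_H[OF S])
    show "\<forall>\<^sub>F u in at_right t. regularize x u \<in> H n"
      unfolding eventually_at_right_field using RH t by (intro exI[of _ "t + 1"]) auto
    show "regularize x t \<in> H n" using RH t by simp
    show "((\<lambda>u. regularize x u (s i)) \<longlongrightarrow> regularize x t (s i)) (at_right t)" for i
      by (rule right_regularization_right[OF regularize_tendsto[OF x] t])
  qed
next
  fix t :: real assume t: "t > 0"
  obtain n where n: "\<And>u. u \<in> dyadics \<Longrightarrow> u < t + 1 \<Longrightarrow> x u \<in> H n" using good_path_H[OF x] by blast
  have RH: "regularize x u \<in> H n" if "0 \<le> u" "u < t + 1" for u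
    by (rule regularize_H(1)[OF x that]) (rule n)
  have "\<forall>\<^sub>F v in left_dyadic t. x v \<in> H n"
    unfolding eventually_left_dyadic using n by (intro exI[of _ 1]) auto
  moreover have "\<And>i. \<exists>l. ((\<lambda>v. x v (s i)) \<longlongrightarrow> l) (left_dyadic t)"
    using x t by (auto simp: good_path_def)
  ultimately obtain z where z: "z \<in> H n" "\<forall>\<phi>. ((\<lambda>v. x v \<phi>) \<longlongrightarrow> z \<phi>) (left_dyadic t)"
    using limit_functional[OF left_dyadic_neq_bot[OF t]] by metis
  have "limitin S (regularize x) z (at_left t)"
  proof (rule limitin_H[OF S _ z(1)])
    show "\<forall>\<^sub>F u in at_left t. regularize x u \<in> H n"
      unfolding eventually_at_left_field using RH t by (intro exI[of _ 0]) auto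
    show "((\<lambda>u. regularize x u (s i)) \<longlongrightarrow> z (s i)) (at_left t)" for i
      by (rule right_regularization_left[OF regularize_tendsto[OF x] t z(2)[rule_format]])
  qed
  then show "\<exists>l. limitin S (regularize x) l (at_left t)" by blast
qed

text \<open>Reduces membership in \<open>H n\<close> to countably many evaluations, hence to a
  measurable condition; the given membership in \<open>H m\<close> supplies the continuity for
  leaving the dense sequence.\<close>

lemma H_iff_dense:
  assumes "y \<in> H m"
  shows "y \<in> H n \<longleftrightarrow> (\<forall>i. \<bar>y (s i)\<bar> \<le> real n * q n (s i))"
proof
  assume b: "\<forall>i. \<bar>y (s i)\<bar> \<le> real n * q n (s i)"
  have ly: "linear y" by (rule H_linear[OF assms])
  have "\<bar>y x\<bar> \<le> real n * q n x" for x
  proof (rule field_le_epsilon)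
    fix e :: real assume "e > 0"
    define k where "k = max m n"
    define d where "d = e / (real m + real n + 1)"
    have d: "d > 0" using \<open>e > 0\<close> by (simp add: d_def add_nonneg_pos)
    then obtain i where i: "q k (x - s i) < d"
      using s_dense[of k] unfolding dense_for_def by blast
    have "\<bar>y (x - s i)\<bar> \<le> real m * q m (x - s i)" by (rule H_bound[OF assms])
    also have "\<dots> \<le> real m * d"
      using i q_mono[of m k "x - s i"] by (intro mult_left_mono) (auto simp: k_def)
    finally have 1: "\<bar>y x - y (s i)\<bar> \<le> real m * d" by (simp add: linear_diff[OF ly])
    have "q n (s i) \<le> q n x + q n (s i - x)" using q.triangle[of n x "s i - x"] by simp
    also have "q n (s i - x) \<le> d"
      using i q_mono[of n k "x - s i"] by (simp add: k_def q.minus_commute[of n "s i" x])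
    finally have "real n * q n (s i) \<le> real n * (q n x + d)" by (intro mult_left_mono) auto
    then have "\<bar>y x\<bar> \<le> real n * q n x + (real m + real n) * d"
      using 1 b[rule_format, of i] by (simp add: algebra_simps)
    also have "(real m + real n) * d \<le> (real m + real n + 1) * d" using d by (intro mult_right_mono) auto
    also have "\<dots> = e" by (simp add: d_def add_nonneg_eq_0_iff)
    finally show "\<bar>y x\<bar> \<le> real n * q n x + e" by simp
  qed
  then show "y \<in> H n" using ly by (simp add: H_def)
qed (simp add: H_bound)

text \<open>By \<open>cylinder_nbhd\<close>, on each \<open>H n\<close> an open set of
  \<open>S\<close> is the preimage of an open set of real sequences under evaluation at the
  \<open>s i\<close>. So evaluations decide Borel measurability although \<open>S\<close> may have
  no countable base.\<close>

lemma measurable_into_ball_coarse: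
  assumes S: "ball_coarse S" and sub: "\<And>\<omega>. \<omega> \<in> space M \<Longrightarrow> \<exists>n. Y \<omega> \<in> H n"
    and meas: "\<And>i. (\<lambda>\<omega>. Y \<omega> (s i)) \<in> borel_measurable M"
  shows "Y \<in> measurable M (borel_of S)"
  unfolding borel_of_def
proof (rule measurable_measure_of)
  show "{U. openin S U} \<subseteq> Pow (topspace S)" by (auto dest: openin_subset)
  show "Y \<in> space M \<rightarrow> topspace S"
  proof
    fix \<omega> assume "\<omega> \<in> space M"
    then obtain n where "Y \<omega> \<in> H n" using sub by blast
    moreover have "H n \<subseteq> topspace S" using S unfolding ball_coarse_def by blast
    ultimately show "Y \<omega> \<in> topspace S" by blast
  qed
  fix U assume "U \<in> {U. openin S U}"
  then have U: "openin S U" by simp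
  define ev where "ev \<omega> = (\<lambda>i. Y \<omega> (s i))" for \<omega>
  have ev [measurable]: "ev \<in> borel_measurable M"
    unfolding ev_def[abs_def] by (intro measurable_coordinatewise_then_product meas)
  have Hm: "{\<omega> \<in> space M. Y \<omega> \<in> H n} \<in> sets M" for n
  proof -
    note meas [measurable]
    have "{\<omega> \<in> space M. Y \<omega> \<in> H n} = {\<omega> \<in> space M. \<forall>i. \<bar>Y \<omega> (s i)\<bar> \<le> real n * q n (s i)}"
      using sub H_iff_dense by blast
    also have "\<dots> \<in> sets M" by measurable
    finally show ?thesis .
  qed
  \<comment> \<open>A union of arbitrarily many open sets is open, so no countable selection of
    cylinders has to be made.\<close>
  define W where "W n = \<Union>{V. open V \<and> (\<forall>z\<in>H n. (\<lambda>i. z (s i)) \<in> V \<longrightarrow> z \<in> U)}" for n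
  have "open (W n)" for n unfolding W_def by (intro open_Union) auto
  then have Wm: "ev -` W n \<inter> space M \<in> sets M" for n by (intro measurable_sets[OF ev]) auto
  have HW: "z \<in> U \<longleftrightarrow> (\<lambda>i. z (s i)) \<in> W n" if z: "z \<in> H n" for z n
  proof
    assume "z \<in> U"
    from cylinder_nbhd[OF S U this z] obtain j \<delta> where \<delta>: "\<delta> > 0"
      "\<forall>v\<in>H n. (\<forall>i<j. \<bar>v (s i) - z (s i)\<bar> < \<delta>) \<longrightarrow> v \<in> U" by blast
    define V where "V = (\<Inter>i\<in>{..<j}. {f :: nat \<Rightarrow> real. \<bar>f i - z (s i)\<bar> < \<delta>})"
    have "open {f :: nat \<Rightarrow> real. \<bar>f i - z (s i)\<bar> < \<delta>}" for i
      by (intro open_Collect_less continuous_intros continuous_on_product_coordinates)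
    then have "open V" unfolding V_def by (intro open_INT) auto
    moreover have "\<forall>v\<in>H n. (\<lambda>i. v (s i)) \<in> V \<longrightarrow> v \<in> U" using \<delta>(2) by (auto simp: V_def)
    moreover have "(\<lambda>i. z (s i)) \<in> V" using \<delta>(1) by (simp add: V_def)
    ultimately show "(\<lambda>i. z (s i)) \<in> W n" unfolding W_def by blast
  next
    assume "(\<lambda>i. z (s i)) \<in> W n"
    then show "z \<in> U" using z unfolding W_def by blast
  qed
  have "Y -` U \<inter> space M = (\<Union>n. {\<omega> \<in> space M. Y \<omega> \<in> H n} \<inter> (ev -` W n \<inter> space M))"
  proof (intro equalityI subsetI)
    fix \<omega> assume \<omega>: "\<omega> \<in> Y -` U \<inter> space M"
    then obtain n where "Y \<omega> \<in> H n" using sub by blast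
    then show "\<omega> \<in> (\<Union>n. {\<omega> \<in> space M. Y \<omega> \<in> H n} \<inter> (ev -` W n \<inter> space M))"
      using \<omega> HW[of "Y \<omega>" n] by (auto simp: ev_def)
  next
    fix \<omega> assume "\<omega> \<in> (\<Union>n. {\<omega> \<in> space M. Y \<omega> \<in> H n} \<inter> (ev -` W n \<inter> space M))"
    then show "\<omega> \<in> Y -` U \<inter> space M" using HW by (auto simp: ev_def)
  qed
  also have "\<dots> \<in> sets M" using Hm Wm by (intro sets.countable_UN sets.Int) auto
  finally show "Y -` U \<inter> space M \<in> sets M" .
qed

end

section \<open>Versions, Radon laws and evaluation\<close>

lemma space_borel_of [simp]: "space (borel_of S) = topspace S"
  unfolding borel_of_def by (intro space_measure_of) (auto dest: openin_subset)

lemma openin_sets_borel_of: "openin S U \<Longrightarrow> U \<in> sets (borel_of S)"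
  unfolding borel_of_def by (subst sets_measure_of) (auto dest: openin_subset)

lemma closedin_sets_borel_of:
  assumes "closedin S K" shows "K \<in> sets (borel_of S)"
proof -
  have "topspace S - K \<in> sets (borel_of S)"
    using assms by (intro openin_sets_borel_of) (auto simp: closedin_def)
  then have "space (borel_of S) - (topspace S - K) \<in> sets (borel_of S)" by (rule sets.compl_sets)
  moreover have "space (borel_of S) - (topspace S - K) = K" using closedin_subset[OF assms] by auto
  ultimately show ?thesis by simp
qed

lemma continuous_map_borel_measurable:
  assumes "continuous_map S euclideanreal f" shows "f \<in> borel_measurable (borel_of S)"
proof (rule borel_measurableI)
  fix U :: "real set" assume "open U"
  then have "openin S {x \<in> topspace S. f x \<in> U}"
    using assms by (intro openin_continuous_map_preimage) auto
  from openin_sets_borel_of[OF this] show "f -` U \<inter> space (borel_of S) \<in> sets (borel_of S)"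
    by (simp add: vimage_def Int_def conj_commute)
qed

text \<open>Preimages under \<open>X\<close> and \<open>Y\<close> differ within a null set;
  completeness makes the second one measurable.\<close>

lemma measurable_AE_version:
  assumes M: "complete_measure M" and X: "X \<in> measurable M N"
    and eq: "AE \<omega> in M. Y \<omega> = X \<omega>" and Y: "\<And>\<omega>. \<omega> \<in> space M \<Longrightarrow> Y \<omega> \<in> space N"
  shows "Y \<in> measurable M N"
proof (rule measurableI)
  fix A assume A: "A \<in> sets N"
  show "Y -` A \<inter> space M \<in> sets M"
  proof (rule complete_measure.in_sets_AE[OF M])
    show "AE \<omega> in M. (\<omega> \<in> X -` A \<inter> space M) = (\<omega> \<in> Y -` A \<inter> space M)"
      using eq by eventually_elim auto
  qed (use measurable_sets[OF X A] in auto)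
qed (rule Y)

context prob_space
begin

lemma indep_vars_AE_version:
  assumes X: "indep_vars N X I" and Y: "\<And>i. i \<in> I \<Longrightarrow> Y i \<in> measurable M (N i)"
    and eq: "\<And>i. i \<in> I \<Longrightarrow> AE \<omega> in M. Y i \<omega> = X i \<omega>"
  shows "indep_vars N Y I"
  unfolding indep_vars_def2
proof (intro conjI ballI Y)
  have Xm: "X i \<in> measurable M (N i)" if "i \<in> I" for i using X that by (simp add: indep_vars_def2)
  show "indep_sets (\<lambda>i. {Y i -` A \<inter> space M |A. A \<in> sets (N i)}) I"
  proof (rule indep_setsI)
    fix i assume "i \<in> I"
    then show "{Y i -` A \<inter> space M |A. A \<in> sets (N i)} \<subseteq> events" using Y by (auto intro: measurable_sets)
  next
    fix A J assume J: "J \<noteq> {}" "J \<subseteq> I" "finite J" "\<forall>j\<in>J. A j \<in> {Y j -` A \<inter> space M |A. A \<in> sets (N j)}"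
    then have "\<forall>j\<in>J. \<exists>C. C \<in> sets (N j) \<and> A j = Y j -` C \<inter> space M" by blast
    then obtain C where C: "\<forall>j\<in>J. C j \<in> sets (N j) \<and> A j = Y j -` C j \<inter> space M"
      by (rule bchoice[THEN exE])
    define A' where "A' j = X j -` C j \<inter> space M" for j
    have ev: "A j \<in> events" "A' j \<in> events" if "j \<in> J" for j
    proof -
      have j: "j \<in> I" "C j \<in> sets (N j)" "A j = Y j -` C j \<inter> space M" using C J(2) that by auto
      show "A j \<in> events" unfolding j(3) by (rule measurable_sets[OF Y[OF j(1)] j(2)])
      show "A' j \<in> events" unfolding A'_def by (rule measurable_sets[OF Xm[OF j(1)] j(2)])
    qed
    have ae: "AE \<omega> in M. (\<omega> \<in> A j) = (\<omega> \<in> A' j)" if "j \<in> J" for j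
    proof -
      have "AE \<omega> in M. Y j \<omega> = X j \<omega>" using that J(2) by (intro eq) auto
      then show ?thesis by eventually_elim (use C that in \<open>auto simp: A'_def\<close>)
    qed
    have "prob (\<Inter>j\<in>J. A j) = prob (\<Inter>j\<in>J. A' j)"
    proof (rule measure_eq_AE)
      have "AE \<omega> in M. \<forall>j\<in>J. (\<omega> \<in> A j) = (\<omega> \<in> A' j)" using ae J(3) by (intro AE_finite_allI) auto
      then show "AE \<omega> in M. (\<omega> \<in> (\<Inter>j\<in>J. A j)) = (\<omega> \<in> (\<Inter>j\<in>J. A' j))" by eventually_elim auto
    qed (use ev J in \<open>auto intro!: sets.finite_INT\<close>)
    also have "\<dots> = (\<Prod>j\<in>J. prob (A' j))"
      using X J C unfolding indep_vars_def2 A'_def by (intro indep_setsD[of _ I]) auto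
    also have "\<dots> = (\<Prod>j\<in>J. prob (A j))"
      using ev ae by (intro prod.cong refl measure_eq_AE) (auto simp: eq_commute)
    finally show "prob (\<Inter>j\<in>J. A j) = (\<Prod>j\<in>J. prob (A j))" .
  qed
qed

text \<open>Turns tightness into almost sure statements. \<open>Q\<close> is an arbitrary predicate;
  measurability rests with the sets \<open>G\<close>.\<close>

lemma AE_I_prob_near_1:
  assumes "\<And>\<epsilon>. \<epsilon> > 0 \<Longrightarrow> \<exists>G\<in>events. 1 - \<epsilon> \<le> prob G \<and> (\<forall>\<omega>\<in>G. Q \<omega>)"
  shows "AE \<omega> in M. Q \<omega>"
proof -
  have "\<forall>n::nat. \<exists>G. G \<in> events \<and> 1 - 1 / Suc n \<le> prob G \<and> (\<forall>\<omega>\<in>G. Q \<omega>)"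
  proof
    fix n show "\<exists>G. G \<in> events \<and> 1 - 1 / Suc n \<le> prob G \<and> (\<forall>\<omega>\<in>G. Q \<omega>)"
      using assms[of "1 / Suc n"] by auto
  qed
  then obtain G where G: "\<forall>n::nat. G n \<in> events \<and> 1 - 1 / Suc n \<le> prob (G n) \<and> (\<forall>\<omega>\<in>G n. Q \<omega>)"
    by (rule choice[THEN exE])
  define U where "U = (\<Union>n. G n)"
  have U: "U \<in> events" using G by (auto simp: U_def)
  have "1 - 1 / real (Suc n) \<le> prob U" for n
  proof -
    have "prob (G n) \<le> prob U" by (rule finite_measure_mono) (use U in \<open>auto simp: U_def\<close>)
    then show ?thesis using G by (meson order_trans)
  qed
  then have "1 - 0 \<le> prob U"
    by (intro LIMSEQ_le_const2[OF tendsto_diff[OF tendsto_const LIMSEQ_Suc[OF lim_1_over_n]]]) blast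
  then have "prob U = 1" using prob_le_1[of U] by simp
  then have "AE \<omega> in M. \<omega> \<in> U" using prob_eq_1[OF U] by simp
  then show ?thesis by eventually_elim (use G in \<open>auto simp: U_def\<close>)
qed

lemma radon_compact:
  assumes "radon_prob S (distr M (borel_of S) X)" and X: "X \<in> measurable M (borel_of S)"
    and S: "Hausdorff_space S" and "\<epsilon> > 0"
  obtains K where "compactin S K" "{\<omega> \<in> space M. X \<omega> \<in> K} \<in> events"
    "1 - \<epsilon> \<le> prob {\<omega> \<in> space M. X \<omega> \<in> K}"
proof -
  have "topspace S \<in> sets (distr M (borel_of S) X)" using openin_sets_borel_of[of S "topspace S"] by simp
  then obtain K where K: "compactin S K" "measure (distr M (borel_of S) X) (topspace S - K) < \<epsilon>"
    using assms(1) \<open>\<epsilon> > 0\<close> unfolding radon_prob_def by meson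
  have "closedin S K" using compactin_imp_closedin[OF S K(1)] .
  then have Km: "K \<in> sets (borel_of S)" by (rule closedin_sets_borel_of)
  have eq: "{\<omega> \<in> space M. X \<omega> \<in> K} = X -` K \<inter> space M" by auto
  have ev: "{\<omega> \<in> space M. X \<omega> \<in> K} \<in> events" unfolding eq using measurable_sets[OF X Km] .
  have "topspace S - K \<in> sets (borel_of S)"
    using sets.compl_sets[OF Km] by simp
  then have "prob (X -` (topspace S - K) \<inter> space M) < \<epsilon>"
    using K(2) by (simp add: measure_distr[OF X])
  moreover have "X -` (topspace S - K) \<inter> space M = space M - {\<omega> \<in> space M. X \<omega> \<in> K}"
    using measurable_space[OF X] by auto
  ultimately have "1 - \<epsilon> \<le> prob {\<omega> \<in> space M. X \<omega> \<in> K}" using prob_compl[OF ev] by simp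
  with K(1) ev show ?thesis by (rule that)
qed

end

text \<open>Composition does not show that a difference of Borel maps into the strong dual is Borel,
  since subtraction need not be measurable for the product sigma-algebra. Measurability is part of
  the independence of increments and is read off from a single step.\<close>

lemma levy_increment_measurable:
  assumes M: "prob_space M" and L: "levy_process M S L" and "s \<ge> 0" "h > 0"
  shows "(\<lambda>\<omega>. L (s + h) \<omega> - L s \<omega>) \<in> measurable M (borel_of S)"
proof -
  define t where "t i = s + real i * h" for i :: nat
  have "independent_increments M S L" using L by (simp add: levy_process_def)
  moreover have "0 \<le> t 0 \<and> (\<forall>i<1. t i < t (Suc i))" using assms by (simp add: t_def)
  ultimately have "prob_space.indep_vars M (\<lambda>_. borel_of S) (\<lambda>i \<omega>. L (t (Suc i)) \<omega> - L (t i) \<omega>) {..<1}"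
    unfolding independent_increments_def by blast
  then have "\<forall>i\<in>{..<1}. (\<lambda>\<omega>. L (t (Suc i)) \<omega> - L (t i) \<omega>) \<in> measurable M (borel_of S)"
    by (simp add: prob_space.indep_vars_def[OF M])
  from bspec[OF this, of 0] show ?thesis by (simp add: t_def)
qed

lemma levy_process_version:
  assumes M: "prob_space M" "complete_measure M" and L: "levy_process M S L"
    and ver: "is_version M L' L"
    and top: "\<And>t \<omega>. t \<ge> 0 \<Longrightarrow> \<omega> \<in> space M \<Longrightarrow> L' t \<omega> \<in> topspace S"
    and diff: "\<And>x y. x \<in> topspace S \<Longrightarrow> y \<in> topspace S \<Longrightarrow> x - y \<in> topspace S"
  shows "levy_process M S L'"
proof -
  interpret prob_space M by fact
  have eq: "AE \<omega> in M. L' t \<omega> = L t \<omega>" if "t \<ge> 0" for t using ver that by (simp add: is_version_def)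
  have Lm: "L t \<in> measurable M (borel_of S)" if "t \<ge> 0" for t
    using L that by (simp add: levy_process_def stoch_process_def)
  have L'm: "L' t \<in> measurable M (borel_of S)" if "t \<ge> 0" for t
    by (rule measurable_AE_version[OF M(2) Lm[OF that] eq[OF that]]) (use top that in simp)
  have eqd: "AE \<omega> in M. L' t \<omega> - L' u \<omega> = L t \<omega> - L u \<omega>" if "t \<ge> 0" "u \<ge> 0" for t u
    using eq[OF that(1)] eq[OF that(2)] by eventually_elim simp
  have dm: "(\<lambda>\<omega>. L (u + h) \<omega> - L u \<omega>) \<in> measurable M (borel_of S)" if "u \<ge> 0" "h \<ge> 0" for u h
  proof (cases "h = 0")
    \<comment> \<open>Independence speaks of increments over positive time only; over time 0 the
      increment is the constant 0, which lies in the space as a difference.\<close>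
    case True
    have "0 \<in> topspace S \<or> space M = {}"
      using diff[OF top top] by (metis all_not_in_conv diff_self order_refl)
    then have "0 \<in> topspace S" using not_empty by blast
    moreover have "(\<lambda>\<omega>. L (u + h) \<omega> - L u \<omega>) = (\<lambda>_. 0)" using True by (simp add: fun_eq_iff)
    ultimately show ?thesis by (simp only:) (rule measurable_const, simp)
  next
    case False
    then show ?thesis using that by (intro levy_increment_measurable[OF M(1) L]) auto
  qed
  have d'm: "(\<lambda>\<omega>. L' (u + h) \<omega> - L' u \<omega>) \<in> measurable M (borel_of S)" if "u \<ge> 0" "h \<ge> 0" for u h
  proof (rule measurable_AE_version[OF M(2) dm[OF that]])
    show "AE \<omega> in M. L' (u + h) \<omega> - L' u \<omega> = L (u + h) \<omega> - L u \<omega>" using that by (intro eqd) auto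
    show "L' (u + h) \<omega> - L' u \<omega> \<in> space (borel_of S)" if "\<omega> \<in> space M" for \<omega>
      using that \<open>u \<ge> 0\<close> \<open>h \<ge> 0\<close> by (simp add: diff top)
  qed
  have distr_eq: "distr M (borel_of S) (L' t) = distr M (borel_of S) (L t)" if "t \<ge> 0" for t
    using eq[OF that] L'm[OF that] Lm[OF that] by (intro distr_cong_AE) auto
  have distr_d: "distr M (borel_of S) (\<lambda>\<omega>. L' (u + h) \<omega> - L' u \<omega>) = distr M (borel_of S) (\<lambda>\<omega>. L (u + h) \<omega> - L u \<omega>)"
    if "u \<ge> 0" "h \<ge> 0" for u h
    using eqd[of "u + h" u] d'm[OF that] dm[OF that] that by (intro distr_cong_AE) auto
  show ?thesis
    unfolding levy_process_def
  proof (intro conjI)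
    show "stoch_process M S L'" using L'm by (simp add: stoch_process_def)
    have "AE \<omega> in M. L 0 \<omega> = 0" using L by (simp add: levy_process_def)
    then show "AE \<omega> in M. L' 0 \<omega> = 0" using eq[of 0, OF order_refl] by eventually_elim simp
    show "independent_increments M S L'"
      unfolding independent_increments_def
    proof (intro allI impI)
      fix n and t :: "nat \<Rightarrow> real" assume t: "0 \<le> t 0 \<and> (\<forall>i<n. t i < t (Suc i))"
      have t0: "0 \<le> t i" if "i \<le> n" for i
        using that
      proof (induction i)
        case (Suc i)
        then have "t i < t (Suc i)" using t by simp
        then show ?case using Suc by simp
      qed (use t in simp)
      have ii: "indep_vars (\<lambda>_. borel_of S) (\<lambda>i \<omega>. L (t (Suc i)) \<omega> - L (t i) \<omega>) {..<n}"
        using L t by (simp add: levy_process_def independent_increments_def)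
      show "indep_vars (\<lambda>_. borel_of S) (\<lambda>i \<omega>. L' (t (Suc i)) \<omega> - L' (t i) \<omega>) {..<n}"
      proof (rule indep_vars_AE_version[OF ii])
        fix i assume i: "i \<in> {..<n}"
        show "(\<lambda>\<omega>. L' (t (Suc i)) \<omega> - L' (t i) \<omega>) \<in> measurable M (borel_of S)"
          using d'm[of "t i" "t (Suc i) - t i"] t0[of i] t i by (simp add: less_imp_le)
        show "AE \<omega> in M. L' (t (Suc i)) \<omega> - L' (t i) \<omega> = L (t (Suc i)) \<omega> - L (t i) \<omega>"
          using t0[of i] t0[of "Suc i"] i by (intro eqd) auto
      qed
    qed
    have "distr M (borel_of S) (\<lambda>\<omega>. L (s + h) \<omega> - L s \<omega>) = distr M (borel_of S) (\<lambda>\<omega>. L (0 + h) \<omega> - L 0 \<omega>)"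
      if "s \<ge> 0" "h \<ge> 0" for s h
      using L that by (simp add: levy_process_def stationary_increments_def)
    then have "distr M (borel_of S) (\<lambda>\<omega>. L' (s + h) \<omega> - L' s \<omega>) = distr M (borel_of S) (\<lambda>\<omega>. L' (0 + h) \<omega> - L' 0 \<omega>)"
      if "s \<ge> 0" "h \<ge> 0" for s h
      unfolding distr_d[OF that] distr_d[OF order_refl that(2)] using that .
    then show "stationary_increments M S L'" by (simp add: stationary_increments_def)
    show "\<forall>t\<ge>0. radon_prob S (distr M (borel_of S) (L' t))"
      using L distr_eq by (simp add: levy_process_def)
    have "weakly_continuous_at_zero S (\<lambda>t. distr M (borel_of S) (L t))" using L by (simp add: levy_process_def)
    then show "weakly_continuous_at_zero S (\<lambda>t. distr M (borel_of S) (L' t))"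
      unfolding weakly_continuous_at_zero_def
    proof (intro allI impI)
      fix f assume wc: "\<forall>f. continuous_map S euclideanreal f \<and> bounded (f ` topspace S) \<longrightarrow>
          ((\<lambda>t. \<integral>x. f x \<partial>distr M (borel_of S) (L t)) \<longlongrightarrow> (\<integral>x. f x \<partial>distr M (borel_of S) (L 0))) (at_right 0)"
        and f: "continuous_map S euclideanreal f \<and> bounded (f ` topspace S)"
      have "\<forall>\<^sub>F t in at_right 0. (\<integral>x. f x \<partial>distr M (borel_of S) (L t)) = (\<integral>x. f x \<partial>distr M (borel_of S) (L' t))"
        using eventually_at_right_less[of "0::real"] by eventually_elim (simp add: distr_eq)
      then show "((\<lambda>t. \<integral>x. f x \<partial>distr M (borel_of S) (L' t)) \<longlongrightarrow> (\<integral>x. f x \<partial>distr M (borel_of S) (L' 0))) (at_right 0)"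
        unfolding distr_eq[OF order_refl] by (rule Lim_transform_eventually[OF wc[rule_format, OF f]])
    qed
  qed
qed

context nuclear
begin

lemma dual_diff: "f \<in> dual T \<Longrightarrow> g \<in> dual T \<Longrightarrow> f - g \<in> dual T"
  unfolding dual_def fun_diff_def
  by (auto intro: continuous_map_diff simp: algebra_simps)

lemma real_levy_eval:
  assumes M: "prob_space M" and L: "levy_process M (strong_dual T) L"
  shows "real_levy M (\<lambda>t \<omega>. L t \<omega> \<phi>)"
proof -
  interpret prob_space M by fact
  let ?S = "strong_dual T"
  have ev: "(\<lambda>f. f \<phi>) \<in> borel_measurable (borel_of ?S)"
    by (rule continuous_map_borel_measurable[OF continuous_map_eval])
  have Lm: "L t \<in> measurable M (borel_of ?S)" if "t \<ge> 0" for t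
    using L that by (simp add: levy_process_def stoch_process_def)
  have Lem: "(\<lambda>\<omega>. L t \<omega> \<phi>) \<in> borel_measurable M" if "t \<ge> 0" for t
    using measurable_compose[OF Lm[OF that] ev] .
  have L0: "AE \<omega> in M. L 0 \<omega> = 0" using L by (simp add: levy_process_def)
  show ?thesis
  proof unfold_locales
    show "(\<lambda>\<omega>. L t \<omega> \<phi>) \<in> borel_measurable M" if "t \<ge> 0" for t by (rule Lem[OF that])
    show "AE \<omega> in M. L 0 \<omega> \<phi> = 0" using L0 by eventually_elim simp
    fix n and t :: "nat \<Rightarrow> real" assume t: "0 \<le> t 0" "\<And>i. i < n \<Longrightarrow> t i < t (Suc i)"
    have "indep_vars (\<lambda>_. borel_of ?S) (\<lambda>i \<omega>. L (t (Suc i)) \<omega> - L (t i) \<omega>) {..<n}"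
      using L t by (simp add: levy_process_def independent_increments_def)
    from indep_vars_compose2[OF this ev]
    show "indep_vars (\<lambda>_. borel) (\<lambda>i \<omega>. L (t (Suc i)) \<omega> \<phi> - L (t i) \<omega> \<phi>) {..<n}" by simp
  next
    fix s h :: real assume sh: "s \<ge> 0" "h \<ge> 0"
    show "distr M borel (\<lambda>\<omega>. L (s + h) \<omega> \<phi> - L s \<omega> \<phi>) = distr M borel (\<lambda>\<omega>. L h \<omega> \<phi>)"
    proof (cases "h = 0")
      case True
      have "AE \<omega> in M. L 0 \<omega> \<phi> = 0" using L0 by eventually_elim simp
      then have "distr M borel (\<lambda>\<omega>. L 0 \<omega> \<phi>) = distr M borel (\<lambda>\<omega>. 0)"
        using Lem[of 0] by (intro distr_cong_AE) auto
      then show ?thesis using True by simp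
    next
      case False
      then have h: "h > 0" using sh by simp
      have m1: "(\<lambda>\<omega>. L (s + h) \<omega> - L s \<omega>) \<in> measurable M (borel_of ?S)"
        by (rule levy_increment_measurable[OF M L sh(1) h])
      have m2: "(\<lambda>\<omega>. L h \<omega> - L 0 \<omega>) \<in> measurable M (borel_of ?S)"
        using levy_increment_measurable[OF M L order_refl h] by simp
      have "distr M (borel_of ?S) (\<lambda>\<omega>. L (s + h) \<omega> - L s \<omega>) = distr M (borel_of ?S) (\<lambda>\<omega>. L h \<omega> - L 0 \<omega>)"
        using L sh by (simp add: levy_process_def stationary_increments_def)
      then have "distr (distr M (borel_of ?S) (\<lambda>\<omega>. L (s + h) \<omega> - L s \<omega>)) borel (\<lambda>f. f \<phi>)
          = distr (distr M (borel_of ?S) (\<lambda>\<omega>. L h \<omega> - L 0 \<omega>)) borel (\<lambda>f. f \<phi>)" by simp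
      then have "distr M borel (\<lambda>\<omega>. L (s + h) \<omega> \<phi> - L s \<omega> \<phi>) = distr M borel (\<lambda>\<omega>. L h \<omega> \<phi> - L 0 \<omega> \<phi>)"
        by (simp add: distr_distr[OF ev m1] distr_distr[OF ev m2] comp_def)
      also have "\<dots> = distr M borel (\<lambda>\<omega>. L h \<omega> \<phi>)"
      proof (rule distr_cong_AE)
        show "AE \<omega> in M. L h \<omega> \<phi> - L 0 \<omega> \<phi> = L h \<omega> \<phi>" using L0 by eventually_elim simp
      qed (use Lem[of h] Lem[of 0] sh in auto)
      finally show ?thesis .
    qed
  next
    \<comment> \<open>A bounded continuous function that vanishes at the zero functional: weak
      continuity of the laws at time 0 becomes stochastic continuity of the evaluation.\<close>
    let ?f = "\<lambda>f. min \<bar>f \<phi>\<bar> 1 :: real"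
    have fc: "continuous_map ?S euclideanreal ?f"
      by (intro continuous_map_real_min continuous_map_real_abs continuous_map_eval) simp
    have "bounded (?f ` topspace ?S)" by (rule boundedI[of _ 1]) auto
    with fc have "((\<lambda>t. \<integral>x. ?f x \<partial>distr M (borel_of ?S) (L t)) \<longlongrightarrow> (\<integral>x. ?f x \<partial>distr M (borel_of ?S) (L 0))) (at_right 0)"
      using L unfolding levy_process_def weakly_continuous_at_zero_def by blast
    moreover have int: "(\<integral>x. ?f x \<partial>distr M (borel_of ?S) (L t)) = (\<integral>\<omega>. min \<bar>L t \<omega> \<phi>\<bar> 1 \<partial>M)" if "t \<ge> 0" for t
      using that by (intro integral_distr Lm continuous_map_borel_measurable fc)
    moreover have "(\<integral>\<omega>. min \<bar>L 0 \<omega> \<phi>\<bar> 1 \<partial>M) = (\<integral>\<omega>. 0 \<partial>M)"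
    proof (rule integral_cong_AE)
      show "AE \<omega> in M. min \<bar>L 0 \<omega> \<phi>\<bar> 1 = 0" using L0 by eventually_elim simp
    qed (use Lem[of 0] in auto)
    moreover have "\<forall>\<^sub>F t in at_right 0. (\<integral>x. ?f x \<partial>distr M (borel_of ?S) (L t)) = (\<integral>\<omega>. min \<bar>L t \<omega> \<phi>\<bar> 1 \<partial>M)"
      using eventually_at_right_less[of "0::real"] by eventually_elim (simp add: int)
    ultimately show "((\<lambda>t. \<integral>\<omega>. min \<bar>L t \<omega> \<phi>\<bar> 1 \<partial>M) \<longlongrightarrow> 0) (at_right 0)"
      using Lim_transform_eventually by fastforce
  qed
qed

end

section \<open>The regularized Levy process\<close>

lemma oscs_antimono_size: "oscs x D c p u \<Longrightarrow> c' \<le> c \<Longrightarrow> oscs x D c' p u"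
proof (induction p arbitrary: u)
  case (Suc p)
  then obtain s t where st: "s \<in> D" "t \<in> D" "u \<le> s" "s < t" "c < \<bar>x t - x s\<bar>" "oscs x D c p t"
    by auto
  then have "c' < \<bar>x t - x s\<bar>" "oscs x D c' p t" using Suc.IH Suc.prems(2) by auto
  then show ?case using st(1-4) unfolding oscs.simps by blast
qed simp

lemma (in real_levy) AE_dyadic_limits:
  "AE \<omega> in M. (\<forall>t\<ge>0. \<exists>l. ((\<lambda>u. X u \<omega>) \<longlongrightarrow> l) (right_dyadic t)) \<and>
    (\<forall>t>0. \<exists>l. ((\<lambda>u. X u \<omega>) \<longlongrightarrow> l) (left_dyadic t))"
proof -
  define Q where "Q c \<omega> \<longleftrightarrow> (\<exists>r>0. \<forall>i::nat. \<exists>p.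
      \<not> oscs (\<lambda>t. X t \<omega>) (dyadics \<inter> {real i * r..(real i + 1) * r}) c p (real i * r))" for c \<omega>
  \<comment> \<open>Countably many sizes suffice, so the exceptional sets add up to a null
    set.\<close>
  have "AE \<omega> in M. Q (1 / real (Suc n)) \<omega>" for n
  proof -
    obtain r where r: "r > 0" "AE \<omega> in M. \<forall>i::nat. \<exists>p.
      \<not> oscs (\<lambda>t. X t \<omega>) (dyadics \<inter> {real i * r..(real i + 1) * r}) (1 / real (Suc n)) p (real i * r)"
      using finitely_many_oscillations[of "1 / real (Suc n)"] by auto
    from r(2) show ?thesis by eventually_elim (use r(1) in \<open>auto simp: Q_def\<close>)
  qed
  then have "AE \<omega> in M. \<forall>n. Q (1 / real (Suc n)) \<omega>" by (simp add: AE_all_countable)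
  then show ?thesis
  proof eventually_elim
    case (elim \<omega>)
    have osc: "\<exists>r>0. \<forall>i::nat. \<exists>p.
        \<not> oscs (\<lambda>t. X t \<omega>) (dyadics \<inter> {real i * r..(real i + 1) * r}) c p (real i * r)" if c: "c > 0" for c
    proof -
      obtain n where n: "1 / real (Suc n) < c" using reals_Archimedean[OF c] by (auto simp: inverse_eq_divide)
      obtain r where r: "r > 0" "\<And>i::nat. \<exists>p.
        \<not> oscs (\<lambda>t. X t \<omega>) (dyadics \<inter> {real i * r..(real i + 1) * r}) (1 / real (Suc n)) p (real i * r)"
        using elim unfolding Q_def by blast
      have "\<exists>p. \<not> oscs (\<lambda>t. X t \<omega>) (dyadics \<inter> {real i * r..(real i + 1) * r}) c p (real i * r)" for i :: nat
        using r(2)[of i] oscs_antimono_size[OF _ less_imp_le[OF n]] by blast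
      then show ?thesis using r(1) by blast
    qed
    show ?case
      using finite_oscillations_limits[of "\<lambda>t. X t \<omega>" dyadics, OF osc] by blast
  qed
qed

text \<open>Borel--Cantelli along dyadic times that approach \<open>t\<close> from the right so fast
  that the increment exceeds \<open>(1 / 2) ^ j\<close> with probability at most
  \<open>(1 / 2) ^ j\<close>: the values tend both to \<open>y \<omega>\<close> and to
  \<open>X t \<omega>\<close>.\<close>

lemma (in real_levy) AE_eq_right_dyadic_limit:
  assumes t: "t \<ge> 0" and lim: "AE \<omega> in M. ((\<lambda>u. X u \<omega>) \<longlongrightarrow> y \<omega>) (right_dyadic t)"
  shows "AE \<omega> in M. y \<omega> = X t \<omega>"
proof -
  have "\<forall>j::nat. \<exists>u. u \<in> dyadics \<and> t < u \<and> u < t + 1 / Suc j \<and>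
      prob {\<omega> \<in> space M. (1 / 2) ^ j < \<bar>X u \<omega> - X t \<omega>\<bar>} \<le> (1 / 2) ^ j"
  proof
    fix j :: nat
    have p: "(1 / 2 :: real) ^ j > 0" by simp
    obtain r where r: "r > 0" "\<And>h. h \<in> {0..r} \<Longrightarrow> prob {\<omega> \<in> space M. (1 / 2) ^ j < \<bar>X h \<omega>\<bar>} \<le> (1 / 2) ^ j"
      using small_increments[OF p p] by auto
    obtain u where u: "u \<in> dyadics" "t < u" "u < t + min r (1 / Suc j)"
      using dyadics_dense[OF t, of "t + min r (1 / Suc j)"] r(1) by auto
    have "prob {\<omega> \<in> space M. (1 / 2) ^ j < \<bar>X u \<omega> - X t \<omega>\<bar>} \<le> (1 / 2) ^ j"
      using u t by (subst prob_increment) (auto intro!: r(2))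
    then show "\<exists>u. u \<in> dyadics \<and> t < u \<and> u < t + 1 / Suc j \<and>
      prob {\<omega> \<in> space M. (1 / 2) ^ j < \<bar>X u \<omega> - X t \<omega>\<bar>} \<le> (1 / 2) ^ j"
      using u by (intro exI[of _ u]) auto
  qed
  then obtain u where u: "\<forall>j::nat. u j \<in> dyadics \<and> t < u j \<and> u j < t + 1 / Suc j \<and>
      prob {\<omega> \<in> space M. (1 / 2) ^ j < \<bar>X (u j) \<omega> - X t \<omega>\<bar>} \<le> (1 / 2) ^ j"
    by (rule choice[THEN exE])
  define A where "A j = {\<omega> \<in> space M. (1 / 2) ^ j < \<bar>X (u j) \<omega> - X t \<omega>\<bar>}" for j
  have A: "A j \<in> events" for j
  proof -
    have "u j \<ge> 0" using u t by (meson less_imp_le order_trans)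
    then have [measurable]: "X (u j) \<in> borel_measurable M" "X t \<in> borel_measurable M"
      using t by (auto intro: X_measurable)
    show ?thesis unfolding A_def by measurable
  qed
  have "summable (\<lambda>j. prob (A j))"
    by (rule summable_comparison_test[OF _ summable_geometric[of "1 / 2 :: real"]])
      (use u in \<open>auto simp: A_def intro!: exI[of _ 0]\<close>)
  then have bc: "AE \<omega> in M. \<forall>\<^sub>F j in sequentially. \<omega> \<in> space M - A j"
    using A by (intro borel_cantelli_AE1) (auto simp: emeasure_eq_measure)
  have filt: "filterlim u (right_dyadic t) sequentially"
    unfolding filterlim_at
  proof
    show "\<forall>\<^sub>F j in sequentially. u j \<in> dyadics \<inter> {t<..} \<and> u j \<noteq> t"
      by (rule always_eventually) (use u in \<open>auto simp: less_imp_neq[symmetric]\<close>)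
    show "u \<longlonglongrightarrow> t"
    proof (rule tendsto_sandwich)
      show "\<forall>\<^sub>F j in sequentially. t \<le> u j" "\<forall>\<^sub>F j in sequentially. u j \<le> t + 1 / Suc j"
        by (rule always_eventually, use u in \<open>auto intro: less_imp_le\<close>)+
      show "(\<lambda>j. t + 1 / real (Suc j)) \<longlonglongrightarrow> t"
        using tendsto_add[OF tendsto_const[of t] LIMSEQ_Suc[OF lim_1_over_n]] by simp
    qed simp
  qed
  from bc lim show ?thesis
  proof eventually_elim
    case (elim \<omega>)
    have "(\<lambda>j. X (u j) \<omega>) \<longlonglongrightarrow> y \<omega>" by (rule filterlim_compose[OF elim(2) filt])
    moreover have "(\<lambda>j. X (u j) \<omega>) \<longlonglongrightarrow> X t \<omega>"
    proof (rule LIM_zero_cancel, rule Lim_null_comparison)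
      show "\<forall>\<^sub>F j in sequentially. norm (X (u j) \<omega> - X t \<omega>) \<le> (1 / 2) ^ j"
        using elim(1) by eventually_elim (auto simp: A_def)
      show "(\<lambda>j. (1 / 2 :: real) ^ j) \<longlonglongrightarrow> 0" by (intro LIMSEQ_power_zero) simp
    qed
    ultimately show ?case by (rule LIMSEQ_unique)
  qed
qed

lemma HS_bound_scale:
  assumes "HS_bound p q C" shows "HS_bound (\<lambda>x. c * p x) q (c\<^sup>2 * C)"
  using assms unfolding HS_bound_def
  by (auto simp: power_mult_distrib sum_distrib_left[symmetric] intro!: mult_left_mono)

lemma hilbertian_seminorm_scale:
  assumes p: "hilbertian_seminorm p" and c: "c \<ge> 0" shows "hilbertian_seminorm (\<lambda>x. c * p x)"
proof (rule hilbertian_seminormI[where Q = "\<lambda>x y. c\<^sup>2 * polar_form p x y"])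
  show "linear (\<lambda>y. c\<^sup>2 * polar_form p x y)" for x
    using linear_compose_scale_right[OF hilbertian_seminorm_form(1)[OF p, of x], of "c\<^sup>2"] by simp
  show "c\<^sup>2 * polar_form p x y = c\<^sup>2 * polar_form p y x" for x y
    using hilbertian_seminorm_form(3)[OF p, of x y] by simp
qed (use c in \<open>auto simp: power_mult_distrib hilbertian_seminorm_form[OF p]\<close>)

text \<open>The integrand is at most \<open>\<bar>u * Y \<omega>\<bar> \<le> b\<close> on
  \<open>E\<close> and at most 2 elsewhere.\<close>

lemma (in prob_space) norm_char_minus_1_le:
  assumes [measurable]: "Y \<in> borel_measurable M" and E: "E \<in> events" "1 - \<epsilon> \<le> prob E"
    and b: "\<And>\<omega>. \<omega> \<in> E \<Longrightarrow> \<bar>Y \<omega>\<bar> \<le> b" and u: "u \<in> {0..1}" and "b \<ge> 0"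
  shows "norm (char (distr M borel Y) u - 1) \<le> b + 2 * \<epsilon>"
proof -
  have "char (distr M borel Y) u = (CLINT \<omega>|M. iexp (u * Y \<omega>))"
    unfolding char_def by (subst integral_distr) auto
  moreover have int: "integrable M (\<lambda>\<omega>. iexp (u * Y \<omega>))"
    by (intro integrable_const_bound[of _ 1]) auto
  ultimately have "char (distr M borel Y) u - 1 = (CLINT \<omega>|M. iexp (u * Y \<omega>) - 1)"
    by (simp add: prob_space)
  also have "norm \<dots> \<le> (\<integral>\<omega>. norm (iexp (u * Y \<omega>) - 1) \<partial>M)"
    by (rule integral_norm_bound)
  also have "\<dots> \<le> (\<integral>\<omega>. b + 2 * indicator (space M - E) \<omega> \<partial>M)"
  proof (rule integral_mono)
    show "integrable M (\<lambda>\<omega>. norm (iexp (u * Y \<omega>) - 1))"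
      using int by (intro integrable_norm Bochner_Integration.integrable_diff) auto
    show "integrable M (\<lambda>\<omega>. b + 2 * indicator (space M - E) \<omega>)"
      using E by (intro Bochner_Integration.integrable_add integrable_mult_right) (auto simp: less_top[symmetric])
    fix \<omega> assume \<omega>: "\<omega> \<in> space M"
    show "norm (iexp (u * Y \<omega>) - 1) \<le> b + 2 * indicator (space M - E) \<omega>"
    proof (cases "\<omega> \<in> E")
      case True
      have "norm (iexp (u * Y \<omega>) - 1) \<le> \<bar>u * Y \<omega>\<bar>"
        using iexp_approx1[of "u * Y \<omega>" 0] by simp
      also have "\<dots> \<le> 1 * b" unfolding abs_mult using u b[OF True] by (intro mult_mono) auto
      finally show ?thesis using True by simp
    next
      case False
      have "norm (iexp (u * Y \<omega>) - 1) \<le> norm (iexp (u * Y \<omega>)) + norm (1 :: complex)"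
        by (rule norm_triangle_ineq4)
      then show ?thesis using False \<omega> \<open>b \<ge> 0\<close> by simp
    qed
  qed
  also have "\<dots> = b + 2 * prob (space M - E)"
    using E by (simp add: prob_space less_top[symmetric])
  also have "\<dots> \<le> b + 2 * \<epsilon>" using E by (simp add: prob_compl)
  finally show ?thesis .
qed

text \<open>Two domination assumptions, because the chain is fixed before the time: it can be
  prepared for the countably many dyadic times, while at a general time the dominating semi-norm may
  come from outside the chain.\<close>

locale HS_levy = HS_chain T P q s + prob_space M
  for T :: "'a::real_vector topology" and P q s and M :: "'w measure" +
  fixes L :: "real \<Rightarrow> 'w \<Rightarrow> 'a \<Rightarrow> real"
  assumes L: "levy_process M (strong_dual T) L"
    and L_dominated: "\<And>t \<epsilon>. t \<ge> 0 \<Longrightarrow> \<epsilon> > 0 \<Longrightarrow> \<exists>p E. continuous_hilbertian T p \<and> E \<in> events \<and>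
      1 - \<epsilon> \<le> prob E \<and> (\<forall>\<omega>\<in>E. \<forall>x. \<bar>L t \<omega> x\<bar> \<le> p x)"
    and L_dominated_dyadic: "\<And>t \<epsilon>. t \<in> dyadics \<Longrightarrow> \<epsilon> > 0 \<Longrightarrow> \<exists>n. \<exists>E\<in>events.
      1 - \<epsilon> \<le> prob E \<and> (\<forall>\<omega>\<in>E. \<forall>x. \<bar>L t \<omega> x\<bar> \<le> q n x)"
begin

sublocale X: real_levy M "\<lambda>t \<omega>. L t \<omega> \<phi>" for \<phi>
  by (rule real_levy_eval[OF prob_space_axioms L])

lemma L_dual: "t \<ge> 0 \<Longrightarrow> \<omega> \<in> space M \<Longrightarrow> L t \<omega> \<in> dual T"
  using L measurable_space[of "L t" M "borel_of (strong_dual T)" \<omega>]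
  by (simp add: levy_process_def stoch_process_def)

lemma L_linear: "t \<ge> 0 \<Longrightarrow> \<omega> \<in> space M \<Longrightarrow> linear (L t \<omega>)"
  by (rule dual_linear[OF L_dual])

lemma AE_dyadic_in_H: "AE \<omega> in M. \<forall>t\<in>dyadics. \<exists>n. L t \<omega> \<in> H n"
proof -
  have "AE \<omega> in M. \<exists>n. L t \<omega> \<in> H n" if t: "t \<in> dyadics" for t
  proof (rule AE_I_prob_near_1)
    fix \<epsilon> :: real assume "\<epsilon> > 0"
    then obtain n E where E: "E \<in> events" "1 - \<epsilon> \<le> prob E" "\<forall>\<omega>\<in>E. \<forall>x. \<bar>L t \<omega> x\<bar> \<le> q n x"
      using L_dominated_dyadic[OF t] by blast
    have "\<exists>n. L t \<omega> \<in> H n" if \<omega>: "\<omega> \<in> E" for \<omega>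
    proof
      \<comment> \<open>\<open>Suc n\<close>, because one index must bound both \<open>n\<close> and
        the factor 1.\<close>
      show "L t \<omega> \<in> H (Suc n)"
      proof (rule H_I[where c = 1 and i = n])
        show "linear (L t \<omega>)"
          using \<omega> sets.sets_into_space[OF E(1)] by (intro L_linear dyadics_nonneg[OF t]) auto
      qed (use E(3) \<omega> in auto)
    qed
    then show "\<exists>G\<in>events. 1 - \<epsilon> \<le> prob G \<and> (\<forall>\<omega>\<in>G. \<exists>n. L t \<omega> \<in> H n)" using E by blast
  qed
  then show ?thesis by (simp add: AE_ball_countable[OF countable_dyadics])
qed

text \<open>Domination of \<open>L 1\<close> makes the characteristic function at time 1 close to 1
  on a small \<open>q i\<close>-ball, \<open>grid_sup_le\<close> carries this to all dyadic times up
  to \<open>N\<close>, and \<open>dyadic_dual_bound\<close> converts it into a bound by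
  \<open>q (Suc i)\<close>.\<close>

lemma AE_uniform_bound:
  "AE \<omega> in M. \<exists>i R. \<forall>k j a. j \<le> N * 2 ^ k \<longrightarrow> \<bar>L (real j / 2 ^ k) \<omega> (s a)\<bar> \<le> R * q i (s a)"
proof (rule AE_I_prob_near_1)
  fix \<epsilon>' :: real assume "\<epsilon>' > 0"
  define \<epsilon> where "\<epsilon> = \<epsilon>' / 18"
  have \<epsilon>: "\<epsilon> > 0" using \<open>\<epsilon>' > 0\<close> by (simp add: \<epsilon>_def)
  obtain \<delta> where \<delta>: "\<delta> > 0" "\<And>c. norm (c - 1) \<le> \<delta> \<Longrightarrow>
      Re c > 0 \<and> (\<forall>t\<in>{0..real N}. norm (exp (of_real t * Ln c) - 1) \<le> \<epsilon> / 4)"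
    by (rule exp_mult_Ln_small[of "real N" "\<epsilon> / 4"]) (use \<epsilon> in auto)
  have "1 \<in> dyadics" unfolding dyadics_def by (intro CollectI exI[of _ 1] exI[of _ 0]) simp
  from L_dominated_dyadic[OF this, of "\<delta> / 4"] \<delta>(1)
  obtain i E where E: "E \<in> events" "1 - \<delta> / 4 \<le> prob E" "\<forall>\<omega>\<in>E. \<forall>x. \<bar>L 1 \<omega> x\<bar> \<le> q i x" by auto
  \<comment> \<open>Chosen so that \<open>p x \<le> 1\<close> gives
    \<open>q i (4 *\<^sub>R x) \<le> \<delta> / 2\<close>; the exceptional probability
    \<open>\<delta> / 4\<close>, counted twice, completes this to \<open>\<delta>\<close>. The
    factor 4 matches the threshold in \<open>grid_sup_le\<close>.\<close>
  define p where "p x = (8 / \<delta>) * q i x" for x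
  have p: "hilbertian_seminorm p"
    unfolding p_def[abs_def] using \<delta>(1) by (intro hilbertian_seminorm_scale q_hilbertian) simp
  obtain C where "HS_bound (q i) (q (Suc i)) C" using q_HS by blast
  then have HS: "HS_bound p (q (Suc i)) ((8 / \<delta>)\<^sup>2 * C)" unfolding p_def[abs_def] by (rule HS_bound_scale)
  define C' where "C' = (8 / \<delta>)\<^sup>2 * C"
  \<comment> \<open>Small enough for \<open>\<sigma>\<^sup>2 * C' \<le> \<epsilon>\<close>; the
    absolute value and the 1 keep the denominator positive.\<close>
  define \<sigma> where "\<sigma> = sqrt (\<epsilon> / (\<bar>C'\<bar> + 1))"
  have d: "\<epsilon> / (\<bar>C'\<bar> + 1) > 0" using \<epsilon> by (intro divide_pos_pos) auto
  have \<sigma>: "\<sigma> > 0" using d by (simp add: \<sigma>_def)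
  have \<sigma>C: "\<sigma>\<^sup>2 * C' \<le> \<epsilon>"
  proof -
    have "\<sigma>\<^sup>2 * C' \<le> \<sigma>\<^sup>2 * (\<bar>C'\<bar> + 1)" by (intro mult_left_mono) auto
    also have "\<dots> = \<epsilon>" using d by (simp add: \<sigma>_def)
    finally show ?thesis .
  qed
  have small: "prob {\<omega> \<in> space M. \<exists>j\<le>N * 2 ^ k. 1 < \<bar>L (real j / 2 ^ k) \<omega> x\<bar>} \<le> \<epsilon>" if x: "p x \<le> 1" for k x
  proof -
    have q4: "q i (4 *\<^sub>R x) \<le> \<delta> / 2" using x \<delta>(1) by (simp add: p_def q.scale field_simps)
    have ch: "norm (X.ch (4 *\<^sub>R x) 1 u - 1) \<le> \<delta>" if u: "u \<in> {0..1}" for u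
    proof -
      have "norm (char (distr M borel (\<lambda>\<omega>. L 1 \<omega> (4 *\<^sub>R x))) u - 1) \<le> \<delta> / 2 + 2 * (\<delta> / 4)"
      proof (rule norm_char_minus_1_le[OF _ E(1,2)])
        show "\<bar>L 1 \<omega> (4 *\<^sub>R x)\<bar> \<le> \<delta> / 2" if "\<omega> \<in> E" for \<omega>
          using E(3) that q4 by (meson order_trans)
      qed (use u \<delta>(1) X.X_measurable[of 1] in auto)
      then show ?thesis by (simp add: X.ch_def)
    qed
    have "prob {\<omega> \<in> space M. \<exists>j\<le>N * 2 ^ k. 4 < \<bar>L (real j / 2 ^ k) \<omega> (4 *\<^sub>R x)\<bar>} \<le> 4 * (\<epsilon> / 4)"
      by (rule X.grid_sup_le[OF \<delta>(2) ch])
    moreover have "{\<omega> \<in> space M. \<exists>j\<le>N * 2 ^ k. 4 < \<bar>L (real j / 2 ^ k) \<omega> (4 *\<^sub>R x)\<bar>}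
        = {\<omega> \<in> space M. \<exists>j\<le>N * 2 ^ k. 1 < \<bar>L (real j / 2 ^ k) \<omega> x\<bar>}"
    proof (rule Collect_cong, rule conj_cong[OF refl])
      fix \<omega> assume "\<omega> \<in> space M"
      then have "L (real j / 2 ^ k) \<omega> (4 *\<^sub>R x) = 4 * L (real j / 2 ^ k) \<omega> x" for j :: nat
        using linear_scale[OF L_linear[of "real j / 2 ^ k" \<omega>], of 4 x] by simp
      then show "(\<exists>j\<le>N * 2 ^ k. 4 < \<bar>L (real j / 2 ^ k) \<omega> (4 *\<^sub>R x)\<bar>)
          = (\<exists>j\<le>N * 2 ^ k. 1 < \<bar>L (real j / 2 ^ k) \<omega> x\<bar>)" by (simp add: abs_mult)
    qed
    ultimately show ?thesis by simp
  qed
  let ?G = "{\<omega> \<in> space M. \<forall>k j a. j \<le> N * 2 ^ k \<longrightarrow>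
      \<bar>L (real j / 2 ^ k) \<omega> (s a)\<bar> \<le> sqrt 2 / \<sigma> * q (Suc i) (s a)}"
  have G1: "?G \<in> events"
    by (rule dyadic_dual_bound(1)[OF L_linear _ p q_hilbertian HS small \<sigma> \<sigma>C[unfolded C'_def]])
      (auto intro: X.X_measurable)
  have "1 - 18 * \<epsilon> \<le> prob ?G"
    by (rule dyadic_dual_bound(2)[OF L_linear _ p q_hilbertian HS small \<sigma> \<sigma>C[unfolded C'_def]])
      (auto intro: X.X_measurable)
  then have G2: "1 - \<epsilon>' \<le> prob ?G" by (simp only: \<epsilon>_def times_divide_eq_right nonzero_mult_div_cancel_left)
  have G3: "\<forall>\<omega>\<in>?G. \<exists>i R. \<forall>k j a. j \<le> N * 2 ^ k \<longrightarrow> \<bar>L (real j / 2 ^ k) \<omega> (s a)\<bar> \<le> R * q i (s a)"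
  proof
    fix \<omega> assume "\<omega> \<in> ?G"
    then have "\<forall>k j a. j \<le> N * 2 ^ k \<longrightarrow>
        \<bar>L (real j / 2 ^ k) \<omega> (s a)\<bar> \<le> sqrt 2 / \<sigma> * q (Suc i) (s a)"
      by (elim CollectE conjE)
    then show "\<exists>i R. \<forall>k j a. j \<le> N * 2 ^ k \<longrightarrow> \<bar>L (real j / 2 ^ k) \<omega> (s a)\<bar> \<le> R * q i (s a)"
      by (intro exI[of _ "Suc i"] exI[of _ "sqrt 2 / \<sigma>"])
  qed
  show "\<exists>G\<in>events. 1 - \<epsilon>' \<le> prob G \<and>
      (\<forall>\<omega>\<in>G. \<exists>i R. \<forall>k j a. j \<le> N * 2 ^ k \<longrightarrow> \<bar>L (real j / 2 ^ k) \<omega> (s a)\<bar> \<le> R * q i (s a))"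
    by (intro bexI[where x = ?G] conjI G1 G2 G3)
qed

lemma AE_good_path: "AE \<omega> in M. good_path (\<lambda>t. L t \<omega>)"
proof -
  have "AE \<omega> in M. \<forall>N. \<exists>i R. \<forall>k j a. j \<le> N * 2 ^ k \<longrightarrow> \<bar>L (real j / 2 ^ k) \<omega> (s a)\<bar> \<le> R * q i (s a)"
    using AE_uniform_bound by (simp add: AE_all_countable)
  moreover have "AE \<omega> in M. \<forall>i. (\<forall>t\<ge>0. \<exists>l. ((\<lambda>u. L u \<omega> (s i)) \<longlongrightarrow> l) (right_dyadic t)) \<and>
      (\<forall>t>0. \<exists>l. ((\<lambda>u. L u \<omega> (s i)) \<longlongrightarrow> l) (left_dyadic t))"
    unfolding AE_all_countable using X.AE_dyadic_limits by blast
  ultimately show ?thesis using AE_dyadic_in_H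
  proof eventually_elim
    case (elim \<omega>)
    have "\<exists>n. \<forall>t\<in>dyadics \<inter> {0..real N}. L t \<omega> \<in> H n" for N
    proof -
      obtain i R where R: "\<And>k j a. j \<le> N * 2 ^ k \<Longrightarrow> \<bar>L (real j / 2 ^ k) \<omega> (s a)\<bar> \<le> R * q i (s a)"
        using elim(1) by blast
      obtain m :: nat where m: "R \<le> real m" using real_arch_simple by blast
      define n where "n = max m i"
      have "L t \<omega> \<in> H n" if t: "t \<in> dyadics \<inter> {0..real N}" for t
      proof -
        obtain j k :: nat where jk: "t = real j / 2 ^ k" using t by (auto simp: dyadics_def)
        have "real j \<le> real (N * 2 ^ k)" using t by (simp add: jk divide_le_eq)
        then have j: "j \<le> N * 2 ^ k" by (simp only: of_nat_le_iff)
        obtain l where l: "L t \<omega> \<in> H l" using elim(3) t by blast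
        have "\<bar>L t \<omega> (s a)\<bar> \<le> real n * q n (s a)" for a
        proof -
          have "\<bar>L t \<omega> (s a)\<bar> \<le> R * q i (s a)" unfolding jk by (rule R[OF j])
          also have "\<dots> \<le> real n * q i (s a)" using m by (intro mult_right_mono) (auto simp: n_def)
          also have "\<dots> \<le> real n * q n (s a)" by (intro mult_left_mono q_mono) (auto simp: n_def)
          finally show ?thesis .
        qed
        \<comment> \<open>The bound is known on the dense sequence only; membership of
          \<open>L t \<omega>\<close> in some \<open>H l\<close> extends it.\<close>
        then show ?thesis using H_iff_dense[OF l] by blast
      qed
      then show ?thesis by blast
    qed
    then show ?case unfolding good_path_def using elim(2) by blast
  qed
qed

text \<open>The value 0 on bad paths keeps every \<open>L' t \<omega>\<close> with
  \<open>t \<ge> 0\<close> in some \<open>H n\<close>, for all \<open>\<omega>\<close>.\<close>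

definition L' :: "real \<Rightarrow> 'w \<Rightarrow> 'a \<Rightarrow> real"
  where "L' t \<omega> = (if good_path (\<lambda>t. L t \<omega>) then regularize (\<lambda>t. L t \<omega>) t else 0)"

lemma L'_in_H: "t \<ge> 0 \<Longrightarrow> \<exists>n. L' t \<omega> \<in> H n"
  using regularize_in_H[of "\<lambda>t. L t \<omega>" t] by (auto simp: L'_def H_def zero_fun_def linear_iff)

text \<open>For a fixed vector the right limit along the dyadics agrees with \<open>L t\<close>
  almost surely. All vectors are reached at once by comparing two functionals continuous for a
  common semi-norm \<open>r\<close> on a countable \<open>r\<close>-dense set:
  \<open>L' t \<omega>\<close> lies in some \<open>H n\<close>, and \<open>L t \<omega>\<close> is
  dominated by some \<open>p\<close> with probability near one.\<close>

lemma L'_version_at: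
  assumes t: "t \<ge> 0" shows "AE \<omega> in M. L' t \<omega> = L t \<omega>"
proof -
  have ptw: "AE \<omega> in M. L' t \<omega> x = L t \<omega> x" for x
  proof (rule X.AE_eq_right_dyadic_limit[OF t])
    show "AE \<omega> in M. ((\<lambda>u. L u \<omega> x) \<longlongrightarrow> L' t \<omega> x) (right_dyadic t)"
      using AE_good_path
    proof eventually_elim
      case (elim \<omega>)
      then show ?case using regularize_tendsto[OF elim t, of x] by (simp add: L'_def)
    qed
  qed
  have "AE \<omega> in M. \<exists>p. continuous_hilbertian T p \<and> (\<forall>x. \<bar>L t \<omega> x\<bar> \<le> p x) \<and>
      (\<forall>n. \<exists>r S. p \<le> r \<and> q n \<le> r \<and> dense_for r S \<and> hilbertian_seminorm r \<and> (\<forall>x\<in>S. L' t \<omega> x = L t \<omega> x))"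
    (is "AE \<omega> in M. ?Q \<omega>")
  proof (rule AE_I_prob_near_1)
    fix \<epsilon> :: real assume "\<epsilon> > 0"
    then obtain p E where p: "continuous_hilbertian T p" and E: "E \<in> events" "1 - \<epsilon> \<le> prob E"
      "\<forall>\<omega>\<in>E. \<forall>x. \<bar>L t \<omega> x\<bar> \<le> p x" using L_dominated[OF t] by blast
    \<comment> \<open>One \<open>r\<close> and one dense set for every \<open>n\<close>, as the
      index with \<open>L' t \<omega> \<in> H n\<close> depends on \<open>\<omega>\<close>.\<close>
    have "\<forall>n. \<exists>rS. p \<le> fst rS \<and> q n \<le> fst rS \<and> dense_for (fst rS) (snd rS) \<and> hilbertian_seminorm (fst rS) \<and>
        countable (snd rS)"
    proof
      fix n
      obtain r where r: "continuous_hilbertian T r" "p \<le> r" "q n \<le> r"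
        using continuous_hilbertian_pair[OF p q_cont] .
      obtain S where "countable S" "dense_for r S" using separable[OF r(1)] .
      then show "\<exists>rS. p \<le> fst rS \<and> q n \<le> fst rS \<and> dense_for (fst rS) (snd rS) \<and> hilbertian_seminorm (fst rS) \<and>
        countable (snd rS)"
        using r by (intro exI[of _ "(r, S)"]) (simp add: continuous_hilbertian_def)
    qed
    then obtain rS where rS: "\<forall>n. p \<le> fst (rS n) \<and> q n \<le> fst (rS n) \<and> dense_for (fst (rS n)) (snd (rS n)) \<and>
        hilbertian_seminorm (fst (rS n)) \<and> countable (snd (rS n))"
      by (rule choice[THEN exE])
    have "AE \<omega> in M. \<forall>x\<in>(\<Union>n. snd (rS n)). L' t \<omega> x = L t \<omega> x"
      using rS ptw by (subst AE_ball_countable) auto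
    then obtain G where "G \<subseteq> {\<omega> \<in> space M. \<forall>x\<in>(\<Union>n. snd (rS n)). L' t \<omega> x = L t \<omega> x}"
      and G: "G \<in> events" "prob G = 1"
      by (rule AE_E_prob)
    then have G3: "\<forall>\<omega>\<in>G. \<forall>x\<in>(\<Union>n. snd (rS n)). L' t \<omega> x = L t \<omega> x" by blast
    have "prob (E \<inter> G) = prob E"
      using measure_space_inter[of E G] E(1) G(1,2) prob_space by simp
    moreover have "?Q \<omega>" if "\<omega> \<in> E \<inter> G" for \<omega>
    proof (rule exI[of _ p], intro conjI allI p)
      show "\<bar>L t \<omega> x\<bar> \<le> p x" for x using E(3) that by blast
      show "\<exists>r S. p \<le> r \<and> q n \<le> r \<and> dense_for r S \<and> hilbertian_seminorm r \<and> (\<forall>x\<in>S. L' t \<omega> x = L t \<omega> x)" for n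
        using rS[rule_format, of n] G3 that by blast
    qed
    ultimately show "\<exists>G\<in>events. 1 - \<epsilon> \<le> prob G \<and> (\<forall>\<omega>\<in>G. ?Q \<omega>)"
      using E(1,2) G(1) by (intro bexI[of _ "E \<inter> G"]) auto
  qed
  then show ?thesis using AE_space
  proof eventually_elim
    case (elim \<omega>)
    then obtain p where p: "\<And>x. \<bar>L t \<omega> x\<bar> \<le> p x"
      and pr: "\<And>n. \<exists>r S. p \<le> r \<and> q n \<le> r \<and> dense_for r S \<and> hilbertian_seminorm r \<and> (\<forall>x\<in>S. L' t \<omega> x = L t \<omega> x)"
      by blast
    obtain n where n: "L' t \<omega> \<in> H n" using L'_in_H[OF t] by blast
    obtain r S where r: "p \<le> r" "q n \<le> r" "dense_for r S" "hilbertian_seminorm r"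
      and S: "\<forall>x\<in>S. L' t \<omega> x = L t \<omega> x" using pr[of n] by blast
    have l': "linear (L' t \<omega>)" by (rule H_linear[OF n])
    have l: "linear (L t \<omega>)" using elim(2) by (rule L_linear[OF t])
    show "L' t \<omega> = L t \<omega>"
    proof
      fix x
      have "\<bar>L' t \<omega> x - L t \<omega> x\<bar> \<le> 0"
      proof (rule field_le_epsilon)
        fix e :: real assume "e > 0"
        then have "e / (real n + 1) > 0" by (intro divide_pos_pos) auto
        then obtain v where v: "v \<in> S" "r (x - v) < e / (real n + 1)"
          using r(3) unfolding dense_for_def by blast
        have "L' t \<omega> x - L t \<omega> x = L' t \<omega> (x - v) - L t \<omega> (x - v)"
          using S v(1) by (simp add: linear_diff[OF l'] linear_diff[OF l])
        also have "\<bar>\<dots>\<bar> \<le> \<bar>L' t \<omega> (x - v)\<bar> + \<bar>L t \<omega> (x - v)\<bar>" by (rule abs_triangle_ineq4)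
        also have "\<dots> \<le> real n * q n (x - v) + p (x - v)" by (intro add_mono H_bound[OF n] p)
        also have "\<dots> \<le> real n * r (x - v) + r (x - v)"
          using r(1,2) by (intro add_mono mult_left_mono) (auto simp: le_fun_def)
        also have "\<dots> = (real n + 1) * r (x - v)" by (simp add: algebra_simps)
        also have "\<dots> \<le> e" using v(2) by (simp add: less_divide_eq mult.commute add_nonneg_pos less_imp_le)
        finally show "\<bar>L' t \<omega> x - L t \<omega> x\<bar> \<le> 0 + e" by simp
      qed
      then show "L' t \<omega> x = L t \<omega> x" by simp
    qed
  qed
qed

lemma L'_version: "is_version M L' L"
  unfolding is_version_def by (intro allI impI L'_version_at)

lemma L'_cadlag_process:
  assumes M: "complete_measure M" and S: "ball_coarse S"
  shows "cadlag_process M S L'"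
  unfolding cadlag_process_def stoch_process_def
proof (intro conjI allI impI)
  fix t :: real assume t: "t \<ge> 0"
  show "L' t \<in> measurable M (borel_of S)"
  proof (rule measurable_into_ball_coarse[OF S])
    show "\<exists>n. L' t \<omega> \<in> H n" for \<omega> by (rule L'_in_H[OF t])
    show "(\<lambda>\<omega>. L' t \<omega> (s i)) \<in> borel_measurable M" for i
    proof (rule measurable_AE_version[OF M X.X_measurable[OF t]])
      show "AE \<omega> in M. L' t \<omega> (s i) = L t \<omega> (s i)" using L'_version_at[OF t] by eventually_elim simp
    qed simp
  qed
next
  show "AE \<omega> in M. cadlag S (\<lambda>t. L' t \<omega>)"
    using AE_good_path
  proof eventually_elim
    case (elim \<omega>)
    then have "(\<lambda>t. L' t \<omega>) = regularize (\<lambda>t. L t \<omega>)" by (simp add: L'_def fun_eq_iff)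
    then show ?case using regularize_cadlag[OF elim S] by simp
  qed
qed

lemma L'_regular: 
  assumes M: "complete_measure M" shows "regular_process M T L'"
  unfolding regular_process_def
proof (intro conjI allI impI)
  show "stoch_process M (strong_dual T) L'"
    using L'_cadlag_process[OF M ball_coarse_strong_dual] by (simp add: cadlag_process_def)
  fix t :: real assume t: "t \<ge> 0"
  have "{\<omega> \<in> space M. L' t \<omega> \<in> dual \<theta>} = space M" using L'_in_H[OF t] H_dual_\<theta> by blast
  then show "\<exists>\<theta>. countably_hilbertian T \<theta> \<and> {\<omega> \<in> space M. L' t \<omega> \<in> dual \<theta>} \<in> events \<and>
      prob {\<omega> \<in> space M. L' t \<omega> \<in> dual \<theta>} = 1"
    using countably_hilbertian_\<theta> by (intro exI[of _ \<theta>]) (simp add: prob_space)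
qed

lemma L'_levy:
  assumes M: "complete_measure M" shows "levy_process M (strong_dual T) L'"
proof (rule levy_process_version[OF prob_space_axioms M L L'_version])
  show "L' t \<omega> \<in> topspace (strong_dual T)" if t: "t \<ge> 0" for t \<omega>
  proof -
    obtain n where "L' t \<omega> \<in> H n" using L'_in_H[OF t] by blast
    from H_dual[OF this] show ?thesis by simp
  qed
  show "x - y \<in> topspace (strong_dual T)"
    if "x \<in> topspace (strong_dual T)" "y \<in> topspace (strong_dual T)" for x y
    using that dual_diff by simp
qed

end

lemma (in nuclear) levy_dominated:
  assumes T: "barrelled_space T" and M: "prob_space M" and L: "levy_process M (strong_dual T) L"
    and t: "t \<ge> 0" and \<epsilon>: "\<epsilon> > 0"
  shows "\<exists>p E. continuous_hilbertian T p \<and> E \<in> sets M \<and> 1 - \<epsilon> \<le> measure M E \<and>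
    (\<forall>\<omega>\<in>E. \<forall>x. \<bar>L t \<omega> x\<bar> \<le> p x)"
proof -
  interpret prob_space M by fact
  have "radon_prob (strong_dual T) (distr M (borel_of (strong_dual T)) (L t))"
    "L t \<in> measurable M (borel_of (strong_dual T))"
    using L t by (simp_all add: levy_process_def stoch_process_def)
  from radon_compact[OF this Hausdorff_strong_dual \<epsilon>]
  obtain K where K: "compactin (strong_dual T) K" "{\<omega> \<in> space M. L t \<omega> \<in> K} \<in> events"
    "1 - \<epsilon> \<le> prob {\<omega> \<in> space M. L t \<omega> \<in> K}" .
  obtain p where "continuous_hilbertian T p" "\<And>f x. f \<in> K \<Longrightarrow> \<bar>f x\<bar> \<le> p x"
    using compact_dominated[OF T K(1)] by blast
  with K show ?thesis by (intro exI[of _ p] exI[of _ "{\<omega> \<in> space M. L t \<omega> \<in> K}"]) simp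
qed

theorem corollary3p11:
  fixes T :: "'a::real_vector topology"
    and M :: "'w measure"
    and L :: "real \<Rightarrow> 'w \<Rightarrow> 'a \<Rightarrow> real"
  assumes "nuclear_space T" and "barrelled_space T"
    and "prob_space M" and "complete_measure M"
    and "levy_process M (strong_dual T) L"
  shows "\<exists>L'. is_version M L' L \<and>
    regular_process M T L' \<and>
    cadlag_process M (strong_dual T) L' \<and>
    levy_process M (strong_dual T) L' \<and>
    (\<exists>\<theta>. countably_hilbertian T \<theta> \<and> cadlag_process M (completion_dual \<theta>) L')"
proof -
  obtain P where "nuclear T P" using nuclear_spaceE[OF assms(1)] .
  then interpret nuclear T P .
  have dom: "\<exists>p E. continuous_hilbertian T p \<and> E \<in> sets M \<and> 1 - \<epsilon> \<le> measure M E \<and>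
      (\<forall>\<omega>\<in>E. \<forall>x. \<bar>L t \<omega> x\<bar> \<le> p x)" if "t \<ge> 0" "\<epsilon> > 0" for t \<epsilon>
    by (rule levy_dominated[OF assms(2,3,5) that])
  define d where "d = from_nat_into dyadics"
  have "0 \<in> dyadics" unfolding dyadics_def by (intro CollectI exI[of _ 0]) simp
  then have d: "range d = dyadics" unfolding d_def by (intro range_from_nat_into countable_dyadics) auto
  \<comment> \<open>\<open>k\<close> encodes a pair of a dyadic time and an accuracy, so that one
    sequence of semi-norms serves all such pairs.\<close>
  have "\<forall>k. \<exists>p. continuous_hilbertian T p \<and> (\<exists>E\<in>sets M. 1 - 1 / Suc (snd (prod_decode k)) \<le> measure M E \<and>
      (\<forall>\<omega>\<in>E. \<forall>x. \<bar>L (d (fst (prod_decode k))) \<omega> x\<bar> \<le> p x))"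
  proof
    fix k
    have "d (fst (prod_decode k)) \<ge> 0" using d dyadics_nonneg by blast
    from dom[OF this, of "1 / Suc (snd (prod_decode k))"]
    show "\<exists>p. continuous_hilbertian T p \<and> (\<exists>E\<in>sets M. 1 - 1 / Suc (snd (prod_decode k)) \<le> measure M E \<and>
      (\<forall>\<omega>\<in>E. \<forall>x. \<bar>L (d (fst (prod_decode k))) \<omega> x\<bar> \<le> p x))" by auto
  qed
  then obtain r where r: "\<forall>k. continuous_hilbertian T (r k) \<and> (\<exists>E\<in>sets M. 1 - 1 / Suc (snd (prod_decode k)) \<le> measure M E \<and>
      (\<forall>\<omega>\<in>E. \<forall>x. \<bar>L (d (fst (prod_decode k))) \<omega> x\<bar> \<le> r k x))"
    by (rule choice[THEN exE])
  have r_cont: "continuous_hilbertian T (r n)" for n using r by simp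
  obtain q :: "nat \<Rightarrow> 'a \<Rightarrow> real" where q: "\<And>n. continuous_hilbertian T (q n)" "\<And>n. r n \<le> q n"
    "\<And>n. q n \<le> q (Suc n)" "\<And>n. \<exists>C. HS_bound (q n) (q (Suc n)) C"
    using HS_chain[of r] r_cont by blast
  have "\<forall>n. \<exists>S. countable S \<and> dense_for (q n) S"
  proof
    fix n
    obtain S where "countable S" "dense_for (q n) S" using separable[of "q n"] q(1) by blast
    then show "\<exists>S. countable S \<and> dense_for (q n) S" by blast
  qed
  then obtain S where S: "\<forall>n. countable (S n) \<and> dense_for (q n) (S n)" by (rule choice[THEN exE])
  define s where "s = from_nat_into (\<Union>n. S n)"
  have "S 0 \<noteq> {}"
  proof
    assume "S 0 = {}"
    moreover have "dense_for (q 0) (S 0)" using S by blast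
    ultimately show False unfolding dense_for_def using zero_less_one by blast
  qed
  then have s: "range s = (\<Union>n. S n)"
    unfolding s_def using S by (intro range_from_nat_into countable_UN) auto
  have chain: "HS_chain T P q s"
  proof (intro HS_chain.intro HS_chain_axioms.intro)
    show "nuclear T P" by (rule nuclear_axioms)
    show "dense_for (q n) (range s)" for n
      using S[rule_format, of n] unfolding s dense_for_def by blast
  qed (rule q)+
  have dom_dyadic: "\<exists>n. \<exists>E\<in>sets M. 1 - \<epsilon> \<le> measure M E \<and> (\<forall>\<omega>\<in>E. \<forall>x. \<bar>L t \<omega> x\<bar> \<le> q n x)"
    if t: "t \<in> dyadics" and \<epsilon>: "\<epsilon> > 0" for t \<epsilon>
  proof -
    obtain a where a: "t = d a" using t d by blast
    obtain m where m: "1 / real (Suc m) < \<epsilon>" using reals_Archimedean[OF \<epsilon>] by (auto simp: inverse_eq_divide)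
    define k where "k = prod_encode (a, m)"
    obtain E where E: "E \<in> sets M" "1 - 1 / Suc m \<le> measure M E" "\<And>\<omega> x. \<omega> \<in> E \<Longrightarrow> \<bar>L t \<omega> x\<bar> \<le> r k x"
      using r[rule_format, of k] by (auto simp: k_def a)
    have "\<bar>L t \<omega> x\<bar> \<le> q k x" if "\<omega> \<in> E" for \<omega> x
      using E(3)[OF that, of x] q(2)[of k] by (simp add: le_fun_def) (meson order_trans)
    then show ?thesis using E(1,2) m by (intro exI[of _ k] bexI[of _ E]) auto
  qed
  interpret HS_levy T P q s M L
    by (intro HS_levy.intro HS_levy_axioms.intro chain assms(3) assms(5) dom dom_dyadic)
  show ?thesis
    using L'_version L'_regular[OF assms(4)] L'_levy[OF assms(4)] countably_hilbertian_\<theta>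
      L'_cadlag_process[OF assms(4) ball_coarse_strong_dual]
      L'_cadlag_process[OF assms(4) ball_coarse_completion_dual]
    by blast
qed

end
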